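(* There exist absolute constants $C_1,C_2,\gamma,M>0$ and $\Delta\in(0,1)$ (independent of $n,m,x_0$) such that, provided that $m\ge Mn^2$, with probability at least $1-C_1\exp(-C_2n)$ over the random matrix $A$, the following holds: for any $x\in\mathbb{C}^n$ that is not almost orthogonal to $x_0$, i.e. such that $$\frac{\|x_0\|\,\|x\|}{\sqrt n}\le|\langle x_0,x\rangle|,$$ the sequence defined by $z_0=x$ and $z_t=A^\dagger\big(b\odot\mathrm{phase}(Az_{t-1})\big)$ for $t\ge1$ satisfies $$\forall t\ge\gamma\log n,\qquad \inf_{\phi\in\mathbb{R}}\|e^{i\phi}x_0-z_t\|\le\Delta^{\,t-\gamma\log n}\,\|x_0\|.$$
   Context: $n,m$ are positive integers. The sensing vectors $a_1,\dots,a_m\in\mathbb{C}^n$ are random; all coordinates $(a_i)_j$ are independent with law $\mathcal N(0,\tfrac12)+i\,\mathcal N(0,\tfrac12)$ (standard complex Gaussian, independent real and imaginary parts). $A\in\mathbb{C}^{m\times n}$ is the matrix whose $i$-th row is $a_i^*$. The vector $x_0\in\mathbb{C}^n$ is fixed (independent of $A$), and $b=|Ax_0|\in\mathbb{R}^m$, where the modulus of a vector is taken entrywise. $A^\dagger$ is the Moore–Penrose pseudo-inverse, $\odot$ is the entrywise product, and $\mathrm{phase}$ is applied entrywise with $\mathrm{phase}(z)=z/|z|$ for $z\in\mathbb{C}\setminus\{0\}$ and $\mathrm{phase}(0)=1$. The index $t$ ranges over integers. $\|\cdot\|$ is the Euclidean norm, $\langle\cdot,\cdot\rangle$ the standard Hermitian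 inner product.
   Formalization: The starting vector x is additionally required to be nonzero: x = 0 satisfies the displayed inequality trivially (0 ≤ 0) although it is orthogonal to x_0, and the claimed convergence fails for it with probability only polynomially small in n. *)

theory Defs
  imports "HOL-Probability.Probability" "Jordan_Normal_Form.Schur_Decomposition"
begin

text \<open>
  Vectors and matrices are those of \<open>Jordan_Normal_Form\<close>, because the constants of the theorem
  must be chosen before the dimensions \<open>n\<close> and \<open>m\<close>.  HOL-Analysis uses the same names and
  infix symbols for its type-indexed vectors, hence the following.
\<close>

hide_const (open) Finite_Cartesian_Product.vec Finite_Cartesian_Product.mat
hide_const (open) Inner_Product.real_inner_class.inner
no_notation Finite_Cartesian_Product.vec_nth (infixl \<open>$\<close> 90)
no_notation Inner_Product.real_inner_class.inner (infix \<open>\<bullet>\<close> 70)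

definition eucl_norm :: "complex vec \<Rightarrow> real" where
  "eucl_norm v = sqrt (\<Sum>i<dim_vec v. (cmod (v $ i))\<^sup>2)"

definition phase :: "complex \<Rightarrow> complex" where
  "phase z = (if z = 0 then 1 else z / of_real (cmod z))"

definition entrywise_prod :: "complex vec \<Rightarrow> complex vec \<Rightarrow> complex vec"  (infixl \<open>\<odot>\<close> 70) where
  "u \<odot> v = vec (dim_vec u) (\<lambda>i. u $ i * v $ i)"

definition entrywise_modulus :: "complex vec \<Rightarrow> complex vec" where
  "entrywise_modulus = map_vec (\<lambda>z. of_real (cmod z))"


subsection \<open>Moore--Penrose pseudo-inverse\<close>

definition is_pseudo_inverse :: "complex mat \<Rightarrow> complex mat \<Rightarrow> bool" where
  "is_pseudo_inverse A X \<longleftrightarrow>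
     X \<in> carrier_mat (dim_col A) (dim_row A) \<and>
     A * X * A = A \<and> X * A * X = X \<and>
     mat_adjoint (A * X) = A * X \<and> mat_adjoint (X * A) = X * A"

definition pseudo_inverse :: "complex mat \<Rightarrow> complex mat" where
  "pseudo_inverse A = (THE X. is_pseudo_inverse A X)"


subsection \<open>Gaussian sensing matrix\<close>

text \<open>The law \<open>N(0,1/2) + \<i> N(0,1/2)\<close>; the second parameter of \<^const>\<open>normal_density\<close> is the
  standard deviation, not the variance.\<close>

definition complex_gaussian :: "complex measure" where
  "complex_gaussian =
     distr (density lborel (normal_density 0 (sqrt (1/2))) \<Otimes>\<^sub>M
            density lborel (normal_density 0 (sqrt (1/2))))
       borel (\<lambda>(x, y). Complex x y)"

text \<open>The joint law of the sensing vectors: \<open>a (i, j)\<close> is the \<open>j\<close>-th coordinate of \<open>a\<^sub>i\<close>.\<close>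

definition gaussian_sensing :: "nat \<Rightarrow> nat \<Rightarrow> (nat \<times> nat \<Rightarrow> complex) measure" where
  "gaussian_sensing m n = (\<Pi>\<^sub>M _\<in>{..<m} \<times> {..<n}. complex_gaussian)"

definition sensing_matrix :: "nat \<Rightarrow> nat \<Rightarrow> (nat \<times> nat \<Rightarrow> complex) \<Rightarrow> complex mat" where
  "sensing_matrix m n a = mat m n (\<lambda>(i, j). cnj (a (i, j)))"


subsection \<open>Alternating projections\<close>

primrec alt_proj :: "complex mat \<Rightarrow> complex vec \<Rightarrow> complex vec \<Rightarrow> nat \<Rightarrow> complex vec" where
  "alt_proj A b x 0 = x"
| "alt_proj A b x (Suc t) = pseudo_inverse A *\<^sub>v (b \<odot> map_vec phase (A *\<^sub>v alt_proj A b x t))"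

text \<open>The zero vector satisfies the displayed inequality trivially although it is orthogonal
  to \<open>x\<^sub>0\<close>; it has to be excluded explicitly.\<close>

definition not_almost_orthogonal :: "nat \<Rightarrow> complex vec \<Rightarrow> complex vec \<Rightarrow> bool" where
  "not_almost_orthogonal n x0 x \<longleftrightarrow>
     x \<noteq> 0\<^sub>v n \<and> eucl_norm x0 * eucl_norm x / sqrt (real n) \<le> cmod (x0 \<bullet>c x)"


subsection \<open>Well-definedness\<close>

lemma complex_gaussian_measurable [measurable]:
  "(\<lambda>(x, y). Complex x y) \<in> borel_measurable
     (density lborel (normal_density 0 (sqrt (1/2))) \<Otimes>\<^sub>M
      density lborel (normal_density 0 (sqrt (1/2))))"
proof -
  have eq: "(\<lambda>(x, y). Complex x y) = (\<lambda>p. complex_of_real (fst p) + \<i> * complex_of_real (snd p))"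
    by (auto simp: fun_eq_iff complex_eq_iff)
  show ?thesis unfolding eq by measurable
qed

lemma prob_space_complex_gaussian: "prob_space complex_gaussian"
proof -
  interpret N: prob_space "density lborel (normal_density 0 (sqrt (1/2)))"
    by (rule prob_space_normal_density) simp
  interpret P: pair_prob_space "density lborel (normal_density 0 (sqrt (1/2)))"
     "density lborel (normal_density 0 (sqrt (1/2)))" ..
  show ?thesis unfolding complex_gaussian_def
    by (rule P.prob_space_distr) (rule complex_gaussian_measurable)
qed

lemma prob_space_gaussian_sensing: "prob_space (gaussian_sensing m n)"
  unfolding gaussian_sensing_def by (intro prob_space_PiM prob_space_complex_gaussian)

lemma mat_adjoint_mult:
  fixes A B :: "complex mat"
  assumes "A \<in> carrier_mat m n" "B \<in> carrier_mat n k"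
  shows "mat_adjoint (A * B) = mat_adjoint B * mat_adjoint A"
  using assms
  by (intro eq_matI)
     (auto simp: mat_adjoint_def mat_of_rows_def scalar_prod_def mult.commute intro!: sum.cong)

lemma is_pseudo_inverse_unique:
  assumes X: "is_pseudo_inverse A X" and Y: "is_pseudo_inverse A Y"
  shows "X = Y"
proof -
  define m where "m = dim_row A"
  define n where "n = dim_col A"
  have c: "A \<in> carrier_mat m n" "X \<in> carrier_mat n m" "Y \<in> carrier_mat n m"
    using X Y by (auto simp: is_pseudo_inverse_def m_def n_def)
  note x = X[unfolded is_pseudo_inverse_def] and y = Y[unfolded is_pseudo_inverse_def]
  have c': "A * X \<in> carrier_mat m m" "A * Y \<in> carrier_mat m m"
           "X * A \<in> carrier_mat n n" "Y * A \<in> carrier_mat n n" using c by auto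
  have l: "A * Y * (A * X) = A * X" "A * X * (A * Y) = A * Y"
    using x y assoc_mult_mat[OF c'(2) c(1) c(2)] assoc_mult_mat[OF c'(1) c(1) c(3)] by auto
  have AA: "A * X = A * Y"
    using mat_adjoint_mult[OF c'(2) c'(1)] l x y by metis
  have r: "X * A * (Y * A) = X * A" "Y * A * (X * A) = Y * A"
    using x y assoc_mult_mat[OF c(2) c(1) c'(4)] assoc_mult_mat[OF c(3) c(1) c'(3)]
      assoc_mult_mat[OF c(1) c(3) c(1)] assoc_mult_mat[OF c(1) c(2) c(1)] by auto
  have BB: "X * A = Y * A"
    using mat_adjoint_mult[OF c'(3) c'(4)] r x y by metis
  have "X = X * (A * X)" using x assoc_mult_mat[OF c(2) c(1) c(2)] by simp
  also have "\<dots> = X * A * Y" unfolding AA using assoc_mult_mat[OF c(2) c(1) c(3)] by simp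
  also have "\<dots> = Y" using BB y by simp
  finally show ?thesis .
qed

end

theory Submission
  imports Defs
begin

text \<open>
  Normalize \<open>\<parallel>x\<^sub>0\<parallel> = 1\<close> and put \<open>u = A x\<^sub>0\<close>, \<open>p = A x\<close>. The next iterate \<open>z\<close> solves the normal equations
  for the data \<open>\<bar>u\<bar> \<odot> phase p\<close>; hence \<open>\<parallel>A z\<parallel> \<le> \<parallel>A x\<^sub>0\<parallel>\<close>, and \<open>\<langle>A x\<^sub>0, A z\<rangle>\<close> is the sum of
  \<open>\<bar>u\<^sub>i\<bar> cnj u\<^sub>i phase p\<^sub>i\<close>. If \<open>x\<close> has correlation \<open>c\<close> with \<open>x\<^sub>0\<close>, the mean of a summand is at least
  \<open>c (1 + \<kappa> (1 - c\<^sup>2)\<^sup>2)\<close>, as one sees by symmetrizing the joint density of \<open>(u\<^sub>i, p\<^sub>i)\<close>. Chaining over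
  the unit sphere, which is where \<open>m \<ge> M n\<^sup>2\<close> enters, shows that the empirical mean is within
  \<open>\<delta> / sqrt n\<close> of its expectation, uniformly in \<open>x\<close>. So the correlation grows geometrically from
  \<open>1 / sqrt n\<close> until it is close to 1, which takes \<open>O(log n)\<close> steps.

  Near \<open>x\<^sub>0\<close>, the vector \<open>\<bar>u\<bar> \<odot> phase p - u\<close> is to first order the part of \<open>A (x - x\<^sub>0)\<close> that is tangential
  to the circles of radii \<open>\<bar>u\<^sub>i\<bar>\<close>. This part carries about half of the energy, and the rows on which the
  linearization fails carry little of it, uniformly in \<open>x\<close>; hence the iteration contracts.\<close>

text \<open>The iterates depend on \<open>A\<close>, so every estimate must hold for all
  \<open>x\<close> on one event. The critical precision is \<open>\<delta> / sqrt n\<close>: the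
  initial correlation may be as small as \<open>1 / sqrt n\<close>, and an error of that order would
  swamp the gain. Such a deviation of an empirical mean has probability about
  \<open>exp (- c m / n)\<close>, while the sphere has entropy of order \<open>n\<close>; this is
  the origin of \<open>m \<ge> M n\<^sup>2\<close>. A single net of the finest scale would cost
  \<open>n log n\<close>, hence the chaining.

  The obstacle is the jump of \<open>phase\<close> at 0. Squared increments of the phase process
  decay only like the square root of the distance, and for suitable \<open>x\<close> some
  measurements vanish whatever \<open>A\<close> is. The chain therefore stops at scale
  \<open>1 / n\<^sup>2\<close>; the last comparison, between a point and its neighbour in the net,
  treats separately the rows whose measurement at the net point is small. Where a measurement
  vanishes, any unimodular value is accepted as its phase.

  The gain factor \<open>(1 - c\<^sup>2)\<^sup>2\<close> vanishes as \<open>c\<close> tends to 1, so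
  growth of the correlation is used only up to \<open>1 - \<eta>\<close>, where the contraction
  argument takes over.\<close>

abbreviation cg :: "complex measure" where "cg \<equiv> complex_gaussian"

section \<open>Density and unitary invariance of the complex Gaussian law\<close>

definition cdens :: "complex \<Rightarrow> real" where
  "cdens z = exp (- (cmod z)\<^sup>2) / pi"

lemma cdens_measurable [measurable]: "cdens \<in> borel_measurable borel"
  unfolding cdens_def by measurable

lemma cdens_nonneg [simp]: "0 \<le> cdens z"
  by (simp add: cdens_def)

lemma Complex_measurable [measurable]:
  "(\<lambda>(x, y). Complex x y) \<in> borel_measurable (lborel \<Otimes>\<^sub>M lborel)"
proof -
  have eq: "(\<lambda>(x, y). Complex x y) = (\<lambda>p. complex_of_real (fst p) + \<i> * complex_of_real (snd p))"
    by (auto simp: fun_eq_iff complex_eq_iff)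
  show ?thesis unfolding eq by measurable
qed

text \<open>Boxes determine Lebesgue measure, and the preimage of a complex box is a product of two
  intervals. With this the Gaussian law gets a density on the plane, where complex shears can
  act.\<close>

lemma lborel_complex: "(lborel :: complex measure) = distr (lborel \<Otimes>\<^sub>M lborel) borel (\<lambda>(x, y). Complex x y)"
proof (rule lborel_eqI)
  fix l u :: complex assume le: "\<And>b. b \<in> Basis \<Longrightarrow> real_inner_class.inner l b \<le> real_inner_class.inner u b"
  have le': "Re l \<le> Re u" "Im l \<le> Im u"
    using le[of 1] le[of \<i>] by (auto simp: Basis_complex_def)
  have "(\<lambda>(x, y). Complex x y) -` box l u \<inter> space (lborel \<Otimes>\<^sub>M lborel) = box (Re l) (Re u) \<times> box (Im l) (Im u)"
    by (auto simp: box_def Basis_complex_def space_pair_measure)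
  then have "emeasure (distr (lborel \<Otimes>\<^sub>M lborel) borel (\<lambda>(x, y). Complex x y)) (box l u)
     = emeasure (lborel \<Otimes>\<^sub>M lborel) (box (Re l) (Re u) \<times> box (Im l) (Im u))"
    by (subst emeasure_distr) auto
  also have "\<dots> = ennreal (Re u - Re l) * ennreal (Im u - Im l)"
    using le' by (subst lborel.emeasure_pair_measure_Times) auto
  also have "\<dots> = (\<Prod>b\<in>Basis. real_inner_class.inner (u - l) b)"
    using le' by (simp add: Basis_complex_def ennreal_mult' mult.commute)
  finally show "emeasure (distr (lborel \<Otimes>\<^sub>M lborel) borel (\<lambda>(x, y). Complex x y)) (box l u) = (\<Prod>b\<in>Basis. real_inner_class.inner (u - l) b)" .
qed simp

lemma complex_gaussian_density: "cg = density lborel cdens"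
proof -
  let ?N = "normal_density 0 (sqrt (1/2))"
  have eq: "ennreal (?N x) * ennreal (?N y) = ennreal (cdens (Complex x y))" for x y
    by (simp add: normal_density_def cdens_def ennreal_mult'[symmetric] cmod_def exp_add[symmetric]
        real_sqrt_mult[symmetric] algebra_simps)
  have "density lborel ?N \<Otimes>\<^sub>M density lborel ?N
      = density (lborel \<Otimes>\<^sub>M lborel) (\<lambda>(x, y). ennreal (?N x) * ennreal (?N y))"
    by (rule pair_measure_density)
       (auto intro!: prob_space_imp_sigma_finite prob_space_normal_density sigma_finite_lborel)
  also have "\<dots> = density (lborel \<Otimes>\<^sub>M lborel) (\<lambda>p. ennreal (cdens ((\<lambda>(x, y). Complex x y) p)))"
    by (intro density_cong) (auto simp: eq case_prod_beta)
  finally have *: "density lborel ?N \<Otimes>\<^sub>M density lborel ?N = \<dots>" .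
  show ?thesis
    unfolding complex_gaussian_def * lborel_complex
    by (subst density_distr) auto
qed

lemma sets_cg [measurable_cong, simp]: "sets cg = sets borel"
  by (simp add: complex_gaussian_def)

lemma space_cg [simp]: "space cg = UNIV"
  by (simp add: complex_gaussian_def)

interpretation cg: prob_space cg
  by (rule prob_space_complex_gaussian)

lemma nn_integral_cg:
  assumes [measurable]: "f \<in> borel_measurable borel"
  shows "(\<integral>\<^sup>+z. f z \<partial>cg) = (\<integral>\<^sup>+z. ennreal (cdens z) * f z \<partial>lborel)"
  unfolding complex_gaussian_density by (subst nn_integral_density) auto

lemma nn_integral_lborel_translate:
  fixes c :: complex
  assumes [measurable]: "f \<in> borel_measurable borel"
  shows "(\<integral>\<^sup>+z. f (z + c) \<partial>lborel) = (\<integral>\<^sup>+z. f z \<partial>lborel)"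
proof -
  have "(\<integral>\<^sup>+z. f z \<partial>lborel) = (\<integral>\<^sup>+z. f z \<partial>distr lborel borel ((+) c))"
    by (simp add: lborel_distr_plus)
  also have "\<dots> = (\<integral>\<^sup>+z. f (c + z) \<partial>lborel)"
    by (subst nn_integral_distr) auto
  finally show ?thesis by (simp add: add.commute)
qed

lemma nn_integral_lborel_scale:
  fixes s :: real
  assumes [measurable]: "f \<in> borel_measurable (borel :: complex measure)" and "s \<noteq> 0"
  shows "(\<integral>\<^sup>+z. f z \<partial>lborel) = ennreal (s\<^sup>2) * (\<integral>\<^sup>+z. f (of_real s * z) \<partial>lborel)"
  by (subst lborel_affine[OF \<open>s \<noteq> 0\<close>, of 0])
     (simp add: nn_integral_density nn_integral_distr nn_integral_cmult scaleR_conv_of_real)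

lemma shear_snd:
  fixes F :: "complex \<Rightarrow> complex \<Rightarrow> ennreal"
  assumes [measurable]: "case_prod F \<in> borel_measurable (borel \<Otimes>\<^sub>M borel)"
  shows "(\<integral>\<^sup>+x. \<integral>\<^sup>+y. F x (y + l * x) \<partial>lborel \<partial>lborel) = (\<integral>\<^sup>+x. \<integral>\<^sup>+y. F x y \<partial>lborel \<partial>lborel)"
  by (intro nn_integral_cong nn_integral_lborel_translate) measurable

lemma shear_fst:
  fixes F :: "complex \<Rightarrow> complex \<Rightarrow> ennreal"
  assumes [measurable]: "case_prod F \<in> borel_measurable (borel \<Otimes>\<^sub>M borel)"
  shows "(\<integral>\<^sup>+x. \<integral>\<^sup>+y. F (x + t * y) y \<partial>lborel \<partial>lborel) = (\<integral>\<^sup>+x. \<integral>\<^sup>+y. F x y \<partial>lborel \<partial>lborel)"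
proof -
  have "(\<integral>\<^sup>+x. \<integral>\<^sup>+y. F (x + t * y) y \<partial>lborel \<partial>lborel) = (\<integral>\<^sup>+y. \<integral>\<^sup>+x. F (x + t * y) y \<partial>lborel \<partial>lborel)"
    by (rule lborel_pair.Fubini') measurable
  also have "\<dots> = (\<integral>\<^sup>+y. \<integral>\<^sup>+x. F x y \<partial>lborel \<partial>lborel)"
    by (intro nn_integral_cong nn_integral_lborel_translate) measurable
  also have "\<dots> = (\<integral>\<^sup>+x. \<integral>\<^sup>+y. F x y \<partial>lborel \<partial>lborel)"
    by (rule lborel_pair.Fubini') measurable
  finally show ?thesis .
qed

text \<open>A matrix of \<open>SU(2)\<close> with nonzero off-diagonal entry is a product of three shears.\<close>

lemma lborel_su2_aux:
  fixes F :: "complex \<Rightarrow> complex \<Rightarrow> ennreal"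
  assumes [measurable]: "case_prod F \<in> borel_measurable (borel \<Otimes>\<^sub>M borel)"
    and ab: "(cmod a)\<^sup>2 + (cmod b)\<^sup>2 = 1" and b: "b \<noteq> 0"
  shows "(\<integral>\<^sup>+x. \<integral>\<^sup>+y. F (a * x + b * y) (- cnj b * x + cnj a * y) \<partial>lborel \<partial>lborel)
       = (\<integral>\<^sup>+x. \<integral>\<^sup>+y. F x y \<partial>lborel \<partial>lborel)"
proof -
  \<comment> \<open>The three shears add t times the second coordinate to the first, then l times
    the first to the second, then s times the second to the first. The product has diagonal entries
    1 + s l and 1 + l t and lower left entry l, which forces these values; the determinant condition
    then yields the entry b.\<close>
  define l where "l = - cnj b"
  define s t where "s = (a - 1) / l" and "t = (cnj a - 1) / l"
  have l: "l \<noteq> 0" using b by (simp add: l_def)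
  have norm: "a * cnj a + b * cnj b = 1"
    using ab by (simp add: complex_norm_square[symmetric] flip: of_real_power of_real_add)
  have e2: "l * (x + t * y) + y = - cnj b * x + cnj a * y" for x y
    using l by (simp add: t_def l_def field_simps)
  have e1: "(x + t * y) + s * (y + l * (x + t * y)) = a * x + b * y" for x y
  proof -
    have "l * ((x + t * y) + s * (y + l * (x + t * y))) = l * (a * x) + (a * cnj a - 1) * y"
      using l by (simp add: t_def s_def field_simps)
    also have "a * cnj a - 1 = l * b"
      using norm by (simp add: l_def algebra_simps)
    finally have "l * ((x + t * y) + s * (y + l * (x + t * y))) = l * (a * x + b * y)"
      by (simp add: algebra_simps)
    then show ?thesis using l by simp
  qed
  have "(\<integral>\<^sup>+x. \<integral>\<^sup>+y. F x y \<partial>lborel \<partial>lborel) = (\<integral>\<^sup>+x. \<integral>\<^sup>+y. F (x + s * y) y \<partial>lborel \<partial>lborel)"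
    by (rule shear_fst[symmetric]) measurable
  also have "\<dots> = (\<integral>\<^sup>+x. \<integral>\<^sup>+y. F (x + s * (y + l * x)) (y + l * x) \<partial>lborel \<partial>lborel)"
    by (rule shear_snd[where F = "\<lambda>x y. F (x + s * y) y", symmetric]) measurable
  also have "\<dots> = (\<integral>\<^sup>+x. \<integral>\<^sup>+y. F ((x + t * y) + s * (y + l * (x + t * y))) (y + l * (x + t * y)) \<partial>lborel \<partial>lborel)"
    by (rule shear_fst[where F = "\<lambda>x y. F (x + s * (y + l * x)) (y + l * x)", symmetric]) measurable
  also have "\<dots> = (\<integral>\<^sup>+x. \<integral>\<^sup>+y. F (a * x + b * y) (- cnj b * x + cnj a * y) \<partial>lborel \<partial>lborel)"
    unfolding e1 using e2 by (simp add: add.commute)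
  finally show ?thesis ..
qed

lemma lborel_su2:
  fixes F :: "complex \<Rightarrow> complex \<Rightarrow> ennreal"
  assumes [measurable]: "case_prod F \<in> borel_measurable (borel \<Otimes>\<^sub>M borel)"
    and ab: "(cmod a)\<^sup>2 + (cmod b)\<^sup>2 = 1"
  shows "(\<integral>\<^sup>+x. \<integral>\<^sup>+y. F (a * x + b * y) (- cnj b * x + cnj a * y) \<partial>lborel \<partial>lborel)
       = (\<integral>\<^sup>+x. \<integral>\<^sup>+y. F x y \<partial>lborel \<partial>lborel)"
proof (cases "b = 0")
  case False
  then show ?thesis using lborel_su2_aux[of F a b] ab by simp
next
  case True
  \<comment> \<open>For b = 0 the previous factorization would divide by zero. The diagonal matrix
    is written as a quarter turn composed with an antidiagonal matrix; both have nonzero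
    off-diagonal entries. \<open>G\<close> absorbs the quarter turn.\<close>
  define G where "G = (\<lambda>x y. F (- y) x)"
  have [measurable]: "case_prod G \<in> borel_measurable (borel \<Otimes>\<^sub>M borel)"
    unfolding G_def by measurable
  have a: "cmod a = 1" using ab True by (simp add: power2_eq_1_iff) (smt (verit) norm_ge_zero)
  have a0: "a \<noteq> 0" using a by auto
  have "(\<integral>\<^sup>+x. \<integral>\<^sup>+y. F (a * x + b * y) (- cnj b * x + cnj a * y) \<partial>lborel \<partial>lborel)
     = (\<integral>\<^sup>+x. \<integral>\<^sup>+y. G (0 * x + cnj a * y) (- cnj (cnj a) * x + cnj 0 * y) \<partial>lborel \<partial>lborel)"
    using True by (simp add: G_def)
  also have "\<dots> = (\<integral>\<^sup>+x. \<integral>\<^sup>+y. G x y \<partial>lborel \<partial>lborel)"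
    by (rule lborel_su2_aux) (use a a0 in auto)
  also have "\<dots> = (\<integral>\<^sup>+x. \<integral>\<^sup>+y. F (0 * x + (-1) * y) (- cnj (-1) * x + cnj 0 * y) \<partial>lborel \<partial>lborel)"
    by (simp add: G_def)
  also have "\<dots> = (\<integral>\<^sup>+x. \<integral>\<^sup>+y. F x y \<partial>lborel \<partial>lborel)"
    by (rule lborel_su2_aux) auto
  finally show ?thesis .
qed

lemma nn_integral_cg2:
  assumes [measurable]: "case_prod F \<in> borel_measurable (borel \<Otimes>\<^sub>M borel)"
  shows "(\<integral>\<^sup>+x. \<integral>\<^sup>+y. F x y \<partial>cg \<partial>cg)
    = (\<integral>\<^sup>+x. \<integral>\<^sup>+y. ennreal (cdens x * cdens y) * F x y \<partial>lborel \<partial>lborel)"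
proof -
  have "(\<integral>\<^sup>+x. \<integral>\<^sup>+y. F x y \<partial>cg \<partial>cg) = (\<integral>\<^sup>+x. ennreal (cdens x) * (\<integral>\<^sup>+y. F x y \<partial>cg) \<partial>lborel)"
    by (rule nn_integral_cg) measurable
  also have "\<dots> = (\<integral>\<^sup>+x. ennreal (cdens x) * (\<integral>\<^sup>+y. ennreal (cdens y) * F x y \<partial>lborel) \<partial>lborel)"
    by (intro nn_integral_cong arg_cong2[of _ _ _ _ times] refl nn_integral_cg) measurable
  also have "\<dots> = (\<integral>\<^sup>+x. \<integral>\<^sup>+y. ennreal (cdens x * cdens y) * F x y \<partial>lborel \<partial>lborel)"
    by (simp add: nn_integral_cmult[symmetric] ennreal_mult' mult.assoc)
  finally show ?thesis .
qed

text \<open>The joint density of two independent standard Gaussians depends only on the sum of the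
  squared moduli, which a unitary map preserves. Rotation invariance and the law of linear
  functionals of a row rest on this.\<close>

lemma cg_su2:
  fixes F :: "complex \<Rightarrow> complex \<Rightarrow> ennreal"
  assumes [measurable]: "case_prod F \<in> borel_measurable (borel \<Otimes>\<^sub>M borel)"
    and ab: "(cmod a)\<^sup>2 + (cmod b)\<^sup>2 = 1"
  shows "(\<integral>\<^sup>+x. \<integral>\<^sup>+y. F (a * x + b * y) (- cnj b * x + cnj a * y) \<partial>cg \<partial>cg)
       = (\<integral>\<^sup>+x. \<integral>\<^sup>+y. F x y \<partial>cg \<partial>cg)"
proof -
  define H where "H = (\<lambda>x y. ennreal (cdens x * cdens y) * F x y)"
  have norm: "a * cnj a + b * cnj b = 1"
    using ab by (simp add: complex_norm_square[symmetric] flip: of_real_power of_real_add)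
  have inv: "(cmod (a * x + b * y))\<^sup>2 + (cmod (- cnj b * x + cnj a * y))\<^sup>2 = (cmod x)\<^sup>2 + (cmod y)\<^sup>2" for x y
  proof -
    have "complex_of_real ((cmod (a * x + b * y))\<^sup>2 + (cmod (- cnj b * x + cnj a * y))\<^sup>2)
      = (a * cnj a + b * cnj b) * (x * cnj x + y * cnj y)"
      by (simp only: of_real_add complex_norm_square) (simp add: algebra_simps)
    also have "\<dots> = complex_of_real ((cmod x)\<^sup>2 + (cmod y)\<^sup>2)"
      by (simp only: norm of_real_add complex_norm_square) simp
    finally show ?thesis using of_real_eq_iff by blast
  qed
  have D: "cdens (a * x + b * y) * cdens (- cnj b * x + cnj a * y) = cdens x * cdens y" for x y
    using inv[of x y] by (simp add: cdens_def exp_add[symmetric] del: mult_minus_left)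
  have "(\<integral>\<^sup>+x. \<integral>\<^sup>+y. F (a * x + b * y) (- cnj b * x + cnj a * y) \<partial>cg \<partial>cg)
    = (\<integral>\<^sup>+x. \<integral>\<^sup>+y. H (a * x + b * y) (- cnj b * x + cnj a * y) \<partial>lborel \<partial>lborel)"
    unfolding H_def D by (rule nn_integral_cg2) measurable
  also have "\<dots> = (\<integral>\<^sup>+x. \<integral>\<^sup>+y. H x y \<partial>lborel \<partial>lborel)"
    by (rule lborel_su2) (use ab in \<open>auto simp: H_def\<close>)
  also have "\<dots> = (\<integral>\<^sup>+x. \<integral>\<^sup>+y. F x y \<partial>cg \<partial>cg)"
    unfolding H_def by (rule nn_integral_cg2[symmetric]) measurable
  finally show ?thesis .
qed

lemma cg_rotate:
  fixes f :: "complex \<Rightarrow> ennreal"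
  assumes [measurable]: "f \<in> borel_measurable borel" and a: "cmod a = 1"
  shows "(\<integral>\<^sup>+x. f (a * x) \<partial>cg) = (\<integral>\<^sup>+x. f x \<partial>cg)"
  using cg_su2[of "\<lambda>x y. f x" a 0] a cg.emeasure_space_1 by simp

text \<open>\<open>lin_form\<close> conjugates the entries of the row; this invariance removes the
  conjugation. Reflection of the plane maps boxes to boxes of equal area, so it preserves Lebesgue
  measure.\<close>

lemma cg_cnj:
  fixes f :: "complex \<Rightarrow> ennreal"
  assumes [measurable]: "f \<in> borel_measurable borel"
  shows "(\<integral>\<^sup>+x. f (cnj x) \<partial>cg) = (\<integral>\<^sup>+x. f x \<partial>cg)"
proof -
  have [measurable]: "cnj \<in> borel_measurable borel" 
    by (intro borel_measurable_continuous_onI continuous_intros)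
  have L: "distr lborel borel cnj = (lborel :: complex measure)"
  proof (rule lborel_eqI[symmetric])
    fix l u :: complex assume le: "\<And>b. b \<in> Basis \<Longrightarrow> real_inner_class.inner l b \<le> real_inner_class.inner u b"
    have le': "Re l \<le> Re u" "Im l \<le> Im u"
      using le[of 1] le[of \<i>] by (auto simp: Basis_complex_def)
    have "cnj -` box l u = box (Complex (Re l) (- Im u)) (Complex (Re u) (- Im l))"
      by (auto simp: box_def Basis_complex_def)
    then show "emeasure (distr lborel borel cnj) (box l u) = (\<Prod>b\<in>Basis. real_inner_class.inner (u - l) b)"
      using le' by (subst emeasure_distr) (auto simp: emeasure_lborel_box_eq Basis_complex_def ennreal_mult')
  qed simp
  have "(\<integral>\<^sup>+x. f x \<partial>cg) = (\<integral>\<^sup>+x. ennreal (cdens x) * f x \<partial>distr lborel borel cnj)"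
    unfolding L by (rule nn_integral_cg) measurable
  also have "\<dots> = (\<integral>\<^sup>+x. ennreal (cdens x) * f (cnj x) \<partial>lborel)"
    by (subst nn_integral_distr) (auto simp: cdens_def)
  also have "\<dots> = (\<integral>\<^sup>+x. f (cnj x) \<partial>cg)"
    by (rule nn_integral_cg[symmetric]) measurable
  finally show ?thesis ..
qed

section \<open>Joint law of two linear functionals of a Gaussian row\<close>

lemma cnj_measurable [measurable]: "cnj \<in> borel_measurable borel"
  by (intro borel_measurable_continuous_onI continuous_intros)

text \<open>Supplies the unitary coefficients that merge two Gaussian variables into one. At the
  origin any unit vector serves; (1, 0) is taken.\<close>

lemma split_unit:
  fixes x y :: complex
  obtains r :: real and a b where "0 \<le> r" "r\<^sup>2 = (cmod x)\<^sup>2 + (cmod y)\<^sup>2"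
    "x = of_real r * a" "y = of_real r * b" "(cmod a)\<^sup>2 + (cmod b)\<^sup>2 = 1"
proof (cases "(cmod x)\<^sup>2 + (cmod y)\<^sup>2 = 0")
  case True
  then have "x = 0" "y = 0" by (auto simp: sum_power2_eq_zero_iff)
  then show ?thesis by (intro that[of 0 1 0]) auto
next
  case False
  define r where "r = sqrt ((cmod x)\<^sup>2 + (cmod y)\<^sup>2)"
  have r: "r > 0" "r\<^sup>2 = (cmod x)\<^sup>2 + (cmod y)\<^sup>2"
    using False by (auto simp: r_def add_nonneg_nonneg less_le)
  show ?thesis
  proof (rule that[of r "x / of_real r" "y / of_real r"])
    show "(cmod (x / of_real r))\<^sup>2 + (cmod (y / of_real r))\<^sup>2 = 1"
      using r False by (simp add: norm_divide power_divide add_divide_distrib[symmetric])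
  qed (use r in auto)
qed

text \<open>A unit combination of two independent standard Gaussians is again standard: complete the
  unit vector to a matrix of SU(2) and integrate out the second coordinate.\<close>

lemma cg_collapse:
  fixes f :: "complex \<Rightarrow> ennreal"
  assumes [measurable]: "f \<in> borel_measurable borel" and ab: "(cmod a)\<^sup>2 + (cmod b)\<^sup>2 = 1"
  shows "(\<integral>\<^sup>+x. \<integral>\<^sup>+y. f (a * x + b * y) \<partial>cg \<partial>cg) = (\<integral>\<^sup>+x. f x \<partial>cg)"
  using cg_su2[of "\<lambda>x y. f x" a b] ab cg.emeasure_space_1 by simp

text \<open>One formula serves both as the measurement of \<open>x\<close> by a row and as the
  Hermitian inner product of two vectors. The index set is arbitrary to allow induction over
  coordinates.\<close>

definition lin_form :: "'i set \<Rightarrow> ('i \<Rightarrow> complex) \<Rightarrow> ('i \<Rightarrow> complex) \<Rightarrow> complex" where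
  "lin_form J r x = (\<Sum>j\<in>J. cnj (r j) * x j)"

lemma lin_measurable [measurable]: "(\<lambda>r. lin_form J r x) \<in> borel_measurable (PiM J (\<lambda>_. cg))"
  unfolding lin_form_def by measurable

interpretation cgP: product_sigma_finite "\<lambda>_. cg"
  by unfold_locales

interpretation cgpair: pair_sigma_finite cg cg
  by unfold_locales

text \<open>In the induction ap_step the new coordinate is absorbed by two unitary rotations, one that
  collects the first functional in a single Gaussian variable and one that collects the remainder
  of the second functional.\<close>

lemma pair_law_nn:
  fixes x y :: "'i \<Rightarrow> complex"
  assumes "finite J"
  shows "\<exists>\<alpha> \<beta> \<gamma>. (cmod \<alpha>)\<^sup>2 = (\<Sum>j\<in>J. (cmod (x j))\<^sup>2) \<and> cnj \<alpha> * \<beta> = (\<Sum>j\<in>J. cnj (x j) * y j)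
     \<and> (cmod \<beta>)\<^sup>2 + (cmod \<gamma>)\<^sup>2 = (\<Sum>j\<in>J. (cmod (y j))\<^sup>2) \<and>
    (\<forall>F :: complex \<Rightarrow> complex \<Rightarrow> ennreal. case_prod F \<in> borel_measurable (borel \<Otimes>\<^sub>M borel) \<longrightarrow>
      (\<integral>\<^sup>+r. F (lin_form J r x) (lin_form J r y) \<partial>PiM J (\<lambda>_. cg)) = (\<integral>\<^sup>+g. \<integral>\<^sup>+h. F (\<alpha> * g) (\<beta> * g + \<gamma> * h) \<partial>cg \<partial>cg))"
  using assms
proof (induction J rule: finite_induct)
  case empty
  interpret E: prob_space "PiM {} (\<lambda>_::'i. cg)" by (rule prob_space_PiM) (rule cg.prob_space_axioms)
  show ?case
    by (intro exI[of _ 0]) (use E.emeasure_space_1 cg.emeasure_space_1 in \<open>auto simp: lin_form_def\<close>)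
next
  case (insert k J)
  then obtain \<alpha> \<beta> \<gamma> where G: "(cmod \<alpha>)\<^sup>2 = (\<Sum>j\<in>J. (cmod (x j))\<^sup>2)" "cnj \<alpha> * \<beta> = (\<Sum>j\<in>J. cnj (x j) * y j)"
     "(cmod \<beta>)\<^sup>2 + (cmod \<gamma>)\<^sup>2 = (\<Sum>j\<in>J. (cmod (y j))\<^sup>2)"
    and IH: "\<And>F :: complex \<Rightarrow> complex \<Rightarrow> ennreal. case_prod F \<in> borel_measurable (borel \<Otimes>\<^sub>M borel) \<Longrightarrow>
      (\<integral>\<^sup>+r. F (lin_form J r x) (lin_form J r y) \<partial>PiM J (\<lambda>_. cg)) = (\<integral>\<^sup>+g. \<integral>\<^sup>+h. F (\<alpha> * g) (\<beta> * g + \<gamma> * h) \<partial>cg \<partial>cg)"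
    by blast
  obtain \<rho> a b where ab: "0 \<le> \<rho>" "\<rho>\<^sup>2 = (cmod \<alpha>)\<^sup>2 + (cmod (x k))\<^sup>2"
    "\<alpha> = of_real \<rho> * a" "x k = of_real \<rho> * b" "(cmod a)\<^sup>2 + (cmod b)\<^sup>2 = 1"
    by (rule split_unit)
  \<comment> \<open>The coordinates of the second functional with respect to the rotated variables
    \<open>a * g + b * z\<close> and \<open>- cnj b * g + cnj a * z\<close>; this is verified in
    \<open>eq2\<close>.\<close>
  define \<beta>1 \<delta>1 where "\<beta>1 = \<beta> * cnj a + y k * cnj b" and "\<delta>1 = - \<beta> * b + y k * a"
  obtain \<rho>2 a2 b2 where ab2: "0 \<le> \<rho>2" "\<rho>2\<^sup>2 = (cmod \<delta>1)\<^sup>2 + (cmod \<gamma>)\<^sup>2"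
    "\<delta>1 = of_real \<rho>2 * a2" "\<gamma> = of_real \<rho>2 * b2" "(cmod a2)\<^sup>2 + (cmod b2)\<^sup>2 = 1"
    by (rule split_unit)
  have norm: "a * cnj a + b * cnj b = 1"
    using ab(5) by (simp add: complex_norm_square[symmetric] flip: of_real_power of_real_add)
  have gram: "(cmod \<beta>1)\<^sup>2 + (cmod \<delta>1)\<^sup>2 = (cmod \<beta>)\<^sup>2 + (cmod (y k))\<^sup>2"
  proof -
    have "complex_of_real ((cmod \<beta>1)\<^sup>2 + (cmod \<delta>1)\<^sup>2)
      = (a * cnj a + b * cnj b) * (\<beta> * cnj \<beta> + y k * cnj (y k))"
      unfolding \<beta>1_def \<delta>1_def by (simp only: of_real_add complex_norm_square) (simp add: algebra_simps)
    also have "\<dots> = complex_of_real ((cmod \<beta>)\<^sup>2 + (cmod (y k))\<^sup>2)"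
      by (simp only: norm of_real_add complex_norm_square) simp
    finally show ?thesis using of_real_eq_iff by blast
  qed
  have eq1: "\<alpha> * g + x k * z = of_real \<rho> * (a * g + b * z)" for g z
    unfolding ab(3,4) by (simp add: algebra_simps)
  have eq2: "\<beta> * g + y k * z = \<beta>1 * (a * g + b * z) + \<delta>1 * (- cnj b * g + cnj a * z)" for g z
  proof -
    have "\<beta>1 * (a * g + b * z) + \<delta>1 * (- cnj b * g + cnj a * z) = (a * cnj a + b * cnj b) * (\<beta> * g + y k * z)"
      unfolding \<beta>1_def \<delta>1_def by (simp add: algebra_simps)
    then show ?thesis using norm by simp
  qed
  show ?case
  proof (intro exI conjI allI impI)
    show "(cmod (of_real \<rho>))\<^sup>2 = (\<Sum>j\<in>insert k J. (cmod (x j))\<^sup>2)"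
      using insert ab G by simp
    show "cnj (of_real \<rho>) * \<beta>1 = (\<Sum>j\<in>insert k J. cnj (x j) * y j)"
      using insert(1,2) G(2)[symmetric] ab(3,4) by (simp add: \<beta>1_def algebra_simps)
    show "(cmod \<beta>1)\<^sup>2 + (cmod (of_real \<rho>2))\<^sup>2 = (\<Sum>j\<in>insert k J. (cmod (y j))\<^sup>2)"
      using insert(1,2) G(3) gram ab2 by simp
    fix F :: "complex \<Rightarrow> complex \<Rightarrow> ennreal"
    assume [measurable]: "case_prod F \<in> borel_measurable (borel \<Otimes>\<^sub>M borel)"
    have upd: "lin_form (insert k J) (r(k := z)) w = cnj z * w k + lin_form J r w" for r z w
    proof -
      have "(\<Sum>j\<in>J. cnj ((r(k := z)) j) * w j) = (\<Sum>j\<in>J. cnj (r j) * w j)"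
        using insert(2) by (intro sum.cong) auto
      then show ?thesis using insert(1,2) by (simp add: lin_form_def)
    qed
    have "(\<integral>\<^sup>+r. F (lin_form (insert k J) r x) (lin_form (insert k J) r y) \<partial>PiM (insert k J) (\<lambda>_. cg))
      = (\<integral>\<^sup>+z. \<integral>\<^sup>+r. F (cnj z * x k + lin_form J r x) (cnj z * y k + lin_form J r y) \<partial>PiM J (\<lambda>_. cg) \<partial>cg)"
      using insert(1,2) by (subst cgP.product_nn_integral_insert_rev) (auto simp: upd)
    also have "\<dots> = (\<integral>\<^sup>+z. \<integral>\<^sup>+g. \<integral>\<^sup>+h. F (cnj z * x k + \<alpha> * g) (cnj z * y k + (\<beta> * g + \<gamma> * h)) \<partial>cg \<partial>cg \<partial>cg)"
      by (intro nn_integral_cong IH) measurable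
    also have "\<dots> = (\<integral>\<^sup>+z. \<integral>\<^sup>+g. \<integral>\<^sup>+h. F (z * x k + \<alpha> * g) (z * y k + (\<beta> * g + \<gamma> * h)) \<partial>cg \<partial>cg \<partial>cg)"
      by (rule cg_cnj) measurable
    also have "\<dots> = (\<integral>\<^sup>+g. \<integral>\<^sup>+z. \<integral>\<^sup>+h. F (z * x k + \<alpha> * g) (z * y k + (\<beta> * g + \<gamma> * h)) \<partial>cg \<partial>cg \<partial>cg)"
      by (rule cgpair.Fubini') measurable
    also have "\<dots> = (\<integral>\<^sup>+g. \<integral>\<^sup>+z. (\<lambda>g' z'. \<integral>\<^sup>+h. F (of_real \<rho> * g') (\<beta>1 * g' + \<delta>1 * z' + \<gamma> * h) \<partial>cg)
           (a * g + b * z) (- cnj b * g + cnj a * z) \<partial>cg \<partial>cg)"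
      by (simp only: eq1[symmetric] eq2[symmetric]) (simp add: algebra_simps)
    also have "\<dots> = (\<integral>\<^sup>+g. \<integral>\<^sup>+z. \<integral>\<^sup>+h. F (of_real \<rho> * g) (\<beta>1 * g + \<delta>1 * z + \<gamma> * h) \<partial>cg \<partial>cg \<partial>cg)"
      by (rule cg_su2) (use ab in measurable)
    also have "\<dots> = (\<integral>\<^sup>+g. \<integral>\<^sup>+z. \<integral>\<^sup>+h. (\<lambda>w. F (of_real \<rho> * g) (\<beta>1 * g + of_real \<rho>2 * w)) (a2 * z + b2 * h) \<partial>cg \<partial>cg \<partial>cg)"
      unfolding ab2(3,4) by (simp add: algebra_simps)
    also have "\<dots> = (\<integral>\<^sup>+g. \<integral>\<^sup>+z. F (of_real \<rho> * g) (\<beta>1 * g + of_real \<rho>2 * z) \<partial>cg \<partial>cg)"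
      by (intro nn_integral_cong cg_collapse) (use ab2 in measurable)
    finally show "(\<integral>\<^sup>+r. F (lin_form (insert k J) r x) (lin_form (insert k J) r y) \<partial>PiM (insert k J) (\<lambda>_. cg))
       = (\<integral>\<^sup>+g. \<integral>\<^sup>+h. F (of_real \<rho> * g) (\<beta>1 * g + of_real \<rho>2 * h) \<partial>cg \<partial>cg)" .
  qed
qed

abbreviation ip :: "nat \<Rightarrow> (nat \<Rightarrow> complex) \<Rightarrow> (nat \<Rightarrow> complex) \<Rightarrow> complex" where
  "ip n \<equiv> lin_form {..<n}"

definition nrm :: "nat \<Rightarrow> (nat \<Rightarrow> complex) \<Rightarrow> real" where
  "nrm n x = sqrt (\<Sum>j<n. (cmod (x j))\<^sup>2)"

abbreviation rowm :: "nat \<Rightarrow> (nat \<Rightarrow> complex) measure" where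
  "rowm n \<equiv> PiM {..<n} (\<lambda>_. cg)"

lemma nrm_sq: "(nrm n x)\<^sup>2 = (\<Sum>j<n. (cmod (x j))\<^sup>2)"
  by (simp add: nrm_def sum_nonneg)

lemma nrm_nonneg [simp]: "0 \<le> nrm n x"
  by (simp add: nrm_def sum_nonneg)

lemma row_law_single:
  fixes f :: "complex \<Rightarrow> ennreal"
  assumes [measurable]: "f \<in> borel_measurable borel"
  shows "(\<integral>\<^sup>+r. f (ip n r x) \<partial>rowm n) = (\<integral>\<^sup>+g. f (of_real (nrm n x) * g) \<partial>cg)"
proof -
  obtain \<alpha> \<beta> \<gamma> where *: "(cmod \<alpha>)\<^sup>2 = (\<Sum>j<n. (cmod (x j))\<^sup>2)"
    "\<And>F :: complex \<Rightarrow> complex \<Rightarrow> ennreal. case_prod F \<in> borel_measurable (borel \<Otimes>\<^sub>M borel) \<Longrightarrow>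
      (\<integral>\<^sup>+r. F (ip n r x) (ip n r x) \<partial>rowm n) = (\<integral>\<^sup>+g. \<integral>\<^sup>+h. F (\<alpha> * g) (\<beta> * g + \<gamma> * h) \<partial>cg \<partial>cg)"
    using pair_law_nn[of "{..<n}" x x] by auto
  have c: "cmod \<alpha> = nrm n x"
    unfolding nrm_def *(1)[symmetric] by simp
  define a where "a = (if \<alpha> = 0 then 1 else \<alpha> / of_real (cmod \<alpha>))"
  have a: "cmod a = 1" "\<alpha> = of_real (nrm n x) * a"
    unfolding c[symmetric] a_def by (auto simp: norm_divide)
  have "(\<integral>\<^sup>+r. f (ip n r x) \<partial>rowm n) = (\<integral>\<^sup>+g. f (of_real (nrm n x) * (a * g)) \<partial>cg)"
    using *(2)[of "\<lambda>u p. f u"] cg.emeasure_space_1 a by (simp add: mult.assoc)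
  also have "\<dots> = (\<integral>\<^sup>+g. f (of_real (nrm n x) * g) \<partial>cg)"
    by (rule cg_rotate[OF _ a(1)]) measurable
  finally show ?thesis .
qed

text \<open>For unit vectors the first coefficient is unimodular. Rotating the first Gaussian makes
  it 1 and turns the second coefficient into the inner product; rotating the other Gaussian makes
  the last coefficient nonnegative. Hence the joint law of two measurements depends on the inner
  product alone.\<close>

lemma row_law_pair:
  assumes "nrm n x0 = 1" "nrm n x = 1"
  shows "cmod (ip n x0 x) \<le> 1"
    and "distr (rowm n) (borel \<Otimes>\<^sub>M borel) (\<lambda>r. (ip n r x0, ip n r x))
       = distr (cg \<Otimes>\<^sub>M cg) (borel \<Otimes>\<^sub>M borel)
           (\<lambda>(g, h). (g, ip n x0 x * g + of_real (sqrt (1 - (cmod (ip n x0 x))\<^sup>2)) * h))"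
proof -
  obtain \<alpha> \<beta> \<gamma> where *: "(cmod \<alpha>)\<^sup>2 = (\<Sum>j<n. (cmod (x0 j))\<^sup>2)" "cnj \<alpha> * \<beta> = (\<Sum>j<n. cnj (x0 j) * x j)"
     "(cmod \<beta>)\<^sup>2 + (cmod \<gamma>)\<^sup>2 = (\<Sum>j<n. (cmod (x j))\<^sup>2)"
    "\<And>F :: complex \<Rightarrow> complex \<Rightarrow> ennreal. case_prod F \<in> borel_measurable (borel \<Otimes>\<^sub>M borel) \<Longrightarrow>
      (\<integral>\<^sup>+r. F (ip n r x0) (ip n r x) \<partial>rowm n) = (\<integral>\<^sup>+g. \<integral>\<^sup>+h. F (\<alpha> * g) (\<beta> * g + \<gamma> * h) \<partial>cg \<partial>cg)"
    using pair_law_nn[of "{..<n}" x0 x] by blast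
  have al: "cmod \<alpha> = 1" using *(1) assms(1) nrm_sq[of n x0] nrm_nonneg
    by (metis norm_ge_zero one_power2 power2_eq_imp_eq zero_le_one)
  define \<zeta> where "\<zeta> = ip n x0 x"
  define s where "s = sqrt (1 - (cmod \<zeta>)\<^sup>2)"
  have zeta: "\<zeta> = cnj \<alpha> * \<beta>" using *(2) by (simp add: \<zeta>_def lin_form_def)
  have nz: "cmod \<zeta> = cmod \<beta>" using al by (simp add: zeta norm_mult)
  have bg: "(cmod \<beta>)\<^sup>2 + (cmod \<gamma>)\<^sup>2 = 1" using *(3) assms(2) nrm_sq[of n x] by simp
  then have s: "s = cmod \<gamma>" by (simp add: s_def nz algebra_simps flip: bg)
  show "cmod (ip n x0 x) \<le> 1"
    unfolding \<zeta>_def[symmetric] nz using bg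
    by (smt (verit) norm_ge_zero one_power2 power2_le_imp_le zero_le_power2)
  have aa: "\<alpha> * cnj \<alpha> = 1" using al by (simp add: complex_norm_square[symmetric])
  define w where "w = (if \<gamma> = 0 then 1 else \<gamma> / of_real (cmod \<gamma>))"
  have w: "cmod w = 1" "\<gamma> = of_real s * w"
    unfolding s w_def by (auto simp: norm_divide)
  have main: "(\<integral>\<^sup>+r. F (ip n r x0) (ip n r x) \<partial>rowm n) = (\<integral>\<^sup>+g. \<integral>\<^sup>+h. F g (\<zeta> * g + of_real s * h) \<partial>cg \<partial>cg)"
    if [measurable]: "case_prod F \<in> borel_measurable (borel \<Otimes>\<^sub>M borel)" for F :: "complex \<Rightarrow> complex \<Rightarrow> ennreal"
  proof -
    have b: "\<beta> = \<zeta> * \<alpha>" using aa by (simp add: zeta mult.commute mult.left_commute)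
    have "(\<integral>\<^sup>+r. F (ip n r x0) (ip n r x) \<partial>rowm n) = (\<integral>\<^sup>+g. \<integral>\<^sup>+h. F (\<alpha> * g) (\<zeta> * (\<alpha> * g) + \<gamma> * h) \<partial>cg \<partial>cg)"
      using *(4)[OF that] by (simp add: b mult.assoc)
    also have "\<dots> = (\<integral>\<^sup>+g. \<integral>\<^sup>+h. F g (\<zeta> * g + \<gamma> * h) \<partial>cg \<partial>cg)"
      by (rule cg_rotate[where f = "\<lambda>g. \<integral>\<^sup>+h. F g (\<zeta> * g + \<gamma> * h) \<partial>cg", OF _ al]) measurable
    also have "\<dots> = (\<integral>\<^sup>+g. \<integral>\<^sup>+h. F g (\<zeta> * g + of_real s * (w * h)) \<partial>cg \<partial>cg)"
      unfolding w(2) by (simp add: mult.assoc)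
    also have "\<dots> = (\<integral>\<^sup>+g. \<integral>\<^sup>+h. F g (\<zeta> * g + of_real s * h) \<partial>cg \<partial>cg)"
      by (intro nn_integral_cong cg_rotate[OF _ w(1)]) measurable
    finally show ?thesis .
  qed
  show "distr (rowm n) (borel \<Otimes>\<^sub>M borel) (\<lambda>r. (ip n r x0, ip n r x))
       = distr (cg \<Otimes>\<^sub>M cg) (borel \<Otimes>\<^sub>M borel)
           (\<lambda>(g, h). (g, ip n x0 x * g + of_real (sqrt (1 - (cmod (ip n x0 x))\<^sup>2)) * h))"
    unfolding \<zeta>_def[symmetric] s_def[symmetric]
  proof (rule measure_eqI)
    fix A assume "A \<in> sets (distr (rowm n) (borel \<Otimes>\<^sub>M borel) (\<lambda>r. (ip n r x0, ip n r x)))"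
    then have [measurable]: "A \<in> sets (borel \<Otimes>\<^sub>M borel)" by simp
    have "emeasure (distr (rowm n) (borel \<Otimes>\<^sub>M borel) (\<lambda>r. (ip n r x0, ip n r x))) A
      = (\<integral>\<^sup>+r. indicator A (ip n r x0, ip n r x) \<partial>rowm n)"
      by (subst nn_integral_indicator[symmetric], simp, subst nn_integral_distr) auto
    also have "\<dots> = (\<integral>\<^sup>+g. \<integral>\<^sup>+h. indicator A (g, \<zeta> * g + of_real s * h) \<partial>cg \<partial>cg)"
      by (rule main[of "\<lambda>u p. indicator A (u, p)"]) measurable
    also have "\<dots> = (\<integral>\<^sup>+q. indicator A (case q of (g, h) \<Rightarrow> (g, \<zeta> * g + of_real s * h)) \<partial>(cg \<Otimes>\<^sub>M cg))"
      by (subst cg.nn_integral_fst[symmetric]) auto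
    also have "\<dots> = emeasure (distr (cg \<Otimes>\<^sub>M cg) (borel \<Otimes>\<^sub>M borel) (\<lambda>(g, h). (g, \<zeta> * g + of_real s * h))) A"
      by (subst nn_integral_indicator[symmetric], simp, subst nn_integral_distr) auto
    finally show "emeasure (distr (rowm n) (borel \<Otimes>\<^sub>M borel) (\<lambda>r. (ip n r x0, ip n r x))) A
      = emeasure (distr (cg \<Otimes>\<^sub>M cg) (borel \<Otimes>\<^sub>M borel) (\<lambda>(g, h). (g, \<zeta> * g + of_real s * h))) A" .
  qed simp
qed

section \<open>Moments and small balls of the complex Gaussian\<close>

lemma nn_integral_cdens: "(\<integral>\<^sup>+z. ennreal (cdens z) \<partial>lborel) = 1"
  using nn_integral_cg[of "\<lambda>_. 1"] cg.emeasure_space_1 by simp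

text \<open>Scaling the plane by \<open>sqrt (1 - c)\<close> turns the integrand back into the
  Gaussian density; the Jacobian is the value.\<close>

lemma cg_exp_moment:
  assumes "c < 1"
  shows "(\<integral>\<^sup>+z. ennreal (exp (c * (cmod z)\<^sup>2)) \<partial>cg) = ennreal (1 / (1 - c))"
proof -
  define s where "s = sqrt (1 - c)"
  have s: "s > 0" "s\<^sup>2 = 1 - c" using assms by (auto simp: s_def)
  have eq: "ennreal (cdens z) * ennreal (exp (c * (cmod z)\<^sup>2)) = ennreal (cdens (of_real s * z))" for z
  proof -
    have c: "c = 1 - s\<^sup>2" using s by simp
    show ?thesis using s(1) unfolding c
      by (simp add: cdens_def ennreal_mult'[symmetric] norm_mult power_mult_distrib exp_add[symmetric] algebra_simps)
  qed
  have "ennreal (s\<^sup>2) * (\<integral>\<^sup>+z. ennreal (cdens (of_real s * z)) \<partial>lborel) = 1"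
    using nn_integral_lborel_scale[of "\<lambda>z. ennreal (cdens z)" s] s nn_integral_cdens by simp
  then have E: "ennreal (s\<^sup>2) * (\<integral>\<^sup>+z. ennreal (cdens (of_real s * z)) \<partial>lborel) = 1" .
  have "(\<integral>\<^sup>+z. ennreal (cdens (of_real s * z)) \<partial>lborel)
      = ennreal (1 / s\<^sup>2) * (ennreal (s\<^sup>2) * (\<integral>\<^sup>+z. ennreal (cdens (of_real s * z)) \<partial>lborel))"
    using s(1) by (simp add: mult.assoc[symmetric] ennreal_mult'[symmetric])
  also have "\<dots> = ennreal (1 / (1 - c))"
    unfolding E by (simp add: s)
  finally show ?thesis
    by (subst nn_integral_cg) (auto simp: eq)
qed

text \<open>The disc lies in a square of area \<open>4 * t\<^sup>2\<close>, and the density is at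
  most \<open>1 / pi \<le> 1 / 2\<close>.\<close>

lemma cg_small_ball: "0 \<le> t \<Longrightarrow> emeasure cg {z. cmod z < t} \<le> ennreal (2 * t\<^sup>2)"
proof -
  assume t: "0 \<le> t"
  have "emeasure cg {z. cmod z < t} = (\<integral>\<^sup>+z. indicator {z. cmod z < t} z \<partial>cg)"
    by (subst nn_integral_indicator) auto
  also have "\<dots> = (\<integral>\<^sup>+z. ennreal (cdens z) * indicator {z. cmod z < t} z \<partial>lborel)"
    by (rule nn_integral_cg) measurable
  also have "\<dots> \<le> (\<integral>\<^sup>+z. ennreal (1/2) * indicator (cbox (Complex (-t) (-t)) (Complex t t)) z \<partial>lborel)"
  proof (intro nn_integral_mono mult_mono)
    fix z :: complex
    have "exp (- (cmod z)\<^sup>2) / pi \<le> 1 / 2"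
      using pi_ge_two by (intro frac_le) auto
    then show "ennreal (cdens z) \<le> ennreal (1/2)" by (intro ennreal_leI) (simp add: cdens_def)
    have "z \<in> cbox (Complex (-t) (-t)) (Complex t t)" if "cmod z < t"
      using that abs_Re_le_cmod[of z] abs_Im_le_cmod[of z] by (auto simp: in_cbox_complex_iff)
    then show "(indicator {z. cmod z < t} z :: ennreal) \<le> indicator (cbox (Complex (-t) (-t)) (Complex t t)) z"
      by (auto simp: indicator_def)
  qed auto
  also have "\<dots> = ennreal (1/2) * ennreal ((2 * t) * (2 * t))"
    using t by (subst nn_integral_cmult_indicator) (auto simp: emeasure_lborel_cbox_eq Basis_complex_def)
  also have "\<dots> = ennreal (2 * t\<^sup>2)"
    using t by (subst ennreal_mult'[symmetric]) (auto simp: power2_eq_square)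
  finally show ?thesis .
qed

text \<open>Dyadic layers: where the modulus is below \<open>(1/2)^k\<close> the integrand is
  charged \<open>2^(k+1)\<close>, and the small ball has probability at most
  \<open>2 * (1/4)^k\<close>. The layers sum to 8. This moment controls how often a measurement
  comes near the jump of the phase.\<close>

lemma cg_inverse_moment: "(\<integral>\<^sup>+z. ennreal (1 / cmod z) \<partial>cg) \<le> 9"
proof -
  define B where "B k = {z::complex. cmod z < (1/2)^k}" for k
  have [measurable]: "B k \<in> sets borel" for k unfolding B_def by measurable
  have pt: "ennreal (1 / cmod z) \<le> 1 + (\<Sum>k. ennreal (2^(k+1)) * indicator (B k) z)" for z
  proof (cases "1 / cmod z \<le> 1")
    case True
    then have "ennreal (1 / cmod z) \<le> 1" using ennreal_leI[OF True] by simp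
    also have "1 \<le> 1 + (\<Sum>k. ennreal (2^(k+1)) * indicator (B k) z)" by simp
    finally show ?thesis .
  next
    case False
    obtain k where k: "1 / cmod z \<le> 2^k" "\<And>j. j < k \<Longrightarrow> \<not> 1 / cmod z \<le> 2^j"
    proof -
      have "\<exists>j. 1 / cmod z \<le> 2^j"
        using real_arch_pow[of 2 "1 / cmod z"] by (auto intro: less_imp_le)
      from LeastI_ex[OF this] show ?thesis
        by (rule that) (rule not_less_Least)
    qed
    obtain l where l: "k = Suc l" using False k(1) by (cases k) auto
    have z0: "cmod z > 0" using False by (cases "z = 0") auto
    have "1 / cmod z > 2^l" using k(2)[of l] l by auto
    then have "cmod z < (1/2)^l" using z0 by (simp add: field_simps power_divide)
    then have "ennreal (1 / cmod z) \<le> ennreal (2^(l+1)) * indicator (B l) z"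
      using k(1) l by (auto simp: B_def intro!: ennreal_leI)
    also have "\<dots> = (\<Sum>k\<in>{l}. ennreal (2^(k+1)) * indicator (B k) z)"
      by (simp only: sum.insert finite.emptyI empty_iff not_False_eq_True sum.empty add_0_right)
    also have "\<dots> \<le> (\<Sum>k. ennreal (2^(k+1)) * indicator (B k) z)"
      by (rule sum_le_suminf) auto
    finally show ?thesis by (simp add: add_increasing)
  qed
  have "(\<integral>\<^sup>+z. ennreal (1 / cmod z) \<partial>cg) \<le> (\<integral>\<^sup>+z. 1 + (\<Sum>k. ennreal (2^(k+1)) * indicator (B k) z) \<partial>cg)"
    by (intro nn_integral_mono pt)
  also have "\<dots> = 1 + (\<Sum>k. \<integral>\<^sup>+z. ennreal (2^(k+1)) * indicator (B k) z \<partial>cg)"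
    by (subst nn_integral_add) (auto simp: nn_integral_suminf cg.emeasure_space_1[simplified])
  also have "(\<Sum>k. \<integral>\<^sup>+z. ennreal (2^(k+1)) * indicator (B k) z \<partial>cg) = (\<Sum>k. ennreal (2^(k+1)) * emeasure cg (B k))"
    by (subst nn_integral_cmult_indicator) auto
  also have "\<dots> \<le> (\<Sum>k. ennreal (4 * (1/2)^k))"
  proof (intro suminf_le)
    fix k
    have "ennreal (2^(k+1)) * emeasure cg (B k) \<le> ennreal (2^(k+1)) * ennreal (2 * ((1/2)^k)\<^sup>2)"
      unfolding B_def by (intro mult_left_mono cg_small_ball) auto
    also have "\<dots> = ennreal (4 * (1/2)^k)"
      by (simp add: ennreal_mult'[symmetric] power2_eq_square power_divide field_simps)
    finally show "ennreal (2^(k+1)) * emeasure cg (B k) \<le> ennreal (4 * (1/2)^k)" .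
  qed auto
  also have "\<dots> = ennreal (\<Sum>k. 4 * (1/2)^k)"
    by (intro suminf_ennreal2) (auto intro!: summable_mult summable_geometric)
  also have "(\<Sum>k. 4 * (1/2)^k) = (8::real)"
    by (subst suminf_mult) (auto simp: suminf_geometric intro!: summable_geometric)
  finally have "(\<integral>\<^sup>+z. ennreal (1 / cmod z) \<partial>cg) \<le> 1 + ennreal 8"
    using add_left_mono by fastforce
  also have "1 + ennreal 8 = 9"
    using ennreal_plus[of 1 8] by simp
  finally show ?thesis .
qed

lemma cg_second_moment: "(\<integral>\<^sup>+z. ennreal ((cmod z)\<^sup>2) \<partial>cg) = 1"
proof -
  let ?N = "density lborel (\<lambda>x. ennreal (normal_density 0 (sqrt (1/2)) x))"
  interpret N: prob_space ?N by (rule prob_space_normal_density) simp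
  have N2: "(\<integral>\<^sup>+x. ennreal (x\<^sup>2) \<partial>?N) = ennreal (1/2)"
  proof -
    have "has_bochner_integral lborel (\<lambda>x. normal_density 0 (sqrt (1/2)) x * (x - 0)^(2 * 1)) (fact (2 * 1) / ((2 / (sqrt (1/2))\<^sup>2)^1 * fact 1))"
      by (rule normal_moment_even) simp
    then have hb: "has_bochner_integral lborel (\<lambda>x. normal_density 0 (sqrt (1/2)) x * x\<^sup>2) (1/2)"
      by simp
    have "(\<integral>\<^sup>+x. ennreal (x\<^sup>2) \<partial>?N) = (\<integral>\<^sup>+x. ennreal (normal_density 0 (sqrt (1/2)) x * x\<^sup>2) \<partial>lborel)"
      by (subst nn_integral_density) (auto simp: ennreal_mult')
    also have "\<dots> = ennreal (LBINT x. normal_density 0 (sqrt (1/2)) x * x\<^sup>2)"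
      using hb by (intro nn_integral_eq_integral) (auto simp: has_bochner_integral_iff)
    also have "(LBINT x. normal_density 0 (sqrt (1/2)) x * x\<^sup>2) = 1/2"
      using hb by (rule has_bochner_integral_integral_eq)
    finally show ?thesis .
  qed
  have "(\<integral>\<^sup>+z. ennreal ((cmod z)\<^sup>2) \<partial>cg) = (\<integral>\<^sup>+p. ennreal ((fst p)\<^sup>2) + ennreal ((snd p)\<^sup>2) \<partial>(?N \<Otimes>\<^sub>M ?N))"
    unfolding complex_gaussian_def
    by (subst nn_integral_distr) (auto simp: case_prod_beta cmod_power2 complex_gaussian_measurable intro!: nn_integral_cong)
  also have "\<dots> = (\<integral>\<^sup>+x. \<integral>\<^sup>+y. ennreal (x\<^sup>2) + ennreal (y\<^sup>2) \<partial>?N \<partial>?N)"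
    by (subst N.nn_integral_fst[symmetric]) auto
  also have "\<dots> = ennreal (1/2) + ennreal (1/2)"
    by (simp add: nn_integral_add N2 N.emeasure_space_1[simplified])
  also have "\<dots> = 1" by (subst ennreal_plus[symmetric]) auto
  finally show ?thesis .
qed

subsection \<open>Concentration for sums over the rows\<close>

abbreviation sens :: "nat \<Rightarrow> nat \<Rightarrow> (nat \<times> nat \<Rightarrow> complex) measure" where
  "sens m n \<equiv> gaussian_sensing m n"

text \<open>The restriction makes the value extensional, hence a point of the product space of
  \<open>rowm n\<close>.\<close>

definition sens_row :: "nat \<Rightarrow> nat \<Rightarrow> (nat \<times> nat \<Rightarrow> complex) \<Rightarrow> nat \<Rightarrow> complex" where
  "sens_row n i a = (\<lambda>j\<in>{..<n}. a (i, j))"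

lemma row_measurable [measurable]:
  "i < m \<Longrightarrow> sens_row n i \<in> sens m n \<rightarrow>\<^sub>M rowm n"
  unfolding gaussian_sensing_def sens_row_def by (intro measurable_restrict measurable_component_singleton) auto

lemma rowm_prob: "prob_space (rowm n)"
  by (intro prob_space_PiM cg.prob_space_axioms)

text \<open>Independence of the rows, in the form needed for moment generating functions. The index
  set of \<open>Suc m\<close> rows is the disjoint union of the first \<open>m\<close> rows and one
  more block, so Fubini applies.\<close>

lemma rows_product:
  assumes "\<And>i. i < m \<Longrightarrow> F i \<in> borel_measurable (rowm n)"
  shows "(\<integral>\<^sup>+a. (\<Prod>i<m. F i (sens_row n i a)) \<partial>sens m n) = (\<Prod>i<m. \<integral>\<^sup>+r. F i r \<partial>rowm n)"
  using assms
proof (induction m)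
  case 0
  show ?case using prob_space.emeasure_space_1[OF prob_space_gaussian_sensing[of 0 n]] by simp
next
  case (Suc m)
  note [measurable] = Suc.prems
  let ?I = "{..<m} \<times> {..<n}" and ?K = "{m} \<times> {..<n}"
  have un: "{..<Suc m} \<times> {..<n} = ?I \<union> ?K" by (auto simp: less_Suc_eq)
  have r1: "sens_row n i (merge ?I ?K (x, y)) = sens_row n i x" if "i < m" for i x y
    using that by (auto simp: sens_row_def merge_def fun_eq_iff)
  have r2: "sens_row n m (merge ?I ?K (x, y)) = sens_row n m y" for x y
    by (auto simp: sens_row_def merge_def fun_eq_iff)
  have [measurable]: "sens_row n m \<in> PiM ?K (\<lambda>_. cg) \<rightarrow>\<^sub>M rowm n"
    unfolding sens_row_def by (intro measurable_restrict measurable_component_singleton) auto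
  have rowK: "(\<integral>\<^sup>+y. F m (sens_row n m y) \<partial>PiM ?K (\<lambda>_. cg)) = (\<integral>\<^sup>+r. F m r \<partial>rowm n)"
  proof -
    have "distr (PiM ?K (\<lambda>_. cg)) (rowm n) (sens_row n m) = rowm n"
      unfolding sens_row_def
      by (rule distr_PiM_reindex[where f = "\<lambda>j. (m, j)" and M = "\<lambda>_. cg"])
         (auto intro: cg.prob_space_axioms simp: inj_on_def)
    then have "(\<integral>\<^sup>+r. F m r \<partial>rowm n) = (\<integral>\<^sup>+r. F m r \<partial>distr (PiM ?K (\<lambda>_. cg)) (rowm n) (sens_row n m))"
      by simp
    also have "\<dots> = (\<integral>\<^sup>+y. F m (sens_row n m y) \<partial>PiM ?K (\<lambda>_. cg))"
      by (rule nn_integral_distr) measurable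
    finally show ?thesis ..
  qed
  have meas: "(\<lambda>a. \<Prod>i<Suc m. F i (sens_row n i a)) \<in> borel_measurable (PiM (?I \<union> ?K) (\<lambda>_. cg))"
    using row_measurable[of _ "Suc m" n] Suc.prems
    unfolding gaussian_sensing_def un by (intro borel_measurable_prod_ennreal) (auto intro: measurable_compose)
  have measI: "(\<lambda>a. \<Prod>i<m. F i (sens_row n i a)) \<in> borel_measurable (PiM ?I (\<lambda>_. cg))"
    using row_measurable[of _ "m" n] Suc.prems
    unfolding gaussian_sensing_def by (intro borel_measurable_prod_ennreal) (auto intro: measurable_compose)
  have "(\<integral>\<^sup>+a. (\<Prod>i<Suc m. F i (sens_row n i a)) \<partial>sens (Suc m) n)
     = (\<integral>\<^sup>+x. \<integral>\<^sup>+y. (\<Prod>i<m. F i (sens_row n i x)) * F m (sens_row n m y) \<partial>PiM ?K (\<lambda>_. cg) \<partial>PiM ?I (\<lambda>_. cg))"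
    unfolding gaussian_sensing_def un
    by (subst cgP.product_nn_integral_fold[OF _ _ _ meas]) (auto simp: r1 r2)
  also have "\<dots> = (\<integral>\<^sup>+x. (\<Prod>i<m. F i (sens_row n i x)) * (\<integral>\<^sup>+r. F m r \<partial>rowm n) \<partial>PiM ?I (\<lambda>_. cg))"
    by (intro nn_integral_cong) (simp add: nn_integral_cmult rowK)
  also have "\<dots> = (\<integral>\<^sup>+x. (\<Prod>i<m. F i (sens_row n i x)) \<partial>PiM ?I (\<lambda>_. cg)) * (\<integral>\<^sup>+r. F m r \<partial>rowm n)"
    by (rule nn_integral_multc) (rule measI)
  also have "\<dots> = (\<Prod>i<Suc m. \<integral>\<^sup>+r. F i r \<partial>rowm n)"
    using Suc by (simp add: gaussian_sensing_def)
  finally show ?case .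
qed

text \<open>Markov's inequality for the exponential of the sum. The tilt is already part of
  \<open>Z\<close>; \<open>b\<close> bounds the logarithm of the moment generating function of a
  single row.\<close>

lemma chernoff:
  assumes [measurable]: "Z \<in> borel_measurable (rowm n)"
    and mgf: "(\<integral>\<^sup>+r. ennreal (exp (Z r)) \<partial>rowm n) \<le> ennreal (exp b)"
  shows "measure (sens m n) {a \<in> space (sens m n). T \<le> (\<Sum>i<m. Z (sens_row n i a))} \<le> exp (real m * b - T)"
proof -
  interpret S: prob_space "sens m n" by (rule prob_space_gaussian_sensing)
  have "emeasure (sens m n) {a \<in> space (sens m n). T \<le> (\<Sum>i<m. Z (sens_row n i a))}
     = (\<integral>\<^sup>+a. indicator {a \<in> space (sens m n). T \<le> (\<Sum>i<m. Z (sens_row n i a))} a \<partial>sens m n)"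
    by (rule nn_integral_indicator[symmetric]) measurable
  also have "\<dots> \<le> (\<integral>\<^sup>+a. ennreal (exp (- T)) * (\<Prod>i<m. ennreal (exp (Z (sens_row n i a)))) \<partial>sens m n)"
  proof (intro nn_integral_mono)
    fix a
    have "ennreal (exp (- T)) * (\<Prod>i<m. ennreal (exp (Z (sens_row n i a)))) = ennreal (exp ((\<Sum>i<m. Z (sens_row n i a)) - T))"
      by (simp add: prod_ennreal exp_sum[symmetric] ennreal_mult'[symmetric] exp_add[symmetric])
    moreover have "1 \<le> exp ((\<Sum>i<m. Z (sens_row n i a)) - T)" if "T \<le> (\<Sum>i<m. Z (sens_row n i a))"
      using that by simp
    ultimately show "indicator {a \<in> space (sens m n). T \<le> (\<Sum>i<m. Z (sens_row n i a))} a
       \<le> ennreal (exp (- T)) * (\<Prod>i<m. ennreal (exp (Z (sens_row n i a))))"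
      by (auto simp: indicator_def)
  qed
  also have "\<dots> = ennreal (exp (- T)) * (\<Prod>i<m. \<integral>\<^sup>+r. ennreal (exp (Z r)) \<partial>rowm n)"
    by (subst nn_integral_cmult) (auto simp: rows_product[where F = "\<lambda>_ r. ennreal (exp (Z r))", simplified])
  also have "\<dots> \<le> ennreal (exp (- T)) * (\<Prod>i<m. ennreal (exp b))"
    unfolding prod_constant by (intro mult_left_mono power_mono mgf) auto
  also have "\<dots> = ennreal (exp (real m * b - T))"
    by (simp add: ennreal_power ennreal_mult'[symmetric] exp_of_nat_mult[symmetric] exp_add[symmetric])
  finally show ?thesis
    by (simp add: S.emeasure_eq_measure)
qed

lemma exp_quadratic_bound: "exp y \<le> 1 + y + y\<^sup>2 * exp \<bar>y\<bar>" for y :: real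
proof -
  obtain t where t: "\<bar>t\<bar> \<le> \<bar>y\<bar>" "exp y = (\<Sum>m<2. y ^ m / fact m) + exp t / fact 2 * y ^ 2"
    using Maclaurin_exp_le[of y 2] by blast
  have "exp t / 2 * y\<^sup>2 \<le> exp \<bar>y\<bar> * y\<^sup>2"
    using t(1) exp_gt_zero[of t] by (intro mult_right_mono) (smt (verit) exp_le_cancel_iff field_sum_of_halves, simp)
  then show ?thesis using t(2) by (simp add: numeral_2_eq_2 mult.commute)
qed

text \<open>The hypothesis is an exponentially weighted second moment because this is the quantity
  that shrinks with the distance along a chain. Through \<open>exp_quadratic_bound\<close> it
  controls the moment generating function for every tilt up to \<open>l0\<close>; the tilt stays
  free so that each level of the chain can choose its own.\<close>

lemma bernstein:
  fixes V :: real
  assumes [measurable]: "Z \<in> borel_measurable (rowm n)"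
    and V: "(\<integral>\<^sup>+r. ennreal ((Z r)\<^sup>2 * exp (l0 * \<bar>Z r\<bar>)) \<partial>rowm n) \<le> ennreal V"
    and l: "0 \<le> l" "l \<le> l0" and V0: "0 \<le> V"
  shows "integrable (rowm n) Z"
    and "measure (sens m n) {a \<in> space (sens m n). real m * ((\<integral>r. Z r \<partial>rowm n) + t) \<le> (\<Sum>i<m. Z (sens_row n i a))}
      \<le> exp (real m * (l\<^sup>2 * V - l * t))"
proof -
  interpret R: prob_space "rowm n" by (rule rowm_prob)
  define W where "W r = (Z r)\<^sup>2 * exp (l0 * \<bar>Z r\<bar>)" for r
  have [measurable]: "W \<in> borel_measurable (rowm n)" unfolding W_def by measurable
  have W0: "0 \<le> W r" for r by (simp add: W_def)
  have intW: "integrable (rowm n) W"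
    using le_less_trans[OF V ennreal_less_top] W0 unfolding W_def[symmetric] by (intro integrableI_nonneg) auto
  have IW: "(\<integral>r. W r \<partial>rowm n) \<le> V"
    using V W0 V0 unfolding W_def[symmetric]
    by (intro integral_real_bounded) auto
  have l0: "0 \<le> l0" using l by simp
  have Zb: "\<bar>Z r\<bar> \<le> 1 + W r" for r
  proof -
    have "\<bar>Z r\<bar> \<le> 1 + (Z r)\<^sup>2"
      using zero_le_power2[of "\<bar>Z r\<bar> - 1"] zero_le_power2[of "Z r"] unfolding power2_diff by simp
    also have "\<dots> \<le> 1 + W r"
      unfolding W_def using l0 by (simp add: mult_le_cancel_left1)
    finally show ?thesis .
  qed
  show intZ: "integrable (rowm n) Z"
    by (rule Bochner_Integration.integrable_bound[of _ "\<lambda>r. 1 + W r"])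
       (use intW Zb W0 in \<open>auto intro!: AE_I2 simp: abs_of_nonneg add_nonneg_nonneg\<close>)
  define \<mu> where "\<mu> = (\<integral>r. Z r \<partial>rowm n)"
  have pt: "exp (l * Z r) \<le> 1 + l * Z r + l\<^sup>2 * W r" for r
  proof -
    have "exp (l * Z r) \<le> 1 + l * Z r + (l * Z r)\<^sup>2 * exp \<bar>l * Z r\<bar>" by (rule exp_quadratic_bound)
    also have "(l * Z r)\<^sup>2 * exp \<bar>l * Z r\<bar> \<le> l\<^sup>2 * W r"
      unfolding W_def power_mult_distrib mult.assoc abs_mult using l
      by (intro mult_left_mono) (auto intro!: mult_right_mono)
    finally show ?thesis by simp
  qed
  have "(\<integral>\<^sup>+r. ennreal (exp (l * Z r)) \<partial>rowm n) \<le> (\<integral>\<^sup>+r. ennreal (1 + l * Z r + l\<^sup>2 * W r) \<partial>rowm n)"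
    by (intro nn_integral_mono ennreal_leI pt)
  also have "\<dots> = ennreal (\<integral>r. 1 + l * Z r + l\<^sup>2 * W r \<partial>rowm n)"
    using intZ intW order.trans[OF exp_ge_zero pt] by (intro nn_integral_eq_integral) auto
  also have "(\<integral>r. 1 + l * Z r + l\<^sup>2 * W r \<partial>rowm n) = 1 + l * \<mu> + l\<^sup>2 * (\<integral>r. W r \<partial>rowm n)"
    using intZ intW by (simp add: \<mu>_def R.prob_space)
  also have "\<dots> \<le> 1 + (l * \<mu> + l\<^sup>2 * V)"
    using IW by (simp add: mult_left_mono)
  also have "\<dots> \<le> exp (l * \<mu> + l\<^sup>2 * V)" by (rule exp_ge_add_one_self)
  finally have mgf: "(\<integral>\<^sup>+r. ennreal (exp (l * Z r)) \<partial>rowm n) \<le> ennreal (exp (l * \<mu> + l\<^sup>2 * V))"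
    by (simp add: ennreal_leI)
  have "measure (sens m n) {a \<in> space (sens m n). l * (real m * (\<mu> + t)) \<le> (\<Sum>i<m. l * Z (sens_row n i a))}
      \<le> exp (real m * (l * \<mu> + l\<^sup>2 * V) - l * (real m * (\<mu> + t)))"
    by (rule chernoff) (use mgf in auto)
  also have "real m * (l * \<mu> + l\<^sup>2 * V) - l * (real m * (\<mu> + t)) = real m * (l\<^sup>2 * V - l * t)"
    by (simp add: algebra_simps)
  finally have *: "measure (sens m n) {a \<in> space (sens m n). l * (real m * (\<mu> + t)) \<le> (\<Sum>i<m. l * Z (sens_row n i a))}
      \<le> exp (real m * (l\<^sup>2 * V - l * t))" .
  interpret S: prob_space "sens m n" by (rule prob_space_gaussian_sensing)
  have "measure (sens m n) {a \<in> space (sens m n). real m * (\<mu> + t) \<le> (\<Sum>i<m. Z (sens_row n i a))}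
    \<le> measure (sens m n) {a \<in> space (sens m n). l * (real m * (\<mu> + t)) \<le> (\<Sum>i<m. l * Z (sens_row n i a))}"
    using l by (intro S.finite_measure_mono) (auto simp: sum_distrib_left[symmetric] mult_left_mono)
  with * show "measure (sens m n) {a \<in> space (sens m n). real m * ((\<integral>r. Z r \<partial>rowm n) + t) \<le> (\<Sum>i<m. Z (sens_row n i a))}
      \<le> exp (real m * (l\<^sup>2 * V - l * t))"
    unfolding \<mu>_def[symmetric] by linarith
qed

subsection \<open>Nets of the unit sphere\<close>

lemma nrm_L2: "nrm n x = L2_set (\<lambda>j. cmod (x j)) {..<n}"
  by (simp add: nrm_def L2_set_def)

lemma nrm_triangle: "nrm n (\<lambda>j. x j + y j) \<le> nrm n x + nrm n y"
proof -
  have "nrm n (\<lambda>j. x j + y j) \<le> L2_set (\<lambda>j. cmod (x j) + cmod (y j)) {..<n}"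
    unfolding nrm_L2 by (intro L2_set_mono norm_triangle_ineq) auto
  also have "\<dots> \<le> nrm n x + nrm n y" unfolding nrm_L2 by (rule L2_set_triangle_ineq)
  finally show ?thesis .
qed

lemma nrm_scale: "nrm n (\<lambda>j. c * x j) = cmod c * nrm n x"
  unfolding nrm_def by (simp add: norm_mult power_mult_distrib sum_distrib_left[symmetric] real_sqrt_mult)

lemma nrm_triangle_sub: "nrm n x \<le> nrm n y + nrm n (\<lambda>j. x j - y j)"
  using nrm_triangle[of n y "\<lambda>j. x j - y j"] by simp

lemma ip_cauchy: "cmod (ip n x y) \<le> nrm n x * nrm n y"
proof -
  have "cmod (ip n x y) \<le> (\<Sum>j<n. \<bar>cmod (x j)\<bar> * \<bar>cmod (y j)\<bar>)"
    unfolding lin_form_def by (rule order.trans[OF norm_sum]) (simp add: norm_mult)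
  also have "\<dots> \<le> nrm n x * nrm n y" unfolding nrm_L2 by (rule L2_set_mult_ineq)
  finally show ?thesis .
qed

lemma lin_diff: "lin_form J r (\<lambda>j. x j - y j) = lin_form J r x - lin_form J r y"
  by (simp add: lin_form_def algebra_simps sum_subtractf)

lemma lin_scale: "lin_form J r (\<lambda>j. c * x j) = c * lin_form J r x"
  by (simp add: lin_form_def algebra_simps sum_distrib_left)

lemma nrm_sum_le: "(\<Sum>j<n. cmod (x j)) \<le> sqrt (real n) * nrm n x"
proof -
  have "(\<Sum>j<n. cmod (x j)) = (\<Sum>j<n. \<bar>1\<bar> * \<bar>cmod (x j)\<bar>)" by simp
  also have "\<dots> \<le> L2_set (\<lambda>_. 1) {..<n} * L2_set (\<lambda>j. cmod (x j)) {..<n}" by (rule L2_set_mult_ineq)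
  also have "L2_set (\<lambda>_. 1) {..<n} = sqrt (real n)" by (simp add: L2_set_def)
  finally show ?thesis by (simp add: nrm_L2)
qed

lemma sum_exp_abs:
  fixes s :: real
  assumes "0 < s" "s \<le> 1"
  shows "(\<Sum>k\<in>{- int L..int L}. exp (- s * \<bar>real_of_int k\<bar>)) \<le> 4 / s"
proof -
  have "(\<Sum>k\<in>{- int L..int L}. exp (- s * \<bar>real_of_int k\<bar>)) \<le> 2 * (\<Sum>j\<le>L. exp (- s) ^ j)"
  proof (induction L)
    case (Suc L)
    have "{- int (Suc L)..int (Suc L)} = insert (- int (Suc L)) (insert (int (Suc L)) {- int L..int L})"
      by auto
    then have "(\<Sum>k\<in>{- int (Suc L)..int (Suc L)}. exp (- s * \<bar>real_of_int k\<bar>))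
       = 2 * exp (- s) ^ Suc L + (\<Sum>k\<in>{- int L..int L}. exp (- s * \<bar>real_of_int k\<bar>))"
      by (simp add: exp_of_nat_mult[symmetric] exp_add[symmetric] algebra_simps del: power_Suc)
    then show ?case using Suc by simp
  qed simp
  also have "(\<Sum>j\<le>L. exp (- s) ^ j) \<le> 1 / (1 - exp (- s))"
  proof -
    have q: "exp (- s) < 1" using assms by simp
    have "(\<Sum>j\<le>L. exp (- s) ^ j) \<le> (\<Sum>j. exp (- s) ^ j)"
      using q by (intro sum_le_suminf summable_geometric) auto
    then show ?thesis using q by (simp add: suminf_geometric)
  qed
  also have "1 / (1 - exp (- s)) \<le> 1 / (s / 2)"
  proof (intro divide_left_mono)
    have "exp (- s) * (1 + s) \<le> exp (- s) * exp s"
      using exp_ge_add_one_self[of s] by (intro mult_left_mono) auto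
    then have "exp (- s) * (1 + s) \<le> 1" by (simp add: exp_minus)
    moreover have "1 \<le> (1 - s / 2) * (1 + s)" using assms by (simp add: algebra_simps mult_left_le)
    ultimately have "exp (- s) * (1 + s) \<le> (1 - s / 2) * (1 + s)" by linarith
    then show "s / 2 \<le> 1 - exp (- s)" using assms by simp
  qed (use assms in auto)
  finally show ?thesis by simp
qed

text \<open>Every point counted has exponential weight at least 1, so the count is at most the total
  weight. The weight factors over the coordinates, and each factor is a two-sided geometric series
  bounded by \<open>4 / s\<close>.\<close>

lemma lattice_count:
  fixes T s :: real
  assumes I: "finite I" and s: "0 < s" "s \<le> 1"
  defines "Q \<equiv> {f \<in> I \<rightarrow>\<^sub>E (UNIV :: int set). (\<Sum>i\<in>I. \<bar>real_of_int (f i)\<bar>) \<le> T}"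
  shows "finite Q" and "real (card Q) \<le> exp (s * T) * (4 / s) ^ card I"
proof -
  define L where "L = nat \<lceil>T\<rceil>"
  have sub: "Q \<subseteq> I \<rightarrow>\<^sub>E {- int L..int L}"
  proof
    fix f assume f: "f \<in> Q"
    have "f i \<in> {- int L..int L}" if "i \<in> I" for i
    proof -
      have "\<bar>real_of_int (f i)\<bar> \<le> (\<Sum>i\<in>I. \<bar>real_of_int (f i)\<bar>)"
        using I that by (intro member_le_sum) auto
      then have "\<bar>real_of_int (f i)\<bar> \<le> T" using f by (simp add: Q_def)
      then have "\<bar>f i\<bar> \<le> int L" unfolding L_def by linarith
      then show ?thesis by auto
    qed
    then show "f \<in> I \<rightarrow>\<^sub>E {- int L..int L}" using f by (auto simp: Q_def PiE_iff)
  qed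
  have fin: "finite (I \<rightarrow>\<^sub>E {- int L..int L})" using I by (intro finite_PiE) auto
  show "finite Q" by (rule finite_subset[OF sub fin])
  have "real (card Q) = (\<Sum>f\<in>Q. 1)" by simp
  also have "\<dots> \<le> (\<Sum>f\<in>Q. exp (s * T) * (\<Prod>i\<in>I. exp (- s * \<bar>real_of_int (f i)\<bar>)))"
  proof (rule sum_mono)
    fix f assume "f \<in> Q"
    then have "0 \<le> s * (T - (\<Sum>i\<in>I. \<bar>real_of_int (f i)\<bar>))" using s by (simp add: Q_def)
    then have "1 \<le> exp (s * (T - (\<Sum>i\<in>I. \<bar>real_of_int (f i)\<bar>)))" by simp
    also have "\<dots> = exp (s * T) * (\<Prod>i\<in>I. exp (- s * \<bar>real_of_int (f i)\<bar>))"
      using I by (simp add: exp_sum[symmetric] exp_add[symmetric] sum_distrib_left sum_negf right_diff_distrib)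
    finally show "1 \<le> exp (s * T) * (\<Prod>i\<in>I. exp (- s * \<bar>real_of_int (f i)\<bar>))" .
  qed
  also have "\<dots> \<le> (\<Sum>f\<in>I \<rightarrow>\<^sub>E {- int L..int L}. exp (s * T) * (\<Prod>i\<in>I. exp (- s * \<bar>real_of_int (f i)\<bar>)))"
    by (rule sum_mono2[OF fin sub]) (auto intro!: prod_nonneg mult_nonneg_nonneg)
  also have "\<dots> = exp (s * T) * (\<Prod>i\<in>I. \<Sum>k\<in>{- int L..int L}. exp (- s * \<bar>real_of_int k\<bar>))"
    using I by (subst prod_sum_PiE) (auto simp: sum_distrib_left)
  also have "\<dots> \<le> exp (s * T) * (\<Prod>i\<in>I. 4 / s)"
    using s by (intro mult_left_mono prod_mono conjI sum_exp_abs sum_nonneg) auto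
  finally show "real (card Q) \<le> exp (s * T) * (4 / s) ^ card I" by simp
qed

text \<open>The points lie on the sphere, so that the Gaussian moment bounds hold at them. The ratio
  256 is a fourth power: weighted second moments of increments decay like the square root of the
  distance, that is like \<open>16 ^ -k\<close>, and the matching tilts grow like
  \<open>4 ^ k\<close>.\<close>

definition is_net :: "nat \<Rightarrow> nat \<Rightarrow> (nat \<Rightarrow> complex) set \<Rightarrow> bool" where
  "is_net n k N \<longleftrightarrow> finite N \<and> (\<forall>x\<in>N. nrm n x = 1) \<and> real (card N) \<le> exp (real n * (8 + 12 * real k)) \<and>
     (\<forall>x. nrm n x = 1 \<longrightarrow> (\<exists>y\<in>N. nrm n (\<lambda>j. x j - y j) \<le> 2 / 256 ^ k))"

text \<open>Cubic cells of side \<open>e / sqrt n\<close> in the \<open>2 n\<close> real coordinates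
  have diameter at most \<open>2 * e\<close>. By Cauchy-Schwarz the real coordinates of a unit
  vector have absolute sum at most \<open>2 * sqrt n\<close>, so the cell index lies in an l1 ball
  of radius \<open>4 * n / e\<close>; counting in l1 avoids a factor \<open>n log n\<close> in the
  exponent. One point of the sphere is kept for each occupied cell.\<close>

lemma ex_net: "\<exists>N. is_net n k N"
proof (cases "n = 0")
  case True
  then show ?thesis by (intro exI[of _ "{}"]) (auto simp: is_net_def nrm_def)
next
  case False
  define e :: real where "e = 1 / 256 ^ k"
  have e: "0 < e" "e \<le> 1" by (auto simp: e_def)
  define I where "I = (UNIV :: bool set) \<times> {..<n}"
  have I: "finite I" "card I = 2 * n" by (auto simp: I_def)
  define part where "part b z = (if b then Re z else Im z)" for b z
  define cell where "cell x = (\<lambda>i\<in>I. \<lfloor>sqrt (real n) / e * part (fst i) (x (snd i))\<rfloor>)" for x :: "nat \<Rightarrow> complex"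
  define S where "S = {x. nrm n x = 1}"
  define Q where "Q = {f \<in> I \<rightarrow>\<^sub>E (UNIV :: int set). (\<Sum>i\<in>I. \<bar>real_of_int (f i)\<bar>) \<le> 4 * real n / e}"
  have Q: "finite Q" "real (card Q) \<le> exp (e * (4 * real n / e)) * (4 / e) ^ card I"
    unfolding Q_def by (rule lattice_count[OF I(1) e])+
  have sqn: "sqrt (real n) > 0" using False by simp
  have cellQ: "cell x \<in> Q" if x: "nrm n x = 1" for x
  proof -
    have "(\<Sum>i\<in>I. \<bar>real_of_int (cell x i)\<bar>) \<le> (\<Sum>i\<in>I. sqrt (real n) / e * \<bar>part (fst i) (x (snd i))\<bar> + 1)"
    proof (intro sum_mono)
      fix i assume i: "i \<in> I"
      have "\<bar>real_of_int \<lfloor>y\<rfloor>\<bar> \<le> \<bar>y\<bar> + 1" for y :: real by linarith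
      from this[of "sqrt (real n) / e * part (fst i) (x (snd i))"]
      show "\<bar>real_of_int (cell x i)\<bar> \<le> sqrt (real n) / e * \<bar>part (fst i) (x (snd i))\<bar> + 1"
        using i e by (simp add: cell_def abs_mult)
    qed
    also have "\<dots> = sqrt (real n) / e * (\<Sum>i\<in>I. \<bar>part (fst i) (x (snd i))\<bar>) + 2 * real n"
      using I by (simp add: sum.distrib sum_distrib_left)
    also have "(\<Sum>i\<in>I. \<bar>part (fst i) (x (snd i))\<bar>) = (\<Sum>j<n. \<bar>Re (x j)\<bar>) + (\<Sum>j<n. \<bar>Im (x j)\<bar>)"
      unfolding I_def sum.cartesian_product' by (simp add: UNIV_bool part_def)
    also have "\<dots> \<le> (\<Sum>j<n. cmod (x j)) + (\<Sum>j<n. cmod (x j))"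
      by (intro add_mono sum_mono abs_Re_le_cmod abs_Im_le_cmod)
    also have "\<dots> \<le> 2 * sqrt (real n)" using nrm_sum_le[of x n] x by simp
    finally have "(\<Sum>i\<in>I. \<bar>real_of_int (cell x i)\<bar>) \<le> sqrt (real n) / e * (2 * sqrt (real n)) + 2 * real n"
      using e sqn by (simp add: mult_left_mono divide_right_mono)
    also have "\<dots> = 2 * real n / e + 2 * real n" by (simp add: field_simps)
    also have "\<dots> \<le> 4 * real n / e" using e by (simp add: field_simps mult_left_le_one_le)
    finally show ?thesis by (auto simp: Q_def cell_def)
  qed
  have close: "nrm n (\<lambda>j. x j - y j) \<le> 2 * e" if "cell x = cell y" for x y
  proof -
    have pd: "\<bar>part b (x j) - part b (y j)\<bar> \<le> e / sqrt (real n)" if j: "j < n" for b j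
    proof -
      have "\<lfloor>sqrt (real n) / e * part b (x j)\<rfloor> = \<lfloor>sqrt (real n) / e * part b (y j)\<rfloor>"
        using fun_cong[OF \<open>cell x = cell y\<close>, of "(b, j)"] j by (simp add: cell_def I_def)
      then have "\<bar>sqrt (real n) / e * part b (x j) - sqrt (real n) / e * part b (y j)\<bar> \<le> 1" by linarith
      then have "sqrt (real n) / e * \<bar>part b (x j) - part b (y j)\<bar> \<le> 1"
        unfolding right_diff_distrib[symmetric] abs_mult using e sqn by simp
      then show ?thesis using e sqn by (simp add: field_simps)
    qed
    have "(nrm n (\<lambda>j. x j - y j))\<^sup>2 \<le> (\<Sum>j<n. 2 * (e / sqrt (real n))\<^sup>2)"
      unfolding nrm_sq
    proof (intro sum_mono)
      fix j assume "j \<in> {..<n}"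
      then have "(Re (x j - y j))\<^sup>2 \<le> (e / sqrt (real n))\<^sup>2" "(Im (x j - y j))\<^sup>2 \<le> (e / sqrt (real n))\<^sup>2"
        using pd[of j True] pd[of j False] e sqn by (auto simp: part_def power2_le_iff_abs_le)
      then show "(cmod (x j - y j))\<^sup>2 \<le> 2 * (e / sqrt (real n))\<^sup>2" by (simp add: cmod_power2)
    qed
    also have "\<dots> = 2 * e\<^sup>2" using False by (simp add: power_divide)
    also have "\<dots> \<le> (2 * e)\<^sup>2" by (simp add: power2_eq_square)
    finally show ?thesis by (rule power2_le_imp_le) (use e in simp)
  qed
  define N where "N = (\<lambda>f. SOME x. x \<in> S \<and> cell x = f) ` (cell ` S)"
  have rep: "(SOME y. y \<in> S \<and> cell y = cell x) \<in> S \<and> cell (SOME y. y \<in> S \<and> cell y = cell x) = cell x" if "x \<in> S" for x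
    by (rule someI[of "\<lambda>y. y \<in> S \<and> cell y = cell x" x]) (use that in auto)
  have sub: "cell ` S \<subseteq> Q" using cellQ by (auto simp: S_def)
  have fin: "finite (cell ` S)" by (rule finite_subset[OF sub Q(1)])
  have "is_net n k N"
    unfolding is_net_def
  proof (intro conjI ballI allI impI)
    show "finite N" unfolding N_def using fin by blast
    show "nrm n x = 1" if "x \<in> N" for x using that rep by (auto simp: N_def S_def)
    have "card N \<le> card Q"
      unfolding N_def using card_image_le[OF fin] card_mono[OF Q(1) sub] order.trans by blast
    then have "real (card N) \<le> exp (4 * real n) * (4 / e) ^ (2 * n)" using Q(2) I e by simp
    \<comment> \<open>Here \<open>4 / e\<close> is \<open>4 * 256 ^ k\<close>, and
      \<open>4 \<le> exp 2\<close>, \<open>256 \<le> exp 6\<close>. The latter follows from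
      \<open>16 \<le> exp 3\<close>, for which five terms of the series suffice.\<close>
    also have "\<dots> \<le> exp (4 * real n) * (exp (2 + 6 * real k)) ^ (2 * n)"
    proof (intro mult_left_mono power_mono)
      have "(4::real) \<le> exp 2" using exp_lower_Taylor_quadratic[of 2] by simp
      moreover have "(256::real) ^ k \<le> exp (6 * real k)"
      proof -
        have "(2::real) \<le> exp 1" using exp_ge_add_one_self[of 1] by simp
        have "(5::real) \<le> exp 2" using exp_lower_Taylor_quadratic[of 2] by simp
        then have "(5::real) * 5 * 5 \<le> exp 2 * exp 2 * exp 2" by (intro mult_mono) auto
        have t: "exp (3::real) \<ge> 1 + 3 + 9/2 + 27/6 + 81/24"
        proof -
          have "(\<Sum>j<5. (3::real)^j /\<^sub>R fact j) \<le> (\<Sum>j. 3^j /\<^sub>R fact j)"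
            by (intro sum_le_suminf summable_exp_generic) auto
          then show ?thesis by (simp add: exp_def eval_nat_numeral fact_numeral)
        qed
        have "(16::real) * 16 \<le> exp 3 * exp 3" using t by (intro mult_mono) auto
        then have "(256::real) \<le> exp 6" by (simp add: exp_add[symmetric])
        then have "(256::real) ^ k \<le> exp 6 ^ k" by (intro power_mono) auto
        then show ?thesis by (simp add: exp_of_nat_mult[symmetric] mult.commute)
      qed
      ultimately have "4 * 256 ^ k \<le> exp 2 * exp (6 * real k)" by (intro mult_mono) auto
      then show "4 / e \<le> exp (2 + 6 * real k)" by (simp add: e_def exp_add)
    qed (use e in auto)
    also have "\<dots> = exp (real n * (8 + 12 * real k))"
      by (simp add: exp_of_nat_mult[symmetric] exp_add[symmetric] algebra_simps)
    finally show "real (card N) \<le> exp (real n * (8 + 12 * real k))" .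
    fix x assume x: "nrm n x = 1"
    then have xS: "x \<in> S" by (simp add: S_def)
    show "\<exists>y\<in>N. nrm n (\<lambda>j. x j - y j) \<le> 2 / 256 ^ k"
    proof (rule bexI)
      show "(SOME y. y \<in> S \<and> cell y = cell x) \<in> N" using xS by (auto simp: N_def)
      show "nrm n (\<lambda>j. x j - (SOME y. y \<in> S \<and> cell y = cell x) j) \<le> 2 / 256 ^ k"
        using close[of x "SOME y. y \<in> S \<and> cell y = cell x"] rep[OF xS] by (simp add: e_def)
    qed
  qed
  then show ?thesis ..
qed

definition net :: "nat \<Rightarrow> nat \<Rightarrow> (nat \<Rightarrow> complex) set" where
  "net n k = (SOME N. is_net n k N)"

lemma net: "is_net n k (net n k)"
  unfolding net_def by (rule someI_ex[OF ex_net])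

subsection \<open>Events of overwhelming probability\<close>

text \<open>The properties quantify over uncountably many vectors, so they are only required to hold
  on some measurable set of large probability. The constants precede \<open>n\<close>,
  \<open>m\<close> and \<open>x0\<close>; the threshold \<open>n0\<close> allows errors such as
  \<open>1 / n\<^sup>2\<close> to be absorbed.\<close>

definition whp :: "(nat \<Rightarrow> nat \<Rightarrow> (nat \<Rightarrow> complex) \<Rightarrow> (nat \<times> nat \<Rightarrow> complex) \<Rightarrow> bool) \<Rightarrow> bool" where
  "whp P \<longleftrightarrow> (\<exists>M K :: real. \<exists>n0 :: nat. 0 < M \<and> 0 \<le> K \<and> (\<forall>n m x0. n0 \<le> n \<longrightarrow> M * (real n)\<^sup>2 \<le> real m \<longrightarrow> nrm n x0 = 1 \<longrightarrow>
     (\<exists>E\<in>sets (sens m n). 1 - K * exp (- real n) \<le> measure (sens m n) E \<and> (\<forall>a\<in>E. P n m x0 a))))"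

lemma whpI:
  assumes "0 < M" "0 \<le> K"
    and "\<And>n m x0. n0 \<le> n \<Longrightarrow> M * (real n)\<^sup>2 \<le> real m \<Longrightarrow> nrm n x0 = 1 \<Longrightarrow>
     \<exists>E\<in>sets (sens m n). 1 - K * exp (- real n) \<le> measure (sens m n) E \<and> (\<forall>a\<in>E. P n m x0 a)"
  shows "whp P"
  unfolding whp_def using assms by blast

text \<open>Raising \<open>M\<close> to at least 1 also provides \<open>n \<le> m\<close> to the
  implication, in particular \<open>m > 0\<close> for positive \<open>n\<close>.\<close>

lemma whp_mono:
  assumes "whp P" and "\<And>n m x0 a. n0 \<le> n \<Longrightarrow> real n \<le> real m \<Longrightarrow> nrm n x0 = 1 \<Longrightarrow> P n m x0 a \<Longrightarrow> Q n m x0 a"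
  shows "whp Q"
proof -
  obtain M K n1 where *: "0 < M" "0 \<le> K" "\<And>n m x0. n1 \<le> n \<Longrightarrow> M * (real n)\<^sup>2 \<le> real m \<Longrightarrow> nrm n x0 = 1 \<Longrightarrow>
     \<exists>E\<in>sets (sens m n). 1 - K * exp (- real n) \<le> measure (sens m n) E \<and> (\<forall>a\<in>E. P n m x0 a)"
    using assms(1) unfolding whp_def by blast
  show ?thesis
  proof (rule whpI[of "max 1 M" K "max n0 n1"])
    fix n m x0 assume n: "max n0 n1 \<le> n" "max 1 M * (real n)\<^sup>2 \<le> real m" "nrm n x0 = 1"
    have "M * (real n)\<^sup>2 \<le> max 1 M * (real n)\<^sup>2" by (intro mult_right_mono) auto
    then obtain E where E: "E \<in> sets (sens m n)" "1 - K * exp (- real n) \<le> measure (sens m n) E" "\<forall>a\<in>E. P n m x0 a"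
      using *(3)[of n m x0] n by auto
    have "real n \<le> 1 * (real n)\<^sup>2" by (cases n) (auto simp: power2_eq_square)
    also have "\<dots> \<le> max 1 M * (real n)\<^sup>2" by (intro mult_right_mono) auto
    finally have "real n \<le> real m" using n by linarith
    then show "\<exists>E\<in>sets (sens m n). 1 - K * exp (- real n) \<le> measure (sens m n) E \<and> (\<forall>a\<in>E. Q n m x0 a)"
      using E n assms(2) by (intro bexI[of _ E]) auto
  qed (use * in auto)
qed

lemma whp_conj:
  assumes "whp P" "whp Q"
  shows "whp (\<lambda>n m x0 a. P n m x0 a \<and> Q n m x0 a)"
proof -
  obtain M K n1 where P: "0 < M" "0 \<le> K" "\<And>n m x0. n1 \<le> n \<Longrightarrow> M * (real n)\<^sup>2 \<le> real m \<Longrightarrow> nrm n x0 = 1 \<Longrightarrow>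
     \<exists>E\<in>sets (sens m n). 1 - K * exp (- real n) \<le> measure (sens m n) E \<and> (\<forall>a\<in>E. P n m x0 a)"
    using assms(1) unfolding whp_def by blast
  obtain M' K' n2 where Q: "0 < M'" "0 \<le> K'" "\<And>n m x0. n2 \<le> n \<Longrightarrow> M' * (real n)\<^sup>2 \<le> real m \<Longrightarrow> nrm n x0 = 1 \<Longrightarrow>
     \<exists>E\<in>sets (sens m n). 1 - K' * exp (- real n) \<le> measure (sens m n) E \<and> (\<forall>a\<in>E. Q n m x0 a)"
    using assms(2) unfolding whp_def by blast
  show ?thesis
  proof (rule whpI[of "max M M'" "K + K'" "max n1 n2"])
    fix n m x0 assume n: "max n1 n2 \<le> n" "max M M' * (real n)\<^sup>2 \<le> real m" "nrm n x0 = 1"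
    interpret S: prob_space "sens m n" by (rule prob_space_gaussian_sensing)
    have "M * (real n)\<^sup>2 \<le> max M M' * (real n)\<^sup>2" "M' * (real n)\<^sup>2 \<le> max M M' * (real n)\<^sup>2"
      by (intro mult_right_mono; simp)+
    then obtain E F where E: "E \<in> sets (sens m n)" "1 - K * exp (- real n) \<le> measure (sens m n) E" "\<forall>a\<in>E. P n m x0 a"
      and F: "F \<in> sets (sens m n)" "1 - K' * exp (- real n) \<le> measure (sens m n) F" "\<forall>a\<in>F. Q n m x0 a"
      using P(3)[of n m x0] Q(3)[of n m x0] n by auto
    have "1 - S.prob (E \<inter> F) = S.prob (space (sens m n) - E \<inter> F)"
      using E F by (intro S.prob_compl[symmetric]) auto
    also have "\<dots> \<le> S.prob ((space (sens m n) - E) \<union> (space (sens m n) - F))"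
      using E F by (intro S.finite_measure_mono) auto
    also have "\<dots> \<le> S.prob (space (sens m n) - E) + S.prob (space (sens m n) - F)"
      using E F by (intro measure_Un_le) auto
    also have "\<dots> = (1 - S.prob E) + (1 - S.prob F)"
      using E F by (simp add: S.prob_compl)
    finally have "1 - (K + K') * exp (- real n) \<le> S.prob (E \<inter> F)"
      using E F by (simp add: algebra_simps)
    then show "\<exists>E\<in>sets (sens m n). 1 - (K + K') * exp (- real n) \<le> measure (sens m n) E \<and> (\<forall>a\<in>E. P n m x0 a \<and> Q n m x0 a)"
      using E F by (intro bexI[of _ "E \<inter> F"]) auto
  qed (use P Q in auto)
qed

lemma good_event:
  assumes "finite I" and "\<And>i. i \<in> I \<Longrightarrow> B i \<in> sets (sens m n)"
    and "(\<Sum>i\<in>I. measure (sens m n) (B i)) \<le> q"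
  obtains E where "E \<in> sets (sens m n)" "1 - q \<le> measure (sens m n) E" "\<And>a i. a \<in> E \<Longrightarrow> i \<in> I \<Longrightarrow> a \<in> space (sens m n) \<and> a \<notin> B i"
proof
  interpret S: prob_space "sens m n" by (rule prob_space_gaussian_sensing)
  let ?E = "space (sens m n) - (\<Union>i\<in>I. B i)"
  show "?E \<in> sets (sens m n)" using assms by auto
  have "S.prob (\<Union>i\<in>I. B i) \<le> (\<Sum>i\<in>I. S.prob (B i))"
    using assms by (intro S.finite_measure_subadditive_finite) auto
  then show "1 - q \<le> measure (sens m n) ?E" using assms by (subst S.prob_compl) auto
  show "\<And>a i. a \<in> ?E \<Longrightarrow> i \<in> I \<Longrightarrow> a \<in> space (sens m n) \<and> a \<notin> B i" by auto
qed

text \<open>The last level of the chain. That \<open>16 ^ finest n\<close> is at least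
  \<open>n\<close> makes the net fine to \<open>2 / n\<^sup>2\<close>; that it is at most
  \<open>16 * n\<close> keeps the tilts \<open>4 ^ k / sqrt n\<close> bounded by a constant.\<close>

definition finest :: "nat \<Rightarrow> nat" where
  "finest n = (LEAST k. real n \<le> 16 ^ k)"

lemma finest_ge: "real n \<le> 16 ^ finest n"
proof -
  have "\<exists>k. real n \<le> 16 ^ k" using real_arch_pow[of 16 "real n"] by (auto intro: less_imp_le)
  then show ?thesis unfolding finest_def by (rule LeastI_ex)
qed

lemma finest_less: "1 \<le> n \<Longrightarrow> 16 ^ finest n \<le> 16 * real n"
proof (cases "finest n")
  case (Suc k)
  then have "\<not> real n \<le> 16 ^ k" using not_less_Least[of k "\<lambda>k. real n \<le> 16 ^ k"] by (simp add: finest_def)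
  then show ?thesis using Suc by simp
qed simp

text \<open>Compares the entropy of the level \<open>k\<close> net, linear in \<open>k\<close>, with
  the exponent of its deviation bound, which grows like \<open>2 ^ k\<close>.\<close>

lemma linear_le_power2: "12 * real k + 8 \<le> 20 * 2 ^ k"
proof (induction k)
  case (Suc k)
  have "1 \<le> (2::real) ^ k" by simp
  moreover have "1 \<le> p \<Longrightarrow> 12 * c + 8 \<le> 20 * p \<Longrightarrow> 12 * (1 + c) + 8 \<le> 20 * (2 * p)" for p c :: real
    by (simp add: algebra_simps)
  ultimately show ?case using Suc unfolding power_Suc of_nat_Suc by blast
qed simp

lemma Suc_le_power2: "real k + 1 \<le> 2 ^ k"
  by (induction k) auto

lemma sum_exp_neg_le: "(\<Sum>k\<le>K. exp (- (real k + 1))) \<le> 1"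
proof -
  have "(\<Sum>k\<le>K. exp (- (real k + 1))) \<le> (\<Sum>k\<le>K. (1/2) ^ Suc k)"
  proof (rule sum_mono)
    fix k
    have "exp (-1) \<le> (1/2::real)" using exp_ge_add_one_self[of 1] by (simp add: exp_minus field_simps)
    then have "exp (-1) ^ Suc k \<le> (1/2::real) ^ Suc k" by (intro power_mono) auto
    then show "exp (- (real k + 1)) \<le> (1/2) ^ Suc k"
      by (simp only: exp_of_nat_mult[symmetric]) (simp add: algebra_simps)
  qed
  also have "\<dots> = 1 - (1/2) ^ Suc K" by (induction K) auto
  finally show ?thesis by (smt (verit) zero_le_power half_gt_zero_iff)
qed

lemma sum_half_powers: "(\<Sum>j\<le>k. (1/2::real) ^ j) \<le> 2"
proof -
  have "(\<Sum>j\<le>k. (1/2::real) ^ j) = 2 - (1/2) ^ k" by (induction k) auto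
  then show ?thesis by simp
qed

text \<open>Chaining. At level \<open>k\<close> the increments have variance proxy of order \<open>16 ^ -k\<close>, so that
  the tilt \<open>4 ^ k / sqrt n\<close> makes a deviation \<open>2 ^ -k / sqrt n\<close> have probability
  \<open>exp (- c 2 ^ k m / n)\<close>, which beats the cardinality of the net since \<open>m / n\<close> is at least a large multiple of \<open>n\<close>.\<close>

lemma chaining:
  fixes Z :: "nat \<Rightarrow> (nat \<Rightarrow> complex) \<Rightarrow> (nat \<Rightarrow> complex) \<Rightarrow> (nat \<Rightarrow> complex) \<Rightarrow> real"
  assumes C: "0 < C" and lam: "0 < lam" and \<delta>: "0 < \<delta>"
    and meas: "\<And>n x0 x. nrm n x0 = 1 \<Longrightarrow> nrm n x = 1 \<Longrightarrow> Z n x0 x \<in> borel_measurable (rowm n)"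
    and base: "\<And>n x0 x. nrm n x0 = 1 \<Longrightarrow> nrm n x = 1 \<Longrightarrow>
      (\<integral>\<^sup>+r. ennreal ((Z n x0 x r)\<^sup>2 * exp (lam * \<bar>Z n x0 x r\<bar>)) \<partial>rowm n) \<le> ennreal C"
    and inc: "\<And>n x0 x y. nrm n x0 = 1 \<Longrightarrow> nrm n x = 1 \<Longrightarrow> nrm n y = 1 \<Longrightarrow>
      (\<integral>\<^sup>+r. ennreal ((Z n x0 x r - Z n x0 y r)\<^sup>2 * exp (lam * \<bar>Z n x0 x r - Z n x0 y r\<bar>)) \<partial>rowm n)
       \<le> ennreal (C * sqrt (nrm n (\<lambda>j. x j - y j)))"
  shows "whp (\<lambda>n m x0 a. \<forall>x\<in>net n (finest n).
     (\<Sum>i<m. Z n x0 x (sens_row n i a)) \<le> real m * ((\<integral>r. Z n x0 x r \<partial>rowm n) + \<delta> / sqrt (real n)))"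
proof -
  define \<theta> where "\<theta> = \<delta> / 2"
  \<comment> \<open>The first bound keeps the largest tilt, at the finest level, below
    \<open>lam\<close>; the second makes the quadratic term of the Bernstein exponent at most half
    of the linear one.\<close>
  define l1 where "l1 = min (lam / 4) (\<theta> / (64 * C))"
  \<comment> \<open>This gives the exponent \<open>22 * n * 2 ^ k\<close>. Of the 22, 20 pay for the
    entropy of the net and 2 leave \<open>exp (- n) * exp (- (k + 1))\<close>, which is summable
    over the levels.\<close>
  define M where "M = 44 / (l1 * \<theta>)"
  have pos: "0 < \<theta>" "0 < l1" "0 < M" using \<delta> lam C by (auto simp: \<theta>_def l1_def M_def)
  have l1: "4 * l1 \<le> lam" "32 * C * l1 \<le> \<theta> / 2"
    using C by (auto simp: l1_def min_def field_simps)
  show ?thesis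
  proof (rule whpI[of M 1 1])
    fix n m :: nat and x0 assume n: "1 \<le> n" and m: "M * (real n)\<^sup>2 \<le> real m" and x0: "nrm n x0 = 1"
    define K where "K = finest n"
    define t where "t k = \<theta> * (1/2) ^ k / sqrt (real n)" for k :: nat
    define par where "par k x = (SOME y. y \<in> net n k \<and> nrm n (\<lambda>j. x j - y j) \<le> 2 / 256 ^ k)" for k x
    have par: "par k x \<in> net n k" "nrm n (\<lambda>j. x j - par k x j) \<le> 2 / 256 ^ k" if "nrm n x = 1" for k x
    proof -
      have "\<exists>y. y \<in> net n k \<and> nrm n (\<lambda>j. x j - y j) \<le> 2 / 256 ^ k"
        using net[of n k] that unfolding is_net_def by blast
      from someI_ex[OF this] show "par k x \<in> net n k" "nrm n (\<lambda>j. x j - par k x j) \<le> 2 / 256 ^ k"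
        unfolding par_def by auto
    qed
    have N: "finite (net n k)" "\<And>x. x \<in> net n k \<Longrightarrow> nrm n x = 1" "real (card (net n k)) \<le> exp (real n * (8 + 12 * real k))" for k
      using net[of n k] unfolding is_net_def by auto
    define W where "W k x r = (if k = 0 then Z n x0 x r else Z n x0 x r - Z n x0 (par (k - 1) x) r)" for k x r
    \<comment> \<open>Level \<open>k\<close> is compared with a parent at level
      \<open>k - 1\<close>, at distance at most \<open>2 / 256 ^ (k - 1)\<close>. The square root of
      that is at most \<open>2 / 16 ^ (k - 1) = 32 / 16 ^ k\<close>.\<close>
    define V where "V k = 32 * C / 16 ^ k" for k :: nat
    define l where "l k = l1 * 4 ^ k / sqrt (real n)" for k :: nat
    have sn: "sqrt (real n) > 0" "sqrt (real n) * sqrt (real n) = real n" using n by auto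
    have Wm: "W k x \<in> borel_measurable (rowm n)" if "x \<in> net n k" for k x
      unfolding W_def using meas[OF x0 N(2)[OF that]] meas[OF x0 N(2)[OF par(1)[OF N(2)[OF that]]]] by auto
    have WV: "(\<integral>\<^sup>+r. ennreal ((W k x r)\<^sup>2 * exp (lam * \<bar>W k x r\<bar>)) \<partial>rowm n) \<le> ennreal (V k)" if x: "x \<in> net n k" for k x
    proof (cases k)
      case 0
      then show ?thesis using order.trans[OF base[OF x0 N(2)[OF x]], of "ennreal (32 * C)"] C
        by (auto simp: W_def V_def intro!: ennreal_leI)
    next
      case (Suc j)
      have "(\<integral>\<^sup>+r. ennreal ((W k x r)\<^sup>2 * exp (lam * \<bar>W k x r\<bar>)) \<partial>rowm n)
         \<le> ennreal (C * sqrt (nrm n (\<lambda>i. x i - par j x i)))"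
        using inc[OF x0 N(2)[OF x] N(2)[OF par(1)[OF N(2)[OF x]]]] Suc by (simp add: W_def)
      also have "sqrt (nrm n (\<lambda>i. x i - par j x i)) \<le> sqrt (2 / 256 ^ j)"
        using par(2)[OF N(2)[OF x]] by simp
      also have "\<dots> \<le> 2 / 16 ^ j"
      proof (rule real_le_lsqrt)
        have "(256::real) ^ j = 16 ^ j * 16 ^ j" by (simp add: power_mult_distrib[symmetric])
        then show "2 / 256 ^ j \<le> (2 / 16 ^ j :: real)\<^sup>2" by (simp add: power2_eq_square divide_right_mono)
      qed auto
      finally show ?thesis
        using C Suc by (simp add: V_def mult_left_mono ennreal_leI order.trans mult.commute)
    qed
    have lk: "0 \<le> l k" "l k \<le> lam" if "k \<le> K" for k
    proof -
      show "0 \<le> l k" using pos by (simp add: l_def)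
      have "((4::real) ^ k)\<^sup>2 = 16 ^ k" by (simp add: power2_eq_square power_mult_distrib[symmetric])
      also have "\<dots> \<le> 16 ^ K" using that by (intro power_increasing) auto
      also have "\<dots> \<le> 16 * real n" unfolding K_def by (rule finest_less[OF n])
      also have "\<dots> \<le> (4 * sqrt (real n))\<^sup>2" by (simp add: power_mult_distrib)
      finally have p4: "(4::real) ^ k \<le> 4 * sqrt (real n)"
        by (rule power2_le_imp_le) simp
      have "sqrt (real n) * 1 \<le> sqrt (real n) * sqrt (real n)"
        using n by (intro mult_left_mono) auto
      have "l k \<le> l1 * (4 * sqrt (real n)) / sqrt (real n)"
        unfolding l_def using p4 pos sn by (intro divide_right_mono mult_left_mono) auto
      also have "\<dots> = 4 * l1" using sn by simp
      finally show "l k \<le> lam" using l1 by linarith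
    qed
    define B where "B = (\<lambda>(k, x). {a \<in> space (sens m n). real m * ((\<integral>r. W k x r \<partial>rowm n) + t k) \<le> (\<Sum>i<m. W k x (sens_row n i a))})"
    define I where "I = (SIGMA k:{..K}. net n k)"
    have Bp: "measure (sens m n) (B (k, x)) \<le> exp (- 22 * real n * 2 ^ k)" if k: "k \<le> K" and x: "x \<in> net n k" for k x
    proof -
      have "measure (sens m n) (B (k, x)) \<le> exp (real m * ((l k)\<^sup>2 * V k - l k * t k))"
        unfolding B_def prod.case
        by (rule bernstein(2)[OF Wm[OF x] WV[OF x] lk(1)[OF k] lk(2)[OF k]]) (use C in \<open>simp add: V_def\<close>)
      also have "(l k)\<^sup>2 * V k - l k * t k = l1 / real n * (32 * C * l1 - \<theta> * 2 ^ k)"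
      proof -
        have e1: "(4::real) ^ k * 4 ^ k = 16 ^ k" "(4::real) ^ k = 2 ^ k * 2 ^ k" by (simp_all add: power_mult_distrib[symmetric])
        have "(l k)\<^sup>2 * V k = l1 * l1 * (4 ^ k * 4 ^ k) / (sqrt (real n) * sqrt (real n)) * (32 * C / 16 ^ k)"
          by (simp add: l_def V_def power2_eq_square)
        also have "\<dots> = l1 / real n * (32 * C * l1)" unfolding e1(1) sn(2) by simp
        finally have a: "(l k)\<^sup>2 * V k = l1 / real n * (32 * C * l1)" .
        have "l k * t k = l1 * \<theta> * (2 ^ k * 2 ^ k * (1/2) ^ k) / (sqrt (real n) * sqrt (real n))"
          unfolding l_def t_def e1(2) by (simp add: field_simps)
        also have "\<dots> = l1 / real n * (\<theta> * 2 ^ k)" unfolding sn(2) by (simp add: power_one_over field_simps)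
        finally show ?thesis using a by (simp add: algebra_simps)
      qed
      also have "real m * (l1 / real n * (32 * C * l1 - \<theta> * 2 ^ k)) \<le> - 22 * real n * 2 ^ k"
      proof -
        have "\<theta> / 2 * 1 \<le> \<theta> / 2 * 2 ^ k" using pos by (intro mult_left_mono) auto
        then have "32 * C * l1 - \<theta> * 2 ^ k \<le> - (\<theta> / 2 * 2 ^ k)" using l1(2) by linarith
        then have "real m * (l1 / real n * (32 * C * l1 - \<theta> * 2 ^ k)) \<le> real m * (l1 / real n * (- (\<theta> / 2 * 2 ^ k)))"
          using pos by (intro mult_left_mono) auto
        also have "\<dots> = - (real m * (l1 / real n * (\<theta> / 2 * 2 ^ k)))" by simp
        also have "\<dots> \<le> - ((M * (real n)\<^sup>2) * (l1 / real n * (\<theta> / 2 * 2 ^ k)))"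
          using pos m by (intro le_imp_neg_le mult_right_mono) auto
        also have "(M * (real n)\<^sup>2) * (l1 / real n * (\<theta> / 2 * 2 ^ k)) = 22 * real n * 2 ^ k"
          using pos n by (simp add: M_def power2_eq_square)
        finally show ?thesis by simp
      qed
      finally show ?thesis by simp
    qed
    have "(\<Sum>i\<in>I. measure (sens m n) (B i)) = (\<Sum>k\<le>K. \<Sum>x\<in>net n k. measure (sens m n) (B (k, x)))"
      unfolding I_def using N(1) by (subst sum.Sigma) (auto simp: case_prod_beta)
    also have "\<dots> \<le> (\<Sum>k\<le>K. exp (- real n) * exp (- (real k + 1)))"
    proof (rule sum_mono)
      fix k assume k: "k \<in> {..K}"
      have "(\<Sum>x\<in>net n k. measure (sens m n) (B (k, x))) \<le> (\<Sum>x\<in>net n k. exp (- 22 * real n * 2 ^ k))"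
        using k by (intro sum_mono Bp) auto
      also have "\<dots> = real (card (net n k)) * exp (- 22 * real n * 2 ^ k)" by simp
      also have "\<dots> \<le> exp (real n * (8 + 12 * real k)) * exp (- 22 * real n * 2 ^ k)"
        by (intro mult_right_mono N) auto
      also have "\<dots> = exp (real n * (8 + 12 * real k - 22 * 2 ^ k))"
        by (simp add: exp_add[symmetric] algebra_simps)
      also have "\<dots> \<le> exp (- real n + (- (real k + 1)))"
      proof -
        have p: "1 \<le> (2::real) ^ k" by simp
        have "8 + 12 * real k - 22 * 2 ^ k \<le> - (2 ^ k) - 2 ^ k" using linear_le_power2[of k] by linarith
        also have "\<dots> \<le> - 1 - (real k + 1)" using p Suc_le_power2[of k] by linarith
        finally have "real n * (8 + 12 * real k - 22 * 2 ^ k) \<le> real n * (- 1 - (real k + 1))"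
          by (intro mult_left_mono) auto
        also have "\<dots> = - real n - real n * (real k + 1)" by (simp add: algebra_simps)
        also have "\<dots> \<le> - real n - 1 * (real k + 1)"
          using n by (intro diff_left_mono mult_right_mono) auto
        finally show ?thesis by simp
      qed
      finally show "(\<Sum>x\<in>net n k. measure (sens m n) (B (k, x))) \<le> exp (- real n) * exp (- (real k + 1))"
        unfolding exp_add .
    qed
    also have "\<dots> \<le> exp (- real n) * 1"
      unfolding sum_distrib_left[symmetric] by (intro mult_left_mono sum_exp_neg_le) auto
    finally have sumB: "(\<Sum>i\<in>I. measure (sens m n) (B i)) \<le> 1 * exp (- real n)" by simp
    have finI: "finite I" unfolding I_def using N(1) by auto
    have Bs: "B i \<in> sets (sens m n)" if iI: "i \<in> I" for i
    proof -
      obtain k x where i: "i = (k, x)" "k \<le> K" "x \<in> net n k" using iI by (auto simp: I_def)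
      note [measurable] = Wm[OF i(3)]
      show ?thesis unfolding B_def i prod.case by measurable
    qed
    obtain E where E: "E \<in> sets (sens m n)" "1 - 1 * exp (- real n) \<le> measure (sens m n) E"
       "\<And>a i. a \<in> E \<Longrightarrow> i \<in> I \<Longrightarrow> a \<in> space (sens m n) \<and> a \<notin> B i"
      using good_event[OF finI Bs sumB] by metis
    \<comment> \<open>Telescoping along the chain of parents: each increment obeys its own deviation
      bound, and the means telescope with the sums.\<close>
    have main: "(\<Sum>i<m. Z n x0 x (sens_row n i a)) \<le> real m * ((\<integral>r. Z n x0 x r \<partial>rowm n) + (\<Sum>j\<le>k. t j))"
      if a: "a \<in> E" and "k \<le> K" and "x \<in> net n k" for a k x
      using that(2,3)
    proof (induction k arbitrary: x)
      case 0
      have "a \<notin> B (0, x)" "a \<in> space (sens m n)" using E(3)[OF a, of "(0, x)"] 0 by (auto simp: I_def)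
      then have "(\<Sum>i<m. W 0 x (sens_row n i a)) \<le> real m * ((\<integral>r. W 0 x r \<partial>rowm n) + t 0)" by (simp add: B_def)
      then show ?case by (simp add: W_def)
    next
      case (Suc k)
      define y where "y = par k x"
      have y: "y \<in> net n k" unfolding y_def using par(1)[OF N(2)[OF Suc.prems(2)]] .
      have IH: "(\<Sum>i<m. Z n x0 y (sens_row n i a)) \<le> real m * ((\<integral>r. Z n x0 y r \<partial>rowm n) + (\<Sum>j\<le>k. t j))"
        using Suc y by auto
      have "a \<notin> B (Suc k, x)" "a \<in> space (sens m n)" using E(3)[OF a, of "(Suc k, x)"] Suc.prems by (auto simp: I_def)
      then have st: "(\<Sum>i<m. W (Suc k) x (sens_row n i a)) \<le> real m * ((\<integral>r. W (Suc k) x r \<partial>rowm n) + t (Suc k))" by (simp add: B_def)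
      have int: "integrable (rowm n) (Z n x0 z)" if "nrm n z = 1" for z
        by (rule bernstein(1)[where l = 0, OF meas[OF x0 that] base[OF x0 that]]) (use lam C in auto)
      have D: "(\<integral>r. W (Suc k) x r \<partial>rowm n) = (\<integral>r. Z n x0 x r \<partial>rowm n) - (\<integral>r. Z n x0 y r \<partial>rowm n)"
        unfolding W_def y_def by (simp add: int N(2)[OF Suc.prems(2)] N(2)[OF par(1)[OF N(2)[OF Suc.prems(2)]]])
      from st[unfolded D] IH show ?case by (simp add: W_def y_def[symmetric] sum_subtractf algebra_simps)
    qed
    have tsum: "(\<Sum>j\<le>K. t j) \<le> \<delta> / sqrt (real n)"
    proof -
      have "(\<Sum>j\<le>K. t j) = \<theta> / sqrt (real n) * (\<Sum>j\<le>K. (1/2) ^ j)"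
        by (simp add: t_def sum_distrib_left)
      also have "\<dots> \<le> \<theta> / sqrt (real n) * 2"
        using pos by (intro mult_left_mono sum_half_powers) auto
      finally show ?thesis by (simp add: \<theta>_def)
    qed
    show "\<exists>E\<in>sets (sens m n). 1 - 1 * exp (- real n) \<le> measure (sens m n) E \<and>
      (\<forall>a\<in>E. \<forall>x\<in>net n (finest n). (\<Sum>i<m. Z n x0 x (sens_row n i a)) \<le> real m * ((\<integral>r. Z n x0 x r \<partial>rowm n) + \<delta> / sqrt (real n)))"
    proof (intro bexI[of _ E] conjI ballI)
      fix a x assume "a \<in> E" "x \<in> net n (finest n)"
      then have "(\<Sum>i<m. Z n x0 x (sens_row n i a)) \<le> real m * ((\<integral>r. Z n x0 x r \<partial>rowm n) + (\<Sum>j\<le>K. t j))"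
        using main[of a K x] by (simp add: K_def)
      also have "\<dots> \<le> real m * ((\<integral>r. Z n x0 x r \<partial>rowm n) + \<delta> / sqrt (real n))"
        using tsum by (intro mult_left_mono) auto
      finally show "(\<Sum>i<m. Z n x0 x (sens_row n i a)) \<le> real m * ((\<integral>r. Z n x0 x r \<partial>rowm n) + \<delta> / sqrt (real n))" .
    qed (use E in auto)
  qed (use pos in auto)
qed

text \<open>At a fixed level the entropy is linear in \<open>n\<close>. The constant tilt
  \<open>l\<close> makes the quadratic term of the exponent at most half of the linear one, and
  \<open>M\<close> makes what remains exceed the entropy by \<open>n\<close>.\<close>

lemma net_law:
  fixes Z :: "nat \<Rightarrow> (nat \<Rightarrow> complex) \<Rightarrow> (nat \<Rightarrow> complex) \<Rightarrow> (nat \<Rightarrow> complex) \<Rightarrow> real"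
  assumes C: "0 < C" and lam: "0 < lam" and \<delta>: "0 < \<delta>"
    and meas: "\<And>n x0 x. nrm n x0 = 1 \<Longrightarrow> nrm n x = 1 \<Longrightarrow> Z n x0 x \<in> borel_measurable (rowm n)"
    and base: "\<And>n x0 x. nrm n x0 = 1 \<Longrightarrow> nrm n x = 1 \<Longrightarrow>
      (\<integral>\<^sup>+r. ennreal ((Z n x0 x r)\<^sup>2 * exp (lam * \<bar>Z n x0 x r\<bar>)) \<partial>rowm n) \<le> ennreal C"
  shows "whp (\<lambda>n m x0 a. \<forall>x\<in>net n k.
     (\<Sum>i<m. Z n x0 x (sens_row n i a)) \<le> real m * ((\<integral>r. Z n x0 x r \<partial>rowm n) + \<delta>))"
proof -
  define l where "l = min lam (\<delta> / (2 * C))"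
  have l: "0 < l" "l \<le> lam" "l * C \<le> \<delta> / 2" using C lam \<delta> by (auto simp: l_def min_def field_simps)
  define M where "M = 2 * (9 + 12 * real k) / (l * \<delta>)"
  have M: "0 < M" using l \<delta> by (simp add: M_def add_pos_nonneg)
  show ?thesis
  proof (rule whpI[of M 1 1])
    fix n m :: nat and x0 assume n: "1 \<le> n" and m: "M * (real n)\<^sup>2 \<le> real m" and x0: "nrm n x0 = 1"
    have N: "finite (net n k)" "\<And>x. x \<in> net n k \<Longrightarrow> nrm n x = 1" "real (card (net n k)) \<le> exp (real n * (8 + 12 * real k))"
      using net[of n k] unfolding is_net_def by auto
    define B where "B x = {a \<in> space (sens m n). real m * ((\<integral>r. Z n x0 x r \<partial>rowm n) + \<delta>) \<le> (\<Sum>i<m. Z n x0 x (sens_row n i a))}" for x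
    have Bs: "B x \<in> sets (sens m n)" if "x \<in> net n k" for x
    proof -
      note [measurable] = meas[OF x0 N(2)[OF that]]
      show ?thesis unfolding B_def by measurable
    qed
    have "real m * (l\<^sup>2 * C - l * \<delta>) \<le> - (real n * (9 + 12 * real k))"
    proof -
      have "l\<^sup>2 * C - l * \<delta> = l * (l * C - \<delta>)" by (simp add: power2_eq_square algebra_simps)
      also have "\<dots> \<le> l * (- (\<delta> / 2))" using l by (intro mult_left_mono) auto
      finally have "real m * (l\<^sup>2 * C - l * \<delta>) \<le> real m * (l * (- (\<delta> / 2)))" by (intro mult_left_mono) auto
      also have "\<dots> = - (real m * (l * \<delta> / 2))" by simp
      also have "\<dots> \<le> - (M * (real n)\<^sup>2 * (l * \<delta> / 2))"
        using l \<delta> m by (intro le_imp_neg_le mult_right_mono) auto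
      also have "M * (real n)\<^sup>2 * (l * \<delta> / 2) = (real n)\<^sup>2 * (9 + 12 * real k)"
        using l \<delta> by (simp add: M_def)
      also have "- ((real n)\<^sup>2 * (9 + 12 * real k)) \<le> - (real n * (9 + 12 * real k))"
        using n by (intro le_imp_neg_le mult_right_mono) (auto simp: power2_eq_square)
      finally show ?thesis .
    qed
    then have Bp: "measure (sens m n) (B x) \<le> exp (- (real n * (9 + 12 * real k)))" if "x \<in> net n k" for x
      unfolding B_def using C l
      by (intro order.trans[OF bernstein(2)[OF meas[OF x0 N(2)[OF that]] base[OF x0 N(2)[OF that]], of l]]) auto
    have "(\<Sum>x\<in>net n k. measure (sens m n) (B x)) \<le> (\<Sum>x\<in>net n k. exp (- (real n * (9 + 12 * real k))))"
      by (intro sum_mono Bp)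
    also have "\<dots> \<le> exp (real n * (8 + 12 * real k)) * exp (- (real n * (9 + 12 * real k)))"
      using N(3) by (simp add: mult_right_mono)
    also have "\<dots> = 1 * exp (- real n)" by (simp add: exp_add[symmetric] algebra_simps)
    finally have sumB: "(\<Sum>x\<in>net n k. measure (sens m n) (B x)) \<le> 1 * exp (- real n)" .
    obtain E where E: "E \<in> sets (sens m n)" "1 - 1 * exp (- real n) \<le> measure (sens m n) E"
       "\<And>a i. a \<in> E \<Longrightarrow> i \<in> net n k \<Longrightarrow> a \<in> space (sens m n) \<and> a \<notin> B i"
      using good_event[OF N(1) Bs sumB] by metis
    then show "\<exists>E\<in>sets (sens m n). 1 - 1 * exp (- real n) \<le> measure (sens m n) E \<and>
      (\<forall>a\<in>E. \<forall>x\<in>net n k. (\<Sum>i<m. Z n x0 x (sens_row n i a)) \<le> real m * ((\<integral>r. Z n x0 x r \<partial>rowm n) + \<delta>))"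
      by (intro bexI[of _ E]) (auto simp: B_def not_le intro: less_imp_le)
  qed (use M in auto)
qed

section \<open>Uniform laws at constant precision\<close>

lemma row_law_single_unit:
  fixes f :: "complex \<Rightarrow> ennreal"
  assumes "f \<in> borel_measurable borel" "nrm n x = 1"
  shows "(\<integral>\<^sup>+r. f (ip n r x) \<partial>rowm n) = (\<integral>\<^sup>+g. f g \<partial>cg)"
  using row_law_single[OF assms(1), of n x] assms(2) by simp

lemma row_exp_moment:
  assumes "nrm n x = 1" "c < 1"
  shows "(\<integral>\<^sup>+r. ennreal (exp (c * (cmod (ip n r x))\<^sup>2)) \<partial>rowm n) = ennreal (1 / (1 - c))"
  using row_law_single_unit[of "\<lambda>z. ennreal (exp (c * (cmod z)\<^sup>2))" n x] assms cg_exp_moment by simp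

lemma row_second_moment: "(\<integral>\<^sup>+r. ennreal ((cmod (ip n r x))\<^sup>2) \<partial>rowm n) = ennreal ((nrm n x)\<^sup>2)"
proof -
  have "(\<integral>\<^sup>+r. ennreal ((cmod (ip n r x))\<^sup>2) \<partial>rowm n) = (\<integral>\<^sup>+g. ennreal ((nrm n x)\<^sup>2) * ennreal ((cmod g)\<^sup>2) \<partial>cg)"
    by (subst row_law_single) (auto simp: norm_mult power_mult_distrib ennreal_mult')
  also have "\<dots> = ennreal ((nrm n x)\<^sup>2)"
    by (simp add: nn_integral_cmult cg_second_moment)
  finally show ?thesis .
qed

lemma row_second_moment_real:
  "integrable (rowm n) (\<lambda>r. (cmod (ip n r x))\<^sup>2)" "(\<integral>r. (cmod (ip n r x))\<^sup>2 \<partial>rowm n) = (nrm n x)\<^sup>2"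
  by (rule integrableI_nonneg; simp add: row_second_moment)
     (rule integral_eq_nn_integral[THEN trans]; simp add: row_second_moment)

lemma square_le_exp: "0 \<le> y \<Longrightarrow> y\<^sup>2 \<le> 32 * exp (y / 4)" for y :: real
  using exp_lower_Taylor_quadratic[of "y / 4"] by (simp add: power2_eq_square)

text \<open>The square is paid for with \<open>exp (y / 4)\<close> and the weight with another
  \<open>exp (y / 4)\<close>, where \<open>y\<close> is the squared modulus of the measurement; the
  total exponent 1/2 has Gaussian moment 2, whence \<open>32 * 2\<close>.\<close>

lemma subexponential_base:
  assumes [measurable]: "case_prod Z \<in> borel_measurable (borel \<Otimes>\<^sub>M borel)"
    and "\<And>u p. \<bar>Z u p\<bar> \<le> (cmod p)\<^sup>2" and "nrm n x = 1"
  shows "(\<integral>\<^sup>+r. ennreal ((Z (ip n r x0) (ip n r x))\<^sup>2 * exp (1/4 * \<bar>Z (ip n r x0) (ip n r x)\<bar>)) \<partial>rowm n) \<le> ennreal 64"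
proof -
  have "(\<integral>\<^sup>+r. ennreal ((Z (ip n r x0) (ip n r x))\<^sup>2 * exp (1/4 * \<bar>Z (ip n r x0) (ip n r x)\<bar>)) \<partial>rowm n)
     \<le> (\<integral>\<^sup>+r. ennreal 32 * ennreal (exp (1/2 * (cmod (ip n r x))\<^sup>2)) \<partial>rowm n)"
  proof (rule nn_integral_mono)
    fix r
    define z y where "z = \<bar>Z (ip n r x0) (ip n r x)\<bar>" and "y = (cmod (ip n r x))\<^sup>2"
    have zy: "0 \<le> z" "z \<le> y" using assms(2) by (auto simp: z_def y_def)
    have "z\<^sup>2 * exp (1/4 * z) \<le> y\<^sup>2 * exp (1/4 * y)"
      using zy by (intro mult_mono power_mono) auto
    also have "\<dots> \<le> 32 * exp (y / 4) * exp (1/4 * y)"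
      using zy by (intro mult_right_mono square_le_exp) auto
    also have "\<dots> = 32 * exp (1/2 * y)" by (simp add: exp_add[symmetric])
    finally show "ennreal ((Z (ip n r x0) (ip n r x))\<^sup>2 * exp (1/4 * \<bar>Z (ip n r x0) (ip n r x)\<bar>))
       \<le> ennreal 32 * ennreal (exp (1/2 * (cmod (ip n r x))\<^sup>2))"
      unfolding z_def y_def by (subst ennreal_mult'[symmetric]) (auto intro!: ennreal_leI)
  qed
  also have "\<dots> = ennreal 32 * ennreal 2"
    using row_exp_moment[of n x "1/2"] assms(3) by (subst nn_integral_cmult) auto
  also have "\<dots> = ennreal 64" by (subst ennreal_mult'[symmetric]) auto
  finally show ?thesis .
qed

definition apply_rows :: "nat \<Rightarrow> (nat \<times> nat \<Rightarrow> complex) \<Rightarrow> (nat \<Rightarrow> complex) \<Rightarrow> nat \<Rightarrow> complex" where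
  "apply_rows n a x i = ip n (sens_row n i a) x"

lemma apply_rows_diff: "apply_rows n a (\<lambda>j. x j - y j) = (\<lambda>i. apply_rows n a x i - apply_rows n a y i)"
  by (simp add: apply_rows_def lin_diff fun_eq_iff)

lemma apply_rows_scale: "apply_rows n a (\<lambda>j. c * x j) = (\<lambda>i. c * apply_rows n a x i)"
  by (simp add: apply_rows_def lin_scale fun_eq_iff)

lemma nrm_zero: "nrm n x = 0 \<Longrightarrow> j < n \<Longrightarrow> x j = 0"
  by (auto simp: nrm_def sum_nonneg_eq_0_iff)

lemma apply_rows_zero: "nrm n x = 0 \<Longrightarrow> apply_rows n a x i = 0"
  using nrm_zero[of n x] by (simp add: apply_rows_def lin_form_def)

lemma net_cover:
  assumes "nrm n x = 1"
  obtains y where "y \<in> net n k" "nrm n y = 1" "nrm n (\<lambda>j. x j - y j) \<le> 2 / 256 ^ k"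
  using net[of n k] assms unfolding is_net_def by blast

text \<open>The net has mesh 1/128, so the supremum \<open>s\<close> over the sphere satisfies
  \<open>s \<le> b + s / 128\<close>. Solving for \<open>s\<close> requires it to be finite, which
  the crude bound \<open>F\<close> guarantees.\<close>

lemma operator_norm_bound_of_net:
  assumes "\<And>x. x \<in> net n 1 \<Longrightarrow> nrm m (apply_rows n a x) \<le> b" "0 \<le> b"
  shows "nrm m (apply_rows n a x) \<le> 128 / 127 * b * nrm n x"
proof -
  let ?f = "\<lambda>x. nrm m (apply_rows n a x)"
  define U where "U = {x. nrm n x = 1}"
  define F where "F = (\<Sum>i<m. nrm n (sens_row n i a))"
  have bdd: "?f x \<le> F" if "nrm n x = 1" for x
  proof -
    have "?f x \<le> (\<Sum>i<m. cmod (apply_rows n a x i))"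
      unfolding nrm_L2 using L2_set_le_sum_abs[of "\<lambda>i. cmod (apply_rows n a x i)" "{..<m}"] by simp
    also have "\<dots> \<le> F" unfolding F_def
    proof (rule sum_mono)
      fix i show "cmod (apply_rows n a x i) \<le> nrm n (sens_row n i a)"
        using ip_cauchy[of n "sens_row n i a" x] that by (simp add: apply_rows_def)
    qed
    finally show ?thesis .
  qed
  define s where "s = Sup (?f ` U)"
  have bd: "bdd_above (?f ` U)" using bdd by (auto simp: U_def intro!: bdd_aboveI2)
  have le_s: "?f x \<le> s" if "nrm n x = 1" for x
    unfolding s_def using bd that by (intro cSup_upper) (auto simp: U_def)
  have normalize: "?f x \<le> s * nrm n x" for x
  proof (cases "nrm n x = 0")
    case True
    then have "nrm m (apply_rows n a x) = 0" using apply_rows_zero[OF True, of a] by (simp add: nrm_def)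
    then show ?thesis using True by simp
  next
    case False
    define c where "c = complex_of_real (1 / nrm n x)"
    have c: "cmod c = 1 / nrm n x" unfolding c_def norm_of_real by simp
    have "nrm n (\<lambda>j. c * x j) = 1" using False by (simp add: nrm_scale c)
    from le_s[OF this] have "1 / nrm n x * ?f x \<le> s" unfolding apply_rows_scale nrm_scale c .
    then show ?thesis using False less_le[of 0 "nrm n x"] by (simp add: field_simps)
  qed
  show ?thesis
  proof (cases "U = {}")
    case True
    have "nrm n x = 0"
    proof (rule ccontr)
      assume *: "nrm n x \<noteq> 0"
      have "nrm n (\<lambda>j. complex_of_real (1 / nrm n x) * x j) = 1"
        unfolding nrm_scale norm_of_real using * by simp
      then show False using True by (auto simp: U_def)
    qed
    then show ?thesis using normalize[of x] by simp
  next
    case False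
    have "?f x \<le> b + s / 128" if x: "nrm n x = 1" for x
    proof -
      obtain y where y: "y \<in> net n 1" "nrm n (\<lambda>j. x j - y j) \<le> 2 / 256 ^ 1"
        using net_cover[OF x] by metis
      have s0: "0 \<le> s" using order.trans[OF nrm_nonneg le_s[OF x]] .
      have "?f x \<le> ?f y + ?f (\<lambda>j. x j - y j)"
        unfolding apply_rows_diff by (rule nrm_triangle_sub)
      also have "\<dots> \<le> b + s * nrm n (\<lambda>j. x j - y j)"
        by (intro add_mono assms(1) y normalize)
      also have "\<dots> \<le> b + s * (1 / 128)"
        using y s0 by (intro add_left_mono mult_left_mono) auto
      finally show ?thesis by simp
    qed
    then have "Sup (?f ` U) \<le> b + s / 128"
      using False by (intro cSUP_least) (auto simp: U_def)
    then have "s \<le> b + s / 128" unfolding s_def[symmetric] .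
    then have "s \<le> 128 / 127 * b" by simp
    then show ?thesis using normalize[of x] mult_right_mono[of s "128 / 127 * b" "nrm n x"] by simp
  qed
qed

lemma operator_norm_bound:
  "whp (\<lambda>n m x0 a. \<forall>x. nrm m (apply_rows n a x) \<le> 2 * sqrt (real m) * nrm n x)"
proof (rule whp_mono[of _ 0])
  let ?Z = "\<lambda>u p :: complex. (cmod p)\<^sup>2"
  have m1: "case_prod ?Z \<in> borel_measurable (borel \<Otimes>\<^sub>M borel)" by measurable
  show "whp (\<lambda>n m x0 a. \<forall>x\<in>net n 1.
     (\<Sum>i<m. ?Z (ip n (sens_row n i a) x0) (ip n (sens_row n i a) x)) \<le> real m * ((\<integral>r. ?Z (ip n r x0) (ip n r x) \<partial>rowm n) + 1))"
    by (rule net_law[where C = 64 and lam = "1/4" and Z = "\<lambda>n x0 x r. ?Z (ip n r x0) (ip n r x)"])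
       (use subexponential_base[OF m1] in auto)
  fix n m x0 a assume *: "\<forall>x\<in>net n 1.
     (\<Sum>i<m. ?Z (ip n (sens_row n i a) x0) (ip n (sens_row n i a) x)) \<le> real m * ((\<integral>r. ?Z (ip n r x0) (ip n r x) \<partial>rowm n) + 1)"
  have b: "nrm m (apply_rows n a x) \<le> sqrt (2 * real m)" if x: "x \<in> net n 1" for x
  proof -
    have "nrm n x = 1" using x net[of n 1] by (simp add: is_net_def)
    then have "(\<Sum>i<m. (cmod (apply_rows n a x i))\<^sup>2) \<le> 2 * real m"
      using *[rule_format, OF x] by (simp add: apply_rows_def row_second_moment_real)
    then show ?thesis unfolding nrm_def by simp
  qed
  have "128 / 127 * sqrt (2 * real m) \<le> 2 * sqrt (real m)"
  proof -
    have "sqrt 2 \<le> 3 / 2" by (rule real_le_lsqrt) (auto simp: power2_eq_square)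
    then have "128 / 127 * sqrt 2 \<le> 2" by simp
    then have "128 / 127 * sqrt 2 * sqrt (real m) \<le> 2 * sqrt (real m)" by (intro mult_right_mono) auto
    then show ?thesis by (simp add: real_sqrt_mult)
  qed
  then show "\<forall>x. nrm m (apply_rows n a x) \<le> 2 * sqrt (real m) * nrm n x"
    by (intro allI order.trans[OF operator_norm_bound_of_net[OF b]] mult_right_mono) auto
qed

text \<open>Since \<open>Z\<close> is locally Lipschitz with a linear modulus, a fixed net suffices.
  The passage to the sphere costs little in the empirical mean, by Cauchy-Schwarz and the operator
  norm, and little in the expectation, by second moments.\<close>

lemma uniform_law_upper:
  fixes Z :: "complex \<Rightarrow> complex \<Rightarrow> real"
  assumes m1 [measurable]: "case_prod Z \<in> borel_measurable (borel \<Otimes>\<^sub>M borel)"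
    and Zb: "\<And>u p. \<bar>Z u p\<bar> \<le> (cmod p)\<^sup>2"
    and Zl: "\<And>u p q. \<bar>Z u p - Z u q\<bar> \<le> cmod (p - q) * (cmod p + cmod q)"
    and \<delta>: "0 < \<delta>"
  shows "whp (\<lambda>n m x0 a. \<forall>x. nrm n x = 1 \<longrightarrow>
    (\<Sum>i<m. Z (apply_rows n a x0 i) (apply_rows n a x i)) \<le> real m * ((\<integral>r. Z (ip n r x0) (ip n r x) \<partial>rowm n) + \<delta>))"
proof -
  \<comment> \<open>With mesh \<open>e\<close>, the empirical mean changes by at most
    \<open>8 * e\<close> and the expectation by at most \<open>2 * e\<close>; together they take the
    half of \<open>\<delta>\<close> that the net leaves.\<close>
  obtain k where k: "40 / \<delta> < 256 ^ k" using real_arch_pow[of 256 "40 / \<delta>"] by auto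
  define e :: real where "e = 2 / 256 ^ k"
  have e: "0 < e" "10 * e \<le> \<delta> / 2" using k \<delta> by (auto simp: e_def field_simps)
  have "whp (\<lambda>n m x0 a. \<forall>x\<in>net n k.
     (\<Sum>i<m. Z (ip n (sens_row n i a) x0) (ip n (sens_row n i a) x)) \<le> real m * ((\<integral>r. Z (ip n r x0) (ip n r x) \<partial>rowm n) + \<delta> / 2))"
    by (rule net_law[where C = 64 and lam = "1/4" and Z = "\<lambda>n x0 x r. Z (ip n r x0) (ip n r x)"])
       (use subexponential_base[OF m1 Zb] \<delta> in auto)
  from whp_conj[OF this operator_norm_bound] show ?thesis
  proof (rule whp_mono[of _ 1], intro allI impI, elim conjE)
    fix n m x0 a x
    assume 1: "\<forall>x\<in>net n k. (\<Sum>i<m. Z (ip n (sens_row n i a) x0) (ip n (sens_row n i a) x))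
        \<le> real m * ((\<integral>r. Z (ip n r x0) (ip n r x) \<partial>rowm n) + \<delta> / 2)"
      and 2: "\<forall>x. nrm m (apply_rows n a x) \<le> 2 * sqrt (real m) * nrm n x"
      and x: "nrm n x = 1"
    obtain y where y: "y \<in> net n k" "nrm n (\<lambda>j. x j - y j) \<le> e"
      and yn: "nrm n y = 1"
      using net_cover[OF x] unfolding e_def by metis
    let ?A = "apply_rows n a"
    have int: "integrable (rowm n) (\<lambda>r. Z (ip n r x0) (ip n r z))" if "nrm n z = 1" for z
      by (rule Bochner_Integration.integrable_bound[OF row_second_moment_real(1)[of n z]]) (use Zb in auto)
    have emp: "(\<Sum>i<m. Z (?A x0 i) (?A x i)) \<le> (\<Sum>i<m. Z (?A x0 i) (?A y i)) + real m * (8 * e)"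
    proof -
      have "(\<Sum>i<m. Z (?A x0 i) (?A x i)) - (\<Sum>i<m. Z (?A x0 i) (?A y i)) = (\<Sum>i<m. Z (?A x0 i) (?A x i) - Z (?A x0 i) (?A y i))"
        by (simp add: sum_subtractf)
      also have "\<dots> \<le> (\<Sum>i<m. \<bar>cmod (?A x i - ?A y i)\<bar> * \<bar>cmod (?A x i) + cmod (?A y i)\<bar>)"
      proof (rule sum_mono)
        fix i
        show "Z (?A x0 i) (?A x i) - Z (?A x0 i) (?A y i) \<le> \<bar>cmod (?A x i - ?A y i)\<bar> * \<bar>cmod (?A x i) + cmod (?A y i)\<bar>"
          using Zl[of "?A x0 i" "?A x i" "?A y i"] by simp
      qed
      also have "\<dots> \<le> L2_set (\<lambda>i. cmod (?A x i - ?A y i)) {..<m} * L2_set (\<lambda>i. cmod (?A x i) + cmod (?A y i)) {..<m}"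
        by (rule L2_set_mult_ineq)
      also have "\<dots> \<le> nrm m (?A (\<lambda>j. x j - y j)) * (nrm m (?A x) + nrm m (?A y))"
        unfolding apply_rows_diff nrm_L2 by (intro mult_left_mono L2_set_triangle_ineq L2_set_nonneg)
      also have "\<dots> \<le> (2 * sqrt (real m) * e) * (2 * sqrt (real m) * 1 + 2 * sqrt (real m) * 1)"
      proof (intro mult_mono add_mono)
        show "nrm m (?A (\<lambda>j. x j - y j)) \<le> 2 * sqrt (real m) * e"
          using 2[rule_format, of "\<lambda>j. x j - y j"] y(2) by (intro order.trans[OF _ mult_left_mono[OF y(2)]]) auto
        show "nrm m (?A x) \<le> 2 * sqrt (real m) * 1" "nrm m (?A y) \<le> 2 * sqrt (real m) * 1"
          using 2[rule_format, of x] 2[rule_format, of y] x yn by auto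
      qed (use e in auto)
      also have "\<dots> = real m * (8 * e)" by (simp add: algebra_simps)
      finally show ?thesis by simp
    qed
    \<comment> \<open>AM-GM with weight \<open>e\<close> replaces the product of a small increment
      and a measurement by squares, whose means are known exactly.\<close>
    have ex: "(\<integral>r. Z (ip n r x0) (ip n r y) \<partial>rowm n) \<le> (\<integral>r. Z (ip n r x0) (ip n r x) \<partial>rowm n) + 2 * e"
    proof -
      let ?w = "\<lambda>j. x j - y j"
      have "(\<integral>r. Z (ip n r x0) (ip n r y) \<partial>rowm n) - (\<integral>r. Z (ip n r x0) (ip n r x) \<partial>rowm n)
         = (\<integral>r. Z (ip n r x0) (ip n r y) - Z (ip n r x0) (ip n r x) \<partial>rowm n)"
        by (simp add: int x yn)
      also have "\<dots> \<le> (\<integral>r. (cmod (ip n r ?w))\<^sup>2 / e + e / 2 * (cmod (ip n r x))\<^sup>2 + e / 2 * (cmod (ip n r y))\<^sup>2 \<partial>rowm n)"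
      proof (rule integral_mono)
        fix r
        define q p p' where "q = cmod (ip n r ?w)" and "p = cmod (ip n r x)" and "p' = cmod (ip n r y)"
        have amgm: "q * v \<le> q\<^sup>2 / (2 * e) + e / 2 * v\<^sup>2" for v
        proof -
          have "0 \<le> (q - e * v)\<^sup>2 / (2 * e)" using e by simp
          also have "\<dots> = q\<^sup>2 / (2 * e) + e / 2 * v\<^sup>2 - q * v"
            using e by (simp add: power2_eq_square field_simps)
          finally show ?thesis by simp
        qed
        have "Z (ip n r x0) (ip n r y) - Z (ip n r x0) (ip n r x) \<le> q * (p + p')"
          using Zl[of "ip n r x0" "ip n r x" "ip n r y"] by (simp add: q_def p_def p'_def lin_diff)
        also have "\<dots> \<le> q\<^sup>2 / e + e / 2 * p\<^sup>2 + e / 2 * p'\<^sup>2"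
          using amgm[of p] amgm[of p'] e by (simp add: algebra_simps)
        finally show "Z (ip n r x0) (ip n r y) - Z (ip n r x0) (ip n r x)
          \<le> (cmod (ip n r ?w))\<^sup>2 / e + e / 2 * (cmod (ip n r x))\<^sup>2 + e / 2 * (cmod (ip n r y))\<^sup>2"
          unfolding q_def p_def p'_def .
      qed (use int x yn row_second_moment_real(1) in auto)
      also have "\<dots> = (nrm n ?w)\<^sup>2 / e + e / 2 + e / 2"
        using x yn by (simp add: row_second_moment_real)
      also have "\<dots> \<le> e\<^sup>2 / e + e"
        using y(2) e by (simp add: divide_right_mono power_mono)
      also have "\<dots> = 2 * e" using e by (simp add: power2_eq_square)
      finally show ?thesis by simp
    qed
    have "(\<Sum>i<m. Z (?A x0 i) (?A x i)) \<le> real m * ((\<integral>r. Z (ip n r x0) (ip n r y) \<partial>rowm n) + \<delta> / 2) + real m * (8 * e)"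
      using emp 1[rule_format, OF y(1)] by (simp add: apply_rows_def)
    also have "\<dots> = real m * ((\<integral>r. Z (ip n r x0) (ip n r y) \<partial>rowm n) + \<delta> / 2 + 8 * e)"
      by (simp add: algebra_simps)
    also have "\<dots> \<le> real m * ((\<integral>r. Z (ip n r x0) (ip n r x) \<partial>rowm n) + \<delta>)"
      using ex e(2) by (intro mult_left_mono) auto
    finally show "(\<Sum>i<m. Z (?A x0 i) (?A x i)) \<le> real m * ((\<integral>r. Z (ip n r x0) (ip n r x) \<partial>rowm n) + \<delta>)" .
  qed
qed

subsection \<open>The mean of the phase process\<close>

lemma phase_measurable [measurable]: "phase \<in> borel_measurable borel"
  unfolding phase_def[abs_def] by measurable

lemma norm_phase [simp]: "cmod (phase z) = 1"
  by (simp add: phase_def norm_divide)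

lemma phase_mult: "cmod w = 1 \<Longrightarrow> z \<noteq> 0 \<Longrightarrow> phase (w * z) = w * phase z"
  by (auto simp: phase_def norm_mult)

abbreviation cg2 :: "(complex \<times> complex) measure" where "cg2 \<equiv> cg \<Otimes>\<^sub>M cg"

lemma sets_cg2 [measurable_cong]: "sets cg2 = sets (borel \<Otimes>\<^sub>M borel)"
  by (intro sets_pair_measure_cong) auto

lemma space_cg2 [simp]: "space cg2 = UNIV"
  by (simp add: space_pair_measure)

interpretation cg2: pair_prob_space cg cg
  by unfold_locales

lemma nn_integral_cg2_iter:
  assumes [measurable]: "F \<in> borel_measurable (borel \<Otimes>\<^sub>M borel)"
  shows "(\<integral>\<^sup>+q. F q \<partial>cg2) = (\<integral>\<^sup>+g. \<integral>\<^sup>+h. F (g, h) \<partial>cg \<partial>cg)"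
  by (rule cg.nn_integral_fst[symmetric]) measurable

text \<open>Transfers a change of variables known for nonnegative integrands to signed ones. It is
  read as equality of two image measures, which gives both the value of the integral and the
  equivalence of integrability.\<close>

lemma cg2_distr_eq:
  assumes [measurable]: "T \<in> borel \<Otimes>\<^sub>M borel \<rightarrow>\<^sub>M borel \<Otimes>\<^sub>M borel" "S \<in> borel \<Otimes>\<^sub>M borel \<rightarrow>\<^sub>M borel \<Otimes>\<^sub>M borel"
    and [measurable]: "w \<in> borel_measurable (borel \<Otimes>\<^sub>M borel)"
    and eq: "\<And>F. F \<in> borel_measurable (borel \<Otimes>\<^sub>M borel) \<Longrightarrow> (\<integral>\<^sup>+q. F (T q) \<partial>cg2) = (\<integral>\<^sup>+q. ennreal (w q) * F (S q) \<partial>cg2)"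
    and w: "\<And>q. 0 \<le> w q" and [measurable]: "f \<in> borel_measurable (borel \<Otimes>\<^sub>M borel)"
  shows "(\<integral>q. f (T q) \<partial>cg2) = (\<integral>q. w q * f (S q) \<partial>cg2 :: real)"
    and "integrable cg2 (\<lambda>q. f (T q)) \<longleftrightarrow> integrable cg2 (\<lambda>q. w q * f (S q) :: real)"
proof -
  have d: "distr cg2 (borel \<Otimes>\<^sub>M borel) T = distr (density cg2 w) (borel \<Otimes>\<^sub>M borel) S"
  proof (rule measure_eqI)
    fix A assume "A \<in> sets (distr cg2 (borel \<Otimes>\<^sub>M borel) T)"
    then have [measurable]: "A \<in> sets (borel \<Otimes>\<^sub>M borel)" by simp
    have "emeasure (distr cg2 (borel \<Otimes>\<^sub>M borel) T) A = (\<integral>\<^sup>+q. indicator A (T q) \<partial>cg2)"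
      by (subst nn_integral_indicator[symmetric], simp, subst nn_integral_distr) auto
    also have "\<dots> = (\<integral>\<^sup>+q. ennreal (w q) * indicator A (S q) \<partial>cg2)"
      by (rule eq) measurable
    also have "\<dots> = emeasure (distr (density cg2 w) (borel \<Otimes>\<^sub>M borel) S) A"
      by (subst nn_integral_indicator[symmetric], simp, subst nn_integral_distr) (auto simp: nn_integral_density)
    finally show "emeasure (distr cg2 (borel \<Otimes>\<^sub>M borel) T) A = emeasure (distr (density cg2 w) (borel \<Otimes>\<^sub>M borel) S) A" .
  qed simp
  have "(\<integral>q. f (T q) \<partial>cg2) = (\<integral>q. f q \<partial>distr cg2 (borel \<Otimes>\<^sub>M borel) T)"
    by (rule integral_distr[symmetric]) measurable
  also have "\<dots> = (\<integral>q. f (S q) \<partial>density cg2 w)"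
    unfolding d by (rule integral_distr) measurable
  also have "\<dots> = (\<integral>q. w q *\<^sub>R f (S q) \<partial>cg2)"
    by (rule integral_density) (use w in auto)
  finally show "(\<integral>q. f (T q) \<partial>cg2) = (\<integral>q. w q * f (S q) \<partial>cg2)" by simp
  have "integrable cg2 (\<lambda>q. f (T q)) \<longleftrightarrow> integrable (distr cg2 (borel \<Otimes>\<^sub>M borel) T) f"
    by (rule integrable_distr_eq[symmetric]) measurable
  also have "\<dots> \<longleftrightarrow> integrable (density cg2 w) (\<lambda>q. f (S q))"
    unfolding d by (rule integrable_distr_eq) measurable
  also have "\<dots> \<longleftrightarrow> integrable cg2 (\<lambda>q. w q *\<^sub>R f (S q))"
    by (rule integrable_density) (use w in auto)
  finally show "integrable cg2 (\<lambda>q. f (T q)) \<longleftrightarrow> integrable cg2 (\<lambda>q. w q * f (S q))" by simp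
qed

lemma cg2_invariant:
  fixes f :: "complex \<times> complex \<Rightarrow> real"
  assumes "T \<in> borel \<Otimes>\<^sub>M borel \<rightarrow>\<^sub>M borel \<Otimes>\<^sub>M borel"
    and "\<And>F. F \<in> borel_measurable (borel \<Otimes>\<^sub>M borel) \<Longrightarrow> (\<integral>\<^sup>+q. F (T q) \<partial>cg2) = (\<integral>\<^sup>+q. F q \<partial>cg2)"
    and "f \<in> borel_measurable (borel \<Otimes>\<^sub>M borel)"
  shows "(\<integral>q. f (T q) \<partial>cg2) = (\<integral>q. f q \<partial>cg2)"
    and "integrable cg2 (\<lambda>q. f (T q)) \<longleftrightarrow> integrable cg2 f"
  using cg2_distr_eq[of T "\<lambda>q. q" "\<lambda>_. 1" f] assms by auto

lemma cg2_rotate: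
  fixes f :: "complex \<times> complex \<Rightarrow> real"
  assumes a: "cmod a = 1" and b: "cmod b = 1" and [measurable]: "f \<in> borel_measurable (borel \<Otimes>\<^sub>M borel)"
  shows "(\<integral>q. f (a * fst q, b * snd q) \<partial>cg2) = (\<integral>q. f q \<partial>cg2)"
    and "integrable cg2 (\<lambda>q. f (a * fst q, b * snd q)) \<longleftrightarrow> integrable cg2 f"
proof -
  have inv: "(\<integral>\<^sup>+q. F (a * fst q, b * snd q) \<partial>cg2) = (\<integral>\<^sup>+q. F q \<partial>cg2)"
    if [measurable]: "F \<in> borel_measurable (borel \<Otimes>\<^sub>M borel)" for F
  proof -
    have "(\<integral>\<^sup>+q. F (a * fst q, b * snd q) \<partial>cg2) = (\<integral>\<^sup>+g. \<integral>\<^sup>+h. F (a * g, b * h) \<partial>cg \<partial>cg)"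
      by (subst nn_integral_cg2_iter) auto
    also have "\<dots> = (\<integral>\<^sup>+g. \<integral>\<^sup>+h. F (a * g, h) \<partial>cg \<partial>cg)"
      by (intro nn_integral_cong cg_rotate[OF _ b]) measurable
    also have "\<dots> = (\<integral>\<^sup>+g. \<integral>\<^sup>+h. F (g, h) \<partial>cg \<partial>cg)"
      by (rule cg_rotate[where f = "\<lambda>g. \<integral>\<^sup>+h. F (g, h) \<partial>cg", OF _ a]) measurable
    also have "\<dots> = (\<integral>\<^sup>+q. F q \<partial>cg2)" by (subst nn_integral_cg2_iter) auto
    finally show ?thesis .
  qed
  show "(\<integral>q. f (a * fst q, b * snd q) \<partial>cg2) = (\<integral>q. f q \<partial>cg2)"
    "integrable cg2 (\<lambda>q. f (a * fst q, b * snd q)) \<longleftrightarrow> integrable cg2 f"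
    using cg2_invariant[of "\<lambda>q. (a * fst q, b * snd q)" f] inv by auto
qed

lemma cg2_cnj:
  fixes f :: "complex \<times> complex \<Rightarrow> real"
  assumes [measurable]: "f \<in> borel_measurable (borel \<Otimes>\<^sub>M borel)"
  shows "(\<integral>q. f (cnj (fst q), cnj (snd q)) \<partial>cg2) = (\<integral>q. f q \<partial>cg2)"
proof -
  have inv: "(\<integral>\<^sup>+q. F (cnj (fst q), cnj (snd q)) \<partial>cg2) = (\<integral>\<^sup>+q. F q \<partial>cg2)"
    if [measurable]: "F \<in> borel_measurable (borel \<Otimes>\<^sub>M borel)" for F
  proof -
    have "(\<integral>\<^sup>+q. F (cnj (fst q), cnj (snd q)) \<partial>cg2) = (\<integral>\<^sup>+g. \<integral>\<^sup>+h. F (cnj g, cnj h) \<partial>cg \<partial>cg)"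
      by (subst nn_integral_cg2_iter) auto
    also have "\<dots> = (\<integral>\<^sup>+g. \<integral>\<^sup>+h. F (cnj g, h) \<partial>cg \<partial>cg)"
      by (intro nn_integral_cong cg_cnj) measurable
    also have "\<dots> = (\<integral>\<^sup>+g. \<integral>\<^sup>+h. F (g, h) \<partial>cg \<partial>cg)"
      by (rule cg_cnj[where f = "\<lambda>g. \<integral>\<^sup>+h. F (g, h) \<partial>cg"]) measurable
    also have "\<dots> = (\<integral>\<^sup>+q. F q \<partial>cg2)" by (subst nn_integral_cg2_iter) auto
    finally show ?thesis .
  qed
  show ?thesis
    using cg2_invariant[of "\<lambda>q. (cnj (fst q), cnj (snd q))" f] inv by auto
qed

lemma cg2_swap:
  fixes f :: "complex \<times> complex \<Rightarrow> real"
  assumes [measurable]: "f \<in> borel_measurable (borel \<Otimes>\<^sub>M borel)"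
  shows "(\<integral>q. f (snd q, fst q) \<partial>cg2) = (\<integral>q. f q \<partial>cg2)"
    and "integrable cg2 (\<lambda>q. f (snd q, fst q)) \<longleftrightarrow> integrable cg2 f"
proof -
  have inv: "(\<integral>\<^sup>+q. F (snd q, fst q) \<partial>cg2) = (\<integral>\<^sup>+q. F q \<partial>cg2)"
    if [measurable]: "F \<in> borel_measurable (borel \<Otimes>\<^sub>M borel)" for F
  proof -
    have "(\<integral>\<^sup>+q. F (snd q, fst q) \<partial>cg2) = (\<integral>\<^sup>+g. \<integral>\<^sup>+h. F (h, g) \<partial>cg \<partial>cg)"
      by (subst nn_integral_cg2_iter) auto
    also have "\<dots> = (\<integral>\<^sup>+h. \<integral>\<^sup>+g. F (h, g) \<partial>cg \<partial>cg)"
      by (rule cgpair.Fubini') measurable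
    also have "\<dots> = (\<integral>\<^sup>+q. F q \<partial>cg2)" by (subst nn_integral_cg2_iter) auto
    finally show ?thesis .
  qed
  show "(\<integral>q. f (snd q, fst q) \<partial>cg2) = (\<integral>q. f q \<partial>cg2)"
    "integrable cg2 (\<lambda>q. f (snd q, fst q)) \<longleftrightarrow> integrable cg2 f"
    using cg2_invariant[of "\<lambda>q. (snd q, fst q)" f] inv by auto
qed

text \<open>The joint density of two Gaussians with real correlation \<open>c\<close> is, after
  dividing both by \<open>s\<close>, the product density times
  \<open>s\<^sup>2 * exp (2 * c * Re (cnj g * p))\<close>. In this form it is symmetric in the two
  variables, which the symmetrization needs.\<close>

lemma cg_tilt:
  fixes F :: "complex \<Rightarrow> complex \<Rightarrow> ennreal"
  assumes [measurable]: "case_prod F \<in> borel_measurable (borel \<Otimes>\<^sub>M borel)"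
    and s: "0 < s" "c\<^sup>2 + s\<^sup>2 = 1"
  shows "(\<integral>\<^sup>+g. \<integral>\<^sup>+h. F g (of_real c * g + of_real s * h) \<partial>cg \<partial>cg)
    = (\<integral>\<^sup>+g. \<integral>\<^sup>+p. ennreal (s\<^sup>2 * exp (2 * c * Re (cnj g * p))) * F (of_real s * g) (of_real s * p) \<partial>cg \<partial>cg)"
proof -
  define G where "G z = (\<integral>\<^sup>+p. ennreal (cdens z * cdens p) * F z (of_real c * z + of_real s * p) \<partial>lborel)" for z
  have [measurable]: "G \<in> borel_measurable borel" unfolding G_def by measurable
  have D: "cdens g * cdens (p + of_real c * g) * (s\<^sup>2 * exp (2 * c * Re (cnj g * (p + of_real c * g))))
     = s\<^sup>2 * (cdens (of_real s * g) * cdens p)" for g p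
  proof -
    have c2: "c\<^sup>2 = 1 - s\<^sup>2" using s by simp
    have "- (cmod g)\<^sup>2 - (cmod (p + of_real c * g))\<^sup>2 + 2 * c * Re (cnj g * (p + of_real c * g))
       = - (cmod (of_real s * g))\<^sup>2 - (cmod p)\<^sup>2"
    proof -
      have "- (cmod g)\<^sup>2 - (cmod (p + of_real c * g))\<^sup>2 + 2 * c * Re (cnj g * (p + of_real c * g))
         = - (cmod p)\<^sup>2 - (1 - c\<^sup>2) * (cmod g)\<^sup>2"
        by (simp add: cmod_power2) (simp add: power2_eq_square algebra_simps)
      also have "\<dots> = - (cmod (of_real s * g))\<^sup>2 - (cmod p)\<^sup>2"
        by (simp add: c2 norm_mult power_mult_distrib)
      finally show ?thesis .
    qed
    then have "exp (- (cmod g)\<^sup>2) * exp (- (cmod (p + of_real c * g))\<^sup>2) * exp (2 * c * Re (cnj g * (p + of_real c * g)))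
       = exp (- (cmod (of_real s * g))\<^sup>2) * exp (- (cmod p)\<^sup>2)"
      unfolding exp_add[symmetric] by (simp add: algebra_simps)
    then show ?thesis unfolding cdens_def by (simp add: field_simps)
  qed
  have "(\<integral>\<^sup>+g. \<integral>\<^sup>+p. ennreal (s\<^sup>2 * exp (2 * c * Re (cnj g * p))) * F (of_real s * g) (of_real s * p) \<partial>cg \<partial>cg)
    = (\<integral>\<^sup>+g. \<integral>\<^sup>+p. ennreal (cdens g * cdens p) * (ennreal (s\<^sup>2 * exp (2 * c * Re (cnj g * p))) * F (of_real s * g) (of_real s * p)) \<partial>lborel \<partial>lborel)"
    by (rule nn_integral_cg2) measurable
  also have "\<dots> = (\<integral>\<^sup>+g. \<integral>\<^sup>+p. ennreal (cdens g * cdens p * (s\<^sup>2 * exp (2 * c * Re (cnj g * p)))) * F (of_real s * g) (of_real s * p) \<partial>lborel \<partial>lborel)"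
    by (simp add: ennreal_mult' mult.assoc)
  also have "\<dots> = (\<integral>\<^sup>+g. \<integral>\<^sup>+p. ennreal (cdens g * cdens (p + of_real c * g) * (s\<^sup>2 * exp (2 * c * Re (cnj g * (p + of_real c * g)))))
       * F (of_real s * g) (of_real s * (p + of_real c * g)) \<partial>lborel \<partial>lborel)"
    by (rule shear_snd[symmetric, where F = "\<lambda>g p. ennreal (cdens g * cdens p * (s\<^sup>2 * exp (2 * c * Re (cnj g * p)))) * F (of_real s * g) (of_real s * p)"]) measurable
  also have "\<dots> = (\<integral>\<^sup>+g. \<integral>\<^sup>+p. ennreal (s\<^sup>2) * (ennreal (cdens (of_real s * g) * cdens p) * F (of_real s * g) (of_real c * (of_real s * g) + of_real s * p)) \<partial>lborel \<partial>lborel)"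
    unfolding D by (simp add: ennreal_mult' algebra_simps)
  also have "\<dots> = ennreal (s\<^sup>2) * (\<integral>\<^sup>+g. G (of_real s * g) \<partial>lborel)"
    unfolding G_def by (simp add: nn_integral_cmult)
  also have "\<dots> = (\<integral>\<^sup>+z. G z \<partial>lborel)"
    by (rule nn_integral_lborel_scale[symmetric]) (use s in auto)
  also have "\<dots> = (\<integral>\<^sup>+g. \<integral>\<^sup>+h. F g (of_real c * g + of_real s * h) \<partial>cg \<partial>cg)"
    unfolding G_def by (rule nn_integral_cg2[symmetric]) measurable
  finally show ?thesis ..
qed

lemma cg2_tilt:
  fixes f :: "complex \<times> complex \<Rightarrow> real"
  assumes [measurable]: "f \<in> borel_measurable (borel \<Otimes>\<^sub>M borel)"
    and s: "0 < s" "c\<^sup>2 + s\<^sup>2 = 1"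
  defines "T \<equiv> \<lambda>q. (fst q, of_real c * fst q + of_real s * snd q)"
    and "R \<equiv> \<lambda>q. s\<^sup>2 * exp (2 * c * Re (cnj (fst q) * snd q)) * f (of_real s * fst q, of_real s * snd q)"
  shows "(\<integral>q. f (T q) \<partial>cg2) = (\<integral>q. R q \<partial>cg2)"
    and "integrable cg2 (\<lambda>q. f (T q)) \<longleftrightarrow> integrable cg2 R"
proof -
  define w where "w = (\<lambda>q :: complex \<times> complex. s\<^sup>2 * exp (2 * c * Re (cnj (fst q) * snd q)))"
  define S where "S = (\<lambda>q :: complex \<times> complex. (complex_of_real s * fst q, complex_of_real s * snd q))"
  have m [measurable]: "w \<in> borel_measurable (borel \<Otimes>\<^sub>M borel)" "S \<in> borel \<Otimes>\<^sub>M borel \<rightarrow>\<^sub>M borel \<Otimes>\<^sub>M borel"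
    "T \<in> borel \<Otimes>\<^sub>M borel \<rightarrow>\<^sub>M borel \<Otimes>\<^sub>M borel"
    unfolding w_def S_def T_def by measurable
  have eq: "(\<integral>\<^sup>+q. F (T q) \<partial>cg2) = (\<integral>\<^sup>+q. ennreal (w q) * F (S q) \<partial>cg2)"
    if [measurable]: "F \<in> borel_measurable (borel \<Otimes>\<^sub>M borel)" for F
    using cg_tilt[of "\<lambda>u p. F (u, p)" s c] s
    by (subst (1 2) nn_integral_cg2_iter) (auto simp: w_def S_def T_def)
  show "(\<integral>q. f (T q) \<partial>cg2) = (\<integral>q. R q \<partial>cg2)"
    "integrable cg2 (\<lambda>q. f (T q)) \<longleftrightarrow> integrable cg2 R"
    using cg2_distr_eq[OF m(3) m(2) m(1) eq _ assms(1)] unfolding R_def w_def S_def by auto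
qed

lemma cg_box_pos: "box l u \<noteq> {} \<Longrightarrow> 0 < emeasure cg (box l u)" for l u :: complex
proof (rule ccontr)
  assume ne: "box l u \<noteq> {}" and "\<not> 0 < emeasure cg (box l u)"
  then have "emeasure cg (box l u) = 0" by (simp add: zero_less_iff_neq_zero)
  then have "(\<integral>\<^sup>+z. ennreal (cdens z) * indicator (box l u) z \<partial>lborel) = 0"
    unfolding complex_gaussian_density by (simp add: emeasure_density)
  then have "AE z in lborel. ennreal (cdens z) * indicator (box l u) z = 0"
    by (subst (asm) nn_integral_0_iff_AE) auto
  then have "AE z in lborel. z \<notin> box l u"
    by eventually_elim (auto simp: cdens_def indicator_def split: if_splits)
  then have "emeasure lborel (box l u) = 0"
    by (subst (asm) AE_iff_measurable[OF _ refl]) auto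
  moreover have lu: "\<And>b. b \<in> Basis \<Longrightarrow> real_inner_class.inner l b < real_inner_class.inner u b"
    using ne by (auto simp: box_ne_empty)
  moreover from lu have "0 < (\<Prod>b\<in>Basis. real_inner_class.inner (u - l) b)"
    by (intro prod_pos) (auto simp: inner_diff_left)
  ultimately have "\<exists>a\<in>Basis. real_inner_class.inner (u - l) a = 0"
    by (auto simp: emeasure_lborel_box_eq less_imp_le inner_diff_left)
  then obtain a where "a \<in> Basis" "real_inner_class.inner (u - l) a = 0" by blast
  then show False using lu[of a] by (simp add: inner_diff_left)
qed

lemma cg2_moments:
  "integrable cg2 (\<lambda>q. (cmod (fst q))\<^sup>2)" "(\<integral>q. (cmod (fst q))\<^sup>2 \<partial>cg2) = 1"
  "integrable cg2 (\<lambda>q. (cmod (snd q))\<^sup>2)" "(\<integral>q. (cmod (snd q))\<^sup>2 \<partial>cg2) = 1"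
proof -
  have m [measurable]: "(\<lambda>q. (cmod (fst q))\<^sup>2) \<in> borel_measurable (borel \<Otimes>\<^sub>M (borel :: complex measure))" by measurable
  have nn: "(\<integral>\<^sup>+q. ennreal ((cmod (fst q))\<^sup>2) \<partial>cg2) = 1"
    by (subst nn_integral_cg2_iter) (auto simp: cg_second_moment cg.emeasure_space_1[simplified])
  show 1: "integrable cg2 (\<lambda>q. (cmod (fst q))\<^sup>2)"
    by (rule integrableI_nonneg) (auto simp: nn)
  show 2: "(\<integral>q. (cmod (fst q))\<^sup>2 \<partial>cg2) = 1"
    by (subst integral_eq_nn_integral) (auto simp: nn)
  show "integrable cg2 (\<lambda>q. (cmod (snd q))\<^sup>2)" "(\<integral>q. (cmod (snd q))\<^sup>2 \<partial>cg2) = 1"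
    using cg2_swap[OF m] 1 2 by auto
qed

lemma AE_cg2_nonzero: "AE q in cg2. fst q \<noteq> 0 \<and> snd q \<noteq> 0"
proof -
  have "AE z in cg. z \<noteq> 0"
    unfolding complex_gaussian_density by (subst AE_density) (auto intro!: AE_I'[of "{0}"])
  moreover have "{q \<in> space cg2. fst q \<noteq> 0 \<and> snd q \<noteq> 0} \<in> sets cg2" by measurable
  ultimately show ?thesis by (intro cgpair.AE_pair_measure) auto
qed

text \<open>The comparison constant below is the mean of the nonnegative function obtained by symmetrizing
  in \<open>g \<mapsto> -g\<close> and in \<open>g \<leftrightarrow> p\<close>; that it is finite follows from the comparison itself.\<close>

definition sym_weight :: "complex \<times> complex \<Rightarrow> real" where
  "sym_weight q = cmod (fst q) / cmod (snd q) + cmod (snd q) / cmod (fst q) - 2"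

lemma sym_weight_nonneg: "fst q \<noteq> 0 \<Longrightarrow> snd q \<noteq> 0 \<Longrightarrow> 0 \<le> sym_weight q"
proof -
  assume "fst q \<noteq> 0" "snd q \<noteq> 0"
  then have "sym_weight q = (cmod (fst q) - cmod (snd q))\<^sup>2 / (cmod (fst q) * cmod (snd q))"
    by (simp add: sym_weight_def power2_eq_square field_simps)
  then show ?thesis by simp
qed

definition corr :: "complex \<times> complex \<Rightarrow> real" where
  "corr q = Re (cnj (fst q) * snd q)"

lemma corr_measurable [measurable]: "corr \<in> borel_measurable (borel \<Otimes>\<^sub>M borel)"
  and sym_weight_measurable [measurable]: "sym_weight \<in> borel_measurable (borel \<Otimes>\<^sub>M borel)"
  unfolding corr_def[abs_def] sym_weight_def[abs_def] by measurable

lemma sinh_ge_self: "0 \<le> y \<Longrightarrow> y \<le> (exp y - exp (- y)) / 2" for y :: real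
proof -
  assume y: "0 \<le> y"
  have "(\<lambda>x. exp x - exp (- x) - 2 * x) 0 \<le> (\<lambda>x. exp x - exp (- x) - 2 * x) y"
  proof (rule DERIV_nonneg_imp_nondecreasing[OF y])
    fix x :: real
    have "((\<lambda>x. exp x - exp (- x) - 2 * x) has_real_derivative exp x + exp (- x) - 2) (at x)"
      by (auto intro!: derivative_eq_intros)
    moreover have "0 \<le> (exp (x/2) - exp (- (x/2)))\<^sup>2" by simp
    then have "0 \<le> exp x + exp (- x) - 2"
      by (simp add: power2_eq_square algebra_simps exp_add[symmetric])
    ultimately show "\<exists>z. ((\<lambda>x. exp x - exp (- x) - 2 * x) has_real_derivative z) (at x) \<and> 0 \<le> z" by blast
  qed
  then show ?thesis by simp
qed

text \<open>Both sides are even in \<open>y\<close>, and \<open>sinh z \<ge> z\<close> for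
  \<open>z \<ge> 0\<close>. A lower bound linear in \<open>c\<close> is what makes the gain
  proportional to the correlation.\<close>

lemma mul_sinh_ge: "c * y\<^sup>2 * 2 \<le> y * ((exp (2 * c * y) - exp (- (2 * c * y))) / 2)" if "0 \<le> c" for y c :: real
proof -
  have *: "c * y\<^sup>2 * 2 \<le> y * ((exp (2 * c * y) - exp (- (2 * c * y))) / 2)" if "0 \<le> y" for y :: real
    using mult_left_mono[OF sinh_ge_self[of "2 * c * y"] that] that \<open>0 \<le> c\<close> by (simp add: power2_eq_square algebra_simps)
  show ?thesis
  proof (cases "0 \<le> y")
    case False
    then show ?thesis using *[of "- y"] by (simp add: algebra_simps)
  qed (rule *)
qed

lemma integral_even_part:
  fixes f :: "complex \<times> complex \<Rightarrow> real"
  assumes [measurable]: "f \<in> borel_measurable (borel \<Otimes>\<^sub>M borel)" and "integrable cg2 f"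
  shows "(\<integral>q. f q \<partial>cg2) = (\<integral>q. (f q + f (- fst q, snd q)) / 2 \<partial>cg2)"
    and "integrable cg2 (\<lambda>q. (f q + f (- fst q, snd q)) / 2)"
  using cg2_rotate[of "-1" 1 f] assms by auto

lemma corr_integrable: "integrable cg2 corr"
proof (rule Bochner_Integration.integrable_bound)
  show "integrable cg2 (\<lambda>q. (cmod (fst q))\<^sup>2 + (cmod (snd q))\<^sup>2)" using cg2_moments by auto
  have "\<bar>corr q\<bar> \<le> (cmod (fst q))\<^sup>2 + (cmod (snd q))\<^sup>2" for q
  proof -
    have "\<bar>corr q\<bar> \<le> cmod (fst q) * cmod (snd q)"
      unfolding corr_def using abs_Re_le_cmod[of "cnj (fst q) * snd q"] by (simp add: norm_mult)
    also have "\<dots> \<le> (cmod (fst q))\<^sup>2 + (cmod (snd q))\<^sup>2"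
      using zero_le_power2[of "cmod (fst q) - cmod (snd q)"] zero_le_power2[of "cmod (fst q)"] zero_le_power2[of "cmod (snd q)"]
      unfolding power2_diff by linarith
    finally show ?thesis .
  qed
  then show "AE q in cg2. norm (corr q) \<le> norm ((cmod (fst q))\<^sup>2 + (cmod (snd q))\<^sup>2)" by auto
qed measurable

lemma corr_mean: "(\<integral>q. corr q \<partial>cg2) = 0"
proof -
  have "(\<integral>q. corr q \<partial>cg2) = (\<integral>q. (corr q + corr (- fst q, snd q)) / 2 \<partial>cg2)"
    by (rule integral_even_part) (use corr_integrable in auto)
  also have "\<dots> = 0" by (simp add: corr_def)
  finally show ?thesis .
qed

text \<open>The linear and the phase functional are both odd in the first variable, so symmetrizing
  the tilted integral leaves the same \<open>H\<close>, with an extra factor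
  \<open>|g| / |p|\<close> for the phase. The linear functional has mean \<open>c\<close>, which
  calibrates \<open>H\<close>. The factor \<open>s ^ 4\<close> is the tilt weight
  \<open>s\<^sup>2\<close> times the quadratic scaling \<open>s\<^sup>2\<close>.\<close>

lemma correlated_identities:
  assumes c: "0 \<le> c" and s: "0 < s" "c\<^sup>2 + s\<^sup>2 = 1"
  defines "H \<equiv> \<lambda>q. corr q * ((exp (2 * c * corr q) - exp (- (2 * c * corr q))) / 2)"
  shows "integrable cg2 H" "c = s ^ 4 * (\<integral>q. H q \<partial>cg2)"
    "integrable cg2 (\<lambda>q. cmod (fst q) / cmod (snd q) * H q)"
    "(\<integral>q. cmod (fst q) * Re (cnj (fst q) * phase (of_real c * fst q + of_real s * snd q)) \<partial>cg2)
       = s ^ 4 * (\<integral>q. cmod (fst q) / cmod (snd q) * H q \<partial>cg2)"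
proof -
  define f1 where "f1 = (\<lambda>q. corr q)"
  define f2 where "f2 = (\<lambda>q. cmod (fst q) * Re (cnj (fst q) * phase (snd q)))"
  have [measurable]: "f1 \<in> borel_measurable (borel \<Otimes>\<^sub>M borel)" "f2 \<in> borel_measurable (borel \<Otimes>\<^sub>M borel)"
    unfolding f1_def f2_def by measurable
  define T where "T q = (fst q, of_real c * fst q + of_real s * snd q)" for q :: "complex \<times> complex"
  have [measurable]: "T \<in> borel \<Otimes>\<^sub>M borel \<rightarrow>\<^sub>M borel \<Otimes>\<^sub>M borel" unfolding T_def by measurable
  have s0: "s \<noteq> 0" using s by simp
  have f1T: "f1 (T q) = c * (cmod (fst q))\<^sup>2 + s * corr q" for q
    unfolding f1_def T_def corr_def cmod_power2 by (simp add: power2_eq_square algebra_simps)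
  have i1: "integrable cg2 (\<lambda>q. f1 (T q))" "(\<integral>q. f1 (T q) \<partial>cg2) = c"
    unfolding f1T using cg2_moments corr_integrable corr_mean by auto
  have i2: "integrable cg2 (\<lambda>q. f2 (T q))"
  proof (rule Bochner_Integration.integrable_bound[OF cg2_moments(1)])
    have "\<bar>f2 (T q)\<bar> \<le> (cmod (fst q))\<^sup>2" for q
    proof -
      have "\<bar>Re (cnj (fst q) * phase (snd (T q)))\<bar> \<le> cmod (fst q)"
        using abs_Re_le_cmod[of "cnj (fst q) * phase (snd (T q))"] by (simp add: norm_mult)
      then have "cmod (fst q) * \<bar>Re (cnj (fst q) * phase (snd (T q)))\<bar> \<le> cmod (fst q) * cmod (fst q)"
        by (intro mult_left_mono) auto
      then show ?thesis by (simp add: f2_def T_def abs_mult power2_eq_square)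
    qed
    then show "AE q in cg2. norm (f2 (T q)) \<le> norm ((cmod (fst q))\<^sup>2)" by auto
  qed measurable
  define R where "R f q = s\<^sup>2 * exp (2 * c * corr q) * f (of_real s * fst q, of_real s * snd q)"
    for f :: "complex \<times> complex \<Rightarrow> real" and q
  have Rm [measurable]: "R f1 \<in> borel_measurable (borel \<Otimes>\<^sub>M borel)" "R f2 \<in> borel_measurable (borel \<Otimes>\<^sub>M borel)"
    unfolding R_def[abs_def] by measurable
  have tilt: "(\<integral>q. f (T q) \<partial>cg2) = (\<integral>q. R f q \<partial>cg2)" "integrable cg2 (\<lambda>q. f (T q)) \<longleftrightarrow> integrable cg2 (R f)"
    if "f \<in> borel_measurable (borel \<Otimes>\<^sub>M borel)" for f
    using cg2_tilt[OF that s] unfolding T_def R_def[abs_def] corr_def by auto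
  have e1: "(R f1 q + R f1 (- fst q, snd q)) / 2 = s ^ 4 * H q" for q
  proof -
    have "f1 (of_real s * fst q, of_real s * snd q) = s\<^sup>2 * corr q"
      "f1 (- (of_real s * fst q), of_real s * snd q) = - (s\<^sup>2 * corr q)"
      "corr (- fst q, snd q) = - corr q"
      by (simp_all add: f1_def corr_def power2_eq_square algebra_simps)
    then show ?thesis
      by (simp add: R_def H_def) (simp add: power2_eq_square power4_eq_xxxx field_simps)
  qed
  have e2: "(R f2 q + R f2 (- fst q, snd q)) / 2 = s ^ 4 * (cmod (fst q) / cmod (snd q) * H q)" if "snd q \<noteq> 0" for q
  proof -
    have ph: "phase (of_real s * snd q) = snd q / of_real (cmod (snd q))"
      using that s by (simp add: phase_def norm_mult)
    have r1: "f2 (of_real s * fst q, of_real s * snd q) = s\<^sup>2 * (cmod (fst q) / cmod (snd q) * corr q)"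
      unfolding f2_def fst_conv snd_conv ph using s by (simp add: norm_mult corr_def power2_eq_square field_simps)
    have r2: "f2 (- (of_real s * fst q), of_real s * snd q) = - (s\<^sup>2 * (cmod (fst q) / cmod (snd q) * corr q))"
      unfolding f2_def fst_conv snd_conv ph using s by (simp add: norm_mult corr_def power2_eq_square field_simps)
    have r3: "corr (- fst q, snd q) = - corr q" by (simp add: corr_def)
    show ?thesis
      using that by (simp add: R_def H_def r1 r2 r3) (simp add: power2_eq_square power4_eq_xxxx field_simps)
  qed
  have intR1: "integrable cg2 (R f1)" using i1(1) tilt(2)[of f1] by auto
  have intR2: "integrable cg2 (R f2)" using i2 tilt(2)[of f2] by auto
  have Hm [measurable]: "H \<in> borel_measurable (borel \<Otimes>\<^sub>M borel)" unfolding H_def by measurable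
  have s4: "s ^ 4 \<noteq> 0" using s by simp
  have "integrable cg2 (\<lambda>q. s ^ 4 * H q)" using integral_even_part(2)[OF Rm(1) intR1] unfolding e1 .
  then show "integrable cg2 H" using s4 by simp
  have "c = (\<integral>q. R f1 q \<partial>cg2)" using i1(2) tilt(1)[of f1] by simp
  also have "\<dots> = (\<integral>q. s ^ 4 * H q \<partial>cg2)" using integral_even_part(1)[OF Rm(1) intR1] unfolding e1 .
  finally show "c = s ^ 4 * (\<integral>q. H q \<partial>cg2)" by simp
  have ae: "AE q in cg2. (R f2 q + R f2 (- fst q, snd q)) / 2 = s ^ 4 * (cmod (fst q) / cmod (snd q) * H q)"
    using AE_cg2_nonzero by eventually_elim (use e2 in auto)
  have "integrable cg2 (\<lambda>q. (R f2 q + R f2 (- fst q, snd q)) / 2) \<longleftrightarrow> integrable cg2 (\<lambda>q. s ^ 4 * (cmod (fst q) / cmod (snd q) * H q))"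
    by (rule integrable_cong_AE) (use ae in measurable)
  then have "integrable cg2 (\<lambda>q. s ^ 4 * (cmod (fst q) / cmod (snd q) * H q))"
    using integral_even_part(2)[OF Rm(2) intR2] by blast
  then show "integrable cg2 (\<lambda>q. cmod (fst q) / cmod (snd q) * H q)" 
    unfolding integrable_mult_left_iff using s4 by blast
  have "(\<integral>q. f2 (T q) \<partial>cg2) = (\<integral>q. R f2 q \<partial>cg2)" using tilt(1)[of f2] by simp
  also have "\<dots> = (\<integral>q. (R f2 q + R f2 (- fst q, snd q)) / 2 \<partial>cg2)" by (rule integral_even_part(1)[OF Rm(2) intR2])
  also have "\<dots> = (\<integral>q. s ^ 4 * (cmod (fst q) / cmod (snd q) * H q) \<partial>cg2)"
    by (rule integral_cong_AE) (use ae in measurable)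
  also have "\<dots> = s ^ 4 * (\<integral>q. cmod (fst q) / cmod (snd q) * H q \<partial>cg2)" by (rule integral_mult_right_zero)
  finally show "(\<integral>q. cmod (fst q) * Re (cnj (fst q) * phase (of_real c * fst q + of_real s * snd q)) \<partial>cg2)
       = s ^ 4 * (\<integral>q. cmod (fst q) / cmod (snd q) * H q \<partial>cg2)"
    by (simp add: f2_def T_def)
qed

definition gain :: real where "gain = (\<integral>q. sym_weight q * (corr q)\<^sup>2 \<partial>cg2)"

text \<open>\<open>H\<close> is invariant under exchange of the variables, so
  \<open>|g| / |p|\<close> may be averaged with its reciprocal. The average is 1 plus half of
  \<open>sym_weight\<close>: the 1 reproduces \<open>c\<close>, and the nonnegative excess yields
  the gain through \<open>mul_sinh_ge\<close>.\<close>

lemma mean_phase_aligned: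
  assumes c: "0 \<le> c" and s: "0 < s" "c\<^sup>2 + s\<^sup>2 = 1"
  shows "c * (1 + gain * s ^ 4) \<le>
    (\<integral>q. cmod (fst q) * Re (cnj (fst q) * phase (of_real c * fst q + of_real s * snd q)) \<partial>cg2)" (is "_ \<le> ?P")
    and "0 < c \<Longrightarrow> integrable cg2 (\<lambda>q. sym_weight q * (corr q)\<^sup>2)"
proof -
  define H where "H = (\<lambda>q. corr q * ((exp (2 * c * corr q) - exp (- (2 * c * corr q))) / 2))"
  have Hm [measurable]: "H \<in> borel_measurable (borel \<Otimes>\<^sub>M borel)" unfolding H_def by measurable
  let ?F = "\<lambda>q. cmod (fst q) / cmod (snd q) * H q"
  have id: "integrable cg2 H" "c = s ^ 4 * (\<integral>q. H q \<partial>cg2)" "integrable cg2 ?F"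
    "?P = s ^ 4 * (\<integral>q. ?F q \<partial>cg2)"
    unfolding H_def by (rule correlated_identities[OF c s])+
  let ?G = "\<lambda>q. cmod (snd q) / cmod (fst q) * H q"
  have Hs: "H (snd q, fst q) = H q" for q by (simp add: H_def corr_def algebra_simps)
  have Fm: "?F \<in> borel_measurable (borel \<Otimes>\<^sub>M borel)" by measurable
  have sw: "(\<integral>q. ?G q \<partial>cg2) = (\<integral>q. ?F q \<partial>cg2)" "integrable cg2 ?G"
    using cg2_swap[OF Fm] id(3) by (simp_all add: Hs)
  have eq: "sym_weight q * H q = ?F q + ?G q - 2 * H q" for q by (simp add: sym_weight_def algebra_simps)
  have intS: "integrable cg2 (\<lambda>q. sym_weight q * H q)" unfolding eq using id sw by auto
  have I: "(\<integral>q. sym_weight q * H q \<partial>cg2) = 2 * (\<integral>q. ?F q \<partial>cg2) - 2 * (\<integral>q. H q \<partial>cg2)"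
    unfolding eq using id sw by simp
  have "?P = s ^ 4 * (\<integral>q. ?F q \<partial>cg2)" by (rule id(4))
  also have "\<dots> = s ^ 4 * (\<integral>q. H q \<partial>cg2) + s ^ 4 * ((\<integral>q. sym_weight q * H q \<partial>cg2) / 2)"
    unfolding I by (simp add: algebra_simps diff_divide_distrib)
  also have "s ^ 4 * (\<integral>q. H q \<partial>cg2) = c" by (rule id(2)[symmetric])
  finally have P: "?P = c + s ^ 4 * ((\<integral>q. sym_weight q * H q \<partial>cg2) / 2)" .
  have le: "AE q in cg2. 0 \<le> 2 * c * (sym_weight q * (corr q)\<^sup>2) \<and> 2 * c * (sym_weight q * (corr q)\<^sup>2) \<le> sym_weight q * H q"
    using AE_cg2_nonzero
  proof eventually_elim
    case (elim q)
    have w: "0 \<le> sym_weight q" using sym_weight_nonneg elim by auto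
    show ?case using mult_left_mono[OF mul_sinh_ge[OF c, of "corr q"] w] w c by (auto simp: H_def algebra_simps)
  qed
  have int2: "integrable cg2 (\<lambda>q. 2 * c * (sym_weight q * (corr q)\<^sup>2))"
    by (rule Bochner_Integration.integrable_bound[OF intS]) (use le in auto)
  have "(\<integral>q. 2 * c * (sym_weight q * (corr q)\<^sup>2) \<partial>cg2) \<le> (\<integral>q. sym_weight q * H q \<partial>cg2)"
    by (rule integral_mono_AE[OF int2 intS]) (use le in auto)
  then have "c * gain \<le> (\<integral>q. sym_weight q * H q \<partial>cg2) / 2" by (simp add: gain_def)
  then have "s ^ 4 * (c * gain) \<le> s ^ 4 * ((\<integral>q. sym_weight q * H q \<partial>cg2) / 2)"
    by (rule mult_left_mono) simp
  then show "c * (1 + gain * s ^ 4) \<le> ?P" unfolding P by (simp add: algebra_simps)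
  show "integrable cg2 (\<lambda>q. sym_weight q * (corr q)\<^sup>2)" if "0 < c"
    using int2 that unfolding integrable_mult_left_iff by auto
qed

lemma gain_pos: "0 < gain"
proof -
  let ?f = "\<lambda>q. sym_weight q * (corr q)\<^sup>2"
  \<comment> \<open>The comparison yields integrability as soon as it is run with some positive
    correlation; 3/5 and 4/5 form a convenient pair.\<close>
  have int: "integrable cg2 ?f"
    by (rule mean_phase_aligned(2)[of "3/5" "4/5"]) (auto simp: power2_eq_square)
  have nn: "AE q in cg2. 0 \<le> ?f q"
    using AE_cg2_nonzero by eventually_elim (use sym_weight_nonneg in auto)
  have "gain \<noteq> 0"
  proof
    assume "gain = 0"
    then have "AE q in cg2. ?f q = 0"
      unfolding gain_def using integral_nonneg_eq_0_iff_AE[OF int nn] by simp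
    \<comment> \<open>On this product of open boxes \<open>|g| < 1 < |p|\<close>, so the weight does
      not vanish, and all real and imaginary parts are positive, so neither does
      \<open>corr\<close>. Open boxes have positive Gaussian measure.\<close>
    let ?B = "box (Complex (1/10) 0) (Complex (1/5) (1/10))" and ?C = "box (Complex 1 0) (Complex 2 1)"
    have "AE q in cg2. q \<notin> ?B \<times> ?C"
      using \<open>AE q in cg2. ?f q = 0\<close>
    proof eventually_elim
      case (elim q)
      show ?case
      proof
        assume q: "q \<in> ?B \<times> ?C"
        obtain g p where gp: "q = (g, p)" by force
        have g: "1/10 < Re g" "Re g < 1/5" "0 < Im g" "Im g < 1/10" and p: "1 < Re p" "0 < Im p"
          using q by (auto simp: gp in_box_complex_iff)
        have "cmod g \<le> \<bar>Re g\<bar> + \<bar>Im g\<bar>" by (rule cmod_le)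
        then have g1: "cmod g < 1" using g by linarith
        have p1: "1 < cmod p" using abs_Re_le_cmod[of p] p by linarith
        have "0 < Re g * Re p + Im g * Im p" using g p by (intro add_pos_pos mult_pos_pos) linarith+
        then have "corr q \<noteq> 0" by (simp add: gp corr_def)
        moreover have "g \<noteq> 0" "p \<noteq> 0" using g p by auto
        then have "sym_weight q = (cmod g - cmod p)\<^sup>2 / (cmod g * cmod p)"
          by (simp add: gp sym_weight_def power2_eq_square field_simps)
        then have "sym_weight q \<noteq> 0" using g1 p1 \<open>g \<noteq> 0\<close> \<open>p \<noteq> 0\<close> by simp
        ultimately show False using elim by simp
      qed
    qed
    then have "emeasure cg2 (?B \<times> ?C) = 0"
      by (subst (asm) AE_iff_measurable[OF _ refl]) auto
    then have "emeasure cg ?B * emeasure cg ?C = 0"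
      by (subst (asm) cg.emeasure_pair_measure_Times) auto
    moreover have "?B \<noteq> {}" "?C \<noteq> {}" by (auto simp: box_ne_empty Basis_complex_def)
    ultimately show False using cg_box_pos[of "Complex (1/10) 0" "Complex (1/5) (1/10)"] cg_box_pos[of "Complex 1 0" "Complex 2 1"]
      by (metis less_irrefl mult_eq_0_iff)
  qed
  moreover have "0 \<le> gain" unfolding gain_def by (rule integral_nonneg_AE[OF nn])
  ultimately show ?thesis by simp
qed

lemma row_inverse_moment:
  assumes "nrm n x = 1"
  shows "(\<integral>\<^sup>+r. ennreal (1 / cmod (ip n r x)) \<partial>rowm n) \<le> 9"
  using row_law_single_unit[of "\<lambda>z. ennreal (1 / cmod z)" n x] assms cg_inverse_moment by simp

lemma AE_row_nonzero:
  assumes "nrm n x = 1"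
  shows "AE r in rowm n. ip n r x \<noteq> 0"
proof -
  have "AE z in cg. z \<noteq> 0"
    unfolding complex_gaussian_density by (subst AE_density) (auto intro!: AE_I'[of "{0}"])
  then have "(\<integral>\<^sup>+z. indicator {0} z \<partial>cg) = 0"
    by (subst nn_integral_0_iff_AE) (auto elim!: eventually_mono)
  then have "(\<integral>\<^sup>+r. indicator {0} (ip n r x) \<partial>rowm n) = 0"
    using row_law_single_unit[of "indicator {0}" n x] assms by simp
  then have "AE r in rowm n. indicator {0} (ip n r x) = (0::ennreal)"
    by (subst (asm) nn_integral_0_iff_AE) auto
  then show ?thesis by eventually_elim (auto simp: indicator_def)
qed

text \<open>Let \<open>w\<close> be the phase of the inner product. Rotating by \<open>w\<close>
  splits the mean into \<open>Re w\<close> times the aligned mean and \<open>Im w\<close> times an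
  integral that vanishes by conjugation symmetry. The sign hypothesis gives
  \<open>0 \<le> Re w\<close>, so the aligned lower bound survives the multiplication.\<close>

lemma mean_phase:
  assumes "nrm n x0 = 1" "nrm n y = 1" and pos: "0 \<le> Re (ip n x0 y)"
  shows "Re (ip n x0 y) * (1 + gain * (1 - (cmod (ip n x0 y))\<^sup>2)\<^sup>2)
    \<le> (\<integral>r. cmod (ip n r x0) * Re (cnj (ip n r x0) * phase (ip n r y)) \<partial>rowm n)"
proof -
  define \<zeta> c where "\<zeta> = ip n x0 y" and "c = cmod \<zeta>"
  define s where "s = sqrt (1 - c\<^sup>2)"
  define w where "w = (if \<zeta> = 0 then 1 else \<zeta> / of_real c)"
  have w: "cmod w = 1" "\<zeta> = w * of_real c" by (auto simp: w_def c_def norm_divide)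
  have c: "0 \<le> c" "c \<le> 1" using row_law_pair(1)[OF assms(1,2)] by (auto simp: c_def \<zeta>_def)
  have s: "0 \<le> s" "c\<^sup>2 + s\<^sup>2 = 1" using c by (auto simp: s_def power_le_one)
  have s4: "(1 - c\<^sup>2)\<^sup>2 = s ^ 4"
  proof -
    have "1 - c\<^sup>2 = s\<^sup>2" using s by simp
    then show ?thesis by (simp add: power2_eq_square power4_eq_xxxx)
  qed
  let ?f = "\<lambda>q :: complex \<times> complex. cmod (fst q) * Re (cnj (fst q) * phase (snd q))"
  let ?T = "\<lambda>q :: complex \<times> complex. of_real c * fst q + of_real s * snd q"
  let ?h = "\<lambda>v q. cmod (fst q) * Re (v * cnj (fst q) * phase (?T q))"
  have fm: "?f \<in> borel_measurable (borel \<Otimes>\<^sub>M borel)" by measurable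
  have hm [measurable]: "?h v \<in> borel_measurable (borel \<Otimes>\<^sub>M borel)" for v by measurable
  have hint: "integrable cg2 (?h v)" if v: "cmod v = 1" for v
  proof (rule Bochner_Integration.integrable_bound[OF cg2_moments(1)])
    have "\<bar>?h v q\<bar> \<le> (cmod (fst q))\<^sup>2" for q
    proof -
      have "\<bar>Re (v * cnj (fst q) * phase (?T q))\<bar> \<le> cmod (fst q)"
        using abs_Re_le_cmod[of "v * cnj (fst q) * phase (?T q)"] v by (simp add: norm_mult)
      then have "cmod (fst q) * \<bar>Re (v * cnj (fst q) * phase (?T q))\<bar> \<le> cmod (fst q) * cmod (fst q)"
        by (intro mult_left_mono) auto
      then show ?thesis by (simp add: abs_mult power2_eq_square)
    qed
    then show "AE q in cg2. norm (?h v q) \<le> norm ((cmod (fst q))\<^sup>2)" by auto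
  qed measurable
  have odd: "(\<integral>q. ?h \<i> q \<partial>cg2) = 0"
  proof -
    have ph: "phase (cnj z) = cnj (phase z)" for z by (simp add: phase_def)
    have "?h \<i> (cnj (fst q), cnj (snd q)) = - ?h \<i> q" for q
    proof -
      have "?T (cnj (fst q), cnj (snd q)) = cnj (?T q)" by simp
      then have "phase (?T (cnj (fst q), cnj (snd q))) = cnj (phase (?T q))" unfolding ph[symmetric] by (rule arg_cong)
      then show ?thesis by (simp add: algebra_simps)
    qed
    then have "(\<integral>q. ?h \<i> (cnj (fst q), cnj (snd q)) \<partial>cg2) = (\<integral>q. - ?h \<i> q \<partial>cg2)"
      by (intro Bochner_Integration.integral_cong) auto
    then show ?thesis
      unfolding cg2_cnj[of "?h \<i>", OF hm] Bochner_Integration.integral_minus by simp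
  qed
  have "(\<integral>r. cmod (ip n r x0) * Re (cnj (ip n r x0) * phase (ip n r y)) \<partial>rowm n)
    = (\<integral>q. ?f q \<partial>distr (rowm n) (borel \<Otimes>\<^sub>M borel) (\<lambda>r. (ip n r x0, ip n r y)))"
    by (subst integral_distr) auto
  also have "\<dots> = (\<integral>q. ?f (case q of (g, h) \<Rightarrow> (g, \<zeta> * g + of_real s * h)) \<partial>cg2)"
    unfolding row_law_pair(2)[OF assms(1,2)] s_def c_def \<zeta>_def by (subst integral_distr) auto
  also have "\<dots> = (\<integral>q. ?f (fst q, \<zeta> * fst q + of_real s * snd q) \<partial>cg2)"
    by (simp add: case_prod_beta)
  also have "\<dots> = (\<integral>q. ?f (1 * fst q, \<zeta> * (1 * fst q) + of_real s * (w * snd q)) \<partial>cg2)"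
  proof -
    have "(\<lambda>q. ?f (fst q, \<zeta> * fst q + of_real s * snd q)) \<in> borel_measurable (borel \<Otimes>\<^sub>M borel)" by measurable
    from cg2_rotate(1)[OF norm_one w(1) this] show ?thesis by simp
  qed
  also have "\<dots> = (\<integral>q. Re w * ?h 1 q + Im w * ?h \<i> q \<partial>cg2)"
  proof (rule integral_cong_AE)
    have ph: "phase (w * z) = w * phase z \<or> z = 0" for z using phase_mult[OF w(1)] by blast
    \<comment> \<open>Equivariance of \<open>phase\<close> may fail at 0, so the argument has to be
      nonzero almost surely. For \<open>s = 0\<close> this follows from \<open>c = 1\<close> and a
      nonzero first variable.\<close>
    have nz: "AE q in cg2. ?T q \<noteq> 0 \<or> s = 0 \<and> True"
    proof (cases "s = 0")
      case False
      have "AE g in cg. AE h in cg. of_real c * g + of_real s * h \<noteq> 0"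
      proof (rule AE_I2)
        fix g
        have "AE h in cg. h \<noteq> - of_real c * g / of_real s"
          unfolding complex_gaussian_density by (subst AE_density) (auto intro!: AE_I'[of "{- of_real c * g / of_real s}"])
        then show "AE h in cg. of_real c * g + of_real s * h \<noteq> 0"
          by eventually_elim (use False in \<open>auto simp: field_simps add_eq_0_iff\<close>)
      qed
      moreover have "{q \<in> space cg2. ?T q \<noteq> 0} \<in> sets cg2" by measurable
      ultimately have "AE q in cg2. ?T q \<noteq> 0" by (intro cgpair.AE_pair_measure) auto
      then show ?thesis by eventually_elim simp
    qed simp
    show "AE q in cg2. ?f (1 * fst q, \<zeta> * (1 * fst q) + of_real s * (w * snd q)) = Re w * ?h 1 q + Im w * ?h \<i> q"
      using nz AE_cg2_nonzero
    proof eventually_elim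
      case (elim q)
      have "c\<^sup>2 = 1" if "s = 0" using s(2) that by simp
      then have "?T q \<noteq> 0" using elim c by (cases "s = 0") auto
      then have "phase (w * ?T q) = w * phase (?T q)" by (rule phase_mult[OF w(1)])
      moreover have "\<zeta> * (1 * fst q) + of_real s * (w * snd q) = w * ?T q" by (simp add: w(2) algebra_simps)
      ultimately have "phase (\<zeta> * (1 * fst q) + of_real s * (w * snd q)) = w * phase (?T q)" by (simp only:)
      then show ?case by (simp only: fst_conv snd_conv) (simp add: algebra_simps)
    qed
  qed measurable
  also have "\<dots> = Re w * (\<integral>q. ?h 1 q \<partial>cg2) + Im w * (\<integral>q. ?h \<i> q \<partial>cg2)"
    using hint[of 1] hint[of \<i>] by (subst Bochner_Integration.integral_add) auto
  also have "(\<integral>q. ?h \<i> q \<partial>cg2) = 0" by (rule odd)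
  finally have eq: "(\<integral>r. cmod (ip n r x0) * Re (cnj (ip n r x0) * phase (ip n r y)) \<partial>rowm n)
     = Re w * (\<integral>q. ?h 1 q \<partial>cg2)" by simp
  \<comment> \<open>The tilt needs \<open>0 < s\<close>. For \<open>s = 0\<close> both variables
    coincide, and both sides equal 1.\<close>
  have lower: "c * (1 + gain * s ^ 4) \<le> (\<integral>q. ?h 1 q \<partial>cg2)"
  proof (cases "s = 0")
    case False
    then show ?thesis using mean_phase_aligned(1)[of c s] c s by simp
  next
    case True
    have c1: "c = 1" using s c True by (simp add: power2_eq_1_iff)
    have "?h 1 q = (cmod (fst q))\<^sup>2" for q
    proof (cases "fst q = 0")
      case False
      have "cnj (fst q) * phase (fst q) = of_real (cmod (fst q))"
      proof -
        have "cnj (fst q) * phase (fst q) = fst q * cnj (fst q) / of_real (cmod (fst q))"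
          using False by (simp add: phase_def)
        also have "\<dots> = of_real (cmod (fst q))"
          using False unfolding complex_norm_square[symmetric] by (simp add: power2_eq_square)
        finally show ?thesis .
      qed
      then show ?thesis using True c1 by (simp add: power2_eq_square)
    qed simp
    then show ?thesis using cg2_moments(2) c1 True by simp
  qed
  have Rew: "Re \<zeta> = Re w * c" by (simp add: w(2))
  show ?thesis
  proof (cases "c = 0")
    case True
    have "\<zeta> = 0" using True by (simp add: c_def)
    have "0 \<le> (\<integral>q. ?h 1 q \<partial>cg2)" using lower True by simp
    then show ?thesis unfolding eq \<zeta>_def[symmetric] using \<open>\<zeta> = 0\<close> by (simp add: w_def)
  next
    case False
    have "0 \<le> Re w" using pos Rew c False unfolding \<zeta>_def[symmetric] by (metis less_eq_real_def mult_neg_pos not_less)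
    from mult_left_mono[OF lower this] show ?thesis
      unfolding eq \<zeta>_def[symmetric] c_def[symmetric] s4 Rew by (simp add: algebra_simps)
  qed
qed

section \<open>Increments of the phase process\<close>

lemma phase_diff_bound: "cmod (phase p - phase q) * cmod p \<le> 2 * cmod (p - q)"
proof (cases "q = 0 \<or> p = 0")
  case True
  have "cmod (phase p - phase q) \<le> 2" using norm_triangle_ineq4[of "phase p" "phase q"] by simp
  then have "cmod (phase p - phase q) * cmod p \<le> 2 * cmod p" by (intro mult_right_mono) auto
  with True show ?thesis by auto
next
  case False
  have "(phase p - phase q) * of_real (cmod p) = (p - q) + phase q * of_real (cmod q - cmod p)"
    using False by (simp add: phase_def field_simps)
  then have "cmod (phase p - phase q) * cmod p = cmod ((p - q) + phase q * of_real (cmod q - cmod p))"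
    by (metis norm_mult norm_of_real abs_norm_cancel)
  also have "\<dots> \<le> cmod (p - q) + \<bar>cmod q - cmod p\<bar>"
    by (rule order.trans[OF norm_triangle_ineq]) (simp only: norm_mult norm_phase norm_of_real mult_1 order_refl)
  also have "\<dots> \<le> 2 * cmod (p - q)" using norm_triangle_ineq3[of q p] by (simp add: norm_minus_commute)
  finally show ?thesis .
qed

text \<open>The inverse square of the modulus is not integrable for a complex Gaussian.
  Interpolating between the Lipschitz bound and the trivial bound 2 replaces the square by a square
  root, which is.\<close>

lemma phase_diff_sq_bound:
  assumes "p \<noteq> 0"
  shows "(cmod (phase p - phase q))\<^sup>2 \<le> 4 * sqrt (cmod (p - q) / cmod p)"
proof -
  define y where "y = cmod (p - q) / cmod p"
  have y: "0 \<le> y" by (simp add: y_def)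
  have 1: "cmod (phase p - phase q) \<le> 2 * y"
    using phase_diff_bound[of p q] assms by (simp add: y_def field_simps)
  have 2: "cmod (phase p - phase q) \<le> 2" using norm_triangle_ineq4[of "phase p" "phase q"] by simp
  show ?thesis
  proof (cases "y \<le> 1")
    case True
    have "(cmod (phase p - phase q))\<^sup>2 \<le> (2 * y)\<^sup>2" using 1 by (intro power_mono) auto
    also have "\<dots> = 4 * (y * y)" by (simp add: power2_eq_square)
    also have "y * y \<le> y" using True y by (simp add: mult_left_le)
    also have "y \<le> sqrt y" using True y by (intro real_le_rsqrt) (simp add: power2_eq_square mult_left_le)
    finally show ?thesis by (simp add: y_def)
  next
    case False
    have "(cmod (phase p - phase q))\<^sup>2 \<le> 2\<^sup>2" using 2 by (intro power_mono) auto
    also have "(2::real)\<^sup>2 = 4 * 1" by simp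
    also have "\<dots> \<le> 4 * sqrt y" using False by (intro mult_left_mono) auto
    finally show ?thesis unfolding y_def .
  qed
qed

lemma normalized_direction:
  assumes "nrm n w \<noteq> 0"
  obtains d where "nrm n d = 1" "\<And>r. ip n r w = of_real (nrm n w) * ip n r d"
proof
  let ?d = "\<lambda>j. complex_of_real (1 / nrm n w) * w j"
  show "nrm n ?d = 1" unfolding nrm_scale norm_of_real using assms by simp
  show "ip n r w = of_real (nrm n w) * ip n r ?d" for r
    unfolding lin_scale using assms by simp
qed

lemma lin_eq_if_nrm_zero: "nrm n (\<lambda>j. x j - y j) = 0 \<Longrightarrow> ip n r x = ip n r y"
proof -
  assume "nrm n (\<lambda>j. x j - y j) = 0"
  then have "\<And>j. j < n \<Longrightarrow> x j = y j" using nrm_zero[of n "\<lambda>j. x j - y j"] by simp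
  then show ?thesis by (auto simp: lin_form_def intro!: sum.cong)
qed

definition phase_proc :: "nat \<Rightarrow> (nat \<Rightarrow> complex) \<Rightarrow> (nat \<Rightarrow> complex) \<Rightarrow> (nat \<Rightarrow> complex) \<Rightarrow> real" where
  "phase_proc n x0 x r = cmod (ip n r x0) * Re (cnj (ip n r x0) * phase (ip n r x))"

lemma phase_proc_diff:
  "\<bar>phase_proc n x0 x r - phase_proc n x0 y r\<bar> \<le> (cmod (ip n r x0))\<^sup>2 * cmod (phase (ip n r x) - phase (ip n r y))"
proof -
  have "\<bar>phase_proc n x0 x r - phase_proc n x0 y r\<bar>
     = cmod (ip n r x0) * \<bar>Re (cnj (ip n r x0) * (phase (ip n r x) - phase (ip n r y)))\<bar>"
    by (simp add: phase_proc_def right_diff_distrib[symmetric] abs_mult del: minus_complex.sel)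
       (simp add: algebra_simps)
  also have "\<dots> \<le> cmod (ip n r x0) * (cmod (ip n r x0) * cmod (phase (ip n r x) - phase (ip n r y)))"
    using abs_Re_le_cmod[of "cnj (ip n r x0) * (phase (ip n r x) - phase (ip n r y))"]
    by (intro mult_left_mono) (auto simp: norm_mult)
  finally show ?thesis by (simp add: power2_eq_square)
qed

lemma phase_proc_measurable [measurable]: "phase_proc n x0 x \<in> borel_measurable (rowm n)"
  unfolding phase_proc_def[abs_def] by measurable

text \<open>Two applications of AM-GM in the increment estimate raise this factor to the fourth
  power; it must stay below a multiple of \<open>exp (R / 2)\<close>, whose Gaussian moment is
  finite.\<close>

lemma power8_exp_bound: "0 \<le> R \<Longrightarrow> (4 * R\<^sup>2 * exp (R / 16)) ^ 4 \<le> 256 * 512 ^ 4 * exp (1/2 * R)" for R :: real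
proof -
  assume R: "0 \<le> R"
  have "R\<^sup>2 \<le> 512 * exp (R / 16)"
    using exp_lower_Taylor_quadratic[of "R / 16"] R by (simp add: power2_eq_square)
  then have "4 * R\<^sup>2 * exp (R / 16) \<le> 4 * (512 * exp (R / 16)) * exp (R / 16)"
    by (intro mult_right_mono mult_left_mono) auto
  then have "(4 * R\<^sup>2 * exp (R / 16)) ^ 4 \<le> (4 * (512 * exp (R / 16)) * exp (R / 16)) ^ 4"
    by (intro power_mono) auto
  also have "\<dots> = 256 * 512 ^ 4 * exp (1/2 * R)"
    by (simp add: power_mult_distrib exp_of_nat_mult[symmetric] exp_add[symmetric])
  finally show ?thesis .
qed

text \<open>The discontinuity of the phase leaves only the square root of the distance, which is the
  decay that \<open>chaining\<close> is designed for.\<close>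

lemma phase_proc_increment:
  assumes x0: "nrm n x0 = 1" and x: "nrm n x = 1"
  shows "(\<integral>\<^sup>+r. ennreal ((phase_proc n x0 x r - phase_proc n x0 y r)\<^sup>2
      * exp (1/32 * \<bar>phase_proc n x0 x r - phase_proc n x0 y r\<bar>)) \<partial>rowm n)
    \<le> ennreal (256 * 512 ^ 4 * sqrt (nrm n (\<lambda>j. x j - y j)))"
proof (cases "nrm n (\<lambda>j. x j - y j) = 0")
  case True
  then show ?thesis using lin_eq_if_nrm_zero[OF True] by (simp add: phase_proc_def)
next
  case False
  define \<rho> where "\<rho> = nrm n (\<lambda>j. x j - y j)"
  obtain d where d: "nrm n d = 1" "\<And>r. ip n r (\<lambda>j. x j - y j) = of_real \<rho> * ip n r d"
    using normalized_direction[OF False] unfolding \<rho>_def by metis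
  have \<rho>: "0 \<le> \<rho>" by (simp add: \<rho>_def)
  have pt: "AE r in rowm n. ennreal ((phase_proc n x0 x r - phase_proc n x0 y r)\<^sup>2
      * exp (1/32 * \<bar>phase_proc n x0 x r - phase_proc n x0 y r\<bar>))
    \<le> ennreal (sqrt \<rho>) * (ennreal (64 * 512 ^ 4) * ennreal (exp (1/2 * (cmod (ip n r x0))\<^sup>2))
         + ennreal (1/4) * ennreal ((cmod (ip n r d))\<^sup>2) + ennreal (1/2) * ennreal (1 / cmod (ip n r x)))"
    using AE_row_nonzero[OF x]
  proof eventually_elim
    case (elim r)
    define D R \<Delta> p v where "D = \<bar>phase_proc n x0 x r - phase_proc n x0 y r\<bar>" and "R = (cmod (ip n r x0))\<^sup>2"
      and "\<Delta> = cmod (phase (ip n r x) - phase (ip n r y))" and "p = cmod (ip n r x)" and "v = cmod (ip n r d)"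
    have R: "0 \<le> R" and v: "0 \<le> v" and p: "0 < p" using elim by (auto simp: R_def v_def p_def)
    have D: "0 \<le> D" "D \<le> R * \<Delta>" using phase_proc_diff[of n x0 x r y] by (auto simp: D_def R_def \<Delta>_def)
    have \<Delta>: "0 \<le> \<Delta>" "\<Delta> \<le> 2" using norm_triangle_ineq4[of "phase (ip n r x)" "phase (ip n r y)"] by (auto simp: \<Delta>_def)
    have D2: "D \<le> R * 2" using D(2) \<Delta>(2) R mult_left_mono order.trans by blast
    have \<Delta>2: "\<Delta>\<^sup>2 \<le> 4 * (sqrt \<rho> * (sqrt v * sqrt (1 / p)))"
    proof -
      have "cmod (ip n r x - ip n r y) = \<rho> * v"
        unfolding lin_diff[symmetric] d(2) v_def using \<rho> by (simp add: norm_mult)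
      then have "\<Delta>\<^sup>2 \<le> 4 * sqrt (\<rho> * v / p)"
        using phase_diff_sq_bound[OF elim, of "ip n r y"] by (simp add: \<Delta>_def p_def)
      also have "sqrt (\<rho> * v / p) = sqrt \<rho> * (sqrt v * sqrt (1 / p))"
        by (simp add: real_sqrt_mult[symmetric])
      finally show ?thesis .
    qed
    define X where "X = 4 * R\<^sup>2 * exp (R / 16)"
    have "D\<^sup>2 * exp (1/32 * D) \<le> (R * \<Delta>)\<^sup>2 * exp (R / 16)"
      using D D2 by (intro mult_mono power_mono) auto
    also have "\<dots> = R\<^sup>2 * exp (R / 16) * \<Delta>\<^sup>2" by (simp add: power_mult_distrib)
    also have "\<dots> \<le> R\<^sup>2 * exp (R / 16) * (4 * (sqrt \<rho> * (sqrt v * sqrt (1 / p))))"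
      by (intro mult_left_mono \<Delta>2) auto
    also have "\<dots> = sqrt \<rho> * ((X * sqrt v) * sqrt (1 / p))" by (simp add: X_def)
    \<comment> \<open>The three factors come from correlated measurements. Two applications of AM-GM
      separate them into an exponential, a second and an inverse moment of one variable
      each.\<close>
    also have "(X * sqrt v) * sqrt (1 / p) \<le> 64 * 512 ^ 4 * exp (1/2 * R) + 1/4 * v\<^sup>2 + 1/2 * (1 / p)"
    proof -
      have ab: "a * b \<le> a\<^sup>2 / 2 + b\<^sup>2 / 2" for a b :: real
        using zero_le_power2[of "a - b"] unfolding power2_diff by simp
      have "(X * sqrt v) * sqrt (1 / p) \<le> (X * sqrt v)\<^sup>2 / 2 + (sqrt (1 / p))\<^sup>2 / 2" by (rule ab)
      also have "(X * sqrt v)\<^sup>2 = X\<^sup>2 * v" using v by (simp add: power_mult_distrib)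
      also have "X\<^sup>2 * v \<le> (X\<^sup>2)\<^sup>2 / 2 + v\<^sup>2 / 2" by (rule ab)
      also have "(X\<^sup>2)\<^sup>2 = X ^ 4" by simp
      also have "X ^ 4 \<le> 256 * 512 ^ 4 * exp (1/2 * R)" unfolding X_def by (rule power8_exp_bound[OF R])
      also have "(sqrt (1 / p))\<^sup>2 = 1 / p" using p by simp
      finally show ?thesis by (simp add: add_divide_distrib mult.commute)
    qed
    finally have "D\<^sup>2 * exp (1/32 * D) \<le> sqrt \<rho> * (64 * 512 ^ 4 * exp (1/2 * R) + 1/4 * v\<^sup>2 + 1/2 * (1 / p))"
      using \<rho> by (simp add: mult_left_mono)
    then have "ennreal (D\<^sup>2 * exp (1/32 * D)) \<le> ennreal (sqrt \<rho> * (64 * 512 ^ 4 * exp (1/2 * R) + 1/4 * v\<^sup>2 + 1/2 * (1 / p)))"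
      by (rule ennreal_leI)
    also have "\<dots> = ennreal (sqrt \<rho>) * (ennreal (64 * 512 ^ 4) * ennreal (exp (1/2 * R)) + ennreal (1/4) * ennreal (v\<^sup>2) + ennreal (1/2) * ennreal (1 / p))"
      using \<rho> p by (simp only: ennreal_mult'[symmetric] ennreal_plus[symmetric] real_sqrt_ge_zero mult_nonneg_nonneg
          add_nonneg_nonneg zero_le_power2 exp_ge_zero zero_le_divide_iff less_imp_le zero_le_numeral zero_le_one zero_le_power simp_thms)
    finally show ?case by (simp add: D_def R_def v_def p_def)
  qed
  have "(\<integral>\<^sup>+r. ennreal ((phase_proc n x0 x r - phase_proc n x0 y r)\<^sup>2
      * exp (1/32 * \<bar>phase_proc n x0 x r - phase_proc n x0 y r\<bar>)) \<partial>rowm n)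
    \<le> (\<integral>\<^sup>+r. ennreal (sqrt \<rho>) * (ennreal (64 * 512 ^ 4) * ennreal (exp (1/2 * (cmod (ip n r x0))\<^sup>2))
         + ennreal (1/4) * ennreal ((cmod (ip n r d))\<^sup>2) + ennreal (1/2) * ennreal (1 / cmod (ip n r x))) \<partial>rowm n)"
    by (rule nn_integral_mono_AE[OF pt])
  also have "\<dots> = ennreal (sqrt \<rho>) * (ennreal (64 * 512 ^ 4) * (\<integral>\<^sup>+r. ennreal (exp (1/2 * (cmod (ip n r x0))\<^sup>2)) \<partial>rowm n)
      + ennreal (1/4) * (\<integral>\<^sup>+r. ennreal ((cmod (ip n r d))\<^sup>2) \<partial>rowm n)
      + ennreal (1/2) * (\<integral>\<^sup>+r. ennreal (1 / cmod (ip n r x)) \<partial>rowm n))"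
  proof -
    have lin3: "(\<integral>\<^sup>+r. c * (k1 * f r + k2 * g r + k3 * h r) \<partial>rowm n)
      = c * (k1 * (\<integral>\<^sup>+r. f r \<partial>rowm n) + k2 * (\<integral>\<^sup>+r. g r \<partial>rowm n) + k3 * (\<integral>\<^sup>+r. h r \<partial>rowm n))"
      if [measurable]: "f \<in> borel_measurable (rowm n)" "g \<in> borel_measurable (rowm n)" "h \<in> borel_measurable (rowm n)"
      for c k1 k2 k3 :: ennreal and f g h
      by (simp add: nn_integral_cmult nn_integral_add)
    show ?thesis by (rule lin3) measurable
  qed
  also have "\<dots> = ennreal (sqrt \<rho>) * (ennreal (64 * 512 ^ 4) * ennreal 2 + ennreal (1/4) * ennreal 1
      + ennreal (1/2) * (\<integral>\<^sup>+r. ennreal (1 / cmod (ip n r x)) \<partial>rowm n))"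
  proof -
    have "(\<integral>\<^sup>+r. ennreal (exp (1/2 * (cmod (ip n r x0))\<^sup>2)) \<partial>rowm n) = ennreal 2"
      using row_exp_moment[OF x0, of "1/2"] by simp
    moreover have "(\<integral>\<^sup>+r. ennreal ((cmod (ip n r d))\<^sup>2) \<partial>rowm n) = ennreal 1"
      using row_second_moment[of n d] d(1) by simp
    ultimately show ?thesis by (simp only:)
  qed
  also have "\<dots> \<le> ennreal (sqrt \<rho>) * (ennreal (64 * 512 ^ 4) * ennreal 2 + ennreal (1/4) * ennreal 1 + ennreal (1/2) * ennreal 9)"
    using row_inverse_moment[OF x] by (intro mult_left_mono add_left_mono) (simp_all only: ennreal_numeral zero_le)
  also have "\<dots> = ennreal (sqrt \<rho> * (64 * 512 ^ 4 * 2 + 1/4 * 1 + 1/2 * 9))"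
    using \<rho> by (simp only: ennreal_mult'[symmetric] ennreal_plus[symmetric] real_sqrt_ge_zero mult_nonneg_nonneg
          add_nonneg_nonneg zero_le_divide_iff zero_le_numeral zero_le_one zero_le_power simp_thms)
  also have "\<dots> \<le> ennreal (sqrt \<rho> * (256 * 512 ^ 4))"
    using \<rho> by (intro ennreal_leI mult_left_mono) auto
  finally show ?thesis by (simp add: \<rho>_def mult.commute)
qed

lemma phase_proc_base:
  assumes x0: "nrm n x0 = 1"
  shows "(\<integral>\<^sup>+r. ennreal ((phase_proc n x0 x r)\<^sup>2 * exp (1/32 * \<bar>phase_proc n x0 x r\<bar>)) \<partial>rowm n) \<le> ennreal (256 * 512 ^ 4)"
proof -
  \<comment> \<open>\<open>subexponential_base\<close> dominates by its second argument, so the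
    measurement of \<open>x0\<close> takes that place.\<close>
  let ?Z = "\<lambda>p u :: complex. cmod u * Re (cnj u * phase p)"
  have "(\<integral>\<^sup>+r. ennreal ((phase_proc n x0 x r)\<^sup>2 * exp (1/32 * \<bar>phase_proc n x0 x r\<bar>)) \<partial>rowm n)
    \<le> (\<integral>\<^sup>+r. ennreal ((?Z (ip n r x) (ip n r x0))\<^sup>2 * exp (1/4 * \<bar>?Z (ip n r x) (ip n r x0)\<bar>)) \<partial>rowm n)"
    unfolding phase_proc_def by (intro nn_integral_mono ennreal_leI mult_left_mono) auto
  also have "\<dots> \<le> ennreal 64"
  proof (rule subexponential_base[OF _ _ x0])
    show "\<bar>cmod p * Re (cnj p * phase u)\<bar> \<le> (cmod p)\<^sup>2" for u p
      using mult_left_mono[OF abs_Re_le_cmod[of "cnj p * phase u"], of "cmod p"]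
      by (simp add: abs_mult norm_mult power2_eq_square)
  qed measurable
  also have "\<dots> \<le> ennreal (256 * 512 ^ 4)" by (rule ennreal_leI) simp
  finally show ?thesis .
qed

lemma phase_proc_net:
  assumes "0 < \<delta>"
  shows "whp (\<lambda>n m x0 a. \<forall>x\<in>net n (finest n).
     real m * ((\<integral>r. phase_proc n x0 x r \<partial>rowm n) - \<delta> / sqrt (real n)) \<le> (\<Sum>i<m. phase_proc n x0 x (sens_row n i a)))"
proof -
  have "whp (\<lambda>n m x0 a. \<forall>x\<in>net n (finest n).
     (\<Sum>i<m. - phase_proc n x0 x (sens_row n i a)) \<le> real m * ((\<integral>r. - phase_proc n x0 x r \<partial>rowm n) + \<delta> / sqrt (real n)))"
  proof (rule chaining[of "256 * 512 ^ 4" "1/32" \<delta> "\<lambda>n x0 x r. - phase_proc n x0 x r"])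
    fix n x0 x y assume "nrm n x0 = 1" "nrm n x = 1" "nrm n y = 1"
    then show "(\<integral>\<^sup>+r. ennreal ((- phase_proc n x0 x r - - phase_proc n x0 y r)\<^sup>2
       * exp (1/32 * \<bar>- phase_proc n x0 x r - - phase_proc n x0 y r\<bar>)) \<partial>rowm n)
       \<le> ennreal (256 * 512 ^ 4 * sqrt (nrm n (\<lambda>j. x j - y j)))"
      using phase_proc_increment[of n x0 x y]
      by (simp add: power2_commute[of "phase_proc n x0 y _" "phase_proc n x0 x _"] abs_minus_commute[of "phase_proc n x0 y _" "phase_proc n x0 x _"])
  qed (use assms phase_proc_base in auto)
  then show ?thesis
    by (rule whp_mono[of _ 0]) (auto simp: sum_negf algebra_simps)
qed

section \<open>The bilinear process at precision \<open>\<delta> / sqrt n\<close>\<close>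

lemma row_integral_pair:
  fixes f :: "complex \<times> complex \<Rightarrow> real"
  assumes [measurable]: "f \<in> borel_measurable (borel \<Otimes>\<^sub>M borel)" and "nrm n x0 = 1" "nrm n x = 1"
  shows "(\<integral>r. f (ip n r x0, ip n r x) \<partial>rowm n)
    = (\<integral>q. f (fst q, ip n x0 x * fst q + of_real (sqrt (1 - (cmod (ip n x0 x))\<^sup>2)) * snd q) \<partial>cg2)"
proof -
  have "(\<integral>r. f (ip n r x0, ip n r x) \<partial>rowm n)
    = (\<integral>q. f q \<partial>distr (rowm n) (borel \<Otimes>\<^sub>M borel) (\<lambda>r. (ip n r x0, ip n r x)))"
    by (subst integral_distr) auto
  also have "\<dots> = (\<integral>q. f (case q of (g, h) \<Rightarrow> (g, ip n x0 x * g + of_real (sqrt (1 - (cmod (ip n x0 x))\<^sup>2)) * h)) \<partial>cg2)"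
    unfolding row_law_pair(2)[OF assms(2,3)] by (subst integral_distr) auto
  finally show ?thesis by (simp add: case_prod_beta)
qed

text \<open>Converts the empirical inner product of \<open>A x0\<close> with the new iterate into
  the true one. Constant precision would not do, because the correlation may start at
  \<open>1 / sqrt n\<close>.\<close>

definition lin_proc :: "nat \<Rightarrow> (nat \<Rightarrow> complex) \<Rightarrow> (nat \<Rightarrow> complex) \<Rightarrow> (nat \<Rightarrow> complex) \<Rightarrow> real" where
  "lin_proc n x0 x r = Re (cnj (ip n r x0) * ip n r x)"

lemma lin_proc_measurable [measurable]: "lin_proc n x0 x \<in> borel_measurable (rowm n)"
  unfolding lin_proc_def[abs_def] by measurable

lemma lin_proc_mean:
  assumes "nrm n x0 = 1" "nrm n x = 1"
  shows "(\<integral>r. lin_proc n x0 x r \<partial>rowm n) = Re (ip n x0 x)"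
proof -
  let ?s = "sqrt (1 - (cmod (ip n x0 x))\<^sup>2)"
  have "(\<integral>r. lin_proc n x0 x r \<partial>rowm n)
    = (\<integral>q. corr (fst q, ip n x0 x * fst q + of_real ?s * snd q) \<partial>cg2)"
    using row_integral_pair[of corr n x0 x] assms by (simp add: lin_proc_def corr_def)
  also have "\<dots> = (\<integral>q. Re (ip n x0 x) * (cmod (fst q))\<^sup>2 + ?s * corr q \<partial>cg2)"
    by (intro Bochner_Integration.integral_cong refl)
       (simp add: corr_def cmod_power2, simp add: power2_eq_square algebra_simps)
  also have "\<dots> = Re (ip n x0 x)"
    using cg2_moments corr_integrable corr_mean by simp
  finally show ?thesis .
qed

text \<open>The product is at most half the sum of squares, and AM-GM on the exponentials separates
  the two correlated variables. The exponent 3/4 is below 1 and has Gaussian moment 4.\<close>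

lemma bilinear_moment:
  assumes x0: "nrm n x0 = 1" and d: "nrm n d = 1"
  shows "(\<integral>\<^sup>+r. ennreal ((cmod (ip n r x0) * cmod (ip n r d))\<^sup>2 * exp (1/16 * (cmod (ip n r x0) * cmod (ip n r d)))) \<partial>rowm n) \<le> ennreal 32"
proof -
  have "(\<integral>\<^sup>+r. ennreal ((cmod (ip n r x0) * cmod (ip n r d))\<^sup>2 * exp (1/16 * (cmod (ip n r x0) * cmod (ip n r d)))) \<partial>rowm n)
    \<le> (\<integral>\<^sup>+r. ennreal 4 * ennreal (exp (3/4 * (cmod (ip n r x0))\<^sup>2)) + ennreal 4 * ennreal (exp (3/4 * (cmod (ip n r d))\<^sup>2)) \<partial>rowm n)"
  proof (rule nn_integral_mono)
    fix r
    define u v t S where "u = cmod (ip n r x0)" and "v = cmod (ip n r d)" and "t = u * v" and "S = u\<^sup>2 + v\<^sup>2"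
    have t: "0 \<le> t" "t \<le> S / 2" and S: "0 \<le> S"
      using zero_le_power2[of "u - v"] unfolding power2_diff by (auto simp: t_def S_def u_def v_def)
    have "t\<^sup>2 * exp (1/16 * t) \<le> (S / 2)\<^sup>2 * exp (1/16 * (S / 2))"
      using t by (intro mult_mono power_mono) auto
    also have "\<dots> = S\<^sup>2 / 4 * exp (S / 32)" by (simp add: power_divide)
    also have "\<dots> \<le> (32 * exp (S / 4)) / 4 * exp (S / 32)"
      using square_le_exp[OF S] by (intro mult_right_mono divide_right_mono) auto
    also have "\<dots> = 8 * exp (9/32 * S)" by (simp add: exp_add[symmetric])
    also have "\<dots> \<le> 8 * exp (3/8 * S)" using S by simp
    also have "exp (3/8 * S) = exp (3/8 * u\<^sup>2) * exp (3/8 * v\<^sup>2)"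
      by (simp add: S_def exp_add[symmetric] algebra_simps)
    also have "\<dots> \<le> ((exp (3/8 * u\<^sup>2))\<^sup>2 + (exp (3/8 * v\<^sup>2))\<^sup>2) / 2"
      using zero_le_power2[of "exp (3/8 * u\<^sup>2) - exp (3/8 * v\<^sup>2)"] unfolding power2_diff by simp
    also have "\<dots> = (exp (3/4 * u\<^sup>2) + exp (3/4 * v\<^sup>2)) / 2"
      by (simp add: exp_double[symmetric])
    finally have "t\<^sup>2 * exp (1/16 * t) \<le> 4 * exp (3/4 * u\<^sup>2) + 4 * exp (3/4 * v\<^sup>2)" by simp
    then have "ennreal (t\<^sup>2 * exp (1/16 * t)) \<le> ennreal (4 * exp (3/4 * u\<^sup>2) + 4 * exp (3/4 * v\<^sup>2))" by (rule ennreal_leI)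
    also have "\<dots> = ennreal 4 * ennreal (exp (3/4 * u\<^sup>2)) + ennreal 4 * ennreal (exp (3/4 * v\<^sup>2))"
      by (subst ennreal_plus) (auto simp: ennreal_mult')
    finally show "ennreal ((cmod (ip n r x0) * cmod (ip n r d))\<^sup>2 * exp (1/16 * (cmod (ip n r x0) * cmod (ip n r d))))
      \<le> ennreal 4 * ennreal (exp (3/4 * (cmod (ip n r x0))\<^sup>2)) + ennreal 4 * ennreal (exp (3/4 * (cmod (ip n r d))\<^sup>2))"
      by (simp add: t_def u_def v_def)
  qed
  also have "\<dots> = ennreal 4 * (\<integral>\<^sup>+r. ennreal (exp (3/4 * (cmod (ip n r x0))\<^sup>2)) \<partial>rowm n)
     + ennreal 4 * (\<integral>\<^sup>+r. ennreal (exp (3/4 * (cmod (ip n r d))\<^sup>2)) \<partial>rowm n)"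
    by (subst nn_integral_add) (auto simp: nn_integral_cmult)
  also have "\<dots> = ennreal 4 * ennreal 4 + ennreal 4 * ennreal 4"
    using row_exp_moment[OF x0, of "3/4"] row_exp_moment[OF d, of "3/4"] by simp
  also have "\<dots> = ennreal 32" by (simp add: ennreal_mult'[symmetric] ennreal_plus[symmetric] del: ennreal_numeral)
  finally show ?thesis .
qed

lemma lin_proc_abs: "\<bar>lin_proc n x0 x r\<bar> \<le> cmod (ip n r x0) * cmod (ip n r x)"
  using abs_Re_le_cmod[of "cnj (ip n r x0) * ip n r x"] by (simp add: lin_proc_def norm_mult)

text \<open>The squared increments are of order \<open>\<rho>\<^sup>2\<close>. Distances on the
  sphere are at most 2, so this is at most \<open>4 * sqrt \<rho>\<close>, and the same chaining
  applies as for the phase process.\<close>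

lemma lin_proc_net:
  assumes "0 < \<delta>"
  shows "whp (\<lambda>n m x0 a. \<forall>x\<in>net n (finest n).
     (\<Sum>i<m. lin_proc n x0 x (sens_row n i a)) \<le> real m * ((\<integral>r. lin_proc n x0 x r \<partial>rowm n) + \<delta> / sqrt (real n)))"
proof (rule chaining[of 128 "1/32" \<delta> lin_proc])
  fix n x0 x assume x: "nrm n x0 = 1" "nrm n x = 1"
  have "(\<integral>\<^sup>+r. ennreal ((lin_proc n x0 x r)\<^sup>2 * exp (1/32 * \<bar>lin_proc n x0 x r\<bar>)) \<partial>rowm n)
    \<le> (\<integral>\<^sup>+r. ennreal ((cmod (ip n r x0) * cmod (ip n r x))\<^sup>2 * exp (1/16 * (cmod (ip n r x0) * cmod (ip n r x)))) \<partial>rowm n)"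
  proof (intro nn_integral_mono ennreal_leI mult_mono)
    fix r
    show "(lin_proc n x0 x r)\<^sup>2 \<le> (cmod (ip n r x0) * cmod (ip n r x))\<^sup>2"
      using power_mono[OF lin_proc_abs[of n x0 x r], of 2] by simp
    show "exp (1/32 * \<bar>lin_proc n x0 x r\<bar>) \<le> exp (1/16 * (cmod (ip n r x0) * cmod (ip n r x)))"
      using lin_proc_abs[of n x0 x r] by simp
  qed auto
  also have "\<dots> \<le> ennreal 128" using bilinear_moment[OF x] by (rule order.trans) (simp add: ennreal_leI del: ennreal_numeral)
  finally show "(\<integral>\<^sup>+r. ennreal ((lin_proc n x0 x r)\<^sup>2 * exp (1/32 * \<bar>lin_proc n x0 x r\<bar>)) \<partial>rowm n) \<le> ennreal 128" .
next
  fix n x0 x y assume x0: "nrm n x0 = 1" and x: "nrm n x = 1" "nrm n y = 1"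
  define \<rho> where "\<rho> = nrm n (\<lambda>j. x j - y j)"
  have \<rho>: "0 \<le> \<rho>" "\<rho> \<le> 2"
    using nrm_triangle[of n x "\<lambda>j. - 1 * y j"] nrm_scale[of n "-1" y] x by (auto simp: \<rho>_def)
  show "(\<integral>\<^sup>+r. ennreal ((lin_proc n x0 x r - lin_proc n x0 y r)\<^sup>2 * exp (1/32 * \<bar>lin_proc n x0 x r - lin_proc n x0 y r\<bar>)) \<partial>rowm n)
     \<le> ennreal (128 * sqrt (nrm n (\<lambda>j. x j - y j)))"
  proof (cases "nrm n (\<lambda>j. x j - y j) = 0")
    case True
    then show ?thesis using lin_eq_if_nrm_zero[OF True] by (simp add: lin_proc_def)
  next
    case False
    obtain d where d: "nrm n d = 1" "\<And>r. ip n r (\<lambda>j. x j - y j) = of_real \<rho> * ip n r d"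
      using normalized_direction[OF False] unfolding \<rho>_def by metis
    have "(\<integral>\<^sup>+r. ennreal ((lin_proc n x0 x r - lin_proc n x0 y r)\<^sup>2 * exp (1/32 * \<bar>lin_proc n x0 x r - lin_proc n x0 y r\<bar>)) \<partial>rowm n)
      \<le> (\<integral>\<^sup>+r. ennreal (\<rho>\<^sup>2) * ennreal ((cmod (ip n r x0) * cmod (ip n r d))\<^sup>2 * exp (1/16 * (cmod (ip n r x0) * cmod (ip n r d)))) \<partial>rowm n)"
    proof (rule nn_integral_mono)
      fix r
      define t D where "t = cmod (ip n r x0) * cmod (ip n r d)" and "D = \<bar>lin_proc n x0 x r - lin_proc n x0 y r\<bar>"
      have t: "0 \<le> t" by (simp add: t_def)
      have "lin_proc n x0 x r - lin_proc n x0 y r = lin_proc n x0 (\<lambda>j. x j - y j) r"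
        by (simp add: lin_proc_def lin_diff algebra_simps)
      then have "D \<le> cmod (ip n r x0) * cmod (ip n r (\<lambda>j. x j - y j))"
        unfolding D_def using lin_proc_abs[of n x0 "\<lambda>j. x j - y j" r] by simp
      then have D: "0 \<le> D" "D \<le> \<rho> * t" using \<rho> by (auto simp: D_def t_def d(2) norm_mult algebra_simps)
      have "D \<le> 2 * t" using D \<rho> t mult_right_mono[of \<rho> 2 t] by linarith
      then have "D\<^sup>2 * exp (1/32 * D) \<le> (\<rho> * t)\<^sup>2 * exp (1/16 * t)"
        using D by (intro mult_mono power_mono) auto
      then have "ennreal (D\<^sup>2 * exp (1/32 * D)) \<le> ennreal (\<rho>\<^sup>2) * ennreal (t\<^sup>2 * exp (1/16 * t))"
        by (subst ennreal_mult'[symmetric]) (auto simp: power_mult_distrib mult.assoc intro!: ennreal_leI)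
      then show "ennreal ((lin_proc n x0 x r - lin_proc n x0 y r)\<^sup>2 * exp (1/32 * \<bar>lin_proc n x0 x r - lin_proc n x0 y r\<bar>))
        \<le> ennreal (\<rho>\<^sup>2) * ennreal ((cmod (ip n r x0) * cmod (ip n r d))\<^sup>2 * exp (1/16 * (cmod (ip n r x0) * cmod (ip n r d))))"
        by (simp add: D_def t_def)
    qed
    also have "\<dots> = ennreal (\<rho>\<^sup>2) * (\<integral>\<^sup>+r. ennreal ((cmod (ip n r x0) * cmod (ip n r d))\<^sup>2 * exp (1/16 * (cmod (ip n r x0) * cmod (ip n r d)))) \<partial>rowm n)"
      by (rule nn_integral_cmult) measurable
    also have "\<dots> \<le> ennreal (\<rho>\<^sup>2) * ennreal 32"
      by (intro mult_left_mono bilinear_moment x0 d) auto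
    also have "\<dots> = ennreal (\<rho>\<^sup>2 * 32)" by (rule ennreal_mult'[symmetric]) simp
    also have "\<dots> \<le> ennreal (128 * sqrt \<rho>)"
    proof (rule ennreal_leI)
      have "sqrt \<rho> \<le> 2" using \<rho> by (intro real_le_lsqrt) auto
      then have "sqrt \<rho> * \<rho> \<le> 2 * 2" using \<rho> by (intro mult_mono) auto
      then have "sqrt \<rho> * (sqrt \<rho> * \<rho>) \<le> sqrt \<rho> * (2 * 2)" using \<rho> by (intro mult_left_mono) auto
      also have "sqrt \<rho> * (sqrt \<rho> * \<rho>) = \<rho>\<^sup>2" using \<rho> by (simp add: power2_eq_square mult.assoc[symmetric])
      finally show "\<rho>\<^sup>2 * 32 \<le> 128 * sqrt \<rho>" by simp
    qed
    finally show ?thesis by (simp add: \<rho>_def)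
  qed
qed (use assms in auto)

lemma finest_distance: "2 / 256 ^ finest n \<le> 2 / (real n)\<^sup>2" if "1 \<le> n"
proof -
  have "(real n)\<^sup>2 \<le> (16 ^ finest n)\<^sup>2" using finest_ge[of n] by (intro power_mono) auto
  also have "\<dots> = 256 ^ finest n" by (simp add: power2_eq_square power_mult_distrib[symmetric])
  finally show ?thesis using that by (intro divide_left_mono) auto
qed

lemma finest_cover:
  assumes "1 \<le> n" "nrm n x = 1"
  obtains y where "y \<in> net n (finest n)" "nrm n y = 1" "nrm n (\<lambda>j. x j - y j) \<le> 2 / (real n)\<^sup>2"
proof -
  obtain y where y: "y \<in> net n (finest n)" "nrm n y = 1" "nrm n (\<lambda>j. x j - y j) \<le> 2 / 256 ^ finest n"
    by (rule net_cover[OF assms(2)])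
  from y(3) finest_distance[OF assms(1)] have "nrm n (\<lambda>j. x j - y j) \<le> 2 / (real n)\<^sup>2" by (rule order.trans)
  with y show thesis by (intro that[of y])
qed

lemma small_over_sqrt:
  assumes "0 < c" "0 < \<delta>" "nat \<lceil>c / \<delta>\<rceil> + 1 \<le> n"
  shows "c / (real n)\<^sup>2 \<le> \<delta> / sqrt (real n)"
proof -
  have n: "1 \<le> real n" "c / \<delta> \<le> real n" using assms by linarith+
  then have "c \<le> \<delta> * real n" using assms by (simp add: field_simps)
  then have "c / (real n)\<^sup>2 \<le> \<delta> * real n / (real n)\<^sup>2" by (intro divide_right_mono) auto
  also have "\<dots> = \<delta> / real n" by (simp add: power2_eq_square)
  also have "\<dots> \<le> \<delta> / sqrt (real n)"
    using n assms by (intro divide_left_mono real_le_lsqrt) (auto simp: power2_eq_square)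
  finally show ?thesis .
qed

lemma apply_rows_cauchy:
  "(\<Sum>i<m. cmod (apply_rows n a x i) * cmod (apply_rows n a y i)) \<le> nrm m (apply_rows n a x) * nrm m (apply_rows n a y)"
  using L2_set_mult_ineq[of "\<lambda>i. cmod (apply_rows n a x i)" "\<lambda>i. cmod (apply_rows n a y i)" "{..<m}"] by (simp add: nrm_L2)

lemma lin_uniform:
  assumes \<delta>: "0 < \<delta>"
  shows "whp (\<lambda>n m x0 a. \<forall>x. nrm n x = 1 \<longrightarrow>
     (\<Sum>i<m. Re (cnj (apply_rows n a x0 i) * apply_rows n a x i)) \<le> real m * (Re (ip n x0 x) + \<delta> / sqrt (real n)))"
  using whp_conj[OF lin_proc_net[of "\<delta> / 2"] operator_norm_bound]
\<comment> \<open>The 10 collects the error of passing from the net to the sphere: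
  \<open>8 / n\<^sup>2\<close> in the empirical sum and \<open>2 / n\<^sup>2\<close> in the inner
  product.\<close>
proof (rule whp_mono[of _ "nat \<lceil>10 / (\<delta> / 2)\<rceil> + 1"], goal_cases)
  case 1
  then show ?case using \<delta> by simp
next
  case (2 n m x0 a)
  let ?A = "apply_rows n a"
  have n: "1 \<le> n" using 2(1) by simp
  show ?case
  proof (intro allI impI)
    fix x assume x: "nrm n x = 1"
    obtain y where y: "y \<in> net n (finest n)" "nrm n y = 1" "nrm n (\<lambda>j. x j - y j) \<le> 2 / (real n)\<^sup>2"
      by (rule finest_cover[OF n x])
    let ?w = "\<lambda>j. x j - y j"
    have "(\<Sum>i<m. Re (cnj (?A x0 i) * ?A x i)) = (\<Sum>i<m. Re (cnj (?A x0 i) * ?A y i)) + (\<Sum>i<m. Re (cnj (?A x0 i) * ?A ?w i))"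
      unfolding apply_rows_diff sum.distrib[symmetric] by (simp add: algebra_simps)
    also have "(\<Sum>i<m. Re (cnj (?A x0 i) * ?A ?w i)) \<le> (\<Sum>i<m. cmod (?A x0 i) * cmod (?A ?w i))"
      by (intro sum_mono order.trans[OF complex_Re_le_cmod]) (simp add: norm_mult)
    also have "\<dots> \<le> nrm m (?A x0) * nrm m (?A ?w)" by (rule apply_rows_cauchy)
    also have "\<dots> \<le> (2 * sqrt (real m) * 1) * (2 * sqrt (real m) * (2 / (real n)\<^sup>2))"
    proof (intro mult_mono)
      show "nrm m (?A x0) \<le> 2 * sqrt (real m) * 1" using 2 by metis
      show "nrm m (?A ?w) \<le> 2 * sqrt (real m) * (2 / (real n)\<^sup>2)"
        using 2(4) y(3) by (meson mult_left_mono order.trans real_sqrt_ge_zero of_nat_0_le_iff mult_nonneg_nonneg zero_le_numeral)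
    qed auto
    also have "\<dots> = real m * (8 / (real n)\<^sup>2)" by simp
    also have "(\<Sum>i<m. Re (cnj (?A x0 i) * ?A y i)) \<le> real m * (Re (ip n x0 y) + \<delta> / 2 / sqrt (real n))"
      using 2(4) y(1) lin_proc_mean[OF 2(3) y(2)] by (auto simp: lin_proc_def apply_rows_def)
    finally have A: "(\<Sum>i<m. Re (cnj (?A x0 i) * ?A x i)) \<le> real m * (Re (ip n x0 y) + \<delta> / 2 / sqrt (real n) + 8 / (real n)\<^sup>2)"
      by (simp add: algebra_simps)
    have "Re (ip n x0 y) - Re (ip n x0 x) \<le> cmod (ip n x0 ?w)"
      using complex_Re_le_cmod[of "- ip n x0 ?w"] by (simp add: lin_diff norm_minus_commute)
    also have "\<dots> \<le> 2 / (real n)\<^sup>2" using ip_cauchy[of n x0 ?w] 2(3) y(3) by simp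
    finally have B: "Re (ip n x0 y) \<le> Re (ip n x0 x) + 2 / (real n)\<^sup>2" by simp
    have C: "10 / (real n)\<^sup>2 \<le> \<delta> / 2 / sqrt (real n)"
      using small_over_sqrt[of 10 "\<delta> / 2" n] 2(1) \<delta> by simp
    have "Re (ip n x0 y) + \<delta> / 2 / sqrt (real n) + 8 / (real n)\<^sup>2 \<le> Re (ip n x0 x) + \<delta> / sqrt (real n)"
      using B C by (simp add: field_simps)
    then have "real m * (Re (ip n x0 y) + \<delta> / 2 / sqrt (real n) + 8 / (real n)\<^sup>2) \<le> real m * (Re (ip n x0 x) + \<delta> / sqrt (real n))"
      by (intro mult_left_mono) auto
    with A show "(\<Sum>i<m. Re (cnj (?A x0 i) * ?A x i)) \<le> real m * (Re (ip n x0 x) + \<delta> / sqrt (real n))" by linarith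
  qed
qed

section \<open>Rows near the jump of the phase, and the passage from the net to the sphere\<close>

definition near_zero :: "real \<Rightarrow> nat \<Rightarrow> (nat \<Rightarrow> complex) \<Rightarrow> (nat \<Rightarrow> complex) \<Rightarrow> (nat \<Rightarrow> complex) \<Rightarrow> real" where
  "near_zero \<eta> n x0 y r = (if cmod (ip n r y) < \<eta> * cmod (ip n r x0) then (cmod (ip n r x0))\<^sup>2 else 0)"

lemma near_zero_measurable [measurable]: "near_zero \<eta> n x0 y \<in> borel_measurable (rowm n)"
  unfolding near_zero_def[abs_def] by measurable

text \<open>On a counted row \<open>1 \<le> sqrt (\<eta> * u / p)\<close>, which gains the factor
  \<open>sqrt \<eta>\<close> at the price of an inverse square root of \<open>p\<close>. AM-GM
  leaves an exponential moment 4 and an inverse moment at most 9, and half of 13 is below 7.\<close>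

lemma near_zero_mgf:
  assumes x0: "nrm n x0 = 1" and y: "nrm n y = 1" and \<eta>: "0 \<le> \<eta>"
  shows "(\<integral>\<^sup>+r. ennreal (exp (near_zero \<eta> n x0 y r / 8)) \<partial>rowm n) \<le> ennreal (exp (7 * sqrt \<eta>))"
proof -
  interpret R: prob_space "rowm n" by (rule rowm_prob)
  have "(\<integral>\<^sup>+r. ennreal (exp (near_zero \<eta> n x0 y r / 8)) \<partial>rowm n)
    \<le> (\<integral>\<^sup>+r. 1 + ennreal (sqrt \<eta> / 2) * (ennreal (exp (3/4 * (cmod (ip n r x0))\<^sup>2)) + ennreal (1 / cmod (ip n r y))) \<partial>rowm n)"
  proof (rule nn_integral_mono_AE)
    show "AE r in rowm n. ennreal (exp (near_zero \<eta> n x0 y r / 8))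
      \<le> 1 + ennreal (sqrt \<eta> / 2) * (ennreal (exp (3/4 * (cmod (ip n r x0))\<^sup>2)) + ennreal (1 / cmod (ip n r y)))"
      using AE_row_nonzero[OF y]
    proof eventually_elim
      case (elim r)
      define u p where "u = cmod (ip n r x0)" and "p = cmod (ip n r y)"
      have u: "0 \<le> u" and p: "0 < p" using elim by (auto simp: u_def p_def)
      show ?case
      proof (cases "p < \<eta> * u")
        case False
        then show ?thesis by (simp add: near_zero_def u_def p_def)
      next
        case True
        have r1: "u \<le> exp (u\<^sup>2 / 2)"
        proof -
          have "u \<le> 1 + u\<^sup>2 / 2" using zero_le_power2[of "u - 1"] unfolding power2_diff by simp
          also have "\<dots> \<le> exp (u\<^sup>2 / 2)" by (rule exp_ge_add_one_self)
          finally show ?thesis .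
        qed
        have "1 \<le> \<eta> * u / p" using True p by simp
        then have one: "1 \<le> sqrt (\<eta> * u / p)" by simp
        have "exp (u\<^sup>2 / 8) * 1 \<le> exp (u\<^sup>2 / 8) * sqrt (\<eta> * u / p)"
          by (intro mult_left_mono one) auto
        also have "\<dots> = sqrt \<eta> * ((exp (u\<^sup>2 / 8) * sqrt u) * sqrt (1 / p))"
          by (simp add: real_sqrt_mult real_sqrt_divide)
        also have "(exp (u\<^sup>2 / 8) * sqrt u) * sqrt (1 / p) \<le> (exp (u\<^sup>2 / 8) * sqrt u)\<^sup>2 / 2 + (sqrt (1 / p))\<^sup>2 / 2"
          using zero_le_power2[of "exp (u\<^sup>2 / 8) * sqrt u - sqrt (1 / p)"] unfolding power2_diff by simp
        also have "(exp (u\<^sup>2 / 8) * sqrt u)\<^sup>2 = exp (u\<^sup>2 / 4) * u"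
          using u by (simp add: power_mult_distrib exp_double[symmetric])
        also have "\<dots> \<le> exp (u\<^sup>2 / 4) * exp (u\<^sup>2 / 2)" by (intro mult_left_mono r1) auto
        also have "\<dots> = exp (3/4 * u\<^sup>2)" by (simp add: exp_add[symmetric])
        also have "(sqrt (1 / p))\<^sup>2 = 1 / p" using p by simp
        finally have "exp (u\<^sup>2 / 8) \<le> sqrt \<eta> / 2 * (exp (3/4 * u\<^sup>2) + 1 / p)"
          using \<eta> by (simp add: mult_right_mono algebra_simps)
        then have "ennreal (exp (u\<^sup>2 / 8)) \<le> ennreal (sqrt \<eta> / 2 * (exp (3/4 * u\<^sup>2) + 1 / p))" by (rule ennreal_leI)
        also have "\<dots> = ennreal (sqrt \<eta> / 2) * (ennreal (exp (3/4 * u\<^sup>2)) + ennreal (1 / p))"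
          using \<eta> p by (subst ennreal_mult') (auto simp: ennreal_plus)
        finally have "ennreal (exp (u\<^sup>2 / 8)) \<le> 1 + ennreal (sqrt \<eta> / 2) * (ennreal (exp (3/4 * u\<^sup>2)) + ennreal (1 / p))"
          by (rule order.trans) simp
        then show ?thesis using True by (simp add: near_zero_def u_def p_def)
      qed
    qed
  qed
  also have "\<dots> = 1 + ennreal (sqrt \<eta> / 2) * ((\<integral>\<^sup>+r. ennreal (exp (3/4 * (cmod (ip n r x0))\<^sup>2)) \<partial>rowm n)
      + (\<integral>\<^sup>+r. ennreal (1 / cmod (ip n r y)) \<partial>rowm n))"
    by (simp add: nn_integral_add nn_integral_cmult R.emeasure_space_1)
  also have "\<dots> \<le> 1 + ennreal (sqrt \<eta> / 2) * (ennreal 4 + ennreal 9)"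
    using row_exp_moment[OF x0, of "3/4"] row_inverse_moment[OF y]
    by (intro add_left_mono mult_left_mono add_mono) (simp_all del: ennreal_numeral, simp)
  also have "\<dots> = ennreal (1 + sqrt \<eta> / 2 * 13)"
    using \<eta> by (subst ennreal_plus[symmetric], simp, simp, subst ennreal_mult'[symmetric], simp, subst ennreal_plus) auto
  also have "\<dots> \<le> ennreal (exp (7 * sqrt \<eta>))"
    using exp_ge_add_one_self[of "7 * sqrt \<eta>"] real_sqrt_ge_zero[OF \<eta>] by (intro ennreal_leI) linarith
  finally show ?thesis .
qed

text \<open>With threshold \<open>\<kappa> / n\<close> the log moment generating function is
  \<open>7 * sqrt \<kappa> / sqrt n\<close>, of the order of the target. The exponent is then of
  order \<open>m / sqrt n\<close>, at least a multiple of \<open>n * sqrt n\<close>. This beats the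
  entropy of the finest net, so one union bound is enough here.\<close>

lemma near_zero_net:
  assumes \<delta>: "0 < \<delta>" and \<kappa>: "0 < \<kappa>" "7 * sqrt \<kappa> \<le> \<delta> / 16"
  shows "whp (\<lambda>n m x0 a. \<forall>y\<in>net n (finest n).
     (\<Sum>i<m. near_zero (\<kappa> / real n) n x0 y (sens_row n i a)) \<le> real m * (\<delta> / sqrt (real n)))"
proof (rule whpI[of "16 * 81 / \<delta>" 1 1])
  fix n m :: nat and x0 assume n: "1 \<le> n" and m: "16 * 81 / \<delta> * (real n)\<^sup>2 \<le> real m" and x0: "nrm n x0 = 1"
  let ?N = "net n (finest n)"
  let ?sn = "sqrt (real n)"
  have N: "finite ?N" "\<And>x. x \<in> ?N \<Longrightarrow> nrm n x = 1" "real (card ?N) \<le> exp (real n * (8 + 12 * real (finest n)))"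
    using net[of n "finest n"] unfolding is_net_def by auto
  have sn: "0 < ?sn" "?sn * ?sn = real n" "1 \<le> ?sn" using n by auto
  define B where "B y = {a \<in> space (sens m n). real m * (\<delta> / ?sn) / 8 \<le> (\<Sum>i<m. near_zero (\<kappa> / real n) n x0 y (sens_row n i a) / 8)}" for y
  have Bs: "B y \<in> sets (sens m n)" for y unfolding B_def by measurable
  have big: "9 + 12 * real (finest n) \<le> 81 * ?sn"
  proof -
    have "12 * real (finest n) + 8 \<le> 20 * 2 ^ finest n" by (rule linear_le_power2)
    also have "\<dots> \<le> 20 * (4 * ?sn)"
    proof (rule mult_left_mono)
      have "(2::real) ^ finest n \<le> 4 ^ finest n" by (intro power_mono) auto
      also have "\<dots> \<le> 4 * ?sn"
      proof (rule power2_le_imp_le)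
        have "((4::real) ^ finest n)\<^sup>2 = 16 ^ finest n" by (simp add: power2_eq_square power_mult_distrib[symmetric])
        also have "\<dots> \<le> 16 * real n" by (rule finest_less[OF n])
        finally show "((4::real) ^ finest n)\<^sup>2 \<le> (4 * ?sn)\<^sup>2" by (simp add: power_mult_distrib)
      qed (use sn in simp)
      finally show "(2::real) ^ finest n \<le> 4 * ?sn" .
    qed simp
    finally have "12 * real (finest n) + 8 \<le> 80 * ?sn" by simp
    then show ?thesis using sn(3) by linarith
  qed
  have Bp: "measure (sens m n) (B y) \<le> exp (- (real n * (9 + 12 * real (finest n))))" if y: "y \<in> ?N" for y
  proof -
    have "measure (sens m n) (B y) \<le> exp (real m * (7 * sqrt (\<kappa> / real n)) - real m * (\<delta> / ?sn) / 8)"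
      unfolding B_def using \<kappa> by (intro chernoff near_zero_mgf x0 N(2)[OF y]) auto
    also have "real m * (7 * sqrt (\<kappa> / real n)) - real m * (\<delta> / ?sn) / 8 = real m / ?sn * (7 * sqrt \<kappa> - \<delta> / 8)"
      using sn by (simp add: real_sqrt_divide field_simps)
    also have "\<dots> \<le> real m / ?sn * (- (\<delta> / 16))"
      using \<kappa> sn by (intro mult_left_mono) auto
    also have "\<dots> \<le> - (16 * 81 / \<delta> * (real n)\<^sup>2 / ?sn * (\<delta> / 16))"
    proof -
      have "16 * 81 / \<delta> * (real n)\<^sup>2 / ?sn * (\<delta> / 16) \<le> real m / ?sn * (\<delta> / 16)"
        using \<delta> by (intro mult_right_mono divide_right_mono m) auto
      then show ?thesis by simp
    qed
    also have "16 * 81 / \<delta> * (real n)\<^sup>2 / ?sn * (\<delta> / 16) = 81 * ((?sn * ?sn) * real n) / ?sn"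
      using \<delta> unfolding sn(2) by (simp add: power2_eq_square)
    also have "\<dots> = real n * (81 * ?sn)" using sn(1) by (simp add: field_simps)
    also have "- (real n * (81 * ?sn)) \<le> - (real n * (9 + 12 * real (finest n)))"
      using big by (intro le_imp_neg_le mult_left_mono) auto
    finally show ?thesis by simp
  qed
  have "(\<Sum>x\<in>?N. measure (sens m n) (B x)) \<le> (\<Sum>x\<in>?N. exp (- (real n * (9 + 12 * real (finest n)))))"
    by (intro sum_mono Bp)
  also have "\<dots> \<le> exp (real n * (8 + 12 * real (finest n))) * exp (- (real n * (9 + 12 * real (finest n))))"
    using N(3) by (simp add: mult_right_mono)
  also have "\<dots> = 1 * exp (- real n)" by (simp add: exp_add[symmetric] algebra_simps)
  finally have sumB: "(\<Sum>x\<in>?N. measure (sens m n) (B x)) \<le> 1 * exp (- real n)" .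
  obtain E where E: "E \<in> sets (sens m n)" "1 - 1 * exp (- real n) \<le> measure (sens m n) E"
     "\<And>a i. a \<in> E \<Longrightarrow> i \<in> ?N \<Longrightarrow> a \<in> space (sens m n) \<and> a \<notin> B i"
    using good_event[OF N(1) Bs sumB] by metis
  show "\<exists>E\<in>sets (sens m n). 1 - 1 * exp (- real n) \<le> measure (sens m n) E \<and>
    (\<forall>a\<in>E. \<forall>y\<in>?N. (\<Sum>i<m. near_zero (\<kappa> / real n) n x0 y (sens_row n i a)) \<le> real m * (\<delta> / ?sn))"
  proof (intro bexI[of _ E] conjI ballI)
    fix a y assume "a \<in> E" "y \<in> ?N"
    then have "a \<in> space (sens m n)" "a \<notin> B y" using E(3) by auto
    then show "(\<Sum>i<m. near_zero (\<kappa> / real n) n x0 y (sens_row n i a)) \<le> real m * (\<delta> / ?sn)"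
      by (simp add: B_def sum_divide_distrib[symmetric])
  qed (use E in auto)
qed (use \<delta> in auto)

text \<open>The value \<open>phase 0 = 1\<close> is not equivariant under rotations. Therefore the estimates are
  stated for arbitrary unimodular \<open>\<phi>\<close> with \<open>p = \<bar>p\<bar> \<phi>\<close>.\<close>

lemma phase_selection_bound:
  assumes "cmod \<phi> = 1" "p = of_real (cmod p) * \<phi>"
  shows "cmod (phase q - \<phi>) * cmod q \<le> 2 * cmod (q - p)"
proof -
  have "(phase q - \<phi>) * of_real (cmod q) = (q - p) + \<phi> * of_real (cmod p - cmod q)"
  proof -
    have "phase q * of_real (cmod q) = q" by (simp add: phase_def)
    moreover have "\<phi> * of_real (cmod p) = p" using assms(2) by (metis mult.commute)
    ultimately show ?thesis by (simp add: left_diff_distrib right_diff_distrib)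
  qed
  then have "cmod (phase q - \<phi>) * cmod q = cmod ((q - p) + \<phi> * of_real (cmod p - cmod q))"
    by (metis norm_mult norm_of_real abs_norm_cancel)
  also have "\<dots> \<le> cmod (q - p) + \<bar>cmod p - cmod q\<bar>"
    by (rule order.trans[OF norm_triangle_ineq]) (simp only: norm_mult assms(1) norm_of_real mult_1 order_refl)
  also have "\<dots> \<le> 2 * cmod (q - p)" using norm_triangle_ineq3[of p q] by (simp add: norm_minus_commute)
  finally show ?thesis .
qed

text \<open>\<open>\<phi>\<close> is a phase at \<open>x\<close>, compared with the phase at the net
  point \<open>y\<close>. If the measurement at \<open>y\<close> is below \<open>\<eta> * u\<close>,
  the trivial bound 2 is charged to \<open>near_zero\<close>; otherwise the phases differ by at most
  \<open>2 * q / p\<close>, and \<open>p\<close> is at least \<open>\<eta> * u\<close>.\<close>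

lemma phase_proc_residual:
  assumes "0 < \<eta>" and \<phi>: "cmod \<phi> = 1" "ip n r x = of_real (cmod (ip n r x)) * \<phi>"
  shows "\<bar>cmod (ip n r x0) * Re (cnj (ip n r x0) * \<phi>) - phase_proc n x0 y r\<bar>
     \<le> 2 * near_zero \<eta> n x0 y r + 2 / \<eta> * (cmod (ip n r x0) * cmod (ip n r x - ip n r y))"
proof -
  define u \<Delta> q p where "u = cmod (ip n r x0)" and "\<Delta> = cmod (phase (ip n r y) - \<phi>)"
    and "q = cmod (ip n r x - ip n r y)" and "p = cmod (ip n r y)"
  have u: "0 \<le> u" and q: "0 \<le> q" by (auto simp: u_def q_def)
  have D: "\<bar>u * Re (cnj (ip n r x0) * \<phi>) - phase_proc n x0 y r\<bar> \<le> u\<^sup>2 * \<Delta>"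
  proof -
    have "u * Re (cnj (ip n r x0) * \<phi>) - phase_proc n x0 y r = u * Re (cnj (ip n r x0) * (\<phi> - phase (ip n r y)))"
      by (simp add: phase_proc_def u_def algebra_simps)
    then have "\<bar>u * Re (cnj (ip n r x0) * \<phi>) - phase_proc n x0 y r\<bar> = u * \<bar>Re (cnj (ip n r x0) * (\<phi> - phase (ip n r y)))\<bar>"
      using u by (simp only: abs_mult abs_of_nonneg)
    also have "\<dots> \<le> u * (u * \<Delta>)"
      using abs_Re_le_cmod[of "cnj (ip n r x0) * (\<phi> - phase (ip n r y))"] u
      by (intro mult_left_mono) (simp_all add: norm_mult u_def \<Delta>_def norm_minus_commute)
    finally show ?thesis by (simp add: power2_eq_square)
  qed
  have \<Delta>: "0 \<le> \<Delta>" "\<Delta> \<le> 2" "\<Delta> * p \<le> 2 * q"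
    using norm_triangle_ineq4[of "phase (ip n r y)" \<phi>] phase_selection_bound[OF \<phi>, of "ip n r y"] \<phi>(1)
    by (auto simp: \<Delta>_def p_def q_def norm_minus_commute)
  have "u\<^sup>2 * \<Delta> \<le> 2 * near_zero \<eta> n x0 y r + 2 / \<eta> * (u * q)"
  proof (cases "p < \<eta> * u")
    case True
    have "u\<^sup>2 * \<Delta> \<le> u\<^sup>2 * 2" using \<Delta>(2) by (intro mult_left_mono) auto
    moreover have "0 \<le> 2 / \<eta> * (u * q)" using assms u q by simp
    ultimately show ?thesis using True by (simp add: near_zero_def u_def p_def)
  next
    case False
    have "u * (\<eta> * u * \<Delta>) \<le> u * (p * \<Delta>)"
      using False u \<Delta> by (intro mult_left_mono mult_right_mono) auto
    also have "\<dots> \<le> u * (2 * q)" using \<Delta>(3) u by (intro mult_left_mono) (auto simp: mult.commute)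
    finally have "\<eta> * (u\<^sup>2 * \<Delta>) \<le> 2 * (u * q)" by (simp add: power2_eq_square algebra_simps)
    then have "u\<^sup>2 * \<Delta> \<le> 2 / \<eta> * (u * q)" using assms by (simp add: field_simps)
    then show ?thesis using False by (simp add: near_zero_def u_def p_def)
  qed
  with D show ?thesis unfolding u_def q_def by linarith
qed

definition selection :: "nat \<Rightarrow> (nat \<Rightarrow> complex) \<Rightarrow> (nat \<Rightarrow> complex) \<Rightarrow> bool" where
  "selection m p f \<longleftrightarrow> (\<forall>i<m. cmod (f i) = 1 \<and> p i = of_real (cmod (p i)) * f i)"

text \<open>A net point near an aligned vector has inner product near \<open>c\<close>, but not
  exactly real. In the constant, \<open>4 * gain\<close> comes from changing the squared factor and
  \<open>1 + gain\<close> from changing the leading one.\<close>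

lemma mean_profile_perturb:
  fixes \<zeta> :: complex
  assumes "0 \<le> c" "c \<le> 1" "cmod \<zeta> \<le> 1" "cmod (of_real c - \<zeta>) \<le> d"
  shows "c * (1 + gain * (1 - c\<^sup>2)\<^sup>2) - (1 + 5 * gain) * d \<le> Re \<zeta> * (1 + gain * (1 - (cmod \<zeta>)\<^sup>2)\<^sup>2)"
proof -
  have k: "0 < gain" by (rule gain_pos)
  define e where "e = cmod \<zeta>"
  have e: "0 \<le> e" "e \<le> 1" using assms by (auto simp: e_def)
  have d: "0 \<le> d" using assms(4) norm_ge_zero order.trans by blast
  have ce: "\<bar>c - e\<bar> \<le> d"
    using norm_triangle_ineq3[of "complex_of_real c" \<zeta>] assms by (simp add: e_def)
  have re: "c - d \<le> Re \<zeta>"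
    using complex_Re_le_cmod[of "of_real c - \<zeta>"] assms(4) by simp
  have p1: "\<bar>c\<^sup>2 - e\<^sup>2\<bar> \<le> 2 * d"
  proof -
    have "\<bar>c\<^sup>2 - e\<^sup>2\<bar> = \<bar>c - e\<bar> * \<bar>c + e\<bar>" by (simp add: power2_eq_square abs_mult[symmetric] algebra_simps)
    also have "\<dots> \<le> d * 2" using ce assms e d by (intro mult_mono) auto
    finally show ?thesis by simp
  qed
  have c2: "0 \<le> 1 - c\<^sup>2" "1 - c\<^sup>2 \<le> 1" and e2: "0 \<le> 1 - e\<^sup>2" "1 - e\<^sup>2 \<le> 1"
    using assms e by (auto simp: power_le_one)
  have p2: "(1 - c\<^sup>2)\<^sup>2 - (1 - e\<^sup>2)\<^sup>2 \<le> 4 * d"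
  proof -
    have "(1 - c\<^sup>2)\<^sup>2 - (1 - e\<^sup>2)\<^sup>2 = (e\<^sup>2 - c\<^sup>2) * ((1 - c\<^sup>2) + (1 - e\<^sup>2))"
      by (simp add: power2_eq_square algebra_simps)
    also have "\<dots> \<le> \<bar>c\<^sup>2 - e\<^sup>2\<bar> * ((1 - c\<^sup>2) + (1 - e\<^sup>2))"
      using c2(1) e2(1) by (intro mult_right_mono) auto
    also have "\<dots> \<le> (2 * d) * 2"
      by (rule mult_mono[OF p1]) (use c2 e2 d in linarith)+
    finally show ?thesis by simp
  qed
  define Q where "Q = 1 + gain * (1 - e\<^sup>2)\<^sup>2"
  have Q: "0 \<le> Q" "Q \<le> 1 + gain"
    using k e2 by (auto simp: Q_def power_le_one intro!: add_nonneg_nonneg)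
  have "c * (1 + gain * (1 - c\<^sup>2)\<^sup>2) - c * Q = c * gain * ((1 - c\<^sup>2)\<^sup>2 - (1 - e\<^sup>2)\<^sup>2)"
    by (simp add: Q_def algebra_simps)
  also have "\<dots> \<le> c * gain * (4 * d)" using p2 assms k by (intro mult_left_mono) auto
  also have "\<dots> \<le> 1 * gain * (4 * d)" using assms k d by (intro mult_right_mono) auto
  finally have 1: "c * (1 + gain * (1 - c\<^sup>2)\<^sup>2) \<le> c * Q + 4 * gain * d" by simp
  have "(c - d) * Q \<le> Re \<zeta> * Q" using re Q by (intro mult_right_mono) auto
  moreover have "d * Q \<le> d * (1 + gain)" using Q d by (intro mult_left_mono) auto
  ultimately have "c * Q - d * (1 + gain) \<le> Re \<zeta> * Q" by (simp add: algebra_simps)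
  with 1 show ?thesis unfolding Q_def e_def by (simp add: algebra_simps)
qed

text \<open>Four errors share \<open>\<delta>\<close> equally: the deviation on the net, the change
  of the mean profile, the rows near zero, and the Lipschitz part on the other rows.\<close>

lemma phase_uniform:
  assumes \<delta>: "0 < \<delta>"
  shows "whp (\<lambda>n m x0 a. \<forall>x c f. nrm n x = 1 \<longrightarrow> ip n x0 x = of_real c \<longrightarrow> 1 / sqrt (real n) \<le> c \<longrightarrow>
     selection m (apply_rows n a x) f \<longrightarrow> real m * (c * (1 + gain * (1 - c\<^sup>2)\<^sup>2) - \<delta> / sqrt (real n))
       \<le> (\<Sum>i<m. cmod (apply_rows n a x0 i) * Re (cnj (apply_rows n a x0 i) * f i)))"
proof -
  \<comment> \<open>Here 112 is 7 times 16, which turns the hypothesis of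
    \<open>near_zero_net\<close> for precision \<open>\<delta> / 8\<close> into an equality.\<close>
  define \<kappa> where "\<kappa> = (\<delta> / 8 / 112)\<^sup>2"
  have \<kappa>: "0 < \<kappa>" "7 * sqrt \<kappa> \<le> \<delta> / 8 / 16" using \<delta> by (auto simp: \<kappa>_def)
  define C where "C = 2 * (1 + 5 * gain)"
  have C: "0 < C" using gain_pos by (simp add: C_def)
  define n0 where "n0 = max (nat \<lceil>C / (\<delta> / 4)\<rceil> + 1) (max (nat \<lceil>(64 / (\<kappa> * \<delta>))\<^sup>2\<rceil>) 2)"
  from whp_conj[OF phase_proc_net[of "\<delta> / 4"] whp_conj[OF near_zero_net[OF _ \<kappa>] operator_norm_bound]]
  show ?thesis
  proof (rule whp_mono[of _ n0], goal_cases)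
    case 1 then show ?case using \<delta> by simp
  next
    case 2 then show ?case using \<delta> by simp
  next
    case (3 n m x0 a)
    let ?A = "apply_rows n a"
    let ?sn = "sqrt (real n)"
    have n: "1 \<le> n" "2 \<le> n" and nC: "nat \<lceil>C / (\<delta> / 4)\<rceil> + 1 \<le> n" and nk: "(64 / (\<kappa> * \<delta>))\<^sup>2 \<le> real n"
      using 3(1) by (auto simp: n0_def)
    have sn: "0 < ?sn" "?sn * ?sn = real n" using n by auto
    have opn: "nrm m (?A x) \<le> 2 * sqrt (real m) * nrm n x" for x using 3(4) by blast
    show ?case
    proof (intro allI impI)
      fix x c f assume x: "nrm n x = 1" and c: "ip n x0 x = of_real c" "1 / ?sn \<le> c"
        and f: "selection m (?A x) f"
      obtain y where y: "y \<in> net n (finest n)" "nrm n y = 1" "nrm n (\<lambda>j. x j - y j) \<le> 2 / (real n)\<^sup>2"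
        by (rule finest_cover[OF n(1) x])
      let ?w = "\<lambda>j. x j - y j"
      define \<zeta> where "\<zeta> = ip n x0 y"
      have c1: "0 \<le> c" "c \<le> 1"
      proof -
        show "0 \<le> c" using c(2) sn by (meson order.trans zero_le_divide_1_iff less_imp_le)
        then show "c \<le> 1" using row_law_pair(1)[OF 3(3) x] c by simp
      qed
      have zd: "cmod (of_real c - \<zeta>) \<le> 2 / (real n)\<^sup>2"
        using ip_cauchy[of n x0 ?w] 3(3) y(3) by (simp add: lin_diff \<zeta>_def c(1))
      \<comment> \<open>The mesh is smaller than the least admissible correlation, so the net point
        still has nonnegative correlation and \<open>mean_phase\<close> applies to it.\<close>
      have "2 / (real n)\<^sup>2 \<le> 1 / ?sn"
      proof -
        have "?sn \<le> real n" using n by (intro real_le_lsqrt) (auto simp: power2_eq_square)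
        then have "2 * ?sn \<le> (real n)\<^sup>2" using n mult_mono[of 2 "real n" ?sn "real n"] by (simp add: power2_eq_square)
        then show ?thesis using sn n by (simp add: field_simps)
      qed
      then have "0 \<le> Re \<zeta>"
        using complex_Re_le_cmod[of "of_real c - \<zeta>"] zd c(2) by simp
      then have mean: "Re \<zeta> * (1 + gain * (1 - (cmod \<zeta>)\<^sup>2)\<^sup>2) \<le> (\<integral>r. phase_proc n x0 y r \<partial>rowm n)"
        using mean_phase[OF 3(3) y(2)] unfolding \<zeta>_def phase_proc_def by simp
      have pert: "c * (1 + gain * (1 - c\<^sup>2)\<^sup>2) - (1 + 5 * gain) * (2 / (real n)\<^sup>2) \<le> Re \<zeta> * (1 + gain * (1 - (cmod \<zeta>)\<^sup>2)\<^sup>2)"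
        using mean_profile_perturb[OF c1 _ zd] row_law_pair(1)[OF 3(3) y(2)] by (simp add: \<zeta>_def)
      have small: "(1 + 5 * gain) * (2 / (real n)\<^sup>2) \<le> \<delta> / 4 / ?sn"
        using small_over_sqrt[OF C _ nC] \<delta> by (simp add: C_def mult.commute)
      have emp: "real m * ((\<integral>r. phase_proc n x0 y r \<partial>rowm n) - \<delta> / 4 / ?sn) \<le> (\<Sum>i<m. phase_proc n x0 y (sens_row n i a))"
        using 3(4) y(1) by blast
      have nz: "(\<Sum>i<m. near_zero (\<kappa> / real n) n x0 y (sens_row n i a)) \<le> real m * (\<delta> / 8 / ?sn)"
        using 3(4) y(1) by blast
      have cs: "(\<Sum>i<m. cmod (?A x0 i) * cmod (?A ?w i)) \<le> real m * (8 / (real n)\<^sup>2)"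
      proof -
        have "(\<Sum>i<m. cmod (?A x0 i) * cmod (?A ?w i)) \<le> nrm m (?A x0) * nrm m (?A ?w)" by (rule apply_rows_cauchy)
        also have "\<dots> \<le> (2 * sqrt (real m) * 1) * (2 * sqrt (real m) * (2 / (real n)\<^sup>2))"
        proof (intro mult_mono)
          show "nrm m (?A x0) \<le> 2 * sqrt (real m) * 1" using opn[of x0] 3(3) by simp
          show "nrm m (?A ?w) \<le> 2 * sqrt (real m) * (2 / (real n)\<^sup>2)"
            by (rule order.trans[OF opn[of ?w]]) (intro mult_left_mono y(3), simp)
        qed auto
        finally show ?thesis by (simp add: mult.commute)
      qed
      let ?S = "\<Sum>i<m. cmod (?A x0 i) * Re (cnj (?A x0 i) * f i)"
      have "(\<Sum>i<m. phase_proc n x0 y (sens_row n i a)) - ?S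
        \<le> (\<Sum>i<m. 2 * near_zero (\<kappa> / real n) n x0 y (sens_row n i a) + 2 / (\<kappa> / real n) * (cmod (?A x0 i) * cmod (?A ?w i)))"
        unfolding sum_subtractf[symmetric]
      proof (rule sum_mono)
        fix i assume "i \<in> {..<m}"
        then have fi: "cmod (f i) = 1" "ip n (sens_row n i a) x = of_real (cmod (ip n (sens_row n i a) x)) * f i"
          using f by (auto simp: selection_def apply_rows_def)
        show "phase_proc n x0 y (sens_row n i a) - cmod (?A x0 i) * Re (cnj (?A x0 i) * f i)
          \<le> 2 * near_zero (\<kappa> / real n) n x0 y (sens_row n i a) + 2 / (\<kappa> / real n) * (cmod (?A x0 i) * cmod (?A ?w i))"
          using phase_proc_residual[OF _ fi, of "\<kappa> / real n" x0 y] \<kappa> n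
          unfolding apply_rows_diff apply_rows_def by auto
      qed
      also have "\<dots> = 2 * (\<Sum>i<m. near_zero (\<kappa> / real n) n x0 y (sens_row n i a)) + 2 / (\<kappa> / real n) * (\<Sum>i<m. cmod (?A x0 i) * cmod (?A ?w i))"
        by (simp add: sum.distrib sum_distrib_left)
      also have "\<dots> \<le> 2 * (real m * (\<delta> / 8 / ?sn)) + 2 / (\<kappa> / real n) * (real m * (8 / (real n)\<^sup>2))"
        using nz cs \<kappa> by (intro add_mono mult_left_mono) auto
      also have "2 / (\<kappa> / real n) * (real m * (8 / (real n)\<^sup>2)) = real m * (16 / (\<kappa> * real n))"
        using n by (simp add: power2_eq_square)
      \<comment> \<open>The threshold \<open>\<kappa> / n\<close> costs a factor
        \<open>n / \<kappa>\<close>. With mesh \<open>2 / n\<^sup>2\<close> a loss of order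
        \<open>1 / n\<close> remains, below \<open>1 / sqrt n\<close>; this is what the finest scale
        is chosen for.\<close>
      also have "16 / (\<kappa> * real n) \<le> \<delta> / 4 / ?sn"
      proof -
        have "64 / (\<kappa> * \<delta>) \<le> ?sn" using nk \<kappa> \<delta> by (intro real_le_rsqrt) auto
        then have "64 \<le> \<kappa> * \<delta> * ?sn" using \<kappa> \<delta> by (simp add: field_simps)
        then have "64 * ?sn \<le> \<kappa> * \<delta> * ?sn * ?sn" using sn by (intro mult_right_mono) auto
        also have "\<dots> = \<kappa> * \<delta> * real n" using sn(2) by (simp add: mult.assoc)
        finally have "64 * ?sn \<le> \<kappa> * \<delta> * real n" .
        then show ?thesis using \<kappa> sn n by (simp add: field_simps)
      qed
      finally have res: "(\<Sum>i<m. phase_proc n x0 y (sens_row n i a)) - ?S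
        \<le> 2 * (real m * (\<delta> / 8 / ?sn)) + real m * (\<delta> / 4 / ?sn)"
        by (simp add: mult_left_mono)
      have "c * (1 + gain * (1 - c\<^sup>2)\<^sup>2) - \<delta> / ?sn \<le> (\<integral>r. phase_proc n x0 y r \<partial>rowm n) - \<delta> / 4 / ?sn - \<delta> / 2 / ?sn"
      proof -
        have "\<delta> / ?sn = \<delta> / 4 / ?sn + \<delta> / 4 / ?sn + \<delta> / 2 / ?sn" by (simp add: field_simps)
        then show ?thesis using pert small mean by linarith
      qed
      then have "real m * (c * (1 + gain * (1 - c\<^sup>2)\<^sup>2) - \<delta> / ?sn) \<le> real m * ((\<integral>r. phase_proc n x0 y r \<partial>rowm n) - \<delta> / 4 / ?sn - \<delta> / 2 / ?sn)"
        by (intro mult_left_mono) auto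
      also have "\<dots> = real m * ((\<integral>r. phase_proc n x0 y r \<partial>rowm n) - \<delta> / 4 / ?sn) - (2 * (real m * (\<delta> / 8 / ?sn)) + real m * (\<delta> / 4 / ?sn))"
        by (simp add: algebra_simps)
      also have "\<dots> \<le> ?S" using emp res by linarith
      finally show "real m * (c * (1 + gain * (1 - c\<^sup>2)\<^sup>2) - \<delta> / ?sn) \<le> ?S" .
    qed
  qed
qed

section \<open>Quadratic energies and large perturbations of the measurements\<close>

lemma quad_uniform:
  assumes "0 < \<delta>"
  shows "whp (\<lambda>n m x0 a. \<forall>x. nrm n x = 1 \<longrightarrow>
    real m * (1 - \<delta>) \<le> (\<Sum>i<m. (cmod (apply_rows n a x i))\<^sup>2) \<and> (\<Sum>i<m. (cmod (apply_rows n a x i))\<^sup>2) \<le> real m * (1 + \<delta>))"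
proof -
  have sq: "\<bar>(cmod p)\<^sup>2 - (cmod q)\<^sup>2\<bar> \<le> cmod (p - q) * (cmod p + cmod q)" for p q :: complex
  proof -
    have "\<bar>(cmod p)\<^sup>2 - (cmod q)\<^sup>2\<bar> = \<bar>cmod p - cmod q\<bar> * (cmod p + cmod q)"
      by (simp add: power2_eq_square square_diff_square_factored abs_mult)
    also have "\<dots> \<le> cmod (p - q) * (cmod p + cmod q)" by (intro mult_right_mono norm_triangle_ineq3) auto
    finally show ?thesis .
  qed
  have up: "whp (\<lambda>n m x0 a. \<forall>x. nrm n x = 1 \<longrightarrow>
    (\<Sum>i<m. (cmod (apply_rows n a x i))\<^sup>2) \<le> real m * ((\<integral>r. (cmod (ip n r x))\<^sup>2 \<partial>rowm n) + \<delta>))"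
    by (rule uniform_law_upper[of "\<lambda>u p. (cmod p)\<^sup>2"]) (use sq assms in auto)
  have lo: "whp (\<lambda>n m x0 a. \<forall>x. nrm n x = 1 \<longrightarrow>
    (\<Sum>i<m. - (cmod (apply_rows n a x i))\<^sup>2) \<le> real m * ((\<integral>r. - (cmod (ip n r x))\<^sup>2 \<partial>rowm n) + \<delta>))"
    by (rule uniform_law_upper[of "\<lambda>u p. - (cmod p)\<^sup>2"]) (use sq assms in \<open>auto simp: abs_minus_commute\<close>)
  show ?thesis
    by (rule whp_mono[OF whp_conj[OF up lo], of 0])
       (auto simp: row_second_moment_real sum_negf algebra_simps)
qed

lemma cg2_moment_vanish:
  fixes f :: "complex \<times> complex \<Rightarrow> real"
  assumes [measurable]: "f \<in> borel_measurable (borel \<Otimes>\<^sub>M borel)" and w: "cmod w = 1" and odd: "\<And>q. f (fst q, w * snd q) = - f q"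
  shows "(\<integral>q. f q \<partial>cg2) = 0"
proof -
  have "(\<integral>q. f q \<partial>cg2) = (\<integral>q. f (1 * fst q, w * snd q) \<partial>cg2)"
    by (rule cg2_rotate(1)[symmetric]) (use w in auto)
  also have "\<dots> = - (\<integral>q. f q \<partial>cg2)" by (simp add: odd)
  finally show ?thesis by simp
qed

text \<open>Write the second measurement as \<open>\<zeta> * g + s * h\<close>. The cross term is
  odd under \<open>h\<close> to \<open>- h\<close>, the pure term in \<open>h\<close> changes sign
  under \<open>h\<close> to \<open>\<i> * h\<close>, and only the term in
  \<open>\<zeta>\<^sup>2\<close> survives. Since \<open>(Im q)\<^sup>2\<close> is half of the
  difference of \<open>(cmod q)\<^sup>2\<close> and \<open>Re (q\<^sup>2)\<close>, this determines
  the mean tangential energy.\<close>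

lemma phase_quad_mean:
  assumes "nrm n x0 = 1" "nrm n x = 1"
  shows "(\<integral>r. Re ((cnj (phase (ip n r x0)) * ip n r x)\<^sup>2) \<partial>rowm n) = Re ((ip n x0 x)\<^sup>2)"
proof -
  define \<zeta> s where "\<zeta> = ip n x0 x" and "s = sqrt (1 - (cmod \<zeta>)\<^sup>2)"
  let ?v = "\<lambda>q :: complex \<times> complex. cnj (phase (fst q))"
  define f1 where "f1 = (\<lambda>q :: complex \<times> complex. Re (2 * \<zeta> * of_real s * of_real (cmod (fst q)) * (?v q * snd q)))"
  define f2 where "f2 = (\<lambda>q :: complex \<times> complex. Re (of_real (s\<^sup>2) * (?v q * snd q)\<^sup>2))"
  have [measurable]: "f1 \<in> borel_measurable (borel \<Otimes>\<^sub>M borel)" "f2 \<in> borel_measurable (borel \<Otimes>\<^sub>M borel)"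
    unfolding f1_def f2_def by measurable
  have z1: "(\<integral>q. f1 q \<partial>cg2) = 0" by (rule cg2_moment_vanish[of _ "-1"]) (auto simp: f1_def algebra_simps)
  have z2: "(\<integral>q. f2 q \<partial>cg2) = 0" by (rule cg2_moment_vanish[of _ \<i>]) (auto simp: f2_def power_mult_distrib algebra_simps)
  have i1: "integrable cg2 f1"
  proof (rule Bochner_Integration.integrable_bound)
    show "integrable cg2 (\<lambda>q. cmod (2 * \<zeta> * of_real s) * ((cmod (fst q))\<^sup>2 + (cmod (snd q))\<^sup>2))" using cg2_moments by auto
    have "\<bar>f1 q\<bar> \<le> cmod (2 * \<zeta> * of_real s) * ((cmod (fst q))\<^sup>2 + (cmod (snd q))\<^sup>2)" for q
    proof -
      have "\<bar>f1 q\<bar> \<le> cmod (2 * \<zeta> * of_real s * of_real (cmod (fst q)) * (?v q * snd q))"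
        unfolding f1_def by (rule abs_Re_le_cmod)
      also have "\<dots> = cmod (2 * \<zeta> * of_real s) * (cmod (fst q) * cmod (snd q))" by (simp add: norm_mult)
      also have "cmod (fst q) * cmod (snd q) \<le> (cmod (fst q))\<^sup>2 + (cmod (snd q))\<^sup>2"
        using zero_le_power2[of "cmod (fst q) - cmod (snd q)"] zero_le_power2[of "cmod (fst q)"] zero_le_power2[of "cmod (snd q)"]
        unfolding power2_diff by linarith
      finally show ?thesis by (simp add: mult_left_mono)
    qed
    then show "AE q in cg2. norm (f1 q) \<le> norm (cmod (2 * \<zeta> * of_real s) * ((cmod (fst q))\<^sup>2 + (cmod (snd q))\<^sup>2))" by auto
  qed measurable
  have i2: "integrable cg2 f2"
  proof (rule Bochner_Integration.integrable_bound)
    show "integrable cg2 (\<lambda>q. s\<^sup>2 * (cmod (snd q))\<^sup>2)" using cg2_moments by auto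
    have "\<bar>f2 q\<bar> \<le> s\<^sup>2 * (cmod (snd q))\<^sup>2" for q
      unfolding f2_def using abs_Re_le_cmod[of "of_real (s\<^sup>2) * (?v q * snd q)\<^sup>2"] by (simp add: norm_mult norm_power)
    then show "AE q in cg2. norm (f2 q) \<le> norm (s\<^sup>2 * (cmod (snd q))\<^sup>2)" by auto
  qed measurable
  have vg: "?v q * fst q = of_real (cmod (fst q))" for q
  proof (cases "fst q = 0")
    case False
    have "?v q * fst q = fst q * cnj (fst q) / of_real (cmod (fst q))"
      using False by (simp add: phase_def)
    also have "\<dots> = of_real (cmod (fst q))"
      using False unfolding complex_norm_square[symmetric] by (simp add: power2_eq_square)
    finally show ?thesis .
  qed simp
  have "(\<integral>r. Re ((cnj (phase (ip n r x0)) * ip n r x)\<^sup>2) \<partial>rowm n)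
    = (\<integral>q. Re ((?v q * (\<zeta> * fst q + of_real s * snd q))\<^sup>2) \<partial>cg2)"
    using row_integral_pair[of "\<lambda>q. Re ((?v q * snd q)\<^sup>2)" n x0 x] assms by (simp add: \<zeta>_def s_def)
  also have "\<dots> = (\<integral>q. Re (\<zeta>\<^sup>2) * (cmod (fst q))\<^sup>2 + f1 q + f2 q \<partial>cg2)"
  proof (intro Bochner_Integration.integral_cong refl)
    fix q :: "complex \<times> complex"
    have "(?v q * (\<zeta> * fst q + of_real s * snd q))\<^sup>2 = (\<zeta> * (?v q * fst q) + of_real s * (?v q * snd q))\<^sup>2"
      by (simp add: algebra_simps)
    also have "\<dots> = \<zeta>\<^sup>2 * of_real ((cmod (fst q))\<^sup>2) + 2 * \<zeta> * of_real s * of_real (cmod (fst q)) * (?v q * snd q)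
        + of_real (s\<^sup>2) * (?v q * snd q)\<^sup>2"
      unfolding vg by (simp add: power2_eq_square algebra_simps)
    finally have e: "(?v q * (\<zeta> * fst q + of_real s * snd q))\<^sup>2 = \<dots>" .
    show "Re ((?v q * (\<zeta> * fst q + of_real s * snd q))\<^sup>2) = Re (\<zeta>\<^sup>2) * (cmod (fst q))\<^sup>2 + f1 q + f2 q"
      unfolding e f1_def f2_def plus_complex.sel by (simp only: Re_complex_of_real Im_complex_of_real times_complex.sel mult_zero_right diff_zero)
  qed
  also have "\<dots> = Re (\<zeta>\<^sup>2)"
    using cg2_moments i1 i2 z1 z2 by simp
  finally show ?thesis by (simp add: \<zeta>_def)
qed

lemma phase_quad_uniform:
  assumes "0 < \<delta>"
  shows "whp (\<lambda>n m x0 a. \<forall>x. nrm n x = 1 \<longrightarrow>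
    real m * (Re ((ip n x0 x)\<^sup>2) - \<delta>) \<le> (\<Sum>i<m. Re ((cnj (phase (apply_rows n a x0 i)) * apply_rows n a x i)\<^sup>2)))"
proof -
  have "whp (\<lambda>n m x0 a. \<forall>x. nrm n x = 1 \<longrightarrow>
    (\<Sum>i<m. - Re ((cnj (phase (apply_rows n a x0 i)) * apply_rows n a x i)\<^sup>2))
      \<le> real m * ((\<integral>r. - Re ((cnj (phase (ip n r x0)) * ip n r x)\<^sup>2) \<partial>rowm n) + \<delta>))"
  proof (rule uniform_law_upper[of "\<lambda>u p. - Re ((cnj (phase u) * p)\<^sup>2)"])
    show "\<bar>- Re ((cnj (phase u) * p)\<^sup>2)\<bar> \<le> (cmod p)\<^sup>2" for u p
      using abs_Re_le_cmod[of "(cnj (phase u) * p)\<^sup>2"] by (simp add: norm_mult norm_power)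
    show "\<bar>- Re ((cnj (phase u) * p)\<^sup>2) - - Re ((cnj (phase u) * q)\<^sup>2)\<bar> \<le> cmod (p - q) * (cmod p + cmod q)" for u p q
    proof -
      let ?v = "cnj (phase u)"
      have "\<bar>- Re ((?v * p)\<^sup>2) - - Re ((?v * q)\<^sup>2)\<bar> = \<bar>Re ((?v * q)\<^sup>2 - (?v * p)\<^sup>2)\<bar>" by simp
      also have "\<dots> \<le> cmod ((?v * q)\<^sup>2 - (?v * p)\<^sup>2)" by (rule abs_Re_le_cmod)
      also have "(?v * q)\<^sup>2 - (?v * p)\<^sup>2 = ?v\<^sup>2 * ((q - p) * (p + q))" by (simp add: power2_eq_square algebra_simps)
      also have "cmod \<dots> = cmod (p - q) * cmod (p + q)" by (simp add: norm_mult norm_power norm_minus_commute)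
      also have "\<dots> \<le> cmod (p - q) * (cmod p + cmod q)" by (intro mult_left_mono norm_triangle_ineq) auto
      finally show ?thesis .
    qed
  qed (use assms in measurable)
  then show ?thesis
  proof (rule whp_mono[of _ 0], intro allI impI)
    fix n m x0 a x
    assume *: "\<forall>x. nrm n x = 1 \<longrightarrow> (\<Sum>i<m. - Re ((cnj (phase (apply_rows n a x0 i)) * apply_rows n a x i)\<^sup>2))
      \<le> real m * ((\<integral>r. - Re ((cnj (phase (ip n r x0)) * ip n r x)\<^sup>2) \<partial>rowm n) + \<delta>)"
      and n: "nrm n x0 = 1" "nrm n x = 1"
    from *[rule_format, OF n(2)]
    show "real m * (Re ((ip n x0 x)\<^sup>2) - \<delta>) \<le> (\<Sum>i<m. Re ((cnj (phase (apply_rows n a x0 i)) * apply_rows n a x i)\<^sup>2))"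
      unfolding Bochner_Integration.integral_minus phase_quad_mean[OF n] sum_negf
      by (simp only: right_diff_distrib distrib_left)
  qed
qed

text \<open>On the support \<open>1 \<le> sqrt (p / (L * u))\<close>, which gains a factor
  \<open>1 / sqrt L\<close>. AM-GM leaves an exponential moment contributing 64 and an inverse
  moment of at most 9; half of 73 is below 37.\<close>

lemma truncated_mean:
  assumes x0: "nrm n x0 = 1" and x: "nrm n x = 1" and L: "0 < L"
  shows "(\<integral>r. (max 0 (cmod (ip n r x) - L * cmod (ip n r x0)))\<^sup>2 \<partial>rowm n) \<le> 37 / sqrt L"
proof -
  have "(\<integral>\<^sup>+r. ennreal ((max 0 (cmod (ip n r x) - L * cmod (ip n r x0)))\<^sup>2) \<partial>rowm n)
    \<le> (\<integral>\<^sup>+r. ennreal (1 / (2 * sqrt L)) * (ennreal 32 * ennreal (exp (1/2 * (cmod (ip n r x))\<^sup>2)) + ennreal (1 / cmod (ip n r x0))) \<partial>rowm n)"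
  proof (rule nn_integral_mono_AE)
    show "AE r in rowm n. ennreal ((max 0 (cmod (ip n r x) - L * cmod (ip n r x0)))\<^sup>2)
      \<le> ennreal (1 / (2 * sqrt L)) * (ennreal 32 * ennreal (exp (1/2 * (cmod (ip n r x))\<^sup>2)) + ennreal (1 / cmod (ip n r x0)))"
      using AE_row_nonzero[OF x0]
    proof eventually_elim
      case (elim r)
      define u p where "u = cmod (ip n r x0)" and "p = cmod (ip n r x)"
      have u: "0 < u" and p: "0 \<le> p" using elim by (auto simp: u_def p_def)
      have sL: "0 < sqrt L" using L by simp
      have "(max 0 (p - L * u))\<^sup>2 \<le> p\<^sup>2 * sqrt (p / (L * u))"
      proof (cases "p \<le> L * u")
        case True
        then have "max 0 (p - L * u) = 0" by simp
        then show ?thesis using p u L by simp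
      next
        case False
        have "1 \<le> p / (L * u)" using False u L by (simp add: field_simps)
        then have "1 \<le> sqrt (p / (L * u))" by simp
        then have "p\<^sup>2 * 1 \<le> p\<^sup>2 * sqrt (p / (L * u))" by (intro mult_left_mono) auto
        moreover have "(max 0 (p - L * u))\<^sup>2 \<le> p\<^sup>2" using False L u p by (intro power_mono) auto
        ultimately show ?thesis by simp
      qed
      also have "\<dots> = (1 / sqrt L) * ((p\<^sup>2 * sqrt p) * sqrt (1 / u))"
        by (simp add: real_sqrt_divide real_sqrt_mult)
      also have "(p\<^sup>2 * sqrt p) * sqrt (1 / u) \<le> (p\<^sup>2 * sqrt p)\<^sup>2 / 2 + (sqrt (1 / u))\<^sup>2 / 2"
        using zero_le_power2[of "p\<^sup>2 * sqrt p - sqrt (1 / u)"] unfolding power2_diff by simp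
      also have "(p\<^sup>2 * sqrt p)\<^sup>2 = (p\<^sup>2)\<^sup>2 * p" using p by (simp add: power_mult_distrib)
      also have "(p\<^sup>2)\<^sup>2 * p \<le> (32 * exp (p\<^sup>2 / 4)) * exp (p\<^sup>2 / 4)"
      proof (rule mult_mono)
        show "(p\<^sup>2)\<^sup>2 \<le> 32 * exp (p\<^sup>2 / 4)" by (rule square_le_exp) simp
        have "p \<le> 1 + p\<^sup>2 / 4" using zero_le_power2[of "p / 2 - 1"] unfolding power2_diff by (simp add: power_divide)
        also have "\<dots> \<le> exp (p\<^sup>2 / 4)" by (rule exp_ge_add_one_self)
        finally show "p \<le> exp (p\<^sup>2 / 4)" .
      qed (use p in auto)
      also have "\<dots> = 32 * exp (1/2 * p\<^sup>2)" by (simp add: exp_add[symmetric])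
      also have "(sqrt (1 / u))\<^sup>2 = 1 / u" using u by simp
      finally have "(max 0 (p - L * u))\<^sup>2 \<le> 1 / (2 * sqrt L) * (32 * exp (1/2 * p\<^sup>2) + 1 / u)"
        using sL by (simp add: divide_right_mono field_simps)
      then have "ennreal ((max 0 (p - L * u))\<^sup>2) \<le> ennreal (1 / (2 * sqrt L) * (32 * exp (1/2 * p\<^sup>2) + 1 / u))"
        by (rule ennreal_leI)
      also have "\<dots> = ennreal (1 / (2 * sqrt L)) * (ennreal 32 * ennreal (exp (1/2 * p\<^sup>2)) + ennreal (1 / u))"
        using sL u by (subst ennreal_mult', simp) (simp add: ennreal_plus ennreal_mult')
      finally show ?case by (simp add: u_def p_def)
    qed
  qed
  also have "\<dots> = ennreal (1 / (2 * sqrt L)) * (ennreal 32 * (\<integral>\<^sup>+r. ennreal (exp (1/2 * (cmod (ip n r x))\<^sup>2)) \<partial>rowm n)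
      + (\<integral>\<^sup>+r. ennreal (1 / cmod (ip n r x0)) \<partial>rowm n))"
  proof -
    have lin2: "(\<integral>\<^sup>+r. c * (k * f r + g r) \<partial>rowm n) = c * (k * (\<integral>\<^sup>+r. f r \<partial>rowm n) + (\<integral>\<^sup>+r. g r \<partial>rowm n))"
      if [measurable]: "f \<in> borel_measurable (rowm n)" "g \<in> borel_measurable (rowm n)" for c k :: ennreal and f g
      by (simp add: nn_integral_cmult nn_integral_add)
    show ?thesis by (rule lin2) measurable
  qed
  also have "\<dots> \<le> ennreal (1 / (2 * sqrt L)) * (ennreal 32 * ennreal 2 + ennreal 9)"
    using row_exp_moment[OF x, of "1/2"] row_inverse_moment[OF x0]
    by (intro mult_left_mono add_mono) (simp_all del: ennreal_numeral, simp)
  also have "\<dots> = ennreal (1 / (2 * sqrt L) * 73)"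
    by (subst ennreal_mult'[symmetric], simp, subst ennreal_plus[symmetric], simp, simp, subst ennreal_mult'[symmetric]) (use L in auto)
  also have "\<dots> \<le> ennreal (37 / sqrt L)" using L by (intro ennreal_leI) (simp add: field_simps)
  finally have "(\<integral>\<^sup>+r. ennreal ((max 0 (cmod (ip n r x) - L * cmod (ip n r x0)))\<^sup>2) \<partial>rowm n) \<le> ennreal (37 / sqrt L)" .
  then show ?thesis using L by (intro integral_real_bounded) auto
qed

text \<open>The truncation is a continuous substitute for restricting to the rows where
  \<open>A x\<close> is large relative to \<open>A x0\<close>, so it meets the Lipschitz condition
  of \<open>uniform_law_upper\<close>. The value of \<open>L\<close> makes the mean at most
  \<open>\<delta> / 2\<close>.\<close>

lemma truncated_uniform:
  assumes \<delta>: "0 < \<delta>"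
  obtains L where "0 < L" "whp (\<lambda>n m x0 a. \<forall>x. nrm n x = 1 \<longrightarrow>
    (\<Sum>i<m. (max 0 (cmod (apply_rows n a x i) - L * cmod (apply_rows n a x0 i)))\<^sup>2) \<le> real m * \<delta>)"
proof
  define L where "L = (74 / \<delta>)\<^sup>2"
  show L: "0 < L" using \<delta> by (simp add: L_def)
  have sL: "37 / sqrt L = \<delta> / 2" using \<delta> by (simp add: L_def)
  have m1: "\<bar>max 0 (cmod p - t) - max 0 (cmod q - t)\<bar> \<le> cmod (p - q)" for p q :: complex and t
    using norm_triangle_ineq3[of p q] by linarith
  have "whp (\<lambda>n m x0 a. \<forall>x. nrm n x = 1 \<longrightarrow>
    (\<Sum>i<m. (max 0 (cmod (apply_rows n a x i) - L * cmod (apply_rows n a x0 i)))\<^sup>2)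
      \<le> real m * ((\<integral>r. (max 0 (cmod (ip n r x) - L * cmod (ip n r x0)))\<^sup>2 \<partial>rowm n) + \<delta> / 2))"
  proof (rule uniform_law_upper[of "\<lambda>u p. (max 0 (cmod p - L * cmod u))\<^sup>2"])
    have le: "max 0 (cmod p - L * cmod u) \<le> cmod p" for u p :: complex using L by simp
    show "\<bar>(max 0 (cmod p - L * cmod u))\<^sup>2\<bar> \<le> (cmod p)\<^sup>2" for u p :: complex
      using power_mono[OF le, of p u 2] by simp
    show "\<bar>(max 0 (cmod p - L * cmod u))\<^sup>2 - (max 0 (cmod q - L * cmod u))\<^sup>2\<bar> \<le> cmod (p - q) * (cmod p + cmod q)" for u p q :: complex
    proof -
      let ?a = "max 0 (cmod p - L * cmod u)" and ?b = "max 0 (cmod q - L * cmod u)"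
      have "\<bar>?a\<^sup>2 - ?b\<^sup>2\<bar> = \<bar>?a - ?b\<bar> * (?a + ?b)"
        by (simp only: power2_eq_square square_diff_square_factored abs_mult) simp
      also have "\<dots> \<le> cmod (p - q) * (cmod p + cmod q)"
        by (intro mult_mono add_mono m1 le) auto
      finally show ?thesis .
    qed
    show "0 < \<delta> / 2" using \<delta> by simp
  qed measurable
  then show "whp (\<lambda>n m x0 a. \<forall>x. nrm n x = 1 \<longrightarrow>
    (\<Sum>i<m. (max 0 (cmod (apply_rows n a x i) - L * cmod (apply_rows n a x0 i)))\<^sup>2) \<le> real m * \<delta>)"
  proof (rule whp_mono[of _ 0], intro allI impI)
    fix n m x0 a x
    assume *: "\<forall>x. nrm n x = 1 \<longrightarrow> (\<Sum>i<m. (max 0 (cmod (apply_rows n a x i) - L * cmod (apply_rows n a x0 i)))\<^sup>2)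
      \<le> real m * ((\<integral>r. (max 0 (cmod (ip n r x) - L * cmod (ip n r x0)))\<^sup>2 \<partial>rowm n) + \<delta> / 2)"
      and x0: "nrm n x0 = 1" and x: "nrm n x = 1"
    have "(\<Sum>i<m. (max 0 (cmod (apply_rows n a x i) - L * cmod (apply_rows n a x0 i)))\<^sup>2)
      \<le> real m * ((\<integral>r. (max 0 (cmod (ip n r x) - L * cmod (ip n r x0)))\<^sup>2 \<partial>rowm n) + \<delta> / 2)"
      using * x by blast
    also have "\<dots> \<le> real m * \<delta>"
      using truncated_mean[OF x0 x L] sL by (intro mult_left_mono) auto
    finally show "(\<Sum>i<m. (max 0 (cmod (apply_rows n a x i) - L * cmod (apply_rows n a x0 i)))\<^sup>2) \<le> real m * \<delta>" .
  qed
qed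

subsection \<open>One ap_step of alternating projections\<close>

text \<open>The pseudo-inverse enters only through the normal equations, tested against every
  \<open>A w\<close>, and the phase only through a selection. In this form a step is equivariant
  under rotation, also at rows where the measurement vanishes.\<close>

definition ap_step :: "nat \<Rightarrow> nat \<Rightarrow> (nat \<times> nat \<Rightarrow> complex) \<Rightarrow> (nat \<Rightarrow> complex) \<Rightarrow> (nat \<Rightarrow> complex) \<Rightarrow> (nat \<Rightarrow> complex) \<Rightarrow> bool" where
  "ap_step n m a x0 x z \<longleftrightarrow> (\<exists>f. selection m (apply_rows n a x) f \<and>
     (\<forall>w. (\<Sum>i<m. cnj (apply_rows n a w i) * apply_rows n a z i)
        = (\<Sum>i<m. cnj (apply_rows n a w i) * (of_real (cmod (apply_rows n a x0 i)) * f i))))"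

text \<open>Allows the current iterate to be normalized and aligned with \<open>x0\<close> before
  the estimates for unit vectors are applied.\<close>

lemma step_scale:
  assumes "ap_step n m a x0 x z" and t: "0 < t" and w: "cmod w = 1"
  shows "ap_step n m a x0 (\<lambda>j. of_real t * w * x j) (\<lambda>j. w * z j)"
proof -
  let ?A = "apply_rows n a"
  obtain f where f: "selection m (?A x) f"
    "\<And>v. (\<Sum>i<m. cnj (?A v i) * ?A z i) = (\<Sum>i<m. cnj (?A v i) * (of_real (cmod (?A x0 i)) * f i))"
    using assms(1) unfolding ap_step_def by blast
  show ?thesis unfolding ap_step_def
  proof (intro exI[of _ "\<lambda>i. w * f i"] conjI allI)
    show "selection m (?A (\<lambda>j. of_real t * w * x j)) (\<lambda>i. w * f i)"
      unfolding selection_def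
    proof (intro allI impI conjI)
      fix i assume "i < m"
      then have fi: "cmod (f i) = 1" "?A x i = of_real (cmod (?A x i)) * f i" using f(1) by (auto simp: selection_def)
      show "cmod (w * f i) = 1" using fi w by (simp add: norm_mult)
      have A: "?A (\<lambda>j. of_real t * w * x j) i = of_real t * w * ?A x i" by (simp only: apply_rows_scale)
      have N: "cmod (?A (\<lambda>j. of_real t * w * x j) i) = t * cmod (?A x i)"
        unfolding A using t w by (simp add: norm_mult)
      have "of_real t * w * ?A x i = of_real t * w * (of_real (cmod (?A x i)) * f i)"
        using fi(2) by (rule arg_cong)
      then have "?A (\<lambda>j. of_real t * w * x j) i = of_real (t * cmod (?A x i)) * (w * f i)"
        unfolding A by (simp add: mult_ac)
      then show "?A (\<lambda>j. of_real t * w * x j) i = of_real (cmod (?A (\<lambda>j. of_real t * w * x j) i)) * (w * f i)"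
        unfolding N .
    qed
    fix v
    have "(\<Sum>i<m. cnj (?A v i) * ?A (\<lambda>j. w * z j) i) = w * (\<Sum>i<m. cnj (?A v i) * ?A z i)"
      unfolding apply_rows_scale sum_distrib_left by (simp add: mult_ac)
    also have "\<dots> = (\<Sum>i<m. cnj (?A v i) * (of_real (cmod (?A x0 i)) * (w * f i)))"
      unfolding f(2) sum_distrib_left by (simp add: mult_ac)
    finally show "(\<Sum>i<m. cnj (?A v i) * ?A (\<lambda>j. w * z j) i) = (\<Sum>i<m. cnj (?A v i) * (of_real (cmod (?A x0 i)) * (w * f i)))" .
  qed
qed

text \<open>The hypothesis says that \<open>b - v\<close> is orthogonal to \<open>v\<close>;
  Cauchy-Schwarz does the rest.\<close>

lemma projection_bound:
  fixes v b :: "nat \<Rightarrow> complex"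
  assumes "(\<Sum>i<m. cnj (v i) * v i) = (\<Sum>i<m. cnj (v i) * b i)"
  shows "nrm m v \<le> nrm m b"
proof -
  have "complex_of_real ((nrm m v)\<^sup>2) = (\<Sum>i<m. cnj (v i) * v i)"
    unfolding nrm_sq of_real_sum complex_norm_square by (simp add: mult.commute)
  also have "\<dots> = lin_form {..<m} v b" unfolding assms lin_form_def ..
  finally have "cmod (complex_of_real ((nrm m v)\<^sup>2)) \<le> nrm m v * nrm m b"
    using ip_cauchy[of m v b] by simp
  then have "(nrm m v)\<^sup>2 \<le> nrm m v * nrm m b" by (simp only: norm_of_real abs_of_nonneg zero_le_power2)
  then show ?thesis
    using nrm_nonneg[of m v] nrm_nonneg[of m b] by (cases "nrm m v = 0") (auto simp: power2_eq_square)
qed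

lemma nrm_cong: "(\<And>i. i < m \<Longrightarrow> cmod (u i) = cmod (v i)) \<Longrightarrow> nrm m u = nrm m v"
  by (simp add: nrm_def)

lemma step_norm:
  assumes "ap_step n m a x0 x z"
  shows "nrm m (apply_rows n a z) \<le> nrm m (apply_rows n a x0)"
proof -
  let ?A = "apply_rows n a"
  obtain f where f: "selection m (?A x) f"
    "\<And>v. (\<Sum>i<m. cnj (?A v i) * ?A z i) = (\<Sum>i<m. cnj (?A v i) * (of_real (cmod (?A x0 i)) * f i))"
    using assms(1) unfolding ap_step_def by blast
  have "nrm m (?A z) \<le> nrm m (\<lambda>i. of_real (cmod (?A x0 i)) * f i)"
    by (rule projection_bound[OF f(2)])
  also have "\<dots> = nrm m (?A x0)"
    using f(1) by (intro nrm_cong) (auto simp: selection_def norm_mult)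
  finally show ?thesis .
qed

text \<open>\<open>A x0\<close> lies in the range of \<open>A\<close>, so \<open>A (z - x0)\<close>
  is the orthogonal projection of the error of the data.\<close>

lemma step_error:
  assumes "ap_step n m a x0 x z"
  obtains f where "selection m (apply_rows n a x) f"
    "nrm m (apply_rows n a (\<lambda>j. z j - x0 j)) \<le> nrm m (\<lambda>i. of_real (cmod (apply_rows n a x0 i)) * f i - apply_rows n a x0 i)"
proof -
  let ?A = "apply_rows n a"
  obtain f where f: "selection m (?A x) f"
    "\<And>v. (\<Sum>i<m. cnj (?A v i) * ?A z i) = (\<Sum>i<m. cnj (?A v i) * (of_real (cmod (?A x0 i)) * f i))"
    using assms(1) unfolding ap_step_def by blast
  let ?w = "\<lambda>j. z j - x0 j"
  have "(\<Sum>i<m. cnj (?A ?w i) * ?A ?w i) = (\<Sum>i<m. cnj (?A ?w i) * ?A z i) - (\<Sum>i<m. cnj (?A ?w i) * ?A x0 i)"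
    unfolding sum_subtractf[symmetric] right_diff_distrib[symmetric] by (simp only: apply_rows_diff)
  also have "\<dots> = (\<Sum>i<m. cnj (?A ?w i) * (of_real (cmod (?A x0 i)) * f i - ?A x0 i))"
    unfolding f(2) by (simp add: sum_subtractf right_diff_distrib)
  finally have "nrm m (?A ?w) \<le> nrm m (\<lambda>i. of_real (cmod (?A x0 i)) * f i - ?A x0 i)"
    by (rule projection_bound)
  then show thesis by (rule that[OF f(1)])
qed

text \<open>If \<open>cmod w\<close> is at most a tenth of \<open>cmod u\<close>, rotate
  \<open>u\<close> to be positive: the error is the deviation of a unimodular number from 1,
  controlled by its imaginary part. Otherwise the error is at most \<open>2 * cmod w\<close>, and
  subtracting \<open>cmod u / 20\<close> removes at most half of \<open>cmod w\<close>, whence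
  \<open>16 = 4\<^sup>2\<close>.\<close>

lemma phase_perturbation:
  fixes u w f :: complex
  assumes f: "cmod f = 1" "u + w = of_real (cmod (u + w)) * f"
  shows "(cmod (of_real (cmod u) * f - u))\<^sup>2
    \<le> 110 / 81 * (Im (cnj (phase u) * w))\<^sup>2 + 16 * (max 0 (cmod w - cmod u / 20))\<^sup>2"
proof -
  define r where "r = cmod u"
  have r0: "0 \<le> r" by (simp add: r_def)
  show ?thesis
  proof (cases "cmod w \<le> r / 10")
    case False
    have "cmod (of_real r * f - u) = cmod (of_real (r - cmod (u + w)) * f + w)"
      using f(2) by (simp add: algebra_simps)
    also have "\<dots> \<le> \<bar>r - cmod (u + w)\<bar> + cmod w"
      by (rule order.trans[OF norm_triangle_ineq]) (simp only: norm_mult f(1) norm_of_real mult_1_right order_refl)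
    also have "\<bar>r - cmod (u + w)\<bar> \<le> cmod w"
      using norm_triangle_ineq3[of u "u + w"] by (simp add: r_def)
    finally have "cmod (of_real r * f - u) \<le> 2 * cmod w" by simp
    also have "2 * cmod w \<le> 4 * max 0 (cmod w - r / 20)"
      using False r0 by (auto simp: max_def field_simps)
    finally have "(cmod (of_real r * f - u))\<^sup>2 \<le> (4 * max 0 (cmod w - r / 20))\<^sup>2" by (intro power_mono) auto
    also have "\<dots> = 16 * (max 0 (cmod w - r / 20))\<^sup>2" by (simp add: power_mult_distrib)
    finally show ?thesis unfolding r_def by (rule order.trans) simp
  next
    case True
    show ?thesis
    proof (cases "r = 0")
      case True
      then show ?thesis by (simp add: r_def)
    next
      case False
      then have r: "0 < r" using r0 by simp
      define v where "v = cnj (phase u)"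
      define \<omega> g t where "\<omega> = v * w" and "g = v * f" and "t = cmod (u + w)"
      have vu: "v * u = of_real r"
      proof -
        have "v * u = u * cnj u / of_real (cmod u)" using False by (simp add: v_def phase_def r_def)
        also have "\<dots> = of_real r" using False unfolding complex_norm_square[symmetric] by (simp add: r_def power2_eq_square)
        finally show ?thesis .
      qed
      have v1: "cmod v = 1" by (simp add: v_def)
      have g1: "cmod g = 1" by (simp add: g_def norm_mult v1 f(1))
      have tg: "of_real r + \<omega> = of_real t * g"
      proof -
        have "v * (u + w) = v * (of_real t * f)" using f(2) unfolding t_def by (rule arg_cong)
        then have "v * u + v * w = of_real t * (v * f)" by (simp add: algebra_simps)
        then show ?thesis unfolding vu \<omega>_def g_def .
      qed
      have w\<omega>: "cmod \<omega> \<le> r / 10" using True by (simp add: \<omega>_def norm_mult v1)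
      have t: "9/10 * r \<le> t" "t \<le> 11/10 * r"
        using True norm_triangle_ineq[of u w] norm_diff_ineq[of u w] by (auto simp: t_def r_def)
      have tRe: "t * Re g = r + Re \<omega>" and tIm: "t * Im g = Im \<omega>"
        using arg_cong[OF tg, of Re] arg_cong[OF tg, of Im] by auto
      have "9/10 * r \<le> t * Re g" unfolding tRe using abs_Re_le_cmod[of \<omega>] w\<omega> by linarith
      also have "t * Re g \<le> 11/10 * r * Re g"
      proof -
        have "0 < t * Re g" using calculation r by linarith
        then have "0 \<le> Re g" using t r by (simp add: zero_less_mult_iff)
        then show ?thesis using t by (intro mult_right_mono) auto
      qed
      finally have Reg: "9/11 \<le> Re g" using r by simp
      have un: "(Re g)\<^sup>2 + (Im g)\<^sup>2 = 1" using g1 by (metis cmod_power2 one_power2)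
      have e: "(cmod (of_real r * f - u))\<^sup>2 = r\<^sup>2 * (2 - 2 * Re g)"
      proof -
        have "cmod (of_real r * f - u) = cmod (v * (of_real r * f - u))" by (simp add: norm_mult v1)
        also have "v * (of_real r * f - u) = of_real r * (g - 1)"
          unfolding right_diff_distrib vu g_def by (simp add: mult_ac)
        also have "cmod \<dots> = r * cmod (g - 1)" using r by (simp add: norm_mult)
        finally have "(cmod (of_real r * f - u))\<^sup>2 = r\<^sup>2 * (cmod (g - 1))\<^sup>2" by (simp add: power_mult_distrib)
        also have "(cmod (g - 1))\<^sup>2 = 2 - 2 * Re g"
          using un by (simp add: cmod_power2 power2_diff)
        finally show ?thesis .
      qed
      \<comment> \<open>As \<open>Re g \<ge> 9/11\<close>, the factor \<open>1 + Re g\<close> of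
        \<open>(Im g)\<^sup>2\<close> is at least 20/11. Together with
        \<open>t \<ge> 9/10 * r\<close> this accounts for
        \<open>110 / 81 = 11/10 * 100/81\<close>.\<close>
      have "2 - 2 * Re g \<le> 11/10 * (Im g)\<^sup>2"
      proof -
        have R1: "Re g \<le> 1" using abs_Re_le_cmod[of g] g1 by simp
        have "(Im g)\<^sup>2 = (1 - Re g) * (1 + Re g)" using un by (simp add: power2_eq_square algebra_simps)
        also have "\<dots> \<ge> (1 - Re g) * (20/11)" using R1 Reg by (intro mult_left_mono) auto
        finally show ?thesis by simp
      qed
      then have "(cmod (of_real r * f - u))\<^sup>2 \<le> r\<^sup>2 * (11/10 * (Im g)\<^sup>2)"
        unfolding e by (intro mult_left_mono) auto
      also have "\<dots> = 11/10 * (100/81) * ((9/10 * r)\<^sup>2 * (Im g)\<^sup>2)" by (simp add: power2_eq_square)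
      also have "\<dots> \<le> 11/10 * (100/81) * (t\<^sup>2 * (Im g)\<^sup>2)"
        using t r by (intro mult_left_mono mult_right_mono power_mono) auto
      also have "t\<^sup>2 * (Im g)\<^sup>2 = (Im \<omega>)\<^sup>2" unfolding tIm[symmetric] by (simp add: power_mult_distrib)
      finally show ?thesis unfolding r_def \<omega>_def v_def by (simp add: add_increasing2)
    qed
  qed
qed

text \<open>All that is used of the randomness; the consequences below are deterministic. The
  quadratic estimates have constant precision \<open>\<epsilon>\<close>, the two correlation
  estimates the finer \<open>\<delta> / sqrt n\<close>.\<close>

definition good_rows :: "real \<Rightarrow> real \<Rightarrow> real \<Rightarrow> nat \<Rightarrow> nat \<Rightarrow> (nat \<Rightarrow> complex) \<Rightarrow> (nat \<times> nat \<Rightarrow> complex) \<Rightarrow> bool" where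
  "good_rows \<delta> \<epsilon> L n m x0 a \<longleftrightarrow>
    (\<forall>x. nrm n x = 1 \<longrightarrow> real m * (1 - \<epsilon>) \<le> (\<Sum>i<m. (cmod (apply_rows n a x i))\<^sup>2) \<and> (\<Sum>i<m. (cmod (apply_rows n a x i))\<^sup>2) \<le> real m * (1 + \<epsilon>)) \<and>
    (\<forall>x c f. nrm n x = 1 \<longrightarrow> ip n x0 x = of_real c \<longrightarrow> 1 / sqrt (real n) \<le> c \<longrightarrow>
     selection m (apply_rows n a x) f \<longrightarrow> real m * (c * (1 + gain * (1 - c\<^sup>2)\<^sup>2) - \<delta> / sqrt (real n))
       \<le> (\<Sum>i<m. cmod (apply_rows n a x0 i) * Re (cnj (apply_rows n a x0 i) * f i))) \<and>
    (\<forall>x. nrm n x = 1 \<longrightarrow>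
     (\<Sum>i<m. Re (cnj (apply_rows n a x0 i) * apply_rows n a x i)) \<le> real m * (Re (ip n x0 x) + \<delta> / sqrt (real n))) \<and>
    (\<forall>x. nrm n x = 1 \<longrightarrow>
    real m * (Re ((ip n x0 x)\<^sup>2) - \<epsilon>) \<le> (\<Sum>i<m. Re ((cnj (phase (apply_rows n a x0 i)) * apply_rows n a x i)\<^sup>2))) \<and>
    (\<forall>x. nrm n x = 1 \<longrightarrow>
    (\<Sum>i<m. (max 0 (cmod (apply_rows n a x i) - L * cmod (apply_rows n a x0 i)))\<^sup>2) \<le> real m * \<epsilon>)"

text \<open>\<open>L\<close> depends on \<open>\<epsilon>\<close> only. The order matters: the
  contraction radius is limited by \<open>1 / L\<close>, and \<open>\<delta>\<close> is later chosen
  small relative to that radius.\<close>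

lemma good_whp:
  assumes "0 < \<epsilon>"
  obtains L where "0 < L" "\<And>\<delta>. 0 < \<delta> \<Longrightarrow> whp (good_rows \<delta> \<epsilon> L)"
proof -
  obtain L where L: "0 < L" "whp (\<lambda>n m x0 a. \<forall>x. nrm n x = 1 \<longrightarrow>
    (\<Sum>i<m. (max 0 (cmod (apply_rows n a x i) - L * cmod (apply_rows n a x0 i)))\<^sup>2) \<le> real m * \<epsilon>)"
    by (rule truncated_uniform[OF assms])
  have "whp (good_rows \<delta> \<epsilon> L)" if "0 < \<delta>" for \<delta>
    unfolding good_rows_def[abs_def]
    by (intro whp_conj quad_uniform phase_uniform lin_uniform phase_quad_uniform L assms that)
  with L(1) show thesis by (rule that)
qed

lemma unit_multiple:
  assumes "nrm n x \<noteq> 0"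
  obtains d where "nrm n d = 1" "x = (\<lambda>j. of_real (nrm n x) * d j)"
proof
  let ?d = "\<lambda>j. complex_of_real (1 / nrm n x) * x j"
  show "nrm n ?d = 1" unfolding nrm_scale norm_of_real using assms by simp
  show "x = (\<lambda>j. of_real (nrm n x) * ?d j)" using assms by (simp add: fun_eq_iff)
qed

lemma good_norm:
  assumes g: "good_rows \<delta> \<epsilon> L n m x0 a"
  shows "real m * (1 - \<epsilon>) * (nrm n x)\<^sup>2 \<le> (nrm m (apply_rows n a x))\<^sup>2"
    and "(nrm m (apply_rows n a x))\<^sup>2 \<le> real m * (1 + \<epsilon>) * (nrm n x)\<^sup>2"
proof -
  have "real m * (1 - \<epsilon>) * (nrm n x)\<^sup>2 \<le> (nrm m (apply_rows n a x))\<^sup>2 \<and>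
     (nrm m (apply_rows n a x))\<^sup>2 \<le> real m * (1 + \<epsilon>) * (nrm n x)\<^sup>2"
  proof (cases "nrm n x = 0")
    case True
    have "nrm m (apply_rows n a x) = 0" using apply_rows_zero[OF True, of a] by (simp add: nrm_def)
    then show ?thesis using True by simp
  next
    case False
    then obtain d where d: "nrm n d = 1" "x = (\<lambda>j. of_real (nrm n x) * d j)" by (rule unit_multiple)
    have e: "(nrm m (apply_rows n a x))\<^sup>2 = (nrm n x)\<^sup>2 * (\<Sum>i<m. (cmod (apply_rows n a d i))\<^sup>2)"
      by (subst d(2)) (simp only: apply_rows_scale nrm_scale norm_of_real power_mult_distrib power2_abs nrm_sq)
    have "real m * (1 - \<epsilon>) \<le> (\<Sum>i<m. (cmod (apply_rows n a d i))\<^sup>2)" "(\<Sum>i<m. (cmod (apply_rows n a d i))\<^sup>2) \<le> real m * (1 + \<epsilon>)"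
      using g d(1) unfolding good_rows_def by blast+
    from mult_left_mono[OF this(1), of "(nrm n x)\<^sup>2"] mult_left_mono[OF this(2), of "(nrm n x)\<^sup>2"]
    show ?thesis unfolding e by (simp add: mult_ac)
  qed
  then show "real m * (1 - \<epsilon>) * (nrm n x)\<^sup>2 \<le> (nrm m (apply_rows n a x))\<^sup>2"
    "(nrm m (apply_rows n a x))\<^sup>2 \<le> real m * (1 + \<epsilon>) * (nrm n x)\<^sup>2" by auto
qed

lemma good_linear:
  assumes g: "good_rows \<delta> \<epsilon> L n m x0 a"
  shows "(\<Sum>i<m. Re (cnj (apply_rows n a x0 i) * apply_rows n a z i))
    \<le> real m * (Re (ip n x0 z) + \<delta> / sqrt (real n) * nrm n z)"
proof (cases "nrm n z = 0")
  case True
  have "ip n x0 z = 0" using ip_cauchy[of n x0 z] True by simp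
  then show ?thesis using apply_rows_zero[OF True, of a] True by simp
next
  case False
  then obtain d where d: "nrm n d = 1" "z = (\<lambda>j. of_real (nrm n z) * d j)" by (rule unit_multiple)
  have A: "apply_rows n a z i = of_real (nrm n z) * apply_rows n a d i" for i
    by (subst d(2)) (simp only: apply_rows_scale)
  have I: "ip n x0 z = of_real (nrm n z) * ip n x0 d"
    by (subst d(2)) (simp only: lin_scale)
  have "(\<Sum>i<m. Re (cnj (apply_rows n a x0 i) * apply_rows n a z i)) = nrm n z * (\<Sum>i<m. Re (cnj (apply_rows n a x0 i) * apply_rows n a d i))"
    unfolding A sum_distrib_left by (intro sum.cong refl) (simp add: algebra_simps)
  also have "\<dots> \<le> nrm n z * (real m * (Re (ip n x0 d) + \<delta> / sqrt (real n)))"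
    using g d(1) unfolding good_rows_def by (intro mult_left_mono) auto
  also have "\<dots> = real m * (Re (ip n x0 z) + \<delta> / sqrt (real n) * nrm n z)"
    unfolding I by (simp add: algebra_simps)
  finally show ?thesis .
qed

text \<open>The norm of \<open>A z\<close> is at most that of \<open>A x0\<close>, so the isometry
  bounds give \<open>(1 + \<epsilon>) / (1 - \<epsilon>)\<close> for the squared norm, which for
  \<open>\<epsilon> \<le> 1/2\<close> is at most
  \<open>(1 + 2 * \<epsilon>)\<^sup>2\<close>.\<close>

lemma step_norm_upper:
  assumes g: "good_rows \<delta> \<epsilon> L n m x0 a" and e: "0 < \<epsilon>" "\<epsilon> \<le> 1/2" and x0: "nrm n x0 = 1" and m: "0 < m"
    and s: "ap_step n m a x0 x z"
  shows "nrm n z \<le> 1 + 2 * \<epsilon>"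
proof -
  have "real m * (1 - \<epsilon>) * (nrm n z)\<^sup>2 \<le> (nrm m (apply_rows n a z))\<^sup>2" by (rule good_norm[OF g])
  also have "\<dots> \<le> (nrm m (apply_rows n a x0))\<^sup>2" using step_norm[OF s] by (intro power_mono) auto
  also have "\<dots> \<le> real m * (1 + \<epsilon>)" using good_norm(2)[OF g, of x0] x0 by simp
  finally have "(1 - \<epsilon>) * (nrm n z)\<^sup>2 \<le> 1 + \<epsilon>" using m by simp
  also have "1 + \<epsilon> \<le> (1 - \<epsilon>) * (1 + 2 * \<epsilon>)\<^sup>2"
  proof -
    have "(1 - \<epsilon>) * (1 + 2 * \<epsilon>)\<^sup>2 = 1 + \<epsilon> + 2 * \<epsilon> * (1 - 2 * \<epsilon> * \<epsilon>)"
      by (simp add: power2_eq_square algebra_simps)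
    moreover have "\<epsilon> * \<epsilon> \<le> 1/2 * (1/2)" using e by (intro mult_mono) auto
    then have "0 \<le> 2 * \<epsilon> * (1 - 2 * \<epsilon> * \<epsilon>)" using e by (intro mult_nonneg_nonneg) auto
    ultimately show ?thesis by linarith
  qed
  finally have "(nrm n z)\<^sup>2 \<le> (1 + 2 * \<epsilon>)\<^sup>2" using e by simp
  then show ?thesis by (rule power2_le_imp_le) (use e in simp)
qed

lemma norm_times_phase: "z = of_real (cmod z) * phase z"
  by (simp add: phase_def)

lemma aligned_unit_vector:
  fixes x0 x :: "nat \<Rightarrow> complex"
  assumes nx: "nrm n x \<noteq> 0"
  defines "c \<equiv> cmod (ip n x0 x) / nrm n x" and "\<omega> \<equiv> cnj (phase (ip n x0 x))"
  defines "x' \<equiv> \<lambda>j. of_real (1 / nrm n x) * \<omega> * x j"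
  shows "nrm n x' = 1" "ip n x0 x' = of_real c" "cmod \<omega> = 1"
proof -
  show w: "cmod \<omega> = 1" by (simp add: \<omega>_def)
  show "nrm n x' = 1" unfolding x'_def nrm_scale norm_mult w norm_of_real using nx by simp
  have "\<omega> * ip n x0 x = of_real (cmod (ip n x0 x))"
  proof -
    have "\<omega> * ip n x0 x = of_real (cmod (ip n x0 x)) * (phase (ip n x0 x) * cnj (phase (ip n x0 x)))"
      by (subst (2) norm_times_phase) (simp add: \<omega>_def mult_ac)
    also have "phase (ip n x0 x) * cnj (phase (ip n x0 x)) = 1" by (simp add: complex_norm_square[symmetric])
    finally show ?thesis by simp
  qed
  then show "ip n x0 x' = of_real c"
    unfolding x'_def lin_scale c_def by (simp add: mult.assoc of_real_divide)
qed

lemma step_correlation: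
  assumes g: "good_rows \<delta> \<epsilon> L n m x0 a" and nx: "nrm n x \<noteq> 0"
    and s: "ap_step n m a x0 x z"
  defines "c \<equiv> cmod (ip n x0 x) / nrm n x" and "\<omega> \<equiv> cnj (phase (ip n x0 x))"
  assumes c: "1 / sqrt (real n) \<le> c"
  shows "real m * (c * (1 + gain * (1 - c\<^sup>2)\<^sup>2) - \<delta> / sqrt (real n))
     \<le> (\<Sum>i<m. Re (cnj (apply_rows n a x0 i) * apply_rows n a (\<lambda>j. \<omega> * z j) i))"
proof -
  let ?A = "apply_rows n a"
  define x' where "x' = (\<lambda>j. of_real (1 / nrm n x) * \<omega> * x j)"
  note al = aligned_unit_vector[OF nx, of x0, folded c_def \<omega>_def, folded x'_def]
  have "0 < 1 / nrm n x" using nx less_le[of 0 "nrm n x"] by simp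
  then have "ap_step n m a x0 x' (\<lambda>j. \<omega> * z j)" unfolding x'_def by (rule step_scale[OF s _ al(3)])
  then obtain f where f: "selection m (?A x') f"
    "\<And>v. (\<Sum>i<m. cnj (?A v i) * ?A (\<lambda>j. \<omega> * z j) i) = (\<Sum>i<m. cnj (?A v i) * (of_real (cmod (?A x0 i)) * f i))"
    unfolding ap_step_def by blast
  have "real m * (c * (1 + gain * (1 - c\<^sup>2)\<^sup>2) - \<delta> / sqrt (real n))
       \<le> (\<Sum>i<m. cmod (?A x0 i) * Re (cnj (?A x0 i) * f i))"
    using g al c f(1) unfolding good_rows_def by blast
  also have "\<dots> = Re (\<Sum>i<m. cnj (?A x0 i) * (of_real (cmod (?A x0 i)) * f i))"
    unfolding Re_sum by (intro sum.cong refl) (simp add: algebra_simps)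
  also have "\<dots> = (\<Sum>i<m. Re (cnj (?A x0 i) * ?A (\<lambda>j. \<omega> * z j) i))"
    unfolding f(2)[symmetric] Re_sum ..
  finally show ?thesis .
qed

text \<open>As \<open>c \<ge> 1 / sqrt n\<close>, the absolute errors are relative ones, in total at
  most \<open>3 * \<delta> * c \<le> \<gamma> * c\<close>. Away from 1 the gain is at least
  \<open>4 * \<gamma>\<close>, so the factor \<open>1 + 3 * \<gamma>\<close> remains. Normalizing
  costs at most \<open>1 + \<gamma>\<close>, and
  \<open>(1 + \<gamma>)\<^sup>2 \<le> 1 + 3 * \<gamma>\<close>.\<close>

lemma correlation_growth:
  assumes g: "good_rows \<delta> \<epsilon> L n m x0 a" and e: "0 < \<epsilon>" "\<epsilon> \<le> 1/2" and x0: "nrm n x0 = 1" and m: "0 < m"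
    and nx: "nrm n x \<noteq> 0" and s: "ap_step n m a x0 x z" and \<delta>: "0 < \<delta>"
    and c: "1 / sqrt (real n) \<le> cmod (ip n x0 x) / nrm n x" "cmod (ip n x0 x) / nrm n x \<le> 1 - \<eta>" and \<eta>: "0 < \<eta>" "\<eta> < 1"
    and \<gamma>: "0 < \<gamma>" "\<gamma> \<le> 1" "4 * \<gamma> \<le> gain * \<eta>\<^sup>2" "3 * \<delta> \<le> \<gamma>" "2 * \<epsilon> \<le> \<gamma>" and n: "0 < n"
  shows "nrm n z \<noteq> 0" "(1 + \<gamma>) * (cmod (ip n x0 x) / nrm n x) \<le> cmod (ip n x0 z) / nrm n z"
proof -
  define c where "c = cmod (ip n x0 x) / nrm n x"
  define \<omega> where "\<omega> = cnj (phase (ip n x0 x))"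
  have w: "cmod \<omega> = 1" by (simp add: \<omega>_def)
  have sn: "0 < 1 / sqrt (real n)" using n by simp
  have c0: "0 < c" using c(1) sn unfolding c_def by linarith
  have zn: "nrm n z \<le> 1 + 2 * \<epsilon>" by (rule step_norm_upper[OF g e x0 m s])
  let ?z = "\<lambda>j. \<omega> * z j"
  have "real m * (c * (1 + gain * (1 - c\<^sup>2)\<^sup>2) - \<delta> / sqrt (real n)) \<le> real m * (Re (ip n x0 ?z) + \<delta> / sqrt (real n) * nrm n ?z)"
    using step_correlation[OF g nx s c(1)] good_linear[OF g, of ?z] unfolding c_def \<omega>_def by linarith
  then have "c * (1 + gain * (1 - c\<^sup>2)\<^sup>2) - \<delta> / sqrt (real n) \<le> Re (ip n x0 ?z) + \<delta> / sqrt (real n) * nrm n ?z"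
    using m by simp
  also have "nrm n ?z = nrm n z" by (simp add: nrm_scale w)
  also have "Re (ip n x0 ?z) \<le> cmod (ip n x0 z)"
    using complex_Re_le_cmod[of "ip n x0 ?z"] by (simp add: lin_scale norm_mult w)
  also have "\<delta> / sqrt (real n) * nrm n z \<le> \<delta> * c * 2"
  proof -
    have "\<delta> * (1 / sqrt (real n)) \<le> \<delta> * c" using c(1) \<delta> unfolding c_def by (intro mult_left_mono) auto
    then show ?thesis using zn e c0 \<delta> by (intro mult_mono) auto
  qed
  finally have A: "c * (1 + gain * (1 - c\<^sup>2)\<^sup>2) - \<delta> / sqrt (real n) \<le> cmod (ip n x0 z) + \<delta> * c * 2" by simp
  have B: "\<delta> / sqrt (real n) \<le> \<delta> * c" using mult_left_mono[OF c(1), of \<delta>] \<delta> unfolding c_def by simp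
  have "\<eta> \<le> 1 - c\<^sup>2"
  proof -
    have "c\<^sup>2 \<le> c" using c0 c(2) \<eta> unfolding c_def[symmetric] by (simp add: power2_eq_square mult_left_le)
    then show ?thesis using c(2) unfolding c_def[symmetric] by linarith
  qed
  then have "gain * \<eta>\<^sup>2 \<le> gain * (1 - c\<^sup>2)\<^sup>2" using \<eta> gain_pos by (intro mult_left_mono power_mono) auto
  then have "c * (1 + 4 * \<gamma>) \<le> c * (1 + gain * (1 - c\<^sup>2)\<^sup>2)" using \<gamma> c0 by (intro mult_left_mono) auto
  moreover have "3 * \<delta> * c \<le> \<gamma> * c" using \<gamma> c0 by (intro mult_right_mono) auto
  ultimately have D: "c * (1 + 3 * \<gamma>) \<le> cmod (ip n x0 z)" using A B by (simp add: algebra_simps)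
  have "0 < c * (1 + 3 * \<gamma>)" using c0 \<gamma> by simp
  then have "0 < cmod (ip n x0 z)" using D by linarith
  then show z0: "nrm n z \<noteq> 0" using ip_cauchy[of n x0 z] by auto
  then have zp: "0 < nrm n z" using less_le[of 0 "nrm n z"] by simp
  have "(1 + \<gamma>) * (1 + 2 * \<epsilon>) \<le> (1 + \<gamma>) * (1 + \<gamma>)" using \<gamma> by (intro mult_left_mono) auto
  also have "\<dots> \<le> 1 + 3 * \<gamma>" using \<gamma> mult_left_mono[of \<gamma> 1 \<gamma>] by (simp add: algebra_simps)
  finally have "c * ((1 + \<gamma>) * (1 + 2 * \<epsilon>)) \<le> c * (1 + 3 * \<gamma>)" using c0 by (intro mult_left_mono) auto
  moreover have "(1 + \<gamma>) * c * nrm n z \<le> (1 + \<gamma>) * c * (1 + 2 * \<epsilon>)" using zn \<gamma> c0 by (intro mult_left_mono) auto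
  ultimately have "(1 + \<gamma>) * c * nrm n z \<le> cmod (ip n x0 z)" using D by (simp add: mult_ac)
  then show "(1 + \<gamma>) * (cmod (ip n x0 x) / nrm n x) \<le> cmod (ip n x0 z) / nrm n z"
    using zp unfolding c_def[symmetric] by (simp add: field_simps)
qed

lemma good_distance:
  assumes g: "good_rows \<delta> \<epsilon> L n m x0 a" and e: "0 < \<epsilon>" "\<epsilon> \<le> 1/2" and m: "0 < m"
    and b: "(nrm m (apply_rows n a x))\<^sup>2 \<le> real m * ((1 - \<epsilon>) * d\<^sup>2)" and d: "0 \<le> d"
  shows "nrm n x \<le> d"
proof -
  have "real m * (1 - \<epsilon>) * (nrm n x)\<^sup>2 \<le> real m * (1 - \<epsilon>) * d\<^sup>2"
    using good_norm(1)[OF g, of x] b by (simp add: mult.assoc)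
  then have "(nrm n x)\<^sup>2 \<le> d\<^sup>2" using e m by simp
  then show ?thesis using d by (rule power2_le_imp_le)
qed

text \<open>Polarization: both \<open>A z\<close> and \<open>A x0\<close> have squared norm at most
  \<open>m * (1 + \<epsilon>)\<close>, and their inner product is at least
  \<open>m * (1 - \<eta> - \<delta>)\<close>. Hence the squared distance is at most
  \<open>2 * m * (\<epsilon> + \<eta> + \<delta>)\<close>; passing from \<open>A z\<close> back to
  \<open>z\<close> at most doubles the constant.\<close>

lemma enter_neighbourhood:
  assumes g: "good_rows \<delta> \<epsilon> L n m x0 a" and e: "0 < \<epsilon>" "\<epsilon> \<le> 1/2" and x0: "nrm n x0 = 1" and m: "0 < m"
    and nx: "nrm n x \<noteq> 0" and s: "ap_step n m a x0 x z" and \<delta>: "0 < \<delta>"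
    and c: "1 / sqrt (real n) \<le> cmod (ip n x0 x) / nrm n x" "1 - \<eta> \<le> cmod (ip n x0 x) / nrm n x"
    and d: "4 * (\<epsilon> + \<eta> + \<delta>) \<le> d\<^sup>2" "0 \<le> d" and n: "0 < n"
  shows "\<exists>w. cmod w = 1 \<and> nrm n (\<lambda>j. w * z j - x0 j) \<le> d"
proof -
  let ?A = "apply_rows n a"
  define c where "c = cmod (ip n x0 x) / nrm n x"
  define \<omega> where "\<omega> = cnj (phase (ip n x0 x))"
  let ?z = "\<lambda>j. \<omega> * z j"
  have w: "cmod \<omega> = 1" by (simp add: \<omega>_def)
  have c0: "0 \<le> c" by (simp add: c_def)
  have sn: "\<delta> / sqrt (real n) \<le> \<delta>"
    using \<delta> n by (intro mult_imp_div_pos_le) auto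
  have "c * 1 \<le> c * (1 + gain * (1 - c\<^sup>2)\<^sup>2)" using c0 gain_pos by (intro mult_left_mono) auto
  then have "real m * (1 - \<eta> - \<delta>) \<le> real m * (c * (1 + gain * (1 - c\<^sup>2)\<^sup>2) - \<delta> / sqrt (real n))"
    using c(2) sn unfolding c_def[symmetric] by (intro mult_left_mono) auto
  also have "\<dots> \<le> (\<Sum>i<m. Re (cnj (?A x0 i) * ?A ?z i))"
    using step_correlation[OF g nx s c(1)] unfolding c_def \<omega>_def .
  finally have S: "real m * (1 - \<eta> - \<delta>) \<le> (\<Sum>i<m. Re (cnj (?A x0 i) * ?A ?z i))" .
  have nz: "(nrm m (?A ?z))\<^sup>2 \<le> (nrm m (?A x0))\<^sup>2"
    using step_norm[OF s] unfolding apply_rows_scale nrm_scale w by (intro power_mono) auto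
  have n0: "(nrm m (?A x0))\<^sup>2 \<le> real m * (1 + \<epsilon>)" using good_norm(2)[OF g, of x0] x0 by simp
  have "(nrm m (?A (\<lambda>j. ?z j - x0 j)))\<^sup>2 = (nrm m (?A ?z))\<^sup>2 + (nrm m (?A x0))\<^sup>2 - 2 * (\<Sum>i<m. Re (cnj (?A x0 i) * ?A ?z i))"
  proof -
    have "(cmod (p - q))\<^sup>2 = (cmod p)\<^sup>2 + (cmod q)\<^sup>2 - 2 * Re (cnj q * p)" for p q :: complex
      unfolding cmod_power2 by (simp add: power2_eq_square algebra_simps)
    then show ?thesis
      unfolding nrm_sq apply_rows_diff by (simp add: sum.distrib sum_subtractf sum_distrib_left)
  qed
  also have "\<dots> \<le> 2 * (real m * (1 + \<epsilon>)) - 2 * (real m * (1 - \<eta> - \<delta>))" using nz n0 S by linarith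
  also have "\<dots> = real m * (2 * (\<epsilon> + \<eta> + \<delta>))" by (simp add: algebra_simps)
  also have "\<dots> \<le> real m * ((1 - \<epsilon>) * d\<^sup>2)"
  proof (rule mult_left_mono)
    have "2 * (\<epsilon> + \<eta> + \<delta>) \<le> 1/2 * d\<^sup>2" using d by simp
    also have "\<dots> \<le> (1 - \<epsilon>) * d\<^sup>2" using e by (intro mult_right_mono) auto
    finally show "2 * (\<epsilon> + \<eta> + \<delta>) \<le> (1 - \<epsilon>) * d\<^sup>2" .
  qed simp
  finally have "nrm n (\<lambda>j. ?z j - x0 j) \<le> d" by (rule good_distance[OF g e m _ d(2)])
  then show ?thesis using w by blast
qed

lemma nrm_diff_sq:
  "(nrm n (\<lambda>j. x j - y j))\<^sup>2 = (nrm n x)\<^sup>2 + (nrm n y)\<^sup>2 - 2 * Re (ip n y x)"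
proof -
  have "(cmod (p - q))\<^sup>2 = (cmod p)\<^sup>2 + (cmod q)\<^sup>2 - 2 * Re (cnj q * p)" for p q :: complex
    unfolding cmod_power2 by (simp add: power2_eq_square algebra_simps)
  then show ?thesis
    unfolding nrm_sq lin_form_def Re_sum by (simp add: sum.distrib sum_subtractf sum_distrib_left)
qed

text \<open>After optimal alignment the error \<open>h\<close> has real inner product with
  \<open>x0\<close>, so the mean of the squared rotated measurement is nonnegative and at most about
  half of the energy of \<open>A h\<close> is tangential. Only this half enters the first-order
  error of the data, and projection does not increase it.\<close>

lemma local_contraction:
  assumes g: "good_rows \<delta> (1/200) L n m x0 a" and x0: "nrm n x0 = 1" and m: "0 < m" and L: "0 < L"
    and s: "ap_step n m a x0 x z" and w0: "cmod w0 = 1" and d: "nrm n (\<lambda>j. w0 * x j - x0 j) \<le> d"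
    and dd: "20 * L * d \<le> 1" "0 < d"
  shows "\<exists>w. cmod w = 1 \<and> nrm n (\<lambda>j. w * z j - x0 j) \<le> 9/10 * d"
proof -
  let ?A = "apply_rows n a"
  define \<omega> where "\<omega> = cnj (phase (ip n x0 x))"
  have w: "cmod \<omega> = 1" by (simp add: \<omega>_def)
  have wip: "\<omega> * ip n x0 x = of_real (cmod (ip n x0 x))"
  proof -
    have "\<omega> * ip n x0 x = of_real (cmod (ip n x0 x)) * (phase (ip n x0 x) * cnj (phase (ip n x0 x)))"
      by (subst (2) norm_times_phase) (simp add: \<omega>_def mult_ac)
    also have "phase (ip n x0 x) * cnj (phase (ip n x0 x)) = 1" by (simp add: complex_norm_square[symmetric])
    finally show ?thesis by simp
  qed
  let ?x = "\<lambda>j. \<omega> * x j" and ?z = "\<lambda>j. \<omega> * z j"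
  define h where "h = (\<lambda>j. ?x j - x0 j)"
  have hd: "nrm n h \<le> d"
  proof -
    \<comment> \<open>\<open>\<omega>\<close> maximizes the real part of the inner product with
      \<open>x0\<close> among all rotations, hence minimizes the distance; the hypothesis for
      \<open>w0\<close> therefore passes to it.\<close>
    have "(nrm n h)\<^sup>2 \<le> (nrm n (\<lambda>j. w0 * x j - x0 j))\<^sup>2"
    proof -
      have "Re (ip n x0 (\<lambda>j. w0 * x j)) \<le> cmod (ip n x0 x)"
        using complex_Re_le_cmod[of "ip n x0 (\<lambda>j. w0 * x j)"] by (simp add: lin_scale norm_mult w0)
      also have "\<dots> = Re (ip n x0 ?x)" by (simp add: lin_scale wip)
      finally show ?thesis unfolding h_def nrm_diff_sq nrm_scale w w0 by simp
    qed
    then have "nrm n h \<le> nrm n (\<lambda>j. w0 * x j - x0 j)" by (rule power2_le_imp_le) simp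
    then show ?thesis using d by linarith
  qed
  have s': "ap_step n m a x0 ?x ?z" using step_scale[OF s _ w, of 1] by simp
  obtain f where f: "selection m (?A ?x) f"
    "nrm m (?A (\<lambda>j. ?z j - x0 j)) \<le> nrm m (\<lambda>i. of_real (cmod (?A x0 i)) * f i - ?A x0 i)"
    by (rule step_error[OF s'])
  have Ah: "?A ?x i = ?A x0 i + ?A h i" for i
    unfolding h_def apply_rows_diff by simp
  have real_h: "Im (ip n x0 h) = 0"
  proof -
    have "complex_of_real ((nrm n x0)\<^sup>2) = ip n x0 x0"
      unfolding nrm_sq of_real_sum complex_norm_square lin_form_def by (simp add: mult.commute)
    then have "ip n x0 x0 = 1" using x0 by simp
    then show ?thesis unfolding h_def lin_diff lin_scale wip by simp
  qed
  have pt: "(nrm m (\<lambda>i. of_real (cmod (?A x0 i)) * f i - ?A x0 i))\<^sup>2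
    \<le> 110 / 81 * (\<Sum>i<m. (Im (cnj (phase (?A x0 i)) * ?A h i))\<^sup>2) + 16 * (\<Sum>i<m. (max 0 (cmod (?A h i) - cmod (?A x0 i) / 20))\<^sup>2)"
    unfolding nrm_sq sum_distrib_left sum.distrib[symmetric]
  proof (rule sum_mono)
    fix i assume "i \<in> {..<m}"
    then have "cmod (f i) = 1" "?A x0 i + ?A h i = of_real (cmod (?A x0 i + ?A h i)) * f i"
      using f(1) unfolding selection_def Ah by auto
    then show "(cmod (of_real (cmod (?A x0 i)) * f i - ?A x0 i))\<^sup>2
      \<le> 110 / 81 * (Im (cnj (phase (?A x0 i)) * ?A h i))\<^sup>2 + 16 * (max 0 (cmod (?A h i) - cmod (?A x0 i) / 20))\<^sup>2"
      by (rule phase_perturbation)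
  qed
  have bound: "110 / 81 * (\<Sum>i<m. (Im (cnj (phase (?A x0 i)) * ?A h i))\<^sup>2) + 16 * (\<Sum>i<m. (max 0 (cmod (?A h i) - cmod (?A x0 i) / 20))\<^sup>2)
     \<le> real m * (8/10 * (nrm n h)\<^sup>2)"
  proof (cases "nrm n h = 0")
    case True
    then show ?thesis using apply_rows_zero[OF True, of a] by simp
  next
    case False
    then obtain y where y: "nrm n y = 1" "h = (\<lambda>j. of_real (nrm n h) * y j)" by (rule unit_multiple)
    define \<rho> where "\<rho> = nrm n h"
    have \<rho>: "0 < \<rho>" "\<rho> \<le> d" using False hd less_le[of 0 "nrm n h"] by (auto simp: \<rho>_def)
    have Ay: "?A h i = of_real \<rho> * ?A y i" for i unfolding \<rho>_def by (subst y(2)) (simp only: apply_rows_scale)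
    have "Im (ip n x0 y) = 0"
    proof -
      have "ip n x0 h = of_real \<rho> * ip n x0 y" unfolding \<rho>_def by (subst y(2)) (simp only: lin_scale)
      then show ?thesis using real_h \<rho> by simp
    qed
    \<comment> \<open>This is where the alignment pays: the square of a real number is
      nonnegative.\<close>
    then have sq: "0 \<le> Re ((ip n x0 y)\<^sup>2)" by (simp add: power2_eq_square)
    let ?v = "\<lambda>i. cnj (phase (?A x0 i))"
    have im: "(Im p)\<^sup>2 = ((cmod p)\<^sup>2 - Re (p\<^sup>2)) / 2" for p
      unfolding cmod_power2 by (simp add: power2_eq_square)
    have "(\<Sum>i<m. (Im (?v i * ?A h i))\<^sup>2) = \<rho>\<^sup>2 * (((\<Sum>i<m. (cmod (?A y i))\<^sup>2) - (\<Sum>i<m. Re ((?v i * ?A y i)\<^sup>2))) / 2)"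
    proof -
      have "(Im (?v i * ?A h i))\<^sup>2 = \<rho>\<^sup>2 * (((cmod (?A y i))\<^sup>2 - Re ((?v i * ?A y i)\<^sup>2)) / 2)" for i
      proof -
        have "?v i * ?A h i = of_real \<rho> * (?v i * ?A y i)" unfolding Ay by (simp add: mult_ac)
        then have "(Im (?v i * ?A h i))\<^sup>2 = \<rho>\<^sup>2 * (Im (?v i * ?A y i))\<^sup>2" by (simp only: Im_complex_of_real Re_complex_of_real times_complex.sel) (simp add: power2_eq_square algebra_simps)
        also have "(Im (?v i * ?A y i))\<^sup>2 = ((cmod (?A y i))\<^sup>2 - Re ((?v i * ?A y i)\<^sup>2)) / 2"
          unfolding im by (simp add: norm_mult)
        finally show ?thesis .
      qed
      then show ?thesis by (simp only: sum_distrib_left[symmetric] sum_divide_distrib[symmetric] sum_subtractf)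
    qed
    also have "\<dots> \<le> \<rho>\<^sup>2 * ((real m * (1 + 1/200) + real m * (1/200)) / 2)"
    proof (intro mult_left_mono divide_right_mono)
      have "(\<Sum>i<m. (cmod (?A y i))\<^sup>2) \<le> real m * (1 + 1/200)" using g y(1) unfolding good_rows_def by blast
      moreover have "real m * (Re ((ip n x0 y)\<^sup>2) - 1/200) \<le> (\<Sum>i<m. Re ((?v i * ?A y i)\<^sup>2))"
        using g y(1) unfolding good_rows_def by blast
      moreover have "- (real m * (1/200)) \<le> real m * (Re ((ip n x0 y)\<^sup>2) - 1/200)"
        using mult_left_mono[OF sq, of "real m"] by (simp add: algebra_simps)
      ultimately show "(\<Sum>i<m. (cmod (?A y i))\<^sup>2) - (\<Sum>i<m. Re ((?v i * ?A y i)\<^sup>2)) \<le> real m * (1 + 1/200) + real m * (1/200)"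
        by linarith
    qed auto
    finally have I: "(\<Sum>i<m. (Im (?v i * ?A h i))\<^sup>2) \<le> real m * (101/200 * \<rho>\<^sup>2)" by (simp add: algebra_simps)
    have "(\<Sum>i<m. (max 0 (cmod (?A h i) - cmod (?A x0 i) / 20))\<^sup>2) \<le> (\<Sum>i<m. \<rho>\<^sup>2 * (max 0 (cmod (?A y i) - L * cmod (?A x0 i)))\<^sup>2)"
    proof (rule sum_mono)
      fix i
      have "L * \<rho> \<le> L * d" using L \<rho> by (intro mult_left_mono) auto
      moreover have "20 * (L * d) \<le> 1" using dd(1) by (simp add: mult.assoc)
      ultimately have "L * \<rho> \<le> 1/20" by linarith
      then have Lr: "\<rho> * L \<le> 1/20" by (simp only: mult.commute)
      have "cmod (?A h i) - cmod (?A x0 i) / 20 \<le> \<rho> * (cmod (?A y i) - L * cmod (?A x0 i))"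
        using mult_right_mono[OF Lr, of "cmod (?A x0 i)"] \<rho> unfolding Ay by (simp add: norm_mult algebra_simps)
      also have "\<dots> \<le> \<rho> * max 0 (cmod (?A y i) - L * cmod (?A x0 i))" using \<rho> by (intro mult_left_mono) auto
      finally have "max 0 (cmod (?A h i) - cmod (?A x0 i) / 20) \<le> \<rho> * max 0 (cmod (?A y i) - L * cmod (?A x0 i))"
        using \<rho> by simp
      then have "(max 0 (cmod (?A h i) - cmod (?A x0 i) / 20))\<^sup>2 \<le> (\<rho> * max 0 (cmod (?A y i) - L * cmod (?A x0 i)))\<^sup>2"
        by (intro power_mono) auto
      then show "(max 0 (cmod (?A h i) - cmod (?A x0 i) / 20))\<^sup>2 \<le> \<rho>\<^sup>2 * (max 0 (cmod (?A y i) - L * cmod (?A x0 i)))\<^sup>2"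
        by (simp only: power_mult_distrib)
    qed
    also have "\<dots> = \<rho>\<^sup>2 * (\<Sum>i<m. (max 0 (cmod (?A y i) - L * cmod (?A x0 i)))\<^sup>2)" by (simp only: sum_distrib_left)
    also have "\<dots> \<le> \<rho>\<^sup>2 * (real m * (1/200))"
      using g y(1) unfolding good_rows_def by (intro mult_left_mono) auto
    finally have II: "(\<Sum>i<m. (max 0 (cmod (?A h i) - cmod (?A x0 i) / 20))\<^sup>2) \<le> real m * (1/200 * \<rho>\<^sup>2)"
      by (simp add: mult_ac)
    \<comment> \<open>The numbers 101/200 and 1/200 give a factor below 0.77. The margin up to 8/10
      and then to \<open>(1 - 1/200) * (9/10)\<^sup>2\<close> leaves room for the lower isometry
      constant.\<close>
    have "110 / 81 * (real m * (101/200 * \<rho>\<^sup>2)) + 16 * (real m * (1/200 * \<rho>\<^sup>2)) \<le> real m * (8/10 * \<rho>\<^sup>2)"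
      by (simp add: algebra_simps)
    then show ?thesis using I II unfolding \<rho>_def by linarith
  qed
  have "(nrm m (?A (\<lambda>j. ?z j - x0 j)))\<^sup>2 \<le> (nrm m (\<lambda>i. of_real (cmod (?A x0 i)) * f i - ?A x0 i))\<^sup>2"
    using f(2) by (intro power_mono) auto
  also have "\<dots> \<le> real m * (8/10 * (nrm n h)\<^sup>2)" using pt bound by linarith
  also have "\<dots> \<le> real m * ((1 - 1/200) * (9/10 * d)\<^sup>2)"
  proof (rule mult_left_mono)
    have "(nrm n h)\<^sup>2 \<le> d\<^sup>2" using hd by (intro power_mono) auto
    moreover have "0 \<le> d\<^sup>2" by simp
    ultimately have "8/10 * (nrm n h)\<^sup>2 \<le> 16119/20000 * d\<^sup>2" by linarith
    also have "\<dots> = (1 - 1/200) * (9/10 * d)\<^sup>2" by (simp add: power_mult_distrib power_divide)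
    finally show "8/10 * (nrm n h)\<^sup>2 \<le> (1 - 1/200) * (9/10 * d)\<^sup>2" .
  qed simp
  finally have bd: "(nrm m (?A (\<lambda>j. ?z j - x0 j)))\<^sup>2 \<le> real m * ((1 - 1/200) * (9/10 * d)\<^sup>2)" .
  have "nrm n (\<lambda>j. ?z j - x0 j) \<le> 9/10 * d"
    by (rule good_distance[OF g _ _ m bd]) (use dd in auto)
  then show ?thesis using w by blast
qed

subsection \<open>The pseudo-inverse of an injective matrix\<close>

lemma mat_adjoint_dim [simp]:
  "dim_row (mat_adjoint A) = dim_col A" "dim_col (mat_adjoint A) = dim_row A"
  by (simp_all add: mat_adjoint_def mat_of_rows_def)

lemma mat_adjoint_index [simp]:
  "i < dim_col A \<Longrightarrow> j < dim_row A \<Longrightarrow> mat_adjoint A $$ (i, j) = conjugate (A $$ (j, i))"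
  by (simp add: mat_adjoint_def mat_of_rows_def)

lemma mat_adjoint_involution: "mat_adjoint (mat_adjoint A) = (A :: complex mat)"
  by (intro eq_matI) auto

lemma gram_injective:
  fixes A :: "complex mat"
  assumes A: "A \<in> carrier_mat m n" and v: "v \<in> carrier_vec n" and "(mat_adjoint A * A) *\<^sub>v v = 0\<^sub>v n"
  shows "A *\<^sub>v v = 0\<^sub>v m"
proof -
  have AA: "mat_adjoint A \<in> carrier_mat n m" using A by auto
  define y where "y = A *\<^sub>v v"
  have y: "y \<in> carrier_vec m" unfolding y_def by (rule mult_mat_vec_carrier[OF A v])
  have "mat_adjoint A *\<^sub>v y = 0\<^sub>v n"
    using assms(3) assoc_mult_mat_vec[OF AA A v] by (simp add: y_def)
  have z: "(\<Sum>i<m. cnj (A $$ (i, j)) * y $ i) = 0" if "j < n" for j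
  proof -
    have "(mat_adjoint A *\<^sub>v y) $ j = (\<Sum>i<m. cnj (A $$ (i, j)) * y $ i)"
      using that A y by (auto simp: scalar_prod_def conjugate_complex_def atLeast0LessThan intro!: sum.cong)
    then show ?thesis using \<open>mat_adjoint A *\<^sub>v y = 0\<^sub>v n\<close> that by simp
  qed
  have "complex_of_real (\<Sum>i<m. (cmod (y $ i))\<^sup>2) = (\<Sum>i<m. y $ i * cnj (y $ i))"
    unfolding of_real_sum complex_norm_square ..
  also have "\<dots> = (\<Sum>i<m. \<Sum>j<n. y $ i * (cnj (A $$ (i, j)) * cnj (v $ j)))"
  proof (rule sum.cong[OF refl])
    fix i assume "i \<in> {..<m}"
    then have "y $ i = (\<Sum>j<n. A $$ (i, j) * v $ j)"
      using A v by (auto simp: y_def scalar_prod_def atLeast0LessThan intro!: sum.cong)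
    then have "cnj (y $ i) = (\<Sum>j<n. cnj (A $$ (i, j)) * cnj (v $ j))" by simp
    then show "y $ i * cnj (y $ i) = (\<Sum>j<n. y $ i * (cnj (A $$ (i, j)) * cnj (v $ j)))"
      by (simp add: sum_distrib_left)
  qed
  also have "\<dots> = (\<Sum>j<n. cnj (v $ j) * (\<Sum>i<m. cnj (A $$ (i, j)) * y $ i))"
    by (subst sum.swap) (simp add: sum_distrib_left mult_ac)
  also have "\<dots> = 0" using z by simp
  finally have "(\<Sum>i<m. (cmod (y $ i))\<^sup>2) = 0" by (simp only: of_real_eq_0_iff)
  then have "\<forall>i<m. y $ i = 0" by (subst (asm) sum_nonneg_eq_0_iff) auto
  then have "y = 0\<^sub>v m" using y by (intro eq_vecI) auto
  then show ?thesis unfolding y_def .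
qed

text \<open>Injectivity makes the Gram matrix invertible, and its inverse times the adjoint of
  \<open>A\<close> is the candidate. Existence matters because \<open>pseudo_inverse\<close> is a
  definite description.\<close>

lemma ex_pseudo_inverse:
  fixes A :: "complex mat"
  assumes A: "A \<in> carrier_mat m n"
    and inj: "\<And>v. v \<in> carrier_vec n \<Longrightarrow> A *\<^sub>v v = 0\<^sub>v m \<Longrightarrow> v = 0\<^sub>v n"
  shows "\<exists>X. is_pseudo_inverse A X"
proof -
  define S H where "S = mat_adjoint A" and "H = S * A"
  have S: "S \<in> carrier_mat n m" using A by (auto simp: S_def)
  have H: "H \<in> carrier_mat n n" using S A by (auto simp: H_def)
  have "det H \<noteq> 0"
  proof
    assume "det H = 0"
    then obtain v where v: "v \<in> carrier_vec n" "v \<noteq> 0\<^sub>v n" "H *\<^sub>v v = 0\<^sub>v n"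
      using det_0_iff_vec_prod_zero_field[OF H] by blast
    then show False using gram_injective[OF A v(1)] inj by (simp add: H_def S_def)
  qed
  then have "H \<in> Units (ring_mat TYPE(complex) n ())" by (rule det_non_zero_imp_unit[OF H])
  then obtain B where B: "B \<in> carrier_mat n n" "B * H = 1\<^sub>m n" "H * B = 1\<^sub>m n"
    by (auto simp: Units_def ring_mat_def)
  have adH: "mat_adjoint H = H"
    unfolding H_def using mat_adjoint_mult[OF S A] by (simp add: S_def mat_adjoint_involution)
  have ad1: "mat_adjoint (1\<^sub>m n) = (1\<^sub>m n :: complex mat)" by (intro eq_matI) auto
  have cB: "mat_adjoint B \<in> carrier_mat n n" using B by auto
  have "mat_adjoint B * H = 1\<^sub>m n"
    using mat_adjoint_mult[OF H B(1)] B(3) adH ad1 by simp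
  then have "mat_adjoint B = B"
    using assoc_mult_mat[OF cB H B(1)] B cB by simp
  have SA: "B * S \<in> carrier_mat n m" using B S by auto
  have XA: "B * S * A = 1\<^sub>m n" using assoc_mult_mat[OF B(1) S A] B by (simp add: H_def)
  show ?thesis
  proof (intro exI[of _ "B * S"])
    have 1: "A * (B * S) * A = A"
      using assoc_mult_mat[OF A SA A] XA A by simp
    have 2: "B * S * A * (B * S) = B * S" unfolding XA by (rule left_mult_one_mat[OF SA])
    have 3: "mat_adjoint (A * (B * S)) = A * (B * S)"
    proof -
      have "mat_adjoint (A * (B * S)) = mat_adjoint (B * S) * S"
        using mat_adjoint_mult[OF A SA] by (simp add: S_def)
      also have "mat_adjoint (B * S) = A * B"
        using mat_adjoint_mult[OF B(1) S] \<open>mat_adjoint B = B\<close> by (simp add: S_def mat_adjoint_involution)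
      finally show ?thesis using assoc_mult_mat[OF A B(1) S] by simp
    qed
    show "is_pseudo_inverse A (B * S)"
      unfolding is_pseudo_inverse_def using SA A 1 2 3 XA ad1 by auto
  qed
qed

lemma pseudo_inverse_is: "is_pseudo_inverse A X \<Longrightarrow> is_pseudo_inverse A (pseudo_inverse A)"
  unfolding pseudo_inverse_def by (rule theI) (auto intro: is_pseudo_inverse_unique)

text \<open>\<open>A * X\<close> is self-adjoint and fixes the range of \<open>A\<close>, so it can
  be moved onto \<open>A w\<close>, where it disappears.\<close>

lemma pseudo_inverse_normal_equations:
  fixes A :: "complex mat"
  assumes A: "A \<in> carrier_mat m n" and X: "is_pseudo_inverse A X" and w: "w \<in> carrier_vec n" and b: "b \<in> carrier_vec m"
  shows "(\<Sum>i<m. cnj ((A *\<^sub>v w) $ i) * (A *\<^sub>v (X *\<^sub>v b)) $ i) = (\<Sum>i<m. cnj ((A *\<^sub>v w) $ i) * b $ i)"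
proof -
  note x = X[unfolded is_pseudo_inverse_def]
  have cX: "X \<in> carrier_mat n m" using x A by auto
  define P where "P = A * X"
  define v where "v = A *\<^sub>v w"
  have P: "P \<in> carrier_mat m m" using A cX by (auto simp: P_def)
  have v: "v \<in> carrier_vec m" unfolding v_def by (rule mult_mat_vec_carrier[OF A w])
  have Pv: "P *\<^sub>v v = v"
  proof -
    have "P *\<^sub>v v = (P * A) *\<^sub>v w" unfolding v_def by (rule assoc_mult_mat_vec[OF P A w, symmetric])
    then show ?thesis using x by (simp add: P_def v_def)
  qed
  have ent: "P $$ (i, j) = cnj (P $$ (j, i))" if "i < m" "j < m" for i j
  proof -
    have "P $$ (i, j) = mat_adjoint P $$ (i, j)" using x by (simp add: P_def)
    then show ?thesis using that P by (simp add: conjugate_complex_def)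
  qed
  have idx: "(P *\<^sub>v u) $ i = (\<Sum>j<m. P $$ (i, j) * u $ j)" if "u \<in> carrier_vec m" "i < m" for u i
    using that P by (auto simp: scalar_prod_def atLeast0LessThan intro!: sum.cong)
  have "A *\<^sub>v (X *\<^sub>v b) = P *\<^sub>v b" unfolding P_def by (rule assoc_mult_mat_vec[OF A cX b, symmetric])
  then have "(\<Sum>i<m. cnj (v $ i) * (A *\<^sub>v (X *\<^sub>v b)) $ i) = (\<Sum>i<m. \<Sum>j<m. cnj (v $ i) * (P $$ (i, j) * b $ j))"
    using idx[OF b] by (simp add: sum_distrib_left)
  also have "\<dots> = (\<Sum>j<m. \<Sum>i<m. cnj (v $ i) * (P $$ (i, j) * b $ j))" by (rule sum.swap)
  also have "\<dots> = (\<Sum>j<m. cnj ((P *\<^sub>v v) $ j) * b $ j)"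
  proof (rule sum.cong[OF refl])
    fix j assume j: "j \<in> {..<m}"
    have "cnj ((P *\<^sub>v v) $ j) = (\<Sum>i<m. cnj (P $$ (j, i)) * cnj (v $ i))" using idx[OF v] j by simp
    also have "\<dots> = (\<Sum>i<m. P $$ (i, j) * cnj (v $ i))"
    proof (rule sum.cong[OF refl])
      fix i assume "i \<in> {..<m}"
      then show "cnj (P $$ (j, i)) * cnj (v $ i) = P $$ (i, j) * cnj (v $ i)"
        using ent[of i j] j by (simp only: lessThan_iff)
    qed
    finally have e: "cnj ((P *\<^sub>v v) $ j) = (\<Sum>i<m. P $$ (i, j) * cnj (v $ i))" .
    show "(\<Sum>i<m. cnj (v $ i) * (P $$ (i, j) * b $ j)) = cnj ((P *\<^sub>v v) $ j) * b $ j"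
      unfolding e sum_distrib_right by (intro sum.cong) (auto simp: mult_ac)
  qed
  finally show ?thesis unfolding Pv unfolding v_def .
qed

subsection \<open>Convergence\<close>

lemma sensing_matrix_carrier: "sensing_matrix m n a \<in> carrier_mat m n"
  by (simp add: sensing_matrix_def)

lemma sensing_matrix_apply:
  "x \<in> carrier_vec n \<Longrightarrow> i < m \<Longrightarrow> (sensing_matrix m n a *\<^sub>v x) $ i = apply_rows n a (\<lambda>j. x $ j) i"
  by (auto simp: sensing_matrix_def scalar_prod_def apply_rows_def lin_form_def sens_row_def atLeast0LessThan intro!: sum.cong)

lemma eucl_norm_nrm: "dim_vec v = n \<Longrightarrow> eucl_norm v = nrm n (\<lambda>j. v $ j)"
  by (simp add: eucl_norm_def nrm_def)

lemma selection_phase: "selection m p (\<lambda>i. phase (p i))"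
  by (simp add: selection_def norm_times_phase[symmetric])

lemma alt_proj_step:
  assumes X: "is_pseudo_inverse (sensing_matrix m n a) X"
    and x0: "x0 \<in> carrier_vec n" and x: "x \<in> carrier_vec n"
  defines "A \<equiv> sensing_matrix m n a"
  defines "z \<equiv> pseudo_inverse A *\<^sub>v (entrywise_modulus (A *\<^sub>v x0) \<odot> map_vec phase (A *\<^sub>v x))"
  shows "z \<in> carrier_vec n" "ap_step n m a (\<lambda>j. x0 $ j) (\<lambda>j. x $ j) (\<lambda>j. z $ j)"
proof -
  have A: "A \<in> carrier_mat m n" unfolding A_def by (rule sensing_matrix_carrier)
  have pi: "is_pseudo_inverse A (pseudo_inverse A)" using pseudo_inverse_is[OF X] by (simp add: A_def)
  define b where "b = entrywise_modulus (A *\<^sub>v x0) \<odot> map_vec phase (A *\<^sub>v x)"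
  have b: "b \<in> carrier_vec m" using A by (auto simp: b_def entrywise_prod_def entrywise_modulus_def)
  have bi: "b $ i = of_real (cmod (apply_rows n a (\<lambda>j. x0 $ j) i)) * phase (apply_rows n a (\<lambda>j. x $ j) i)" if "i < m" for i
    using that A sensing_matrix_apply[OF x0 that, of a] sensing_matrix_apply[OF x that, of a]
    by (simp add: b_def entrywise_prod_def entrywise_modulus_def A_def)
  have "pseudo_inverse A \<in> carrier_mat (dim_col A) (dim_row A)"
    using pi unfolding is_pseudo_inverse_def by (rule conjunct1)
  then have pc: "pseudo_inverse A \<in> carrier_mat n m" using A by simp
  have z: "z = pseudo_inverse A *\<^sub>v b" unfolding z_def b_def ..
  show zc: "z \<in> carrier_vec n" unfolding z by (rule mult_mat_vec_carrier[OF pc b])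
  show "ap_step n m a (\<lambda>j. x0 $ j) (\<lambda>j. x $ j) (\<lambda>j. z $ j)"
    unfolding ap_step_def
  proof (intro exI conjI allI)
    show "selection m (apply_rows n a (\<lambda>j. x $ j)) (\<lambda>i. phase (apply_rows n a (\<lambda>j. x $ j) i))"
      by (rule selection_phase)
    fix w :: "nat \<Rightarrow> complex"
    define wv where "wv = vec n w"
    have wv: "wv \<in> carrier_vec n" by (simp add: wv_def)
    have aw: "apply_rows n a (\<lambda>j. wv $ j) = apply_rows n a w"
      by (auto simp: apply_rows_def lin_form_def wv_def fun_eq_iff intro!: sum.cong)
    have Aw: "(A *\<^sub>v wv) $ i = apply_rows n a w i" if "i < m" for i
      using sensing_matrix_apply[OF wv that, of a] by (simp add: A_def aw)
    have "(\<Sum>i<m. cnj (apply_rows n a w i) * apply_rows n a (\<lambda>j. z $ j) i) = (\<Sum>i<m. cnj ((A *\<^sub>v wv) $ i) * (A *\<^sub>v z) $ i)"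
      using sensing_matrix_apply[OF zc, of _ m a] by (intro sum.cong) (auto simp: A_def[symmetric] Aw)
    also have "\<dots> = (\<Sum>i<m. cnj ((A *\<^sub>v wv) $ i) * b $ i)"
      unfolding z by (rule pseudo_inverse_normal_equations[OF A pi wv b])
    also have "\<dots> = (\<Sum>i<m. cnj (apply_rows n a w i) * (of_real (cmod (apply_rows n a (\<lambda>j. x0 $ j) i)) * phase (apply_rows n a (\<lambda>j. x $ j) i)))"
      using bi by (intro sum.cong) (auto simp: Aw)
    finally show "(\<Sum>i<m. cnj (apply_rows n a w i) * apply_rows n a (\<lambda>j. z $ j) i)
      = (\<Sum>i<m. cnj (apply_rows n a w i) * (of_real (cmod (apply_rows n a (\<lambda>j. x0 $ j) i)) * phase (apply_rows n a (\<lambda>j. x $ j) i)))" .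
  qed
qed

text \<open>The uniform estimates concern unit \<open>x0\<close>; homogeneity of the data in
  \<open>x0\<close> covers the other nonzero vectors.\<close>

lemma step_rescale:
  assumes "ap_step n m a (\<lambda>j. of_real R * x0 j) x z" "0 < R"
  shows "ap_step n m a x0 x (\<lambda>j. of_real (1 / R) * z j)"
proof -
  let ?A = "apply_rows n a"
  obtain f where f: "selection m (?A x) f"
    "\<And>v. (\<Sum>i<m. cnj (?A v i) * ?A z i) = (\<Sum>i<m. cnj (?A v i) * (of_real (cmod (?A (\<lambda>j. of_real R * x0 j) i)) * f i))"
    using assms(1) unfolding ap_step_def by blast
  show ?thesis unfolding ap_step_def
  proof (intro exI[of _ f] conjI allI f(1))
    fix v
    have "(\<Sum>i<m. cnj (?A v i) * ?A (\<lambda>j. of_real (1 / R) * z j) i) = of_real (1 / R) * (\<Sum>i<m. cnj (?A v i) * ?A z i)"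
      unfolding apply_rows_scale sum_distrib_left by (simp add: mult_ac)
    also have "\<dots> = of_real (1 / R) * (\<Sum>i<m. of_real R * (cnj (?A v i) * (of_real (cmod (?A x0 i)) * f i)))"
      unfolding f(2) apply_rows_scale using assms(2) by (simp add: norm_mult mult_ac)
    also have "\<dots> = (\<Sum>i<m. cnj (?A v i) * (of_real (cmod (?A x0 i)) * f i))"
      unfolding sum_distrib_left[symmetric] using assms(2) by simp
    finally show "(\<Sum>i<m. cnj (?A v i) * ?A (\<lambda>j. of_real (1 / R) * z j) i) = (\<Sum>i<m. cnj (?A v i) * (of_real (cmod (?A x0 i)) * f i))" .
  qed
qed

lemma good_injective:
  assumes g: "good_rows \<delta> \<epsilon> L n m x0 a" and "0 < \<epsilon>" "\<epsilon> \<le> 1/2" "0 < m"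
    and v: "v \<in> carrier_vec n" "sensing_matrix m n a *\<^sub>v v = 0\<^sub>v m"
  shows "v = 0\<^sub>v n"
proof -
  have "apply_rows n a (\<lambda>j. v $ j) i = 0" if "i < m" for i
    using sensing_matrix_apply[OF v(1) that, of a] v(2) that by simp
  then have "nrm m (apply_rows n a (\<lambda>j. v $ j)) = 0" by (simp add: nrm_def)
  then have "real m * (1 - \<epsilon>) * (nrm n (\<lambda>j. v $ j))\<^sup>2 \<le> 0" using good_norm(1)[OF g, of "\<lambda>j. v $ j"] by simp
  then have "nrm n (\<lambda>j. v $ j) = 0" using assms(3,4) by (simp add: mult_le_0_iff)
  then have "v $ j = 0" if "j < n" for j using nrm_zero[of n "\<lambda>j. v $ j"] that by blast
  then show ?thesis using v(1) by (intro eq_vecI) auto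
qed

text \<open>Two instances of \<open>good_rows\<close> serve the two phases. The fixed precision
  1/200 determines \<open>L\<close>, and so the radius \<open>d\<close>, before anything else; the
  smaller \<open>\<epsilon>\<close> is then adapted to \<open>d\<close> and to the growth
  factor.\<close>

lemma iteration_converges:
  fixes y :: "nat \<Rightarrow> nat \<Rightarrow> complex"
  assumes g: "good_rows \<delta> \<epsilon> L' n m x0 a" and g2: "good_rows \<delta> (1/200) L n m x0 a"
    and e: "0 < \<epsilon>" "\<epsilon> \<le> 1/2" and x0: "nrm n x0 = 1" and m: "0 < m" and n: "3 \<le> n" and L: "0 < L"
    and \<delta>: "0 < \<delta>" and \<eta>: "0 < \<eta>" "\<eta> < 1"
    and \<gamma>: "0 < \<gamma>" "\<gamma> \<le> 1" "4 * \<gamma> \<le> gain * \<eta>\<^sup>2" "3 * \<delta> \<le> \<gamma>" "2 * \<epsilon> \<le> \<gamma>"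
    and d: "4 * (\<epsilon> + \<eta> + \<delta>) \<le> d\<^sup>2" "0 < d" "d \<le> 1" "20 * L * d \<le> 1"
    and y: "\<And>t. ap_step n m a x0 (y t) (y (Suc t))" and y0: "nrm n (y 0) \<noteq> 0"
    and c0: "1 / sqrt (real n) \<le> cmod (ip n x0 (y 0)) / nrm n (y 0)"
    and t: "(1 / (2 * ln (1 + \<gamma>)) + 3) * ln (real n) \<le> real t"
  shows "\<exists>w. cmod w = 1 \<and> nrm n (\<lambda>j. w * y t j - x0 j) \<le> (9/10) powr (real t - (1 / (2 * ln (1 + \<gamma>)) + 3) * ln (real n))"
proof -
  define c where "c s = cmod (ip n x0 (y s)) / nrm n (y s)" for s
  have sn: "0 < sqrt (real n)" using n by simp
  have grow: "nrm n (y s) \<noteq> 0 \<and> (1 + \<gamma>) ^ s / sqrt (real n) \<le> c s" if "\<And>r. r < s \<Longrightarrow> c r < 1 - \<eta>" for s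
    using that
  proof (induction s)
    case 0
    then show ?case using y0 c0 by (simp add: c_def)
  next
    case (Suc s)
    then have IH: "nrm n (y s) \<noteq> 0" "(1 + \<gamma>) ^ s / sqrt (real n) \<le> c s" and lt: "c s < 1 - \<eta>" by auto
    have "1 * (1 / sqrt (real n)) \<le> (1 + \<gamma>) ^ s * (1 / sqrt (real n))"
      using \<gamma> sn by (intro mult_right_mono one_le_power) auto
    then have lo: "1 / sqrt (real n) \<le> c s" using IH(2) by simp
    note cg = correlation_growth[OF g e x0 m IH(1) y \<delta> lo[unfolded c_def] less_imp_le[OF lt[unfolded c_def]] \<eta> \<gamma>]
    have "(1 + \<gamma>) * ((1 + \<gamma>) ^ s / sqrt (real n)) \<le> (1 + \<gamma>) * c s" using IH(2) \<gamma> by (intro mult_left_mono) auto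
    also have "\<dots> \<le> c (Suc s)" using cg(2) n unfolding c_def by simp
    finally show ?case using cg(1) n by simp
  qed
  have c1: "c s \<le> 1" for s
    using ip_cauchy[of n x0 "y s"] x0 unfolding c_def by (cases "nrm n (y s) = 0") (auto simp: divide_le_eq less_le)
  define T where "T = nat \<lceil>ln (sqrt (real n)) / ln (1 + \<gamma>)\<rceil>"
  have lg: "0 < ln (1 + \<gamma>)" using \<gamma> by simp
  have T1: "1 \<le> (1 + \<gamma>) ^ T / sqrt (real n)"
  proof -
    have "ln (sqrt (real n)) / ln (1 + \<gamma>) \<le> real T" unfolding T_def by linarith
    then have "ln (sqrt (real n)) \<le> real T * ln (1 + \<gamma>)" using lg by (simp add: field_simps)
    also have "\<dots> = ln ((1 + \<gamma>) ^ T)" using \<gamma> by (simp add: ln_realpow)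
    finally have "sqrt (real n) \<le> (1 + \<gamma>) ^ T" using sn \<gamma> by (subst (asm) ln_le_cancel_iff) auto
    then show ?thesis using sn by simp
  qed
  \<comment> \<open>Otherwise the growth would carry the correlation from \<open>1 / sqrt n\<close>
    to at least 1 by time \<open>T\<close>.\<close>
  have "\<exists>s\<le>T. 1 - \<eta> \<le> c s"
  proof (rule ccontr)
    assume "\<not> (\<exists>s\<le>T. 1 - \<eta> \<le> c s)"
    then have lt: "c s < 1 - \<eta>" if "s \<le> T" for s using that by (meson not_le)
    then have "(1 + \<gamma>) ^ T / sqrt (real n) \<le> c T" using grow[of T] by simp
    then show False using T1 lt[of T] \<eta> by linarith
  qed
  then obtain s0 where s0: "s0 \<le> T" "1 - \<eta> \<le> c s0" by blast
  \<comment> \<open>Minimality keeps all earlier correlations below \<open>1 - \<eta>\<close>, so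
    the growth lemma applies up to \<open>s\<close>; in particular the iterate at \<open>s\<close>
    is nonzero.\<close>
  define s where "s = (LEAST s. 1 - \<eta> \<le> c s)"
  have s: "1 - \<eta> \<le> c s" "s \<le> T"
    using LeastI[of "\<lambda>s. 1 - \<eta> \<le> c s", OF s0(2)] Least_le[of "\<lambda>s. 1 - \<eta> \<le> c s", OF s0(2)] s0(1)
    unfolding s_def[symmetric] by linarith+
  have below: "c r < 1 - \<eta>" if "r < s" for r
    using not_less_Least[of r "\<lambda>s. 1 - \<eta> \<le> c s"] that unfolding s_def[symmetric] by linarith
  have gs: "nrm n (y s) \<noteq> 0" "(1 + \<gamma>) ^ s / sqrt (real n) \<le> c s" using grow[OF below] by auto
  have "1 * (1 / sqrt (real n)) \<le> (1 + \<gamma>) ^ s * (1 / sqrt (real n))"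
    using \<gamma> sn by (intro mult_right_mono one_le_power) auto
  then have lo: "1 / sqrt (real n) \<le> c s" using gs(2) by simp
  have entered: "\<exists>w. cmod w = 1 \<and> nrm n (\<lambda>j. w * y (Suc s) j - x0 j) \<le> d"
    by (rule enter_neighbourhood[OF g e x0 m gs(1) y \<delta> lo[unfolded c_def] s(1)[unfolded c_def]]) (use d n in auto)
  have contract: "\<exists>w. cmod w = 1 \<and> nrm n (\<lambda>j. w * y (Suc s + k) j - x0 j) \<le> (9/10) ^ k * d" for k
  proof (induction k)
    case 0
    then show ?case using entered by simp
  next
    case (Suc k)
    then obtain w where w: "cmod w = 1" "nrm n (\<lambda>j. w * y (Suc s + k) j - x0 j) \<le> (9/10) ^ k * d" by blast
    have "(9/10) ^ k * d \<le> 1 * d" using d by (intro mult_right_mono power_le_one) auto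
    then have "20 * L * ((9/10) ^ k * d) \<le> 20 * L * d" using L by (intro mult_left_mono) auto
    then have "20 * L * ((9/10) ^ k * d) \<le> 1" using d by linarith
    from local_contraction[OF g2 x0 m L y[of "Suc s + k"] w this] d show ?case by (simp add: mult.assoc)
  qed
  \<comment> \<open>Growth takes at most \<open>ln n / (2 * ln (1 + \<gamma>)) + 1\<close> steps
    after rounding, entering the neighbourhood one more. The extra 2 is below
    \<open>3 * ln n\<close> because \<open>n \<ge> 3\<close> gives
    \<open>ln n \<ge> 1\<close>.\<close>
  define G where "G = (1 / (2 * ln (1 + \<gamma>)) + 3) * ln (real n)"
  have ln1: "1 \<le> ln (real n)"
  proof -
    have "exp 1 \<le> (3::real)" using exp_le by simp
    also have "\<dots> \<le> real n" using n by simp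
    finally show ?thesis using n by (subst ln_ge_iff) auto
  qed
  have sG: "real (Suc s) \<le> G"
  proof -
    have q0: "0 \<le> ln (sqrt (real n)) / ln (1 + \<gamma>)" using lg n by simp
    have "real s \<le> real T" using s(2) by simp
    also have "\<dots> \<le> ln (sqrt (real n)) / ln (1 + \<gamma>) + 1" unfolding T_def using q0 by linarith
    also have "ln (sqrt (real n)) = ln (real n) / 2" using n by (simp add: ln_sqrt)
    finally have "real (Suc s) \<le> 1 / (2 * ln (1 + \<gamma>)) * ln (real n) + 2" by simp
    also have "\<dots> \<le> G" unfolding G_def using ln1 by (simp add: algebra_simps)
    finally show ?thesis .
  qed
  then have st: "Suc s \<le> t" using t unfolding G_def[symmetric] by linarith
  obtain w where w: "cmod w = 1" "nrm n (\<lambda>j. w * y t j - x0 j) \<le> (9/10) ^ (t - Suc s) * d"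
    using contract[of "t - Suc s"] st by auto
  have "(9/10) ^ (t - Suc s) * d \<le> (9/10::real) ^ (t - Suc s) * 1" using d by (intro mult_left_mono) auto
  also have "\<dots> = (9/10) powr real (t - Suc s)" by (simp add: powr_realpow)
  also have "\<dots> \<le> (9/10) powr (real t - G)"
    using sG st by (intro powr_mono') (auto simp: of_nat_diff)
  finally show ?thesis using w unfolding G_def by (intro exI[of _ w]) auto
qed

theorem corollary4p2:
  shows "\<exists>C1 C2 \<gamma> M \<Delta> :: real. C1 > 0 \<and> C2 > 0 \<and> \<gamma> > 0 \<and> M > 0 \<and> 0 < \<Delta> \<and> \<Delta> < 1 \<and>
    (\<forall>n m :: nat. \<forall>x0 \<in> carrier_vec n. n \<ge> 1 \<longrightarrow> m \<ge> 1 \<longrightarrow> real m \<ge> M * (real n)\<^sup>2 \<longrightarrow>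
      (\<exists>E \<in> sets (gaussian_sensing m n).
        measure (gaussian_sensing m n) E \<ge> 1 - C1 * exp (- C2 * real n) \<and>
        (\<forall>a \<in> E. \<forall>x \<in> carrier_vec n. not_almost_orthogonal n x0 x \<longrightarrow>
          (let A = sensing_matrix m n a; b = entrywise_modulus (A *\<^sub>v x0) in
            \<forall>t :: nat. real t \<ge> \<gamma> * ln (real n) \<longrightarrow>
              (INF \<phi> :: real. eucl_norm (cis \<phi> \<cdot>\<^sub>v x0 - alt_proj A b x t))
                \<le> \<Delta> powr (real t - \<gamma> * ln (real n)) * eucl_norm x0))))"
proof -
  obtain L where L: "0 < L" and whpL: "\<And>\<delta>. 0 < \<delta> \<Longrightarrow> whp (good_rows \<delta> (1/200) L)"
    by (rule good_whp[of "1/200"]) auto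
  define d where "d = min 1 (1 / (20 * L))"
  have d: "0 < d" "d \<le> 1" "20 * L * d \<le> 1"
    using L by (auto simp: d_def min_def field_simps)
  have d2: "0 < d\<^sup>2" "d\<^sup>2 \<le> 1" using d by (auto simp: power_le_one)
  \<comment> \<open>The budget \<open>d\<^sup>2\<close> of \<open>enter_neighbourhood\<close>:
    \<open>4 * \<eta>\<close> takes a third of it, and with the choices of \<open>\<delta>\<close>
    and \<open>\<epsilon>\<close> below the rest is \<open>10/3 * \<gamma>\<close>, which is at most
    10/36 of it.\<close>
  define \<eta> where "\<eta> = d\<^sup>2 / 12"
  have \<eta>: "0 < \<eta>" "\<eta> < 1" using d2 by (auto simp: \<eta>_def)
  define \<gamma> where "\<gamma> = min (gain * \<eta>\<^sup>2 / 4) (d\<^sup>2 / 12)"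
  have \<gamma>: "0 < \<gamma>" "\<gamma> \<le> 1" "4 * \<gamma> \<le> gain * \<eta>\<^sup>2" "\<gamma> \<le> d\<^sup>2 / 12" using gain_pos \<eta> d2 by (auto simp: \<gamma>_def min_def)
  define \<delta> where "\<delta> = \<gamma> / 3"
  define \<epsilon> where "\<epsilon> = \<gamma> / 2"
  have \<delta>: "0 < \<delta>" "3 * \<delta> \<le> \<gamma>" and \<epsilon>: "0 < \<epsilon>" "\<epsilon> \<le> 1/2" "2 * \<epsilon> \<le> \<gamma>" using \<gamma> by (auto simp: \<delta>_def \<epsilon>_def)
  have sum: "4 * (\<epsilon> + \<eta> + \<delta>) \<le> d\<^sup>2" 
  proof -
    have "4 * (\<epsilon> + \<eta> + \<delta>) = 10/3 * \<gamma> + d\<^sup>2 / 3" by (simp add: \<epsilon>_def \<eta>_def \<delta>_def)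
    then show ?thesis using \<gamma>(4) d2(1) by linarith
  qed
  obtain L' where L': "0 < L'" and whpL': "\<And>\<delta>. 0 < \<delta> \<Longrightarrow> whp (good_rows \<delta> \<epsilon> L')"
    using good_whp[OF \<epsilon>(1)] by blast
  obtain M K :: real and n0 :: nat where M: "0 < M" "0 \<le> K"
    and W: "\<And>n m x0. n0 \<le> n \<Longrightarrow> M * (real n)\<^sup>2 \<le> real m \<Longrightarrow> nrm n x0 = 1 \<Longrightarrow>
     \<exists>E\<in>sets (sens m n). 1 - K * exp (- real n) \<le> measure (sens m n) E \<and>
       (\<forall>a\<in>E. good_rows \<delta> \<epsilon> L' n m x0 a \<and> good_rows \<delta> (1/200) L n m x0 a)"
    using whp_conj[OF whpL'[OF \<delta>(1)] whpL[OF \<delta>(1)]] unfolding whp_def by blast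
  define n1 where "n1 = max n0 3"
  \<comment> \<open>For \<open>n\<close> below the threshold \<open>n1\<close> the term
    \<open>exp n1\<close> makes the claimed lower bound on the probability nonpositive, so the empty
    event serves.\<close>
  define C1 where "C1 = max K (exp (real n1))"
  define \<Gamma> where "\<Gamma> = 1 / (2 * ln (1 + \<gamma>)) + 3"
  have \<Gamma>: "0 < \<Gamma>" using \<gamma> by (simp add: \<Gamma>_def add_nonneg_pos)
  have main: "\<exists>E \<in> sets (sens m n).
        measure (sens m n) E \<ge> 1 - C1 * exp (- 1 * real n) \<and>
        (\<forall>a \<in> E. \<forall>x \<in> carrier_vec n. not_almost_orthogonal n x0 x \<longrightarrow>
          (let A = sensing_matrix m n a; b = entrywise_modulus (A *\<^sub>v x0) in
            \<forall>t :: nat. real t \<ge> \<Gamma> * ln (real n) \<longrightarrow>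
              (INF \<phi> :: real. eucl_norm (cis \<phi> \<cdot>\<^sub>v x0 - alt_proj A b x t))
                \<le> (9/10) powr (real t - \<Gamma> * ln (real n)) * eucl_norm x0))"
    if x0: "x0 \<in> carrier_vec n" and n: "n \<ge> 1" and m: "m \<ge> 1" "real m \<ge> M * (real n)\<^sup>2" for n m :: nat and x0
  proof (cases "n < n1")
    case True
    have "exp (real n) \<le> C1" using True by (auto simp: C1_def le_max_iff_disj)
    then have "exp (real n) * exp (- real n) \<le> C1 * exp (- real n)" by (intro mult_right_mono) auto
    then have "1 \<le> C1 * exp (- real n)" by (simp add: exp_add[symmetric])
    then show ?thesis by (intro bexI[of _ "{}"]) auto
  next
    case False
    then have n3: "3 \<le> n" "n0 \<le> n" by (auto simp: n1_def)
    define R where "R = nrm n (\<lambda>j. x0 $ j)"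
    have eR: "eucl_norm x0 = R" using x0 by (simp add: eucl_norm_nrm R_def)
    \<comment> \<open>For \<open>x0 = 0\<close> there is no direction to normalize. A basis vector
      takes its place, so that the isometry bounds, and with them injectivity of \<open>A\<close>,
      remain available.\<close>
    define u where "u = (if R = 0 then (\<lambda>j. if j = 0 then 1 else 0) else (\<lambda>j. complex_of_real (1 / R) * x0 $ j))"
    have u: "nrm n u = 1"
    proof (cases "R = 0")
      case True
      have "(\<Sum>j<n. (cmod (if j = 0 then 1 else 0))\<^sup>2) = (\<Sum>j<n. if j = 0 then 1 else 0)"
        by (intro sum.cong) auto
      also have "\<dots> = 1" using n by (simp add: sum.delta)
      finally have "(\<Sum>j<n. (cmod (if j = 0 then 1 else 0))\<^sup>2) = 1" .
      then show ?thesis using True by (simp add: u_def nrm_def)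
    next
      case False
      have "cmod (complex_of_real (1 / R)) = 1 / R" unfolding norm_of_real by (simp add: R_def)
      then show ?thesis using False by (simp add: u_def nrm_scale R_def[symmetric] del: of_real_divide)
    qed
    obtain E where E: "E \<in> sets (sens m n)" "1 - K * exp (- real n) \<le> measure (sens m n) E"
      "\<And>a. a \<in> E \<Longrightarrow> good_rows \<delta> \<epsilon> L' n m u a \<and> good_rows \<delta> (1/200) L n m u a"
      using W[OF n3(2) m(2) u] by blast
    show ?thesis
    proof (intro bexI[of _ E] conjI ballI impI)
      have "K * exp (- real n) \<le> C1 * exp (- real n)" by (intro mult_right_mono) (auto simp: C1_def)
      moreover have "- 1 * real n = - real n" by simp
      ultimately show "1 - C1 * exp (- 1 * real n) \<le> measure (sens m n) E" using E(2) by (simp only:)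
      fix a x assume a: "a \<in> E" and x: "x \<in> carrier_vec n" and nao: "not_almost_orthogonal n x0 x"
      have g: "good_rows \<delta> \<epsilon> L' n m u a" "good_rows \<delta> (1/200) L n m u a" using E(3)[OF a] by auto
      have m0: "0 < m" using m by simp
      define A where "A = sensing_matrix m n a"
      define b where "b = entrywise_modulus (A *\<^sub>v x0)"
      obtain X where X: "is_pseudo_inverse (sensing_matrix m n a) X"
        using ex_pseudo_inverse[OF sensing_matrix_carrier good_injective[OF g(1) \<epsilon>(1,2) m0]] by blast
      have ap: "alt_proj A b x t \<in> carrier_vec n" for t
      proof (induction t)
        case (Suc t)
        then show ?case using alt_proj_step(1)[OF X x0 Suc] by (simp add: A_def b_def)
      qed (simp add: x)
      have stp: "ap_step n m a (\<lambda>j. x0 $ j) (\<lambda>j. alt_proj A b x t $ j) (\<lambda>j. alt_proj A b x (Suc t) $ j)" for t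
        using alt_proj_step(2)[OF X x0 ap[of t]] by (simp add: A_def b_def)
      have inf_le: "(INF \<phi> :: real. eucl_norm (cis \<phi> \<cdot>\<^sub>v x0 - v)) \<le> eucl_norm (cis \<phi> \<cdot>\<^sub>v x0 - v)" for \<phi> v
        by (rule cINF_lower) (auto intro!: bdd_belowI[of _ 0] simp: eucl_norm_def sum_nonneg)
      have nrm_form: "eucl_norm (w \<cdot>\<^sub>v x0 - v) = nrm n (\<lambda>j. w * x0 $ j - v $ j)" if "v \<in> carrier_vec n" for w v
      proof -
        have "eucl_norm (w \<cdot>\<^sub>v x0 - v) = nrm n (\<lambda>j. (w \<cdot>\<^sub>v x0 - v) $ j)"
          using that by (intro eucl_norm_nrm) auto
        also have "\<dots> = nrm n (\<lambda>j. w * x0 $ j - v $ j)"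
          using that x0 by (intro nrm_cong) auto
        finally show ?thesis .
      qed
      have "(INF \<phi> :: real. eucl_norm (cis \<phi> \<cdot>\<^sub>v x0 - alt_proj A b x t)) \<le> (9/10) powr (real t - \<Gamma> * ln (real n)) * eucl_norm x0"
        if t: "\<Gamma> * ln (real n) \<le> real t" for t
      proof (cases "R = 0")
        case True
        have x00: "x0 $ j = 0" if "j < n" for j using nrm_zero[of n "\<lambda>j. x0 $ j"] True that by (simp add: R_def)
        \<comment> \<open>At \<open>t = 0\<close> the iterate is the nonzero \<open>x\<close>, for
          which the bound would fail. A positive threshold forces \<open>t \<ge> 1\<close>, and from
          the first step on the data and the iterate vanish.\<close>
        have "0 < \<Gamma> * ln (real n)" using \<Gamma> n3 by (intro mult_pos_pos) auto
        then obtain t' where t': "t = Suc t'" using t by (cases t) auto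
        define z where "z = alt_proj A b x t"
        have "nrm m (apply_rows n a (\<lambda>j. z $ j)) \<le> nrm m (apply_rows n a (\<lambda>j. x0 $ j))"
          unfolding z_def t' by (rule step_norm[OF stp])
        also have "\<dots> = 0" using apply_rows_zero[of n "\<lambda>j. x0 $ j" a] True by (simp add: R_def nrm_def)
        finally have "nrm m (apply_rows n a (\<lambda>j. z $ j)) = 0"
          using nrm_nonneg by (rule antisym)
        then have "(nrm m (apply_rows n a (\<lambda>j. z $ j)))\<^sup>2 \<le> real m * ((1 - \<epsilon>) * 0\<^sup>2)" by simp
        then have "nrm n (\<lambda>j. z $ j) \<le> 0" by (rule good_distance[OF g(1) \<epsilon>(1,2) m0]) simp
        then have z0: "nrm n (\<lambda>j. z $ j) = 0" using nrm_nonneg[of n "\<lambda>j. z $ j"] by linarith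
        have "eucl_norm (cis 0 \<cdot>\<^sub>v x0 - z) = nrm n (\<lambda>j. z $ j)"
          unfolding nrm_form[OF ap[of t, folded z_def]] by (intro nrm_cong) (simp add: x00)
        then show ?thesis using inf_le[of z 0] z0 eR True by (simp add: z_def)
      next
        case False
        have R: "0 < R" using False less_le[of 0 R] by (simp add: R_def)
        have ur: "(\<lambda>j. x0 $ j) = (\<lambda>j. complex_of_real R * u j)" using False by (simp add: u_def fun_eq_iff)
        define y where "y t j = complex_of_real (1 / R) * alt_proj A b x t $ j" for t j
        have ys: "ap_step n m a u (y s) (y (Suc s))" for s
        proof -
          have "ap_step n m a u (\<lambda>j. alt_proj A b x s $ j) (y (Suc s))"
            using step_rescale[OF stp[of s, unfolded ur] R] by (simp add: y_def[abs_def])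
          then show ?thesis
            using step_scale[of n m a u _ _ "1 / R" 1] R by (simp add: y_def[abs_def])
        qed
        define xn where "xn = nrm n (\<lambda>j. x $ j)"
        have "xn \<noteq> 0"
        proof
          assume "xn = 0"
          then have "x $ j = 0" if "j < n" for j using nrm_zero[of n "\<lambda>j. x $ j"] that by (simp add: xn_def)
          then have "x = 0\<^sub>v n" using x by (intro eq_vecI) auto
          then show False using nao by (simp add: not_almost_orthogonal_def)
        qed
        then have xp: "0 < xn" using less_le[of 0 xn] by (simp add: xn_def)
        have ny0: "nrm n (y 0) = xn / R" 
        proof -
          have "nrm n (y 0) = cmod (complex_of_real (1 / R)) * xn"
            unfolding y_def[abs_def] nrm_scale xn_def by simp
          then show ?thesis using R unfolding norm_of_real by simp
        qed
        have ipx: "cmod (x0 \<bullet>c x) = cmod (ip n (\<lambda>j. x0 $ j) (\<lambda>j. x $ j))"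
        proof -
          have "x0 \<bullet>c x = cnj (ip n (\<lambda>j. x0 $ j) (\<lambda>j. x $ j))"
            using x x0 by (auto simp: scalar_prod_def lin_form_def conjugate_complex_def atLeast0LessThan intro!: sum.cong)
          then show ?thesis by simp
        qed
        have ipu: "ip n (\<lambda>j. x0 $ j) w = of_real R * ip n u w" for w
          unfolding ur by (simp add: lin_form_def sum_distrib_left mult_ac)
        have "R * xn / sqrt (real n) \<le> cmod (ip n (\<lambda>j. x0 $ j) (\<lambda>j. x $ j))"
          using nao x eR unfolding not_almost_orthogonal_def ipx by (simp add: eucl_norm_nrm xn_def)
        then have "R * (xn / sqrt (real n)) \<le> R * cmod (ip n u (\<lambda>j. x $ j))"
          unfolding ipu using R by (simp add: norm_mult)
        then have "xn / sqrt (real n) \<le> cmod (ip n u (\<lambda>j. x $ j))" using R by (rule mult_left_le_imp_le)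
        then have c0: "1 / sqrt (real n) \<le> cmod (ip n u (y 0)) / nrm n (y 0)"
        proof -
          have "y 0 = (\<lambda>j. complex_of_real (1 / R) * x $ j)" by (simp add: y_def fun_eq_iff)
          then have "ip n u (y 0) = complex_of_real (1 / R) * ip n u (\<lambda>j. x $ j)" by (simp only: lin_scale)
          then have "cmod (ip n u (y 0)) = 1 / R * cmod (ip n u (\<lambda>j. x $ j))"
            using R by (simp only: norm_mult norm_of_real) simp
          moreover have "1 / sqrt (real n) * xn \<le> cmod (ip n u (\<lambda>j. x $ j))"
            using \<open>xn / sqrt (real n) \<le> cmod (ip n u (\<lambda>j. x $ j))\<close> by simp
          ultimately show ?thesis unfolding ny0 using R xp by (simp add: pos_le_divide_eq)
        qed
        obtain w where w: "cmod w = 1" "nrm n (\<lambda>j. w * y t j - u j) \<le> (9/10) powr (real t - \<Gamma> * ln (real n))"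
          using iteration_converges[OF g \<epsilon>(1,2) u m0 n3(1) L \<delta>(1) \<eta> \<gamma>(1,2,3) \<delta>(2) \<epsilon>(3) sum d ys _ c0, of t]
            t ny0 xp R unfolding \<Gamma>_def by auto
        \<comment> \<open>The convergence estimate rotates the iterate towards \<open>u\<close>,
          whereas the infimum rotates \<open>x0\<close> towards the iterate; hence the
          conjugate.\<close>
        define v where "v = cnj w"
        have v: "cmod v = 1" "v * w = 1" using w(1) by (auto simp: v_def complex_norm_square[symmetric] mult.commute)
        have vc: "cis (Arg v) = v"
        proof -
          have "v \<noteq> 0" using v by auto
          then have "cis (Arg v) = sgn v" by (rule cis_Arg)
          then show ?thesis using v by (simp add: sgn_div_norm)
        qed
        have "eucl_norm (cis (Arg v) \<cdot>\<^sub>v x0 - alt_proj A b x t) = nrm n (\<lambda>j. v * x0 $ j - alt_proj A b x t $ j)"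
          unfolding vc by (rule nrm_form[OF ap])
        also have "\<dots> = nrm n (\<lambda>j. (- of_real R * v) * (w * y t j - u j))"
        proof (rule nrm_cong)
          fix j
          have "alt_proj A b x t $ j = of_real R * y t j" using R by (simp add: y_def)
          moreover have "x0 $ j = of_real R * u j" using fun_cong[OF ur, of j] .
          ultimately have "v * x0 $ j - alt_proj A b x t $ j = of_real R * (v * u j - (v * w) * y t j)"
            unfolding v(2) by (simp add: algebra_simps)
          also have "\<dots> = (- of_real R * v) * (w * y t j - u j)" by (simp add: algebra_simps)
          finally show "cmod (v * x0 $ j - alt_proj A b x t $ j) = cmod ((- of_real R * v) * (w * y t j - u j))" by simp
        qed
        also have "\<dots> = R * nrm n (\<lambda>j. w * y t j - u j)" unfolding nrm_scale using v R by (simp add: norm_mult)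
        also have "\<dots> \<le> R * (9/10) powr (real t - \<Gamma> * ln (real n))" using w(2) R by (intro mult_left_mono) auto
        finally show ?thesis using inf_le[of "alt_proj A b x t" "Arg v"] eR by (simp add: mult.commute)
      qed
      then show "let A = sensing_matrix m n a; b = entrywise_modulus (A *\<^sub>v x0) in
            \<forall>t :: nat. real t \<ge> \<Gamma> * ln (real n) \<longrightarrow>
              (INF \<phi> :: real. eucl_norm (cis \<phi> \<cdot>\<^sub>v x0 - alt_proj A b x t))
                \<le> (9/10) powr (real t - \<Gamma> * ln (real n)) * eucl_norm x0"
        unfolding Let_def A_def b_def by blast
    qed (rule E(1))
  qed
  show ?thesis
  proof (rule exI[of _ C1], rule exI[of _ 1], rule exI[of _ \<Gamma>], rule exI[of _ M], rule exI[of _ "9/10"],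
      intro conjI allI ballI impI)
    show "0 < C1" using exp_gt_zero[of "real n1"] unfolding C1_def by linarith
  qed (use \<Gamma> M main in simp_all)
qed

end
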